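(* Let $\Bbbk$ be a field of characteristic zero, $k\in\mathbb Z$ and $m,n\ge0$. In $\operatorname{Kar}(\mathcal{H}eis_k)$ there are isomorphisms $$H_m^+\otimes H_n^+\cong H_n^+\otimes H_m^+,\qquad E_m^-\otimes E_n^-\cong E_n^-\otimes E_m^-,$$ $$H_m^+\otimes E_n^-\cong\bigoplus_{r=0}^{\min(m,n,k)}\ \bigoplus_{\lambda\in\mathcal P_{r,k}}E_{n-r}^-\otimes H_{m-r}^+\qquad\text{if }k\ge0,$$ $$E_m^-\otimes H_n^+\cong\bigoplus_{r=0}^{\min(m,n,-k)}\ \bigoplus_{\lambda\in\mathcal P_{r,-k}}H_{n-r}^+\otimes E_{m-r}^-\qquad\text{if }k\le0.$$
   Context: $\mathcal P_{r,k}$ (for $0\le r\le k$) denotes the set of all partitions whose Young diagram fits into an $r\times(k-r)$ rectangle. The degenerate Heisenberg category. $\mathcal{H}eis_k$ is the strict $\Bbbk$-linear monoidal category (unit object $\mathbb 1$) generated by objects $\uparrow,\downarrow$ and morphisms $x:\uparrow\to\uparrow$, $s:\uparrow\otimes\uparrow\to\uparrow\otimes\uparrow$, $c:\mathbb 1\to\downarrow\otimes\uparrow$, $d:\uparrow\otimes\downarrow\to\mathbb 1$ subject to the relations $s\circ s=1$; $(s\otimes1_\uparrow)(1_\uparrow\otimes s)(s\otimes1_\uparrow)=(1_\uparrow\otimes s)(s\otimes1_\uparrow)(1_\uparrow\otimes s)$; $s\circ(x\otimes1_\uparrow)=(1_\uparrow\otimes x)\circ s+1_{\uparrow\otimes\uparrow}$;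 $(d\otimes1_\uparrow)\circ(1_\uparrow\otimes c)=1_\uparrow$; $(1_\downarrow\otimes d)\circ(c\otimes1_\downarrow)=1_\downarrow$; together with the following inversion relation. Put $t:=(1_\downarrow\otimes1_\uparrow\otimes d)\circ(1_\downarrow\otimes s\otimes1_\downarrow)\circ(c\otimes1_\uparrow\otimes1_\downarrow):\uparrow\otimes\downarrow\to\downarrow\otimes\uparrow$. If $k\ge0$ the column matrix with entries $t,\ d\circ(x^a\otimes1_\downarrow)$ $(0\le a\le k-1)$ is required to be invertible as a morphism $\uparrow\otimes\downarrow\to(\downarrow\otimes\uparrow)\oplus\mathbb 1^{\oplus k}$ in the additive envelope; if $k\le0$ the row matrix with entries $t,\ (1_\downarrow\otimes x^a)\circ c$ $(0\le a\le -k-1)$ is required to be invertible as a morphism $(\uparrow\otimes\downarrow)\oplus\mathbb 1^{\oplus(-k)}\to\downarrow\otimes\uparrow$ (i.e. matrix entries of a two-sided inverse are adjoined as further generators). The objects $\uparrow$ and $\downarrow$ are dual to each other. Karoubi envelope and objects. $\operatorname{Kar}(\mathcal C)$ denotes the idempotent completion of the additive envelope $\operatorname{Add}(\mathcal C)$; its objects include pairs $(X,e)$ with $e=e^2\in\operatorname{End}_{\mathcal C}(X)$. Let $\imath_n:\Bbbk\mathfrak S_n\to\operatorname{End}_{\mathcal{H}eis_k}(\uparrow^{\otimes n})$ be the algebra homomorphism with $s_i\mapsto1_\uparrow^{\otimes(n-i-1)}\otimes s\otimes1_\uparrow^{\otimes(i-1)}$. Let $e_{(n)}=\frac1{n!}\sum_{\pi\in\mathfrak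 S_n}\pi$ and $e_{(1^n)}=\frac1{n!}\sum_{\pi\in\mathfrak S_n}(-1)^{\ell(\pi)}\pi$. Put $H_n^+:=(\uparrow^{\otimes n},\imath_n(e_{(n)}))$, $E_n^+:=(\uparrow^{\otimes n},\imath_n(e_{(1^n)}))$, and let $H_n^-:=(H_n^+)^*$, $E_n^-:=(E_n^+)^*$ be their duals; thus $E_n^-=(\downarrow^{\otimes n},\imath_n(e_{(1^n)})^* )$, where $f^*$ is the mate of $f$ under the duality between $\uparrow^{\otimes n}$ and $\downarrow^{\otimes n}$ built from nested copies of $c$ and $d$. *)

theory Defs
  imports "HOL-Combinatorics.Combinatorics"
begin

section \<open>Strict linear monoidal categories\<close>

text \<open>
  Composition is written in the usual order: \<open>cmp C g f\<close> is $g \circ f$. Morphism sets of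
  different pairs of objects need not be disjoint.
\<close>

record ('o, 'm, 'a) linmon =
  obs :: "'o set"
  hom :: "'o \<Rightarrow> 'o \<Rightarrow> 'm set"
  idm :: "'o \<Rightarrow> 'm"
  cmp :: "'m \<Rightarrow> 'm \<Rightarrow> 'm"
  zer :: "'o \<Rightarrow> 'o \<Rightarrow> 'm"
  add :: "'m \<Rightarrow> 'm \<Rightarrow> 'm"
  scl :: "'a \<Rightarrow> 'm \<Rightarrow> 'm"
  unt :: "'o"
  tob :: "'o \<Rightarrow> 'o \<Rightarrow> 'o"
  tmo :: "'m \<Rightarrow> 'm \<Rightarrow> 'm"

locale strict_linear_monoidal =
  fixes C :: "('o, 'm, 'a::field) linmon"
  assumes idm_hom: "X \<in> obs C \<Longrightarrow> idm C X \<in> hom C X X"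
    and cmp_hom: "\<lbrakk>X \<in> obs C; Y \<in> obs C; Z \<in> obs C; f \<in> hom C X Y; g \<in> hom C Y Z\<rbrakk>
      \<Longrightarrow> cmp C g f \<in> hom C X Z"
    and idm_left: "\<lbrakk>X \<in> obs C; Y \<in> obs C; f \<in> hom C X Y\<rbrakk> \<Longrightarrow> cmp C (idm C Y) f = f"
    and idm_right: "\<lbrakk>X \<in> obs C; Y \<in> obs C; f \<in> hom C X Y\<rbrakk> \<Longrightarrow> cmp C f (idm C X) = f"
    and cmp_assoc: "\<lbrakk>X \<in> obs C; Y \<in> obs C; Z \<in> obs C; W \<in> obs C;
        f \<in> hom C X Y; g \<in> hom C Y Z; h \<in> hom C Z W\<rbrakk>
      \<Longrightarrow> cmp C (cmp C h g) f = cmp C h (cmp C g f)"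
    and zer_hom: "\<lbrakk>X \<in> obs C; Y \<in> obs C\<rbrakk> \<Longrightarrow> zer C X Y \<in> hom C X Y"
    and add_hom: "\<lbrakk>X \<in> obs C; Y \<in> obs C; f \<in> hom C X Y; g \<in> hom C X Y\<rbrakk>
      \<Longrightarrow> add C f g \<in> hom C X Y"
    and scl_hom: "\<lbrakk>X \<in> obs C; Y \<in> obs C; f \<in> hom C X Y\<rbrakk> \<Longrightarrow> scl C a f \<in> hom C X Y"
    and add_assoc: "\<lbrakk>X \<in> obs C; Y \<in> obs C; f \<in> hom C X Y; g \<in> hom C X Y; h \<in> hom C X Y\<rbrakk>
      \<Longrightarrow> add C (add C f g) h = add C f (add C g h)"
    and add_comm: "\<lbrakk>X \<in> obs C; Y \<in> obs C; f \<in> hom C X Y; g \<in> hom C X Y\<rbrakk>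
      \<Longrightarrow> add C f g = add C g f"
    and add_zer: "\<lbrakk>X \<in> obs C; Y \<in> obs C; f \<in> hom C X Y\<rbrakk> \<Longrightarrow> add C (zer C X Y) f = f"
    and scl_zero: "\<lbrakk>X \<in> obs C; Y \<in> obs C; f \<in> hom C X Y\<rbrakk> \<Longrightarrow> scl C 0 f = zer C X Y"
    and scl_one: "\<lbrakk>X \<in> obs C; Y \<in> obs C; f \<in> hom C X Y\<rbrakk> \<Longrightarrow> scl C 1 f = f"
    and scl_mult: "\<lbrakk>X \<in> obs C; Y \<in> obs C; f \<in> hom C X Y\<rbrakk>
      \<Longrightarrow> scl C a (scl C b f) = scl C (a * b) f"
    and scl_add_left: "\<lbrakk>X \<in> obs C; Y \<in> obs C; f \<in> hom C X Y\<rbrakk>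
      \<Longrightarrow> scl C (a + b) f = add C (scl C a f) (scl C b f)"
    and scl_add_right: "\<lbrakk>X \<in> obs C; Y \<in> obs C; f \<in> hom C X Y; g \<in> hom C X Y\<rbrakk>
      \<Longrightarrow> scl C a (add C f g) = add C (scl C a f) (scl C a g)"
    and cmp_add_left: "\<lbrakk>X \<in> obs C; Y \<in> obs C; Z \<in> obs C;
        f \<in> hom C X Y; g \<in> hom C Y Z; g' \<in> hom C Y Z\<rbrakk>
      \<Longrightarrow> cmp C (add C g g') f = add C (cmp C g f) (cmp C g' f)"
    and cmp_add_right: "\<lbrakk>X \<in> obs C; Y \<in> obs C; Z \<in> obs C;
        f \<in> hom C X Y; f' \<in> hom C X Y; g \<in> hom C Y Z\<rbrakk>
      \<Longrightarrow> cmp C g (add C f f') = add C (cmp C g f) (cmp C g f')"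
    and cmp_scl_left: "\<lbrakk>X \<in> obs C; Y \<in> obs C; Z \<in> obs C; f \<in> hom C X Y; g \<in> hom C Y Z\<rbrakk>
      \<Longrightarrow> cmp C (scl C a g) f = scl C a (cmp C g f)"
    and cmp_scl_right: "\<lbrakk>X \<in> obs C; Y \<in> obs C; Z \<in> obs C; f \<in> hom C X Y; g \<in> hom C Y Z\<rbrakk>
      \<Longrightarrow> cmp C g (scl C a f) = scl C a (cmp C g f)"
    and unt_obs: "unt C \<in> obs C"
    and tob_obs: "\<lbrakk>X \<in> obs C; Y \<in> obs C\<rbrakk> \<Longrightarrow> tob C X Y \<in> obs C"
    and tmo_hom: "\<lbrakk>X \<in> obs C; Y \<in> obs C; X' \<in> obs C; Y' \<in> obs C;
        f \<in> hom C X Y; f' \<in> hom C X' Y'\<rbrakk>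
      \<Longrightarrow> tmo C f f' \<in> hom C (tob C X X') (tob C Y Y')"
    and tob_assoc: "\<lbrakk>X \<in> obs C; Y \<in> obs C; Z \<in> obs C\<rbrakk>
      \<Longrightarrow> tob C (tob C X Y) Z = tob C X (tob C Y Z)"
    and tob_unt_left: "X \<in> obs C \<Longrightarrow> tob C (unt C) X = X"
    and tob_unt_right: "X \<in> obs C \<Longrightarrow> tob C X (unt C) = X"
    and tmo_assoc: "\<lbrakk>X \<in> obs C; Y \<in> obs C; X' \<in> obs C; Y' \<in> obs C; X'' \<in> obs C; Y'' \<in> obs C;
        f \<in> hom C X Y; f' \<in> hom C X' Y'; f'' \<in> hom C X'' Y''\<rbrakk>
      \<Longrightarrow> tmo C (tmo C f f') f'' = tmo C f (tmo C f' f'')"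
    and tmo_unt_left: "\<lbrakk>X \<in> obs C; Y \<in> obs C; f \<in> hom C X Y\<rbrakk> \<Longrightarrow> tmo C (idm C (unt C)) f = f"
    and tmo_unt_right: "\<lbrakk>X \<in> obs C; Y \<in> obs C; f \<in> hom C X Y\<rbrakk> \<Longrightarrow> tmo C f (idm C (unt C)) = f"
    and tmo_idm: "\<lbrakk>X \<in> obs C; Y \<in> obs C\<rbrakk> \<Longrightarrow> tmo C (idm C X) (idm C Y) = idm C (tob C X Y)"
    and tmo_cmp: "\<lbrakk>X \<in> obs C; Y \<in> obs C; Z \<in> obs C; X' \<in> obs C; Y' \<in> obs C; Z' \<in> obs C;
        f \<in> hom C X Y; g \<in> hom C Y Z; f' \<in> hom C X' Y'; g' \<in> hom C Y' Z'\<rbrakk>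
      \<Longrightarrow> tmo C (cmp C g f) (cmp C g' f') = cmp C (tmo C g g') (tmo C f f')"
    and tmo_add_left: "\<lbrakk>X \<in> obs C; Y \<in> obs C; X' \<in> obs C; Y' \<in> obs C;
        f \<in> hom C X Y; g \<in> hom C X Y; f' \<in> hom C X' Y'\<rbrakk>
      \<Longrightarrow> tmo C (add C f g) f' = add C (tmo C f f') (tmo C g f')"
    and tmo_add_right: "\<lbrakk>X \<in> obs C; Y \<in> obs C; X' \<in> obs C; Y' \<in> obs C;
        f \<in> hom C X Y; f' \<in> hom C X' Y'; g' \<in> hom C X' Y'\<rbrakk>
      \<Longrightarrow> tmo C f (add C f' g') = add C (tmo C f f') (tmo C f g')"
    and tmo_scl_left: "\<lbrakk>X \<in> obs C; Y \<in> obs C; X' \<in> obs C; Y' \<in> obs C;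
        f \<in> hom C X Y; f' \<in> hom C X' Y'\<rbrakk>
      \<Longrightarrow> tmo C (scl C a f) f' = scl C a (tmo C f f')"
    and tmo_scl_right: "\<lbrakk>X \<in> obs C; Y \<in> obs C; X' \<in> obs C; Y' \<in> obs C;
        f \<in> hom C X Y; f' \<in> hom C X' Y'\<rbrakk>
      \<Longrightarrow> tmo C f (scl C a f') = scl C a (tmo C f f')"

definition isomorphic :: "('o, 'm, 'a) linmon \<Rightarrow> 'o \<Rightarrow> 'o \<Rightarrow> bool" where
  "isomorphic C X Y \<longleftrightarrow> X \<in> obs C \<and> Y \<in> obs C \<and>
     (\<exists>f\<in>hom C X Y. \<exists>g\<in>hom C Y X. cmp C g f = idm C X \<and> cmp C f g = idm C Y)"


section \<open>Presentations by generators and relations\<close>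

text \<open>
  Objects are words in the generating objects. Morphisms are formal expressions in the generating
  morphisms modulo the smallest congruence containing the given relations and the axioms of a
  strict linear monoidal category.
\<close>

datatype ('a, 'o, 'g) tm =
    Gen 'g
  | Idt "'o list"
  | Cmp "('a, 'o, 'g) tm" "('a, 'o, 'g) tm"
  | Ten "('a, 'o, 'g) tm" "('a, 'o, 'g) tm"
  | Zer "'o list" "'o list"
  | Add "('a, 'o, 'g) tm" "('a, 'o, 'g) tm"
  | Scl 'a "('a, 'o, 'g) tm"

record ('o, 'g) signat =
  gens :: "'g set"
  src :: "'g \<Rightarrow> 'o list"
  tgt :: "'g \<Rightarrow> 'o list"

inductive typed :: "('o, 'g) signat \<Rightarrow> ('a, 'o, 'g) tm \<Rightarrow> 'o list \<Rightarrow> 'o list \<Rightarrow> bool"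
  for S where
  "g \<in> gens S \<Longrightarrow> typed S (Gen g) (src S g) (tgt S g)"
| "typed S (Idt X) X X"
| "typed S f X Y \<Longrightarrow> typed S g Y Z \<Longrightarrow> typed S (Cmp g f) X Z"
| "typed S f X Y \<Longrightarrow> typed S f' X' Y' \<Longrightarrow> typed S (Ten f f') (X @ X') (Y @ Y')"
| "typed S (Zer X Y) X Y"
| "typed S f X Y \<Longrightarrow> typed S g X Y \<Longrightarrow> typed S (Add f g) X Y"
| "typed S f X Y \<Longrightarrow> typed S (Scl a f) X Y"

inductive tmeq :: "('o, 'g) signat \<Rightarrow> (('a::field, 'o, 'g) tm \<Rightarrow> ('a, 'o, 'g) tm \<Rightarrow> bool)
    \<Rightarrow> ('a, 'o, 'g) tm \<Rightarrow> ('a, 'o, 'g) tm \<Rightarrow> bool"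
  for S R where
  rel: "R f g \<Longrightarrow> typed S f X Y \<Longrightarrow> typed S g X Y \<Longrightarrow> tmeq S R f g"
| refl: "typed S f X Y \<Longrightarrow> tmeq S R f f"
| sym: "tmeq S R f g \<Longrightarrow> tmeq S R g f"
| trans: "tmeq S R f g \<Longrightarrow> tmeq S R g h \<Longrightarrow> tmeq S R f h"
| cong_Cmp: "tmeq S R f f' \<Longrightarrow> tmeq S R g g' \<Longrightarrow> typed S f X Y \<Longrightarrow> typed S g Y Z
    \<Longrightarrow> tmeq S R (Cmp g f) (Cmp g' f')"
| cong_Ten: "tmeq S R f f' \<Longrightarrow> tmeq S R g g' \<Longrightarrow> tmeq S R (Ten f g) (Ten f' g')"
| cong_Add: "tmeq S R f f' \<Longrightarrow> tmeq S R g g' \<Longrightarrow> typed S f X Y \<Longrightarrow> typed S g X Y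
    \<Longrightarrow> tmeq S R (Add f g) (Add f' g')"
| cong_Scl: "tmeq S R f f' \<Longrightarrow> tmeq S R (Scl a f) (Scl a f')"
| id_left: "typed S f X Y \<Longrightarrow> tmeq S R (Cmp (Idt Y) f) f"
| id_right: "typed S f X Y \<Longrightarrow> tmeq S R (Cmp f (Idt X)) f"
| assoc_Cmp: "typed S f X Y \<Longrightarrow> typed S g Y Z \<Longrightarrow> typed S h Z W
    \<Longrightarrow> tmeq S R (Cmp (Cmp h g) f) (Cmp h (Cmp g f))"
| assoc_Add: "typed S f X Y \<Longrightarrow> typed S g X Y \<Longrightarrow> typed S h X Y
    \<Longrightarrow> tmeq S R (Add (Add f g) h) (Add f (Add g h))"
| comm_Add: "typed S f X Y \<Longrightarrow> typed S g X Y \<Longrightarrow> tmeq S R (Add f g) (Add g f)"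
| zero_Add: "typed S f X Y \<Longrightarrow> tmeq S R (Add (Zer X Y) f) f"
| Scl_zero: "typed S f X Y \<Longrightarrow> tmeq S R (Scl 0 f) (Zer X Y)"
| Scl_one: "typed S f X Y \<Longrightarrow> tmeq S R (Scl 1 f) f"
| Scl_mult: "typed S f X Y \<Longrightarrow> tmeq S R (Scl a (Scl b f)) (Scl (a * b) f)"
| Scl_add_left: "typed S f X Y \<Longrightarrow> tmeq S R (Scl (a + b) f) (Add (Scl a f) (Scl b f))"
| Scl_add_right: "typed S f X Y \<Longrightarrow> typed S g X Y
    \<Longrightarrow> tmeq S R (Scl a (Add f g)) (Add (Scl a f) (Scl a g))"
| Cmp_add_left: "typed S f X Y \<Longrightarrow> typed S g Y Z \<Longrightarrow> typed S g' Y Z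
    \<Longrightarrow> tmeq S R (Cmp (Add g g') f) (Add (Cmp g f) (Cmp g' f))"
| Cmp_add_right: "typed S f X Y \<Longrightarrow> typed S f' X Y \<Longrightarrow> typed S g Y Z
    \<Longrightarrow> tmeq S R (Cmp g (Add f f')) (Add (Cmp g f) (Cmp g f'))"
| Cmp_scl_left: "typed S f X Y \<Longrightarrow> typed S g Y Z
    \<Longrightarrow> tmeq S R (Cmp (Scl a g) f) (Scl a (Cmp g f))"
| Cmp_scl_right: "typed S f X Y \<Longrightarrow> typed S g Y Z
    \<Longrightarrow> tmeq S R (Cmp g (Scl a f)) (Scl a (Cmp g f))"
| assoc_Ten: "typed S f X Y \<Longrightarrow> typed S f' X' Y' \<Longrightarrow> typed S f'' X'' Y''
    \<Longrightarrow> tmeq S R (Ten (Ten f f') f'') (Ten f (Ten f' f''))"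
| Ten_unit_left: "typed S f X Y \<Longrightarrow> tmeq S R (Ten (Idt []) f) f"
| Ten_unit_right: "typed S f X Y \<Longrightarrow> tmeq S R (Ten f (Idt [])) f"
| Ten_Idt: "tmeq S R (Ten (Idt X) (Idt Y)) (Idt (X @ Y))"
| Ten_Cmp: "typed S f X Y \<Longrightarrow> typed S g Y Z \<Longrightarrow> typed S f' X' Y' \<Longrightarrow> typed S g' Y' Z'
    \<Longrightarrow> tmeq S R (Ten (Cmp g f) (Cmp g' f')) (Cmp (Ten g g') (Ten f f'))"
| Ten_add_left: "typed S f X Y \<Longrightarrow> typed S g X Y \<Longrightarrow> typed S f' X' Y'
    \<Longrightarrow> tmeq S R (Ten (Add f g) f') (Add (Ten f f') (Ten g f'))"
| Ten_add_right: "typed S f X Y \<Longrightarrow> typed S f' X' Y' \<Longrightarrow> typed S g' X' Y'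
    \<Longrightarrow> tmeq S R (Ten f (Add f' g')) (Add (Ten f f') (Ten f g'))"
| Ten_scl_left: "typed S f X Y \<Longrightarrow> typed S f' X' Y'
    \<Longrightarrow> tmeq S R (Ten (Scl a f) f') (Scl a (Ten f f'))"
| Ten_scl_right: "typed S f X Y \<Longrightarrow> typed S f' X' Y'
    \<Longrightarrow> tmeq S R (Ten f (Scl a f')) (Scl a (Ten f f'))"

definition presented :: "('o, 'g) signat \<Rightarrow> (('a::field, 'o, 'g) tm \<Rightarrow> ('a, 'o, 'g) tm \<Rightarrow> bool)
    \<Rightarrow> ('o list, ('a, 'o, 'g) tm set, 'a) linmon" where
  "presented S R = \<lparr>
     obs = UNIV,
     hom = (\<lambda>X Y. {Collect (tmeq S R f) | f. typed S f X Y}),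
     idm = (\<lambda>X. Collect (tmeq S R (Idt X))),
     cmp = (\<lambda>G F. {h. \<exists>g\<in>G. \<exists>f\<in>F. tmeq S R (Cmp g f) h}),
     zer = (\<lambda>X Y. Collect (tmeq S R (Zer X Y))),
     add = (\<lambda>F G. {h. \<exists>f\<in>F. \<exists>g\<in>G. tmeq S R (Add f g) h}),
     scl = (\<lambda>a F. {h. \<exists>f\<in>F. tmeq S R (Scl a f) h}),
     unt = [],
     tob = (@),
     tmo = (\<lambda>F G. {h. \<exists>f\<in>F. \<exists>g\<in>G. tmeq S R (Ten f g) h})\<rparr>"

lemma typed_unique: "typed S f X Y \<Longrightarrow> typed S f X' Y' \<Longrightarrow> X' = X \<and> Y' = Y"
proof (induction arbitrary: X' Y' rule: typed.induct)
  case (4 f X Y f' X2 Y2)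
  from 4(5) obtain A A' B B' where "X' = A @ A'" "Y' = B @ B'" "typed S f A B" "typed S f' A' B'"
    by (cases rule: typed.cases) auto
  with 4 show ?case by metis
next
  case (1 g) then show ?case by (auto elim: typed.cases)
next
  case (2 X) then show ?case by (auto elim: typed.cases)
next
  case (3 f X Y g Z)
  from 3(5) obtain W where "typed S f X' W" "typed S g W Y'" by (auto elim: typed.cases)
  with 3 show ?case by blast
next
  case (5 X Y) then show ?case by (auto elim: typed.cases)
next
  case (6 f X Y g)
  from 6(5) have "typed S f X' Y'" by (auto elim: typed.cases)
  with 6 show ?case by blast
next
  case (7 f X Y a)
  from 7(3) have "typed S f X' Y'" by (auto elim: typed.cases)
  with 7 show ?case by blast
qed

lemma tmeq_typed: "tmeq S R f g \<Longrightarrow> \<exists>X Y. typed S f X Y \<and> typed S g X Y"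
proof (induction rule: tmeq.induct)
  case (trans f g h)
  then show ?case by (metis typed_unique)
next
  case (cong_Cmp f f' g g' X Y Z)
  then show ?case by (metis typed.intros(3) typed_unique)
next
  case (cong_Ten f f' g g')
  then show ?case by (metis typed.intros(4))
next
  case (cong_Add f f' g g' X Y)
  then show ?case by (metis typed.intros(6) typed_unique)
next
  case (assoc_Ten f X Y f' X' Y' f'' X'' Y'')
  then have "typed S (Ten (Ten f f') f'') ((X @ X') @ X'') ((Y @ Y') @ Y'')"
    "typed S (Ten f (Ten f' f'')) (X @ (X' @ X'')) (Y @ (Y' @ Y''))"
    by (blast intro: typed.intros)+
  then show ?case by auto
next
  case (Ten_unit_left f X Y)
  then have "typed S (Ten (Idt []) f) ([] @ X) ([] @ Y)" by (blast intro: typed.intros)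
  with Ten_unit_left show ?case by auto
next
  case (Ten_unit_right f X Y)
  then have "typed S (Ten f (Idt [])) (X @ []) (Y @ [])" by (blast intro: typed.intros)
  with Ten_unit_right show ?case by auto
qed (blast intro: typed.intros)+

lemma tmeq_typed_right: "tmeq S R f g \<Longrightarrow> typed S f X Y \<Longrightarrow> typed S g X Y"
  by (metis tmeq_typed typed_unique)

lemma tmeq_class_eq: "tmeq S R f g \<Longrightarrow> Collect (tmeq S R f) = Collect (tmeq S R g)"
  by (blast intro: tmeq.sym tmeq.trans)

context
  fixes S :: "('o, 'g) signat" and R :: "('a::field, 'o, 'g) tm \<Rightarrow> ('a, 'o, 'g) tm \<Rightarrow> bool"
begin

definition reps :: "('a, 'o, 'g) tm set \<Rightarrow> ('a, 'o, 'g) tm \<Rightarrow> 'o list \<Rightarrow> 'o list \<Rightarrow> bool" where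
  "reps F f X Y \<longleftrightarrow> F = Collect (tmeq S R f) \<and> typed S f X Y"

lemma reps_cmp: "reps F f X Y \<Longrightarrow> reps G g Y Z \<Longrightarrow> reps (cmp (presented S R) G F) (Cmp g f) X Z"
  unfolding presented_def reps_def
  by (auto intro: tmeq.refl typed.intros) (meson tmeq.cong_Cmp tmeq.trans tmeq.refl)+

lemma reps_add: "reps F f X Y \<Longrightarrow> reps G g X Y \<Longrightarrow> reps (add (presented S R) F G) (Add f g) X Y"
  unfolding presented_def reps_def
  by (auto intro: tmeq.refl typed.intros) (meson tmeq.cong_Add tmeq.trans tmeq.refl)+

lemma reps_scl: "reps F f X Y \<Longrightarrow> reps (scl (presented S R) a F) (Scl a f) X Y"
  unfolding presented_def reps_def
  by (auto intro: tmeq.refl typed.intros) (meson tmeq.cong_Scl tmeq.trans tmeq.refl)+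

lemma reps_tmo: "reps F f X Y \<Longrightarrow> reps G g X' Y'
    \<Longrightarrow> reps (tmo (presented S R) F G) (Ten f g) (X @ X') (Y @ Y')"
  unfolding presented_def reps_def
  by (auto intro: tmeq.refl typed.intros) (meson tmeq.cong_Ten tmeq.trans tmeq.refl)+

lemma reps_idm: "reps (idm (presented S R) X) (Idt X) X X"
  and reps_zer: "reps (zer (presented S R) X Y) (Zer X Y) X Y"
  by (simp_all add: presented_def reps_def typed.intros)

lemma presented_hom: "F \<in> hom (presented S R) X Y \<longleftrightarrow> (\<exists>f. reps F f X Y)"
  by (auto simp: presented_def reps_def)

lemma presented_homI: "reps F f X Y \<Longrightarrow> F \<in> hom (presented S R) X Y"
  by (auto simp: presented_hom)

lemma reps_eqI: "reps F f X Y \<Longrightarrow> reps G g X' Y' \<Longrightarrow> tmeq S R f g \<Longrightarrow> F = G"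
  by (auto simp: reps_def dest: tmeq_class_eq)

lemma reps_typed: "reps F f X Y \<Longrightarrow> typed S f X Y"
  by (simp add: reps_def)

lemma presented_objects: "X \<in> obs (presented S R)" "unt (presented S R) = []"
  "tob (presented S R) X Y = X @ Y"
  by (simp_all add: presented_def)

lemmas reps_intros = reps_cmp reps_add reps_scl reps_tmo reps_idm reps_zer

end

lemmas presented_axioms = tmeq.id_left tmeq.id_right tmeq.assoc_Cmp tmeq.assoc_Add tmeq.comm_Add
  tmeq.zero_Add tmeq.Scl_zero tmeq.Scl_one tmeq.Scl_mult tmeq.Scl_add_left tmeq.Scl_add_right
  tmeq.Cmp_add_left tmeq.Cmp_add_right tmeq.Cmp_scl_left tmeq.Cmp_scl_right tmeq.assoc_Ten
  tmeq.Ten_unit_left tmeq.Ten_unit_right tmeq.Ten_Idt tmeq.Ten_Cmp tmeq.Ten_add_left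
  tmeq.Ten_add_right tmeq.Ten_scl_left tmeq.Ten_scl_right

theorem presented_strict_linear_monoidal: "strict_linear_monoidal (presented S R)"
  apply unfold_locales
  apply (unfold presented_hom presented_objects)
  apply (elim exE | (simp add: presented_objects; fail) | (rule exI, ((assumption | rule reps_intros)+)[1])
     | (rule reps_eqI, ((assumption | rule reps_intros)+)[2], rule presented_axioms; (erule reps_typed)+))+
  done


section \<open>Additive envelope and Karoubi envelope\<close>

text \<open>
  Objects of the additive envelope are formal direct sums, that is lists of objects. A morphism
  \<open>X\<^sub>0 \<oplus> \<dots> \<oplus> X\<^sub>p \<rightarrow> Y\<^sub>0 \<oplus> \<dots> \<oplus> Y\<^sub>q\<close> is a matrix whose \<open>(i, j)\<close> entry is a morphism
  \<open>X\<^sub>j \<rightarrow> Y\<^sub>i\<close>; entries out of range are \<open>undefined\<close> so that equality is extensional.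
\<close>

datatype ('o, 'm) mat = Mat (mdom: "'o list") (mcod: "'o list") (ent: "nat \<Rightarrow> nat \<Rightarrow> 'm")

definition mk_mat :: "'o list \<Rightarrow> 'o list \<Rightarrow> (nat \<Rightarrow> nat \<Rightarrow> 'm) \<Rightarrow> ('o, 'm) mat" where
  "mk_mat X Y E = Mat X Y (\<lambda>i j. if i < length Y \<and> j < length X then E i j else undefined)"

definition hom_sum :: "('o, 'm, 'a) linmon \<Rightarrow> 'o \<Rightarrow> 'o \<Rightarrow> 'm list \<Rightarrow> 'm" where
  "hom_sum C X Y fs = foldr (add C) fs (zer C X Y)"

text \<open>
  The tensor product distributes over formal direct sums; the summands of a tensor product are
  ordered lexicographically, so \<open>X\<^sub>i \<otimes> X'\<^sub>j\<close> has index \<open>i * length X' + j\<close>.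
\<close>

definition additive_envelope ::
    "('o, 'm, 'a) linmon \<Rightarrow> ('o list, ('o, 'm) mat, 'a) linmon" where
  "additive_envelope C = \<lparr>
     obs = lists (obs C),
     hom = (\<lambda>X Y. {mk_mat X Y E | E.
        \<forall>i<length Y. \<forall>j<length X. E i j \<in> hom C (X ! j) (Y ! i)}),
     idm = (\<lambda>X. mk_mat X X (\<lambda>i j. if i = j then idm C (X ! i) else zer C (X ! j) (X ! i))),
     cmp = (\<lambda>N M. mk_mat (mdom M) (mcod N) (\<lambda>i j. hom_sum C (mdom M ! j) (mcod N ! i)
        (map (\<lambda>l. cmp C (ent N i l) (ent M l j)) [0..<length (mcod M)]))),
     zer = (\<lambda>X Y. mk_mat X Y (\<lambda>i j. zer C (X ! j) (Y ! i))),
     add = (\<lambda>M N. mk_mat (mdom M) (mcod M) (\<lambda>i j. add C (ent M i j) (ent N i j))),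
     scl = (\<lambda>a M. mk_mat (mdom M) (mcod M) (\<lambda>i j. scl C a (ent M i j))),
     unt = [unt C],
     tob = (\<lambda>X X'. [tob C x x'. x \<leftarrow> X, x' \<leftarrow> X']),
     tmo = (\<lambda>M N. mk_mat
        [tob C x x'. x \<leftarrow> mdom M, x' \<leftarrow> mdom N] [tob C y y'. y \<leftarrow> mcod M, y' \<leftarrow> mcod N]
        (\<lambda>i j. tmo C
           (ent M (i div length (mcod N)) (j div length (mdom N)))
           (ent N (i mod length (mcod N)) (j mod length (mdom N)))))\<rparr>"

definition idempotent_completion ::
    "('o, 'm, 'a) linmon \<Rightarrow> ('o \<times> 'm, 'm, 'a) linmon" where
  "idempotent_completion C = \<lparr>
     obs = {(X, e). X \<in> obs C \<and> e \<in> hom C X X \<and> cmp C e e = e},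
     hom = (\<lambda>(X, e) (Y, f). {g \<in> hom C X Y. cmp C f (cmp C g e) = g}),
     idm = (\<lambda>(X, e). e),
     cmp = cmp C,
     zer = (\<lambda>(X, e) (Y, f). zer C X Y),
     add = add C,
     scl = scl C,
     unt = (unt C, idm C (unt C)),
     tob = (\<lambda>(X, e) (Y, f). (tob C X Y, tmo C e f)),
     tmo = tmo C\<rparr>"

type_synonym ('o, 'm) kar_ob = "'o list \<times> ('o, 'm) mat"

definition Kar :: "('o, 'm, 'a) linmon \<Rightarrow> (('o, 'm) kar_ob, ('o, 'm) mat, 'a) linmon" where
  "Kar C = idempotent_completion (additive_envelope C)"

definition kar_pair :: "'o \<Rightarrow> 'm \<Rightarrow> ('o, 'm) kar_ob" where
  "kar_pair X e = ([X], mk_mat [X] [X] (\<lambda>i j. e))"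

definition mat_dsum :: "('o, 'm, 'a) linmon \<Rightarrow> ('o, 'm) mat \<Rightarrow> ('o, 'm) mat \<Rightarrow> ('o, 'm) mat" where
  "mat_dsum C M N = mk_mat (mdom M @ mdom N) (mcod M @ mcod N)
     (\<lambda>i j.
        if i < length (mcod M) \<and> j < length (mdom M) then ent M i j
        else if length (mcod M) \<le> i \<and> length (mdom M) \<le> j
          then ent N (i - length (mcod M)) (j - length (mdom M))
        else zer C ((mdom M @ mdom N) ! j) ((mcod M @ mcod N) ! i))"

definition kar_dsum :: "('o, 'm, 'a) linmon \<Rightarrow> ('o, 'm) kar_ob \<Rightarrow> ('o, 'm) kar_ob \<Rightarrow> ('o, 'm) kar_ob"
  where "kar_dsum C A B = (fst A @ fst B, mat_dsum C (snd A) (snd B))"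

definition kar_zero_ob :: "('o, 'm) kar_ob" where
  "kar_zero_ob = ([], mk_mat [] [] (\<lambda>i j. undefined))"

text \<open>
  The direct sum of a family of objects over a finite index set. The summands are listed in some
  order, on which the result depends only up to isomorphism.
\<close>

definition kar_Dsum :: "('o, 'm, 'a) linmon \<Rightarrow> 'i set \<Rightarrow> ('i \<Rightarrow> ('o, 'm) kar_ob) \<Rightarrow> ('o, 'm) kar_ob"
  where "kar_Dsum C I A =
    foldr (kar_dsum C) (map A (SOME is. distinct is \<and> set is = I)) kar_zero_ob"


section \<open>The degenerate Heisenberg category\<close>

datatype updown = Up | Down

text \<open>
  \<open>Gt'\<close>, \<open>Gu a\<close> and \<open>Gv a\<close> are the entries of the inverse matrix in the inversion relation:
  the row \<open>(Gt', Gu 0, \<dots>, Gu (k - 1))\<close> for \<open>k \<ge> 0\<close> and the column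
  \<open>(Gt', Gv 0, \<dots>, Gv (- k - 1))\<close> for \<open>k \<le> 0\<close>.
\<close>

datatype heis_gen = Gx | Gs | Gc | Gd | Gt' | Gu nat | Gv nat

fun heis_src :: "heis_gen \<Rightarrow> updown list" where
  "heis_src Gx = [Up]"
| "heis_src Gs = [Up, Up]"
| "heis_src Gc = []"
| "heis_src Gd = [Up, Down]"
| "heis_src Gt' = [Down, Up]"
| "heis_src (Gu a) = []"
| "heis_src (Gv a) = [Down, Up]"

fun heis_tgt :: "heis_gen \<Rightarrow> updown list" where
  "heis_tgt Gx = [Up]"
| "heis_tgt Gs = [Up, Up]"
| "heis_tgt Gc = [Down, Up]"
| "heis_tgt Gd = []"
| "heis_tgt Gt' = [Up, Down]"
| "heis_tgt (Gu a) = [Up, Down]"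
| "heis_tgt (Gv a) = []"

definition heis_signat :: "int \<Rightarrow> (updown, heis_gen) signat" where
  "heis_signat k = \<lparr>
     gens = {Gx, Gs, Gc, Gd, Gt'} \<union> {Gu a | a. int a < k} \<union> {Gv a | a. int a < - k},
     src = heis_src, tgt = heis_tgt\<rparr>"

type_synonym 'a heis_tm = "('a, updown, heis_gen) tm"

abbreviation iU :: "'a heis_tm" where "iU \<equiv> Idt [Up]"
abbreviation iD :: "'a heis_tm" where "iD \<equiv> Idt [Down]"

fun xpow :: "nat \<Rightarrow> 'a heis_tm" where
  "xpow 0 = iU"
| "xpow (Suc a) = Cmp (Gen Gx) (xpow a)"

definition t_tm :: "'a heis_tm" where
  "t_tm = Cmp (Ten iD (Ten iU (Gen Gd))) (Cmp (Ten iD (Ten (Gen Gs) iD)) (Ten (Gen Gc) (Ten iU iD)))"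

definition dx :: "nat \<Rightarrow> 'a heis_tm" where
  "dx a = Cmp (Gen Gd) (Ten (xpow a) iD)"

definition xc :: "nat \<Rightarrow> 'a heis_tm" where
  "xc a = Cmp (Ten iD (xpow a)) (Gen Gc)"

definition tm_sum :: "updown list \<Rightarrow> updown list \<Rightarrow> 'a heis_tm list \<Rightarrow> 'a heis_tm" where
  "tm_sum X Y fs = foldr Add fs (Zer X Y)"

text \<open>
  The rules \<open>pos_\<dots>\<close> (\<open>neg_\<dots>\<close>) are the matrix entries of the two equations saying that the row
  (column) of new generators is a two-sided inverse; for \<open>k = 0\<close> both families say that \<open>Gt'\<close> is
  inverse to \<open>t\<close>.
\<close>

inductive heis_rel :: "int \<Rightarrow> 'a::field heis_tm \<Rightarrow> 'a heis_tm \<Rightarrow> bool" for k where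
  s_square: "heis_rel k (Cmp (Gen Gs) (Gen Gs)) (Idt [Up, Up])"
| s_braid: "heis_rel k
    (Cmp (Ten (Gen Gs) iU) (Cmp (Ten iU (Gen Gs)) (Ten (Gen Gs) iU)))
    (Cmp (Ten iU (Gen Gs)) (Cmp (Ten (Gen Gs) iU) (Ten iU (Gen Gs))))"
| s_dot: "heis_rel k
    (Cmp (Gen Gs) (Ten (Gen Gx) iU))
    (Add (Cmp (Ten iU (Gen Gx)) (Gen Gs)) (Idt [Up, Up]))"
| zigzag_up: "heis_rel k (Cmp (Ten (Gen Gd) iU) (Ten iU (Gen Gc))) iU"
| zigzag_down: "heis_rel k (Cmp (Ten iD (Gen Gd)) (Ten (Gen Gc) iD)) iD"
| pos_tt': "0 \<le> k \<Longrightarrow> heis_rel k (Cmp t_tm (Gen Gt')) (Idt [Down, Up])"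
| pos_tu: "int a < k \<Longrightarrow> heis_rel k (Cmp t_tm (Gen (Gu a))) (Zer [] [Down, Up])"
| pos_dt': "int a < k \<Longrightarrow> heis_rel k (Cmp (dx a) (Gen Gt')) (Zer [Down, Up] [])"
| pos_du: "int a < k \<Longrightarrow> int b < k \<Longrightarrow>
    heis_rel k (Cmp (dx a) (Gen (Gu b))) (if a = b then Idt [] else Zer [] [])"
| pos_sum: "0 \<le> k \<Longrightarrow> heis_rel k
    (Add (Cmp (Gen Gt') t_tm)
      (tm_sum [Up, Down] [Up, Down] (map (\<lambda>a. Cmp (Gen (Gu a)) (dx a)) [0..<nat k])))
    (Idt [Up, Down])"
| neg_t't: "k \<le> 0 \<Longrightarrow> heis_rel k (Cmp (Gen Gt') t_tm) (Idt [Up, Down])"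
| neg_t'c: "int a < - k \<Longrightarrow> heis_rel k (Cmp (Gen Gt') (xc a)) (Zer [] [Up, Down])"
| neg_vt: "int a < - k \<Longrightarrow> heis_rel k (Cmp (Gen (Gv a)) t_tm) (Zer [Up, Down] [])"
| neg_vc: "int a < - k \<Longrightarrow> int b < - k \<Longrightarrow>
    heis_rel k (Cmp (Gen (Gv a)) (xc b)) (if a = b then Idt [] else Zer [] [])"
| neg_sum: "k \<le> 0 \<Longrightarrow> heis_rel k
    (Add (Cmp t_tm (Gen Gt'))
      (tm_sum [Down, Up] [Down, Up] (map (\<lambda>a. Cmp (xc a) (Gen (Gv a))) [0..<nat (- k)])))
    (Idt [Down, Up])"

type_synonym 'a heis_mor = "'a heis_tm set"

definition Heis :: "int \<Rightarrow> (updown list, 'a::field heis_mor, 'a) linmon" where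
  "Heis k = presented (heis_signat k) (heis_rel k)"

definition heis_class :: "int \<Rightarrow> 'a::field heis_tm \<Rightarrow> 'a heis_mor" where
  "heis_class k f = Collect (tmeq (heis_signat k) (heis_rel k) f)"


section \<open>Symmetric groups\<close>

text \<open>The group algebra of the symmetric group on \<open>{1..n}\<close>, as functions on the group.\<close>

definition grp_alg :: "nat \<Rightarrow> ((nat \<Rightarrow> nat) \<Rightarrow> 'a::field) set" where
  "grp_alg n = {a. \<forall>\<pi>. \<not> \<pi> permutes {1..n} \<longrightarrow> a \<pi> = 0}"

definition grp_basis :: "(nat \<Rightarrow> nat) \<Rightarrow> (nat \<Rightarrow> nat) \<Rightarrow> 'a::field" where
  "grp_basis \<pi> = (\<lambda>\<sigma>. if \<sigma> = \<pi> then 1 else 0)"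

definition grp_mult :: "nat \<Rightarrow> ((nat \<Rightarrow> nat) \<Rightarrow> 'a::field) \<Rightarrow> ((nat \<Rightarrow> nat) \<Rightarrow> 'a) \<Rightarrow> (nat \<Rightarrow> nat) \<Rightarrow> 'a" where
  "grp_mult n a b = (\<lambda>\<pi>. \<Sum>\<sigma> | \<sigma> permutes {1..n}. a \<sigma> * b (inv \<sigma> \<circ> \<pi>))"

definition grp_alg_hom :: "nat \<Rightarrow> ('o, 'm, 'a::field) linmon \<Rightarrow> 'o \<Rightarrow> (((nat \<Rightarrow> nat) \<Rightarrow> 'a) \<Rightarrow> 'm) \<Rightarrow> bool" where
  "grp_alg_hom n C X \<phi> \<longleftrightarrow>
     (\<forall>a\<in>grp_alg n. \<phi> a \<in> hom C X X) \<and>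
     \<phi> (grp_basis id) = idm C X \<and>
     (\<forall>a\<in>grp_alg n. \<forall>b\<in>grp_alg n. \<phi> (grp_mult n a b) = cmp C (\<phi> a) (\<phi> b)) \<and>
     (\<forall>a\<in>grp_alg n. \<forall>b\<in>grp_alg n. \<phi> (\<lambda>\<pi>. a \<pi> + b \<pi>) = add C (\<phi> a) (\<phi> b)) \<and>
     (\<forall>c. \<forall>a\<in>grp_alg n. \<phi> (\<lambda>\<pi>. c * a \<pi>) = scl C c (\<phi> a))"

definition simple_transp :: "nat \<Rightarrow> nat \<Rightarrow> nat" where
  "simple_transp i = transpose i (Suc i)"

definition coxeter_length :: "nat \<Rightarrow> (nat \<Rightarrow> nat) \<Rightarrow> nat" where
  "coxeter_length n \<pi> = (LEAST l. \<exists>is. length is = l \<and> set is \<subseteq> {1..<n} \<and>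
     \<pi> = foldr (\<circ>) (map simple_transp is) id)"

definition symmetrizer :: "nat \<Rightarrow> (nat \<Rightarrow> nat) \<Rightarrow> 'a::field_char_0" where
  "symmetrizer n = (\<lambda>\<pi>. if \<pi> permutes {1..n} then 1 / fact n else 0)"

definition antisymmetrizer :: "nat \<Rightarrow> (nat \<Rightarrow> nat) \<Rightarrow> 'a::field_char_0" where
  "antisymmetrizer n =
     (\<lambda>\<pi>. if \<pi> permutes {1..n} then (- 1) ^ coxeter_length n \<pi> / fact n else 0)"

text \<open>
  \<open>iota k n\<close> is determined on \<open>grp_alg n\<close>, since the simple transpositions generate the group algebra;
  its values elsewhere are arbitrary.
\<close>

definition iota :: "int \<Rightarrow> nat \<Rightarrow> ((nat \<Rightarrow> nat) \<Rightarrow> 'a::field) \<Rightarrow> 'a heis_mor" where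
  "iota k n = (SOME \<phi>. grp_alg_hom n (Heis k) (replicate n Up) \<phi> \<and>
     (\<forall>i\<in>{1..<n}. \<phi> (grp_basis (simple_transp i)) =
        heis_class k (Ten (Idt (replicate (n - i - 1) Up))
          (Ten (Gen Gs) (Idt (replicate (i - 1) Up))))))"


section \<open>Symmetric and exterior powers of the generating objects\<close>

fun ncup :: "nat \<Rightarrow> 'a heis_tm" where
  "ncup 0 = Idt []"
| "ncup (Suc n) = Cmp (Ten iD (Ten (ncup n) iU)) (Gen Gc)"

fun ncap :: "nat \<Rightarrow> 'a heis_tm" where
  "ncap 0 = Idt []"
| "ncap (Suc n) = Cmp (Gen Gd) (Ten iU (Ten (ncap n) iD))"

definition mate :: "int \<Rightarrow> nat \<Rightarrow> 'a::field heis_mor \<Rightarrow> 'a heis_mor" where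
  "mate k n f = (let C = Heis k; D = idm C (replicate n Down) in
     cmp C (tmo C D (heis_class k (ncap n)))
       (cmp C (tmo C D (tmo C f D)) (tmo C (heis_class k (ncup n)) D)))"

type_synonym 'a heis_kar_ob = "(updown list, 'a heis_mor) kar_ob"

definition Hplus :: "int \<Rightarrow> nat \<Rightarrow> 'a::field_char_0 heis_kar_ob" where
  "Hplus k n = kar_pair (replicate n Up) (iota k n (symmetrizer n))"

text \<open>The dual of \<open>(\<up>\<^sup>n, \<iota>\<^sub>n(e))\<close> with \<open>e\<close> the antisymmetrizer.\<close>

definition Eminus :: "int \<Rightarrow> nat \<Rightarrow> 'a::field_char_0 heis_kar_ob" where
  "Eminus k n = kar_pair (replicate n Down) (mate k n (iota k n (antisymmetrizer n)))"

text \<open>Partitions, as weakly decreasing lists of positive parts, inside an \<open>r \<times> (k - r)\<close> rectangle.\<close>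

definition box_partitions :: "nat \<Rightarrow> nat \<Rightarrow> nat list set" where
  "box_partitions r k = {l. sorted_wrt (\<ge>) l \<and> (\<forall>p\<in>set l. 0 < p \<and> p \<le> k - r) \<and> length l \<le> r}"

end

theory Submission
  imports Defs
begin

text \<open>
  For \<open>k \<ge> 0\<close>, map $H_m^+ \otimes E_n^-$ to its summands as follows: cap off the \<open>r\<close> innermost pairs of strands
  by nested caps carrying \<open>l\<^sub>1, \<dots>, l\<^sub>r < k\<close> dots, and let the remaining upward strands cross the remaining
  downward ones. Against a symmetrizer and an antisymmetrizer the nested dotted caps are alternating in the \<open>l\<^sub>i\<close>
  up to caps with fewer dots, so that the strictly decreasing \<open>l\<close> suffice; subtracting the staircase turns these
  into the partitions in an \<open>r \<times> (k - r)\<close> rectangle. For \<open>m = n = 1\<close> the inversion relation says that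
  these maps form an isomorphism. The general case follows by adding one strand at a time: the identity is a
  combination of the maps, and preimages of the summands exist by triangularity in \<open>l\<^sub>1 + \<dots> + l\<^sub>r\<close>.
  The case \<open>k \<le> 0\<close> is the same argument in the opposite category, with upward and downward strands exchanged, and
  the first two isomorphisms are crossings of all strands of one factor with all strands of the other.
\<close>

section \<open>Word categories\<close>

text \<open>The alternation comes from one sign. Two nested caps turn a crossing of their upward
  legs into a crossing of their downward legs, and on the two idempotents these take opposite values
  \<open>\<eta>\<close> and \<open>- \<eta>\<close>. Sliding dots through the crossing costs only
  terms with fewer dots in total and with each count below the old maximum, so all counts stay below
  \<open>k\<close>. The obstacle is that adding a strand is not just tensoring:
  \<open>e (Suc m)\<close> is a proper summand of \<open>e m\<close> tensored with a strand. The
  known cases decompose this larger idempotent \<open>F\<close>, and the wanted maps have to be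
  compared with its components \<open>\<Omega>\<close>. The expansion of \<open>Suc m\<close> times
  \<open>e (Suc m)\<close> over coset representatives does this; its scalars must be inverted, hence
  characteristic zero. The components in which the new strand is capped form a block that the
  preimages for short lists kill. Only the lists that cap every upward strand mix with each other,
  and there the number of dots gives a triangular order. No inverse is written down: it suffices
  that the idempotent factors through the maps and that every summand has a preimage.\<close>

text \<open>
  All morphisms live in one vector space, with a total bilinear composition (zero for mismatched objects) and
  whiskering \<open>wh Z f W\<close>, the tensor product of \<open>f\<close> with the identities of \<open>Z\<close> and \<open>W\<close>. Hence
  associativity and functoriality hold without typing assumptions.
\<close>

locale word_category = vector_space scale
  for scale :: "'a::field_char_0 \<Rightarrow> 'v::ab_group_add \<Rightarrow> 'v" (infixr \<open>*s\<close> 75) +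
  fixes hom :: "'g list \<Rightarrow> 'g list \<Rightarrow> 'v set"
    and one :: "'g list \<Rightarrow> 'v"
    and mul :: "'v \<Rightarrow> 'v \<Rightarrow> 'v" (infixr \<open>\<bullet>\<close> 70)
    and wh :: "'g list \<Rightarrow> 'v \<Rightarrow> 'g list \<Rightarrow> 'v"
  assumes subspace_hom: "subspace (hom X Y)"
    and one_hom: "one X \<in> hom X X"
    and mul_hom: "f \<in> hom X Y \<Longrightarrow> g \<in> hom Y Z \<Longrightarrow> g \<bullet> f \<in> hom X Z"
    and wh_hom: "f \<in> hom X Y \<Longrightarrow> wh Z f W \<in> hom (Z @ X @ W) (Z @ Y @ W)"
    and mul_assoc: "(h \<bullet> g) \<bullet> f = h \<bullet> (g \<bullet> f)"
    and mul_add_left: "(g + g') \<bullet> f = g \<bullet> f + g' \<bullet> f"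
    and mul_add_right: "g \<bullet> (f + f') = g \<bullet> f + g \<bullet> f'"
    and mul_scale_left: "(a *s g) \<bullet> f = a *s (g \<bullet> f)"
    and mul_scale_right: "g \<bullet> (a *s f) = a *s (g \<bullet> f)"
    and one_left: "f \<in> hom X Y \<Longrightarrow> one Y \<bullet> f = f"
    and one_right: "f \<in> hom X Y \<Longrightarrow> f \<bullet> one X = f"
    and wh_add: "wh Z (f + g) W = wh Z f W + wh Z g W"
    and wh_scale: "wh Z (a *s f) W = a *s wh Z f W"
    and wh_mul: "wh Z (g \<bullet> f) W = wh Z g W \<bullet> wh Z f W"
    and wh_wh: "wh Z (wh Z' f W') W = wh (Z @ Z') f (W' @ W)"
    and wh_Nil: "f \<in> hom X Y \<Longrightarrow> wh [] f [] = f"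
    and wh_one: "wh Z (one X) W = one (Z @ X @ W)"
    and interchange: "f \<in> hom X Y \<Longrightarrow> g \<in> hom X' Y' \<Longrightarrow>
       wh [] f Y' \<bullet> wh X g [] = wh Y g [] \<bullet> wh [] f X'"
begin

text \<open>Reversing composition exchanges sources and targets but leaves the tensor order alone,
  so \<open>wh\<close> is kept and only \<open>interchange\<close> is read backwards. This is the
  route to \<open>k \<le> 0\<close>.\<close>

lemma opposite: "word_category scale (\<lambda>X Y. hom Y X) one (\<lambda>g f. f \<bullet> g) wh"
  by unfold_locales (auto simp: subspace_hom one_hom mul_hom wh_hom mul_assoc mul_add_left
    mul_add_right mul_scale_left mul_scale_right wh_add wh_scale wh_mul wh_wh wh_one
    intro: one_left one_right wh_Nil mul_hom interchange[symmetric])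

lemma module_hom_mul_left: "module_hom scale scale (\<lambda>f. f \<bullet> g)"
  by unfold_locales (simp_all add: mul_add_left mul_scale_left)

lemma module_hom_mul_right: "module_hom scale scale (\<lambda>f. g \<bullet> f)"
  by unfold_locales (simp_all add: mul_add_right mul_scale_right)

lemma module_hom_wh: "module_hom scale scale (\<lambda>f. wh Z f W)"
  by unfold_locales (simp_all add: wh_add wh_scale)

lemmas mul_zero_left [simp] = module_hom.zero[OF module_hom_mul_left]
  and mul_zero_right [simp] = module_hom.zero[OF module_hom_mul_right]
  and wh_zero [simp] = module_hom.zero[OF module_hom_wh]
  and mul_diff_left = module_hom.diff[OF module_hom_mul_left]
  and mul_diff_right = module_hom.diff[OF module_hom_mul_right]
  and wh_diff = module_hom.diff[OF module_hom_wh]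
  and mul_minus_left = module_hom.neg[OF module_hom_mul_left]
  and mul_minus_right = module_hom.neg[OF module_hom_mul_right]
  and wh_minus = module_hom.neg[OF module_hom_wh]
  and mul_sum_left = module_hom.sum[OF module_hom_mul_left]
  and mul_sum_right = module_hom.sum[OF module_hom_mul_right]
  and wh_sum = module_hom.sum[OF module_hom_wh]

lemmas distribs = mul_add_left mul_add_right mul_diff_left mul_diff_right mul_minus_left
  mul_minus_right mul_scale_left mul_scale_right wh_add wh_diff wh_minus wh_scale
  scale_right_distrib scale_left_distrib scale_right_diff_distrib

lemmas zero_hom = subspace_0[OF subspace_hom]
  and add_hom = subspace_add[OF subspace_hom]
  and diff_hom = subspace_diff[OF subspace_hom]
  and scale_hom = subspace_scale[OF subspace_hom]
  and sum_hom = subspace_sum[OF subspace_hom]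

lemma wh_homI: "f \<in> hom X Y \<Longrightarrow> A = Z @ X @ W \<Longrightarrow> B = Z @ Y @ W \<Longrightarrow> wh Z f W \<in> hom A B"
  using wh_hom by simp

lemma one_homI: "A = X \<Longrightarrow> B = X \<Longrightarrow> one X \<in> hom A B"
  using one_hom by simp

lemmas typing = mul_hom wh_homI one_homI zero_hom add_hom diff_hom scale_hom

lemmas words = replicate_add replicate_app_Cons_same

lemma rep_rep [simp]: "replicate a x @ replicate b x = replicate (a + b) x"
  "replicate a x @ replicate b x @ xs = replicate (a + b) x @ xs"
  "replicate a x @ x # xs = x # replicate a x @ xs"
  by (simp_all add: replicate_add replicate_app_Cons_same)

text \<open>Morphisms on disjoint blocks of a word commute; \<open>Z\<close>, \<open>M\<close>,
  \<open>W\<close> are the idle strands to the left, in between and to the right. All height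
  exchanges of diagrams below are instances.\<close>

lemma exchange: "f \<in> hom X Y \<Longrightarrow> g \<in> hom X' Y' \<Longrightarrow>
  wh Z f (M @ Y' @ W) \<bullet> wh (Z @ X @ M) g W = wh (Z @ Y @ M) g W \<bullet> wh Z f (M @ X' @ W)"
proof -
  assume f: "f \<in> hom X Y" and g: "g \<in> hom X' Y'"
  have "wh [] (wh [] (wh Z f M) Y' \<bullet> wh (Z @ X @ M) g []) W = wh [] (wh (Z @ Y @ M) g [] \<bullet> wh [] (wh Z f M) X') W"
    using interchange[OF wh_hom[OF f] g] by simp
  then show ?thesis by (simp add: wh_mul wh_wh)
qed

text \<open>Products are kept nested to the right, where an equation for two factors no longer
  matches inside a longer product. This turns it into a rewrite rule for that situation.\<close>

lemma reassoc: "a \<bullet> b = r \<Longrightarrow> a \<bullet> (b \<bullet> z) = r \<bullet> z"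
  by (simp flip: mul_assoc)

section \<open>Strands, symmetrizers and antisymmetrizers\<close>

text \<open>\<open>pol V s \<chi> n w c\<close>: \<open>w\<close> is a linear combination of words in the crossings of adjacent strands
  among \<open>n\<close> strands of colour \<open>V\<close>, and \<open>c\<close> is its value under the character \<open>s \<mapsto> \<chi>\<close>.\<close>

inductive pol :: "'g \<Rightarrow> 'v \<Rightarrow> 'a \<Rightarrow> nat \<Rightarrow> 'v \<Rightarrow> 'a \<Rightarrow> bool" for V s \<chi> where
  pol_one: "pol V s \<chi> n (one (replicate n V)) 1"
| pol_mul: "pol V s \<chi> n w c \<Longrightarrow> n = Suc (Suc (a + b)) \<Longrightarrow>
    pol V s \<chi> n (wh (replicate a V) s (replicate b V) \<bullet> w) (\<chi> * c)"
| pol_add: "pol V s \<chi> n w c \<Longrightarrow> pol V s \<chi> n w' c' \<Longrightarrow> pol V s \<chi> n (w + w') (c + c')"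
| pol_scale: "pol V s \<chi> n w c \<Longrightarrow> pol V s \<chi> n (a *s w) (a * c)"

text \<open>\<open>labs\<close> and \<open>rabs\<close> make \<open>\<xi>\<close> an eigenvector,
  with eigenvalue \<open>\<chi>\<close>, of the crossings among \<open>n\<close> adjacent strands of
  its target or source. Only generators are mentioned; \<open>pol_labs\<close> and
  \<open>pol_rabs\<close> extend this to all words.\<close>

definition labs where "labs V s \<chi> n Z W \<xi> \<longleftrightarrow>
  (\<forall>a b. n = Suc (Suc (a + b)) \<longrightarrow> wh (Z @ replicate a V) s (replicate b V @ W) \<bullet> \<xi> = \<chi> *s \<xi>)"

definition rabs where "rabs V s \<chi> n Z W \<xi> \<longleftrightarrow>
  (\<forall>a b. n = Suc (Suc (a + b)) \<longrightarrow> \<xi> \<bullet> wh (Z @ replicate a V) s (replicate b V @ W) = \<chi> *s \<xi>)"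

text \<open>The idempotent of the one-dimensional representation \<open>\<chi>\<close> of the
  symmetric group: symmetrizer for \<open>\<chi> = 1\<close>, antisymmetrizer for
  \<open>\<chi> = - 1\<close>. It is characterized, not constructed. Absorption and the value 1 give
  idempotency and uniqueness, so that no sum over permutations appears until the group algebra is
  brought in.\<close>

definition proj where "proj V s \<chi> n e \<longleftrightarrow> pol V s \<chi> n e 1 \<and> labs V s \<chi> n [] [] e \<and> rabs V s \<chi> n [] [] e"

end

locale strands = word_category scale hom one mul wh
  for scale :: "'a::field_char_0 \<Rightarrow> 'v::ab_group_add \<Rightarrow> 'v" (infixr \<open>*s\<close> 75)
    and hom :: "'g list \<Rightarrow> 'g list \<Rightarrow> 'v set" and one :: "'g list \<Rightarrow> 'v"
    and mul :: "'v \<Rightarrow> 'v \<Rightarrow> 'v" (infixr \<open>\<bullet>\<close> 70)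
    and wh :: "'g list \<Rightarrow> 'v \<Rightarrow> 'g list \<Rightarrow> 'v" +
  fixes V :: 'g and s :: 'v and \<chi> :: 'a
  assumes s_hom: "s \<in> hom [V, V] [V, V]"
    and s_sq: "s \<bullet> s = one [V, V]"
    and braid: "wh [] s [V] \<bullet> wh [V] s [] \<bullet> wh [] s [V] = wh [V] s [] \<bullet> wh [] s [V] \<bullet> wh [V] s []"
    and char_sq: "\<chi> * \<chi> = 1"
begin

abbreviation P where "P n \<equiv> replicate n V"

lemma pol_hom: "pol V s \<chi> n w c \<Longrightarrow> w \<in> hom (P n) (P n)"
proof (induction rule: pol.induct)
  case (pol_mul n w c a b)
  then show ?case by (intro mul_hom[OF pol_mul.IH] wh_homI[OF s_hom]) simp_all
qed (auto intro: typing one_hom)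

lemma s_homI: "n = Suc (Suc (a + b)) \<Longrightarrow> wh (P a) s (P b) \<in> hom (P n) (P n)"
  by (intro wh_homI[OF s_hom]) simp_all

lemma pol_prod: "pol V s \<chi> n w c \<Longrightarrow> pol V s \<chi> n w' c' \<Longrightarrow> pol V s \<chi> n (w \<bullet> w') (c * c')"
proof (induction rule: pol.induct)
  case (pol_one n) then show ?case by (simp add: one_left[OF pol_hom])
next
  case (pol_mul n w c a b)
  then show ?case using pol.pol_mul[of V s \<chi> n "w \<bullet> w'" "c * c'" a b] by (simp add: mul_assoc mult.assoc)
next
  case (pol_add n w1 c1 w2 c2)
  then show ?case by (simp add: mul_add_left distrib_right pol.pol_add)
next
  case (pol_scale n w c a)
  then show ?case by (simp add: mul_scale_left mult.assoc pol.pol_scale)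
qed

lemma pol_s: "n = Suc (Suc (a + b)) \<Longrightarrow> pol V s \<chi> n (wh (P a) s (P b)) \<chi>"
  using pol_mul[OF pol_one, of n a b V s \<chi>] one_right[OF s_homI[of n a b]] by simp

lemma pol_wh: "pol V s \<chi> n w c \<Longrightarrow> m = a + n + b \<Longrightarrow> pol V s \<chi> m (wh (P a) w (P b)) c"
proof (induction arbitrary: m rule: pol.induct)
  case (pol_one n)
  show ?case using pol.pol_one[of V s \<chi> m] pol_one by (simp add: wh_one add.assoc)
next
  case (pol_mul n w c i j)
  show ?case using pol.pol_mul[OF pol_mul.IH[OF pol_mul.prems], of "a + i" "b + j"] pol_mul.prems pol_mul.hyps
    by (simp add: wh_mul wh_wh add_ac)
next
  case (pol_add n w1 c1 w2 c2)
  then show ?case by (simp add: wh_add pol.pol_add)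
next
  case (pol_scale n w c a)
  then show ?case by (simp add: wh_scale pol.pol_scale)
qed

text \<open>On a common eigenvector of the crossings a word acts through the character, whose value
  is what \<open>pol\<close> records.\<close>

lemma pol_labs: "pol V s \<chi> n w c \<Longrightarrow> labs V s \<chi> n Z W \<xi> \<Longrightarrow> \<xi> \<in> hom A (Z @ P n @ W)
  \<Longrightarrow> wh Z w W \<bullet> \<xi> = c *s \<xi>"
proof (induction rule: pol.induct)
  case (pol_one n) then show ?case by (simp add: wh_one one_left)
next
  case (pol_mul n w c a b)
  then show ?case unfolding labs_def by (simp add: wh_mul wh_wh mul_assoc mul_scale_right mult.commute)
qed (simp_all add: wh_add wh_scale distribs)

lemma pol_rabs: "pol V s \<chi> n w c \<Longrightarrow> rabs V s \<chi> n Z W \<xi> \<Longrightarrow> \<xi> \<in> hom (Z @ P n @ W) A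
  \<Longrightarrow> \<xi> \<bullet> wh Z w W = c *s \<xi>"
proof (induction rule: pol.induct)
  case (pol_one n) then show ?case by (simp add: wh_one one_right)
next
  case (pol_mul n w c a b)
  then show ?case unfolding rabs_def by (simp add: wh_mul wh_wh flip: mul_assoc) (simp add: mul_scale_left)
qed (simp_all add: wh_add wh_scale distribs)

lemma proj_hom: "proj V s \<chi> n e \<Longrightarrow> e \<in> hom (P n) (P n)"
  by (metis proj_def pol_hom)

lemma labs_mul: "labs V s \<chi> n Z W \<xi> \<Longrightarrow> labs V s \<chi> n Z W (\<xi> \<bullet> \<zeta>)"
  by (simp add: labs_def mul_scale_left flip: mul_assoc)

lemma labs_wh: "labs V s \<chi> n Z W \<xi> \<Longrightarrow> labs V s \<chi> n (Z' @ Z) (W @ W') (wh Z' \<xi> W')"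
  unfolding labs_def
proof (intro allI impI)
  fix a b assume "\<forall>a b. n = Suc (Suc (a + b)) \<longrightarrow> wh (Z @ P a) s (P b @ W) \<bullet> \<xi> = \<chi> *s \<xi>"
    and "n = Suc (Suc (a + b))"
  then have "wh Z' (wh (Z @ P a) s (P b @ W) \<bullet> \<xi>) W' = wh Z' (\<chi> *s \<xi>) W'" by simp
  then show "wh ((Z' @ Z) @ P a) s (P b @ W @ W') \<bullet> wh Z' \<xi> W' = \<chi> *s wh Z' \<xi> W'"
    by (simp add: wh_mul wh_scale wh_wh)
qed

lemma rabs_wh: "rabs V s \<chi> n Z W \<xi> \<Longrightarrow> rabs V s \<chi> n (Z' @ Z) (W @ W') (wh Z' \<xi> W')"
  unfolding rabs_def
proof (intro allI impI)
  fix a b assume "\<forall>a b. n = Suc (Suc (a + b)) \<longrightarrow> \<xi> \<bullet> wh (Z @ P a) s (P b @ W) = \<chi> *s \<xi>"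
    and "n = Suc (Suc (a + b))"
  then have "wh Z' (\<xi> \<bullet> wh (Z @ P a) s (P b @ W)) W' = wh Z' (\<chi> *s \<xi>) W'" by simp
  then show "wh Z' \<xi> W' \<bullet> wh ((Z' @ Z) @ P a) s (P b @ W @ W') = \<chi> *s wh Z' \<xi> W'"
    by (simp add: wh_mul wh_scale wh_wh)
qed

lemma labs_sub: "labs V s \<chi> n Z W \<xi> \<Longrightarrow> n = a + m + b \<Longrightarrow> labs V s \<chi> m (Z @ P a) (P b @ W) \<xi>"
  unfolding labs_def
proof (intro allI impI)
  fix c d assume "\<forall>a b. n = Suc (Suc (a + b)) \<longrightarrow> wh (Z @ P a) s (P b @ W) \<bullet> \<xi> = \<chi> *s \<xi>"
    "n = a + m + b" "m = Suc (Suc (c + d))"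
  then show "wh ((Z @ P a) @ P c) s (P d @ P b @ W) \<bullet> \<xi> = \<chi> *s \<xi>"
    by (auto dest!: spec[of _ "a + c"] spec[of _ "d + b"])
qed

lemma rabs_sub: "rabs V s \<chi> n Z W \<xi> \<Longrightarrow> n = a + m + b \<Longrightarrow> rabs V s \<chi> m (Z @ P a) (P b @ W) \<xi>"
  unfolding rabs_def
proof (intro allI impI)
  fix c d assume "\<forall>a b. n = Suc (Suc (a + b)) \<longrightarrow> \<xi> \<bullet> wh (Z @ P a) s (P b @ W) = \<chi> *s \<xi>"
    "n = a + m + b" "m = Suc (Suc (c + d))"
  then show "\<xi> \<bullet> wh ((Z @ P a) @ P c) s (P d @ P b @ W) = \<chi> *s \<xi>"
    by (auto dest!: spec[of _ "a + c"] spec[of _ "d + b"])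
qed

lemma proj_labs: "proj V s \<chi> n e \<Longrightarrow> labs V s \<chi> n Z W (wh Z e W)"
  using labs_wh[of n "[]" "[]" e Z W] by (simp add: proj_def)

lemma proj_rabs: "proj V s \<chi> n e \<Longrightarrow> rabs V s \<chi> n Z W (wh Z e W)"
  using rabs_wh[of n "[]" "[]" e Z W] by (simp add: proj_def)

lemma proj_labs_mul: "proj V s \<chi> n e \<Longrightarrow> labs V s \<chi> n Z W \<xi> \<Longrightarrow> \<xi> \<in> hom A (Z @ P n @ W) \<Longrightarrow> wh Z e W \<bullet> \<xi> = \<xi>"
  using pol_labs[of n e 1] by (simp add: proj_def)

lemma proj_rabs_mul: "proj V s \<chi> n e \<Longrightarrow> rabs V s \<chi> n Z W \<xi> \<Longrightarrow> \<xi> \<in> hom (Z @ P n @ W) A \<Longrightarrow> \<xi> \<bullet> wh Z e W = \<xi>"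
  using pol_rabs[of n e 1] by (simp add: proj_def)

lemma proj_idem: assumes "proj V s \<chi> n e" shows "e \<bullet> e = e"
  using proj_labs_mul[OF assms, of "[]" "[]" e] assms wh_Nil[OF proj_hom[OF assms]] proj_hom[OF assms]
  by (simp add: proj_def)

text \<open>The product \<open>e \<bullet> e'\<close> is \<open>e'\<close> because \<open>e\<close>
  has value 1 and \<open>e'\<close> absorbs on the left; it is \<open>e\<close> for the mirrored
  reason.\<close>

lemma proj_unique: assumes "proj V s \<chi> n e" "proj V s \<chi> n e'" shows "e = e'"
  using proj_labs_mul[OF assms(1), of "[]" "[]" e'] proj_rabs_mul[OF assms(2), of "[]" "[]" e]
    assms wh_Nil[OF proj_hom[OF assms(1)]] wh_Nil[OF proj_hom[OF assms(2)]]
    proj_hom[OF assms(1)] proj_hom[OF assms(2)]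
  by (simp add: proj_def)

text \<open>The crossings of a sub-block are among those of the whole block, so a smaller projector
  next to a larger one acts by its value 1.\<close>

lemma proj_absorb_left:
  assumes "proj V s \<chi> n e" "proj V s \<chi> m e'" "n = a + m + b"
  shows "wh (Z @ P a) e' (P b @ W) \<bullet> wh Z e W = wh Z e W"
  by (rule proj_labs_mul[OF assms(2) labs_sub[OF proj_labs[OF assms(1)] assms(3)]])
    (use assms(3) in \<open>auto intro!: wh_homI[OF proj_hom[OF assms(1)]] simp: add.assoc\<close>)

lemma proj_absorb_right:
  assumes "proj V s \<chi> n e" "proj V s \<chi> m e'" "n = a + m + b"
  shows "wh Z e W \<bullet> wh (Z @ P a) e' (P b @ W) = wh Z e W"
  by (rule proj_rabs_mul[OF assms(2) rabs_sub[OF proj_rabs[OF assms(1)] assms(3)]])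
    (use assms(3) in \<open>auto intro!: wh_homI[OF proj_hom[OF assms(1)]] simp: add.assoc\<close>)

lemma proj_0: "proj V s \<chi> 0 e \<Longrightarrow> e = one []"
proof (rule proj_unique)
  show "proj V s \<chi> 0 (one [])" using pol_one[of V s \<chi> 0] by (simp add: proj_def labs_def rabs_def)
qed

lemma proj_1: "proj V s \<chi> (Suc 0) e \<Longrightarrow> e = one [V]"
proof (rule proj_unique)
  show "proj V s \<chi> (Suc 0) (one [V])" using pol_one[of V s \<chi> "Suc 0"] by (simp add: proj_def labs_def rabs_def)
qed

text \<open>\<open>e \<bullet> w\<close> is \<open>e\<close> since \<open>w\<close> has value 1, and
  it is \<open>w\<close> since \<open>w\<close> absorbs crossings. Absorption on one side is
  therefore enough to recognize the projector.\<close>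

lemma proj_eqI:
  assumes e: "proj V s \<chi> n e" and "pol V s \<chi> n w 1" "labs V s \<chi> n [] [] w"
  shows "e = w"
  using pol_rabs[OF assms(2), of "[]" "[]" e] proj_labs_mul[OF e assms(3)] pol_hom[OF assms(2)] proj_hom[OF e]
     wh_Nil[OF proj_hom[OF e]] wh_Nil[OF pol_hom[OF assms(2)]] e
  by (simp add: proj_def)

text \<open>\<open>crossings r\<close> moves the rightmost of \<open>r + 1\<close> strands to the left, and \<open>coset m\<close> is the sum of
  the coset representatives of \<open>S\<^sub>m\<close> in \<open>S\<^bsub>m+1\<^esub>\<close>, twisted by the character.\<close>

primrec crossings :: "nat \<Rightarrow> 'v" where
  "crossings 0 = one [V]"
| "crossings (Suc r) = wh [] s (P r) \<bullet> wh [V] (crossings r) []"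

primrec coset :: "nat \<Rightarrow> 'v" where
  "coset 0 = one [V]"
| "coset (Suc m) = one (P (Suc (Suc m))) + \<chi> *s (wh [] (coset m) [V] \<bullet> wh (P m) s [])"

lemma pol_crossings: "\<exists>c. pol V s \<chi> (Suc r) (crossings r) c"
proof (induction r)
  case 0 show ?case using pol_one[of V s \<chi> 1] by auto
next
  case (Suc r)
  then obtain c where "pol V s \<chi> (Suc r) (crossings r) c" by blast
  have "pol V s \<chi> (Suc (Suc r)) (wh [V] (crossings r) []) c"
    using pol_wh[OF \<open>pol V s \<chi> (Suc r) (crossings r) c\<close>, of "Suc (Suc r)" 1 0] by simp
  from pol_mul[OF this, of 0 r] show ?case by auto
qed

lemma crossings_hom: "crossings r \<in> hom (P (Suc r)) (P (Suc r))"
  using pol_crossings pol_hom by blast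

lemma pol_coset: "pol V s \<chi> (Suc m) (coset m) (of_nat (Suc m))"
proof (induction m)
  case 0 show ?case using pol_one[of V s \<chi> 1] by auto
next
  case (Suc m)
  have a: "pol V s \<chi> (Suc (Suc m)) (wh [] (coset m) [V]) (of_nat (Suc m))"
    using pol_wh[OF Suc, of "Suc (Suc m)" 0 "Suc 0"] by simp
  have b: "pol V s \<chi> (Suc (Suc m)) (wh (P m) s []) \<chi>"
    using pol_s[of "Suc (Suc m)" m 0] by simp
  have c: "1 + \<chi> * (of_nat (Suc m) * \<chi>) = of_nat (Suc (Suc m))"
    using char_sq by (simp add: algebra_simps)
  show ?case using pol_add[OF pol_one pol_scale[OF pol_prod[OF a b], of \<chi>]] unfolding c coset.simps .
qed

lemma coset_hom: "coset m \<in> hom (P (Suc m)) (P (Suc m))"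
  using pol_coset pol_hom by blast

text \<open>The representatives that move a strand only among the last \<open>r\<close> strands are
  separated from those that carry one across all of them. In the induction step the last
  \<open>r\<close> strands are the capped ones, and the factor \<open>coset p\<close> acts on the
  strands that pass.\<close>

lemma coset_split: "coset (p + r) = (\<Sum>j<r. \<chi> ^ j *s wh (P (p + r - j)) (crossings j) [])
   + \<chi> ^ r *s (wh [] (coset p) (P r) \<bullet> wh (P p) (crossings r) [])"
proof (induction r arbitrary: p)
  case 0
  have "wh [] (coset p) [] \<bullet> wh (P p) (one [V]) [] = coset p"
    using one_right[OF coset_hom[of p]] by (simp add: wh_one wh_Nil[OF coset_hom])
  then show ?case by simp
next
  case (Suc r)
  have *: "wh [] (coset (Suc p)) (P r) \<bullet> wh (P (Suc p)) (crossings r) []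
     = wh (P (Suc p)) (crossings r) [] + \<chi> *s (wh [] (coset p) (P (Suc r)) \<bullet> wh (P p) (crossings (Suc r)) [])"
  proof -
    have "one (P (Suc (Suc p)) @ P r) \<bullet> wh (P (Suc p)) (crossings r) [] = wh (P (Suc p)) (crossings r) []"
      by (rule one_left, rule wh_homI[OF crossings_hom]) simp_all
    then show ?thesis
      by (simp add: distribs wh_wh wh_mul wh_one mul_assoc)
  qed
  have "coset (p + Suc r) = coset (Suc p + r)" by simp
  also have "\<dots> = (\<Sum>j<r. \<chi> ^ j *s wh (P (Suc p + r - j)) (crossings j) [])
     + \<chi> ^ r *s (wh (P (Suc p)) (crossings r) [] + \<chi> *s (wh [] (coset p) (P (Suc r)) \<bullet> wh (P p) (crossings (Suc r)) []))"
    by (simp only: Suc *)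
  also have "\<dots> = (\<Sum>j<Suc r. \<chi> ^ j *s wh (P (p + Suc r - j)) (crossings j) [])
     + \<chi> ^ Suc r *s (wh [] (coset p) (P (Suc r)) \<bullet> wh (P p) (crossings (Suc r)) [])"
    by (simp add: distribs mult.commute)
  finally show ?case .
qed

end

context word_category begin

lemma reassoc3: "a \<bullet> b \<bullet> c = r \<Longrightarrow> a \<bullet> b \<bullet> c \<bullet> z = r \<bullet> z"
  by (metis mul_assoc)

end

context strands begin

lemma char_sq': "\<chi> * (\<chi> * a) = a"
  by (simp add: char_sq flip: mult.assoc)

lemma wh_sq: "wh Z s W \<bullet> wh Z s W = one (Z @ V # V # W)"
  using arg_cong[OF s_sq, of "\<lambda>f. wh Z f W"] by (simp add: wh_mul wh_one)

lemma wh_braid: "wh Z s (V # W) \<bullet> wh (Z @ [V]) s W \<bullet> wh Z s (V # W)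
   = wh (Z @ [V]) s W \<bullet> wh Z s (V # W) \<bullet> wh (Z @ [V]) s W"
  using arg_cong[OF braid, of "\<lambda>f. wh Z f W"] by (simp add: wh_mul wh_wh)

lemma wh_sq_mul: "\<xi> \<in> hom A (Z @ V # V # W) \<Longrightarrow> wh Z s W \<bullet> wh Z s W \<bullet> \<xi> = \<xi>"
  by (simp add: reassoc[OF wh_sq] one_left)

lemma labs_scale: "labs V s \<chi> n Z W \<xi> \<Longrightarrow> labs V s \<chi> n Z W (c *s \<xi>)"
  by (simp add: labs_def mul_scale_right mult.commute)

text \<open>Left multiplication by a crossing permutes the cosets up to factors that the projector
  absorbs, so the twisted sum is an eigenvector. In the induction, crossings away from the last
  strand belong to the previous case and the last crossing needs the braid relation.\<close>

lemma coset_absorb: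
  assumes e: "\<And>n. proj V s \<chi> n (e n)"
  shows "labs V s \<chi> (Suc m) [] [] (coset m \<bullet> wh [] (e m) [V])"
proof (induction m)
  case 0 then show ?case by (simp add: labs_def)
next
  case (Suc m)
  define E where "E = wh [] (e (Suc m)) [V]"
  define S where "S = wh (P m) s []"
  define C where "C = wh [] (coset m) [V]"
  have Eh: "E \<in> hom (P (Suc (Suc m))) (P (Suc (Suc m)))"
    unfolding E_def by (rule wh_homI[OF proj_hom[OF e]]) simp_all
  have Sh: "S \<in> hom (P (Suc (Suc m))) (P (Suc (Suc m)))"
    unfolding S_def by (rule wh_homI[OF s_hom]) simp_all
  have Ch: "C \<in> hom (P (Suc (Suc m))) (P (Suc (Suc m)))"
    unfolding C_def by (rule wh_homI[OF coset_hom]) simp_all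
  have labsE: "labs V s \<chi> (Suc m) [] [V] E"
    unfolding E_def by (rule proj_labs[OF e])
  have SSE: "S \<bullet> S \<bullet> E = E" unfolding S_def using Eh by (intro wh_sq_mul) simp
  have X: "coset (Suc m) \<bullet> E = E + \<chi> *s (C \<bullet> S \<bullet> E)"
    by (simp add: distribs mul_assoc C_def S_def one_left[OF Eh, simplified])
  \<comment> \<open>\<open>S\<close> does not touch the first \<open>m\<close> strands, so the
    factor \<open>e m\<close> contained in \<open>E\<close> can be copied to its left. This is the
    form in which the induction hypothesis applies to \<open>C\<close>.\<close>
  have SE: "\<exists>E2 . E2 = wh [] (e m) [V, V] \<and> S \<bullet> E = E2 \<bullet> S \<bullet> E"
  proof -
    have "wh [] (e m) [V, V] \<bullet> E = E" unfolding E_def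
      using proj_absorb_left[OF e e, of "Suc m" 0 m 1 "[]" "[V]"] by simp
    moreover have "wh [] (e m) [V, V] \<bullet> S = S \<bullet> wh [] (e m) [V, V]" unfolding S_def
      using exchange[OF proj_hom[OF e] s_hom, of "[]" m "[]" "[]"] by simp
    ultimately have "S \<bullet> E = wh [] (e m) [V, V] \<bullet> S \<bullet> E"
      by (metis mul_assoc)
    then show ?thesis by blast
  qed
  have "wh (P a) s (P b) \<bullet> (E + \<chi> *s (C \<bullet> S \<bullet> E)) = \<chi> *s (E + \<chi> *s (C \<bullet> S \<bullet> E))"
    if ab: "Suc (Suc m) = Suc (Suc (a + b))" for a b
  proof (cases b)
    case (Suc b')
    have 1: "wh (P a) s (P b) \<bullet> E = \<chi> *s E"
      using labsE ab Suc unfolding labs_def by auto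
    have "labs V s \<chi> (Suc m) ([] @ []) ([] @ [V]) (wh [] (coset m \<bullet> wh [] (e m) [V]) [V])"
      by (rule labs_wh[OF Suc.IH])
    then have "wh (P a) s (P b) \<bullet> (C \<bullet> wh [] (e m) [V, V]) = \<chi> *s (C \<bullet> wh [] (e m) [V, V])"
      using ab Suc unfolding labs_def C_def by (auto simp: wh_mul wh_wh)
    then have 2: "wh (P a) s (P b) \<bullet> C \<bullet> S \<bullet> E = \<chi> *s (C \<bullet> S \<bullet> E)"
      using SE by (metis mul_assoc mul_scale_left)
    show ?thesis by (simp add: distribs 1 2)
  next
    case 0
    then have S: "wh (P a) s (P b) = S" using ab by (simp add: S_def)
    \<comment> \<open>This is the eigenvector equation solved for
      \<open>S \<bullet> C \<bullet> S \<bullet> E\<close>. Expanding \<open>C\<close> once more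
      makes a braid move possible, after which \<open>E\<close> absorbs \<open>S2\<close>.\<close>
    have "S \<bullet> C \<bullet> S \<bullet> E = E + \<chi> *s (C \<bullet> S \<bullet> E) - S \<bullet> \<chi> *s E"
    proof (cases m)
      case 0
      have "C = one (P (Suc (Suc m)))" using 0 by (simp add: C_def wh_one)
      then have "C \<bullet> S \<bullet> E = S \<bullet> E" using one_left[OF mul_hom[OF Eh Sh]] by simp
      then show ?thesis using SSE by (simp add: distribs)
    next
      case (Suc m')
      define C2 where "C2 = wh [] (coset m') [V, V]"
      define S2 where "S2 = wh (P m') s [V]"
      have S2: "S2 \<bullet> E = \<chi> *s E"
        using labsE[unfolded labs_def, rule_format, of m' 0] Suc unfolding S2_def by simp
      have SC: "S \<bullet> C2 = C2 \<bullet> S" unfolding C2_def S_def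
        using exchange[OF coset_hom[of m'] s_hom, of "[]" "[]" "[]"] Suc by simp
      have br: "S \<bullet> S2 \<bullet> S = S2 \<bullet> S \<bullet> S2"
        using wh_braid[of "P m'" "[]"] Suc unfolding S_def S2_def by simp
      have C: "C \<bullet> w = w + \<chi> *s (C2 \<bullet> S2 \<bullet> w)" if "w \<in> hom A (P (Suc (Suc m)))" for w A
        unfolding C_def C2_def S2_def using Suc one_left[OF that]
        by (simp add: distribs wh_one wh_mul wh_wh mul_assoc)
      have "S \<bullet> C \<bullet> S \<bullet> E = E + \<chi> *s (C2 \<bullet> S2 \<bullet> S \<bullet> S2 \<bullet> E)"
        unfolding C[OF mul_hom[OF Eh Sh]] using SSE
        by (simp add: distribs reassoc[OF SC] mul_assoc reassoc3[OF br])
      moreover have "\<chi> *s (C \<bullet> S \<bullet> E) = \<chi> *s (S \<bullet> E) + C2 \<bullet> S2 \<bullet> S \<bullet> E"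
        unfolding C[OF mul_hom[OF Eh Sh]] by (simp add: distribs char_sq)
      ultimately show ?thesis
        by (simp add: S2 distribs char_sq)
    qed
    then show ?thesis unfolding S by (simp add: distribs char_sq)
  qed
  then show ?case by (simp add: labs_def X E_def[symmetric] del: coset.simps)
qed

text \<open>\<open>coset m\<close> has value \<open>Suc m\<close>, so the right-hand side divided by
  \<open>Suc m\<close> has value 1 and absorbs crossings on the left; \<open>proj_eqI\<close>
  identifies it.\<close>

lemma proj_Suc:
  assumes e: "\<And>n. proj V s \<chi> n (e n)"
  shows "of_nat (Suc m) *s e (Suc m) = coset m \<bullet> wh [] (e m) [V]"
proof -
  have a: "pol V s \<chi> (Suc m) (wh [] (e m) [V]) 1"
    using pol_wh[of m "e m" 1 "Suc m" 0 1] e by (simp add: proj_def)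
  have "e (Suc m) = (1 / of_nat (Suc m)) *s (coset m \<bullet> wh [] (e m) [V])"
  proof (rule proj_eqI[OF e])
    show "pol V s \<chi> (Suc m) ((1 / of_nat (Suc m)) *s (coset m \<bullet> wh [] (e m) [V])) 1"
      using pol_scale[OF pol_prod[OF pol_coset a], of "1 / of_nat (Suc m)"]
      by (simp del: coset.simps of_nat_Suc)
    show "labs V s \<chi> (Suc m) [] [] ((1 / of_nat (Suc m)) *s (coset m \<bullet> wh [] (e m) [V]))"
      by (rule labs_scale[OF coset_absorb[OF e]])
  qed
  then show ?thesis by (simp del: of_nat_Suc coset.simps)
qed

lemma coset_proj: 
  assumes e: "\<And>n. proj V s \<chi> n (e n)"
  shows "coset m \<bullet> wh [] (e m) [V] = of_nat (Suc m) *s e (Suc m)"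
  using proj_Suc[OF e] by simp

text \<open>The two double cosets of \<open>S\<^bsub>n+1\<^esub>\<close> in \<open>S\<^bsub>n+2\<^esub>\<close>.\<close>

lemma proj_Suc_left:
  assumes e: "\<And>n. proj V s \<chi> n (e n)"
  defines "F \<equiv> \<lambda>n. wh [V] (e (Suc n)) []" and "S \<equiv> \<lambda>n. wh [] s (P n)"
  shows "of_nat (n + 2) *s e (Suc (Suc n)) = F n + (of_nat (Suc n) * \<chi>) *s (F n \<bullet> S n \<bullet> F n)"
proof (induction n)
  have Fh: "F n \<in> hom (P (Suc (Suc n))) (P (Suc (Suc n)))" for n
    unfolding F_def by (rule wh_homI[OF proj_hom[OF e]]) simp_all
  have Sh: "S n \<in> hom (P (Suc (Suc n))) (P (Suc (Suc n)))" for n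
    unfolding S_def by (rule wh_homI[OF s_hom]) simp_all
  have Fpol: "pol V s \<chi> (Suc (Suc n)) (F n) 1" for n
    using pol_wh[of "Suc n" "e (Suc n)" 1 "Suc (Suc n)" 1 0] e by (simp add: F_def proj_def)
  have Spol: "pol V s \<chi> (Suc (Suc n)) (S n) \<chi>" for n
    using pol_s[of "Suc (Suc n)" 0 n] by (simp add: S_def)
  \<comment> \<open>Crossings other than the first lie inside \<open>F n\<close> and are absorbed by
    it. Only the first crossing \<open>S n\<close> is left, and it is the content of
    \<open>key\<close>.\<close>
  have main: "of_nat (n + 2) *s e (Suc (Suc n)) = F n + (of_nat (Suc n) * \<chi>) *s (F n \<bullet> S n \<bullet> F n)"
    if key: "S n \<bullet> (F n + (of_nat (Suc n) * \<chi>) *s (F n \<bullet> S n \<bullet> F n)) = \<chi> *s (F n + (of_nat (Suc n) * \<chi>) *s (F n \<bullet> S n \<bullet> F n))" for n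
  proof -
    let ?R = "F n + (of_nat (Suc n) * \<chi>) *s (F n \<bullet> S n \<bullet> F n)"
    have nz: "(of_nat (n + 2) :: 'a) \<noteq> 0" by (metis of_nat_eq_0_iff add_2_eq_Suc' nat.distinct(1))
    have aug: "1 + of_nat (Suc n) * \<chi> * (1 * (\<chi> * 1)) = (of_nat (n + 2) :: 'a)"
      using char_sq by (simp add: mult.assoc)
    have "e (Suc (Suc n)) = (1 / of_nat (n + 2)) *s ?R"
    proof (rule proj_eqI[OF e])
      show "pol V s \<chi> (Suc (Suc n)) ((1 / of_nat (n + 2)) *s ?R) 1"
        using pol_scale[OF pol_add[OF Fpol pol_scale[OF pol_prod[OF Fpol pol_prod[OF Spol Fpol]]], of n "of_nat (Suc n) * \<chi>"], of "1 / of_nat (n + 2)"]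
        unfolding aug using nz by simp
      have "wh (P a) s (P b) \<bullet> ?R = \<chi> *s ?R" if ab: "Suc (Suc n) = Suc (Suc (a + b))" for a b
      proof (cases a)
        case 0 then show ?thesis using key ab by (simp add: S_def)
      next
        case (Suc a')
        have "wh (P a) s (P b) \<bullet> F n = \<chi> *s F n"
          using proj_labs[OF e, of "Suc n" "[V]" "[]"] Suc ab unfolding labs_def F_def by auto
        then show ?thesis by (simp add: distribs reassoc[of _ "F n"])
      qed
      then show "labs V s \<chi> (Suc (Suc n)) [] [] ((1 / of_nat (n + 2)) *s ?R)"
        by (intro labs_scale) (simp add: labs_def)
    qed
    then show ?thesis using nz by simp
  qed
  {
    case 0
    have "F 0 = one [V, V]" using proj_1[OF e] by (simp add: F_def wh_one)
    moreover have "S 0 \<bullet> S 0 = one [V, V]" using wh_sq[of "[]" "[]"] by (simp add: S_def)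
    ultimately show ?case using main[of 0] one_left[OF Sh[of 0]] one_right[OF Sh[of 0]]
      by (simp add: distribs char_sq)
  next
    case (Suc n)
    let ?F = "F (Suc n)" and ?S = "S (Suc n)"
    define F2 where "F2 = wh [V] (F n) []"
    define S2 where "S2 = wh [V] (S n) []"
    define N where "N = (of_nat (n + 2) :: 'a)"
    have F2': "F2 = wh [V, V] (e (Suc n)) []" by (simp add: F2_def F_def wh_wh)
    \<comment> \<open>The left factor of \<open>?F \<bullet> ?S \<bullet> ?F\<close> is going to be
      expanded by the induction hypothesis, shifted by one strand. \<open>F2\<close> commutes with
      \<open>?S\<close> and is absorbed by \<open>?F\<close>, which leaves a braid relation.\<close>
    have "wh [V] (of_nat (n + 2) *s e (Suc (Suc n))) [] = wh [V] (F n + (of_nat (Suc n) * \<chi>) *s (F n \<bullet> S n \<bullet> F n)) []"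
      by (simp only: Suc)
    then have Fexp: "N *s ?F = F2 + (of_nat (Suc n) * \<chi>) *s (F2 \<bullet> S2 \<bullet> F2)"
      by (simp add: F2_def S2_def wh_add wh_scale wh_mul N_def F_def)
    have SF2: "?S \<bullet> F2 = F2 \<bullet> ?S"
      unfolding F2' S_def using exchange[OF s_hom proj_hom[OF e[of "Suc n"]], of "[]" "[]" "[]"] by simp
    have F2F: "F2 \<bullet> ?F = ?F"
      unfolding F2' F_def using proj_absorb_left[OF e e, of "Suc (Suc n)" 1 "Suc n" 0 "[V]" "[]"] by simp
    have S2F: "S2 \<bullet> ?F = \<chi> *s ?F"
      using proj_labs[OF e, of "Suc (Suc n)" "[V]" "[]", unfolded labs_def, rule_format, of 0 n]
      unfolding F_def S2_def S_def by (simp add: wh_wh)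
    have br: "?S \<bullet> S2 \<bullet> ?S = S2 \<bullet> ?S \<bullet> S2"
      using wh_braid[of "[]" "P n"] unfolding S_def S2_def by (simp add: wh_wh)
    have SS: "?S \<bullet> ?S \<bullet> ?F = ?F" unfolding S_def using Fh[of "Suc n"] by (intro wh_sq_mul) simp
    have A: "N *s (?F \<bullet> ?S \<bullet> ?F) = ?S \<bullet> ?F + (of_nat (Suc n) * \<chi>) *s (F2 \<bullet> S2 \<bullet> ?S \<bullet> ?F)"
    proof -
      have "N *s (?F \<bullet> ?S \<bullet> ?F) = (N *s ?F) \<bullet> ?S \<bullet> ?F" by (simp add: mul_scale_left)
      also have "\<dots> = ?S \<bullet> ?F + (of_nat (Suc n) * \<chi>) *s (F2 \<bullet> S2 \<bullet> ?S \<bullet> ?F)"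
        unfolding Fexp by (simp only: distribs mul_assoc reassoc[OF SF2[symmetric]] F2F)
      finally show ?thesis .
    qed
    have B: "N *s (?S \<bullet> ?F \<bullet> ?S \<bullet> ?F) = ?F + of_nat (Suc n) *s (F2 \<bullet> S2 \<bullet> ?S \<bullet> ?F)"
    proof -
      have "N *s (?S \<bullet> ?F \<bullet> ?S \<bullet> ?F) = ?S \<bullet> (N *s (?F \<bullet> ?S \<bullet> ?F))" by (simp add: mul_scale_right)
      also have "\<dots> = ?F + (of_nat (Suc n) * \<chi>) *s (F2 \<bullet> (?S \<bullet> S2 \<bullet> ?S) \<bullet> ?F)"
        unfolding A by (simp only: distribs mul_assoc reassoc[OF SF2] SS)
      also have "F2 \<bullet> (?S \<bullet> S2 \<bullet> ?S) \<bullet> ?F = \<chi> *s (F2 \<bullet> S2 \<bullet> ?S \<bullet> ?F)"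
        unfolding br by (simp only: mul_assoc S2F mul_scale_right)
      finally show ?thesis by (simp add: char_sq mult.assoc)
    qed
    have N: "of_nat (Suc (Suc n)) = N" by (simp add: N_def)
    show ?case
      by (rule main, unfold N, unfold distribs)
        (simp add: A B N_def[symmetric] mult.commute[of N] flip: scale_scale, simp add: distribs char_sq char_sq' mult_ac add_ac distrib_left)
  }
qed

end

section \<open>Crossings of strands of two colours\<close>

context word_category begin

definition invertible where
  "invertible X Y f \<longleftrightarrow> f \<in> hom X Y \<and> (\<exists>g\<in>hom Y X. g \<bullet> f = one X \<and> f \<bullet> g = one Y)"

lemma invertible_one: "invertible X X (one X)"
  using one_hom one_left[OF one_hom] unfolding invertible_def by blast

lemma invertible_wh: "invertible X Y f \<Longrightarrow> invertible (Z @ X @ W) (Z @ Y @ W) (wh Z f W)"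
  unfolding invertible_def by (metis wh_hom wh_mul wh_one)

lemma invertible_mul:
  assumes f: "invertible X Y f" and g: "invertible Y Z g" shows "invertible X Z (g \<bullet> f)"
proof -
  obtain f' where f': "f' \<in> hom Y X" "f' \<bullet> f = one X" "f \<bullet> f' = one Y" "f \<in> hom X Y"
    using f by (auto simp: invertible_def)
  obtain g' where g': "g' \<in> hom Z Y" "g' \<bullet> g = one Y" "g \<bullet> g' = one Z" "g \<in> hom Y Z"
    using g by (auto simp: invertible_def)
  show ?thesis unfolding invertible_def
    using f' g' by (intro conjI bexI[of _ "f' \<bullet> g'"])
      (auto intro: mul_hom simp: mul_assoc reassoc[OF f'(3)] reassoc[OF g'(2)] one_left)
qed

end

text \<open>The two colours may coincide, \<open>t\<close> being the crossing itself; this case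
  yields the isomorphisms that merely commute two factors. The slide axioms pull a crossing of one
  colour through a strand of the other.\<close>

locale crossing = word_category scale hom one mul wh +
  L: strands scale hom one mul wh U sU \<chi>U + R: strands scale hom one mul wh V sV \<chi>V
  for scale :: "'a::field_char_0 \<Rightarrow> 'v::ab_group_add \<Rightarrow> 'v" (infixr \<open>*s\<close> 75)
    and hom :: "'g list \<Rightarrow> 'g list \<Rightarrow> 'v set" and one :: "'g list \<Rightarrow> 'v"
    and mul :: "'v \<Rightarrow> 'v \<Rightarrow> 'v" (infixr \<open>\<bullet>\<close> 70)
    and wh :: "'g list \<Rightarrow> 'v \<Rightarrow> 'g list \<Rightarrow> 'v"
    and U sU \<chi>U V sV \<chi>V +
  fixes t :: 'v
  assumes t_hom: "t \<in> hom [U, V] [V, U]"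
    and slideU: "wh [V] sU [] \<bullet> wh [] t [U] \<bullet> wh [U] t [] = wh [] t [U] \<bullet> wh [U] t [] \<bullet> wh [] sU [V]"
    and slideV: "wh [] sV [U] \<bullet> wh [V] t [] \<bullet> wh [] t [V] = wh [V] t [] \<bullet> wh [] t [V] \<bullet> wh [U] sV []"
begin

abbreviation up where "up n \<equiv> replicate n U"
abbreviation vp where "vp n \<equiv> replicate n V"

text \<open>\<open>tau q\<close> carries one strand to the right past \<open>q\<close> strands of
  the other colour; \<open>cross p q\<close> does this for \<open>p\<close> strands, the rightmost
  one first.\<close>

primrec tau :: "nat \<Rightarrow> 'v" where
  "tau 0 = one [U]"
| "tau (Suc q) = wh [V] (tau q) [] \<bullet> wh [] t (vp q)"

primrec cross :: "nat \<Rightarrow> nat \<Rightarrow> 'v" where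
  "cross 0 q = one (vp q)"
| "cross (Suc p) q = wh [] (cross p q) [U] \<bullet> wh (up p) (tau q) []"

lemma tau_hom: "tau q \<in> hom (U # vp q) (vp q @ [U])"
proof (induction q)
  case 0 show ?case using one_hom[of "[U]"] by simp
next
  case (Suc q)
  show ?case unfolding tau.simps
    by (rule mul_hom[of _ _ "V # U # vp q"], rule wh_homI[OF t_hom]) (auto intro!: wh_homI[OF Suc])
qed

lemma cross_hom: "cross p q \<in> hom (up p @ vp q) (vp q @ up p)"
proof (induction p)
  case 0 show ?case using one_hom[of "vp q"] by simp
next
  case (Suc p)
  show ?case unfolding cross.simps
    by (rule mul_hom[of _ _ "up p @ vp q @ [U]"], rule wh_homI[OF tau_hom])
      (auto intro!: wh_homI[OF Suc])
qed

lemma tau_Nil: "wh [] (tau q) [] = tau q"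
  by (rule wh_Nil[OF tau_hom])

lemma tau_1: "tau (Suc 0) = t"
  using t_hom by (simp add: wh_one wh_Nil[OF t_hom] one_left)

lemma tau_add: "tau (a + b) = wh (vp a) (tau b) [] \<bullet> wh [] (tau a) (vp b)"
proof (induction a)
  case 0
  then show ?case using one_right[OF tau_hom[of b]] by (simp add: tau_Nil wh_one)
next
  case (Suc a)
  then show ?case by (simp add: wh_mul wh_wh mul_assoc)
qed

lemma tau_sV: "wh (vp a) sV (vp b @ [U]) \<bullet> tau (Suc (Suc (a + b))) = tau (Suc (Suc (a + b))) \<bullet> wh (U # vp a) sV (vp b)"
proof (induction a)
  case 0
  have 1: "wh [] sV (vp b @ [U]) \<bullet> wh [V, V] (tau b) [] = wh [V, V] (tau b) [] \<bullet> wh [] sV (U # vp b)"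
    using exchange[OF R.s_hom tau_hom[of b], of "[]" "[]" "[]"] by simp
  have 2: "wh [] sV (U # vp b) \<bullet> wh [V] t (vp b) \<bullet> wh [] t (V # vp b) = wh [V] t (vp b) \<bullet> wh [] t (V # vp b) \<bullet> wh [U] sV (vp b)"
    using arg_cong[OF slideV, of "\<lambda>f. wh [] f (vp b)"] by (simp add: wh_mul wh_wh)
  show ?case by (simp add: wh_mul wh_wh mul_assoc reassoc[OF 1] 2)
next
  case (Suc a)
  have 1: "wh [] t (vp (Suc (Suc (a + b)))) \<bullet> wh (U # V # vp a) sV (vp b) = wh (V # U # vp a) sV (vp b) \<bullet> wh [] t (vp (Suc (Suc (a + b))))"
    using exchange[OF t_hom R.s_hom, of "[]" "vp a" "vp b"] by simp
  have 2: "wh (V # vp a) sV (vp b @ [U]) \<bullet> wh [V] (tau (Suc (Suc (a + b)))) []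
      = wh [V] (tau (Suc (Suc (a + b)))) [] \<bullet> wh (V # U # vp a) sV (vp b)"
    using arg_cong[OF Suc, of "\<lambda>f. wh [V] f []"] by (simp add: wh_mul wh_wh del: tau.simps)
  show ?case unfolding tau.simps(2)[of "Suc (Suc (a + b))"] add_Suc
    using 1 2 by (simp add: mul_assoc reassoc[OF 2] del: tau.simps)
qed

definition tau2 where "tau2 q = wh [] (tau q) [U] \<bullet> wh [U] (tau q) []"

text \<open>Regrouping, so that both strands pass one strand of colour \<open>V\<close> before
  either meets the next, brings each step to the shape of \<open>slideU\<close>.\<close>

lemma tau2_Suc: "tau2 (Suc q) = wh [V] (tau2 q) [] \<bullet> wh [] (wh [] t [U] \<bullet> wh [U] t []) (vp q)"
proof -
  have "wh [] t (vp q @ [U]) \<bullet> wh [U, V] (tau q) [] = wh [V, U] (tau q) [] \<bullet> wh [] t (U # vp q)"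
    using exchange[OF t_hom tau_hom[of q], of "[]" "[]" "[]"] by simp
  from reassoc[OF this] show ?thesis
    by (simp add: tau2_def wh_mul wh_wh mul_assoc)
qed

lemma tau2_sU: "wh (vp q) sU [] \<bullet> tau2 q = tau2 q \<bullet> wh [] sU (vp q)"
proof (induction q)
  case 0
  then show ?case by (simp add: tau2_def wh_one wh_Nil[OF L.s_hom] one_left[OF L.s_hom] one_right[OF L.s_hom] one_left[OF one_hom])
next
  case (Suc q)
  have 1: "wh (V # vp q) sU [] \<bullet> wh [V] (tau2 q) [] = wh [V] (tau2 q) [] \<bullet> wh [V] sU (vp q)"
    using arg_cong[OF Suc, of "\<lambda>f. wh [V] f []"] by (simp add: wh_mul wh_wh)
  have 2: "wh [V] sU (vp q) \<bullet> wh [] t (U # vp q) \<bullet> wh [U] t (vp q) = wh [] t (U # vp q) \<bullet> wh [U] t (vp q) \<bullet> wh [] sU (V # vp q)"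
    using arg_cong[OF slideU, of "\<lambda>f. wh [] f (vp q)"] by (simp add: wh_mul wh_wh)
  show ?case by (simp add: tau2_Suc wh_mul wh_wh mul_assoc reassoc[OF 1] 2)
qed

lemma cross_sV: "n = Suc (Suc (a + b)) \<Longrightarrow> 
  wh (vp a) sV (vp b @ up p) \<bullet> cross p n = cross p n \<bullet> wh (up p @ vp a) sV (vp b)"
proof (induction p)
  case 0 then show ?case using R.s_homI[of n a b] by (simp add: one_left one_right)
next
  case (Suc p)
  have 1: "wh (vp a) sV (vp b @ up (Suc p)) \<bullet> wh [] (cross p n) [U] = wh [] (cross p n) [U] \<bullet> wh (up p @ vp a) sV (vp b @ [U])"
    using arg_cong[OF Suc.IH[OF Suc.prems], of "\<lambda>f. wh [] f [U]"] by (simp add: wh_mul wh_wh)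
  have 2: "wh (up p @ vp a) sV (vp b @ [U]) \<bullet> wh (up p) (tau n) [] = wh (up p) (tau n) [] \<bullet> wh (up (Suc p) @ vp a) sV (vp b)"
    using arg_cong[OF tau_sV[of a b], of "\<lambda>f. wh (up p) f []"] Suc.prems by (simp add: wh_mul wh_wh del: tau.simps)
  show ?case by (simp only: cross.simps mul_assoc reassoc[OF 1] 2)
qed

text \<open>Induction on the number of strands to the right of the crossing, since
  \<open>cross\<close> moves the rightmost strand first. When none is left, the two strands travel
  together and \<open>tau2_sU\<close> applies.\<close>

lemma cross_sU: "p = Suc (Suc (a + b)) \<Longrightarrow>
  wh (vp q @ up a) sU (up b) \<bullet> cross p q = cross p q \<bullet> wh (up a) sU (up b @ vp q)"
proof (induction b arbitrary: p)
  case 0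
  have 1: "wh (vp q @ up a) sU [] \<bullet> wh [] (cross a q) [U, U] = wh [] (cross a q) [U, U] \<bullet> wh (up a @ vp q) sU []"
    using exchange[OF cross_hom[of a q] L.s_hom, of "[]" "[]" "[]"] by simp
  have 2: "wh (up a @ vp q) sU [] \<bullet> wh (up a) (tau q) [U] \<bullet> wh (up (Suc a)) (tau q) [] =
    wh (up a) (tau q) [U] \<bullet> wh (up (Suc a)) (tau q) [] \<bullet> wh (up a) sU (vp q)"
    using arg_cong[OF tau2_sU[of q], of "\<lambda>f. wh (up a) f []"] by (simp add: wh_mul wh_wh tau2_def mul_assoc)
  show ?case using 0 2 by (simp add: wh_mul wh_wh mul_assoc reassoc[OF 1])
next
  case (Suc b)
  then obtain p' where p: "p = Suc p'" "p' = Suc (Suc (a + b))" by simp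
  have 1: "wh (vp q @ up a) sU (up (Suc b)) \<bullet> wh [] (cross p' q) [U] = wh [] (cross p' q) [U] \<bullet> wh (up a) sU (up b @ vp q @ [U])"
    using arg_cong[OF Suc.IH[OF p(2)], of "\<lambda>f. wh [] f [U]"] by (simp add: wh_mul wh_wh)
  have 2: "wh (up a) sU (up b @ vp q @ [U]) \<bullet> wh (up p') (tau q) [] = wh (up p') (tau q) [] \<bullet> wh (up a) sU (up (Suc b) @ vp q)"
    using exchange[OF L.s_hom tau_hom[of q], of "up a" "up b" "[]"] p by simp
  show ?case unfolding p(1) by (simp only: cross.simps mul_assoc reassoc[OF 1] 2)
qed

lemma cross_polV: "pol V sV \<chi>V n w c \<Longrightarrow> wh [] w (up p) \<bullet> cross p n = cross p n \<bullet> wh (up p) w []"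
proof (induction rule: pol.induct)
  case (pol_one n) then show ?case by (simp add: wh_one one_left[OF cross_hom] one_right[OF cross_hom])
next
  case (pol_mul n w c a b)
  then show ?case using cross_sV[OF pol_mul.hyps(2), of p]
    by (simp add: wh_mul wh_wh mul_assoc) (simp flip: mul_assoc)
qed (simp_all add: distribs)

lemma cross_polU: "pol U sU \<chi>U p w c \<Longrightarrow> wh (vp q) w [] \<bullet> cross p q = cross p q \<bullet> wh [] w (vp q)"
proof (induction rule: pol.induct)
  case (pol_one n) then show ?case by (simp add: wh_one one_left[OF cross_hom] one_right[OF cross_hom])
next
  case (pol_mul n w c a b)
  then show ?case using cross_sU[OF pol_mul.hyps(2), of q]
    by (simp add: wh_mul wh_wh mul_assoc) (simp flip: mul_assoc)
qed (simp_all add: distribs)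

lemma invertible_cross:
  assumes "invertible [U, V] [V, U] t"
  shows "invertible (up p @ vp q) (vp q @ up p) (cross p q)"
proof -
  have tau: "invertible (U # vp q) (vp q @ [U]) (tau q)" for q
  proof (induction q)
    case 0 then show ?case using invertible_one[of "[U]"] by simp
  next
    case (Suc q)
    show ?case
      using invertible_mul[OF invertible_wh[OF assms, of "[]" "vp q"]] invertible_wh[OF Suc, of "[V]" "[]"] by simp
  qed
  show ?thesis
  proof (induction p)
    case 0 then show ?case using invertible_one[of "vp q"] by simp
  next
    case (Suc p)
    show ?case using invertible_mul[OF invertible_wh[OF tau[of q], of "up p" "[]"]]
       invertible_wh[OF Suc, of "[]" "[U]"] by simp
  qed
qed

end

section \<open>Dotted caps\<close>

context word_category begin

lemma span_map:
  assumes "module_hom scale scale F" "w \<in> span S" "\<And>x. x \<in> S \<Longrightarrow> F x \<in> span T"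
  shows "F w \<in> span T"
proof -
  interpret module_hom scale scale F by fact
  from assms(2) show ?thesis
    by (induction rule: span_induct) (auto intro!: subspaceI simp: zero add scale span_zero span_add span_scale assms(3))
qed

lemma span_subset: "w \<in> span S \<Longrightarrow> (\<And>x. x \<in> S \<Longrightarrow> x \<in> span T) \<Longrightarrow> w \<in> span T"
  by (meson span_minimal subsetD subsetI subspace_span)

text \<open>The sum of position times entry, positions counted from 0. Swapping an ascending
  neighbouring pair lowers it and keeps the sum of the list, so it breaks ties in
  \<open>sort_span\<close>.\<close>

fun weight :: "nat list \<Rightarrow> nat" where
  "weight [] = 0"
| "weight (a # l) = sum_list l + weight l"

lemma weight_append: "weight (u @ v) = weight u + length u * sum_list v + weight v"
  by (induction u) auto

lemma not_strict_adjacent: "\<not> sorted_wrt (>) (b :: nat list) \<Longrightarrow> \<exists>u \<alpha> \<beta> v. b = u @ [\<alpha>, \<beta>] @ v \<and> \<alpha> \<le> \<beta>"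
proof (induction b)
  case Nil then show ?case by simp
next
  case (Cons a b)
  show ?case
  proof (cases "sorted_wrt (>) b")
    case False
    with Cons obtain u \<alpha> \<beta> v where "b = u @ [\<alpha>, \<beta>] @ v" "\<alpha> \<le> \<beta>" by blast
    then show ?thesis by (intro exI[of _ "a # u"]) auto
  next
    case True
    with Cons obtain \<beta> v where b: "b = \<beta> # v" by (cases b) auto
    have "a \<le> \<beta>" using Cons.prems True b by auto
    then show ?thesis using b by (intro exI[of _ "[]"]) auto
  qed
qed

text \<open>Bubble sort for a map that alternates modulo smaller totals. Equal neighbours make twice
  the value a lower term, whence the factor 1/2; the bound by \<open>max \<alpha> \<beta>\<close>
  keeps all corrections inside \<open>{..<k}\<close>.\<close>

lemma sort_span:
  fixes \<Phi> :: "nat list \<Rightarrow> 'v"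
  assumes swap: "\<And>u \<alpha> \<beta> v. Suc (Suc (length u + length v)) = r \<Longrightarrow>
     \<Phi> (u @ [\<alpha>, \<beta>] @ v) + \<Phi> (u @ [\<beta>, \<alpha>] @ v)
       \<in> span {\<Phi> (u @ [i, j] @ v) | i j. i + j < \<alpha> + \<beta> \<and> i < max \<alpha> \<beta> \<and> j < max \<alpha> \<beta>}"
  shows "length b = r \<Longrightarrow> set b \<subseteq> {..<k} \<Longrightarrow>
     \<Phi> b \<in> span {\<Phi> l | l. length l = r \<and> sorted_wrt (>) l \<and> set l \<subseteq> {..<k} \<and> sum_list l \<le> sum_list b}"
    (is "_ \<Longrightarrow> _ \<Longrightarrow> _ \<in> span (?T b)")
proof (induction b rule: wf_induct[OF wf_measures[of "[sum_list, weight]"]])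
  case (1 b)
  show ?case
  proof (cases "sorted_wrt (>) b")
    case True
    with 1 show ?thesis by (intro span_base) auto
  next
    case False
    then obtain u \<alpha> \<beta> v where b: "b = u @ [\<alpha>, \<beta>] @ v" "\<alpha> \<le> \<beta>" using not_strict_adjacent by blast
    have IH: "\<Phi> b' \<in> span (?T b)" if "(b', b) \<in> measures [sum_list, weight]" "length b' = r" "set b' \<subseteq> {..<k}" for b'
    proof (rule span_subset)
      show "\<Phi> b' \<in> span (?T b')" using 1(1) that by blast
      have "sum_list b' \<le> sum_list b" using that(1) by auto
      then show "\<And>x. x \<in> ?T b' \<Longrightarrow> x \<in> span (?T b)" by (fastforce intro: span_base)
    qed
    have low: "\<Phi> (u @ [\<alpha>, \<beta>] @ v) + \<Phi> (u @ [\<beta>, \<alpha>] @ v) \<in> span (?T b)"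
    proof (rule span_subset[OF swap])
      show "Suc (Suc (length u + length v)) = r" using 1 b by simp
      fix y assume "y \<in> {\<Phi> (u @ [i, j] @ v) | i j. i + j < \<alpha> + \<beta> \<and> i < max \<alpha> \<beta> \<and> j < max \<alpha> \<beta>}"
      then obtain i j where "y = \<Phi> (u @ [i, j] @ v)" "i + j < \<alpha> + \<beta>" "i < max \<alpha> \<beta>" "j < max \<alpha> \<beta>" by blast
      then have "(u @ [i, j] @ v, b) \<in> measures [sum_list, weight]" "length (u @ [i, j] @ v) = r"
        "set (u @ [i, j] @ v) \<subseteq> {..<k}"
        using 1(2,3) b by auto
      then show "y \<in> span (?T b)" using IH \<open>y = \<Phi> (u @ [i, j] @ v)\<close> by blast
    qed
    show ?thesis
    proof (cases "\<alpha> = \<beta>")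
      case True
      have half: "(1 / 2 :: 'a) + 1 / 2 = 1" by simp
      have "(1 / 2) *s (\<Phi> b + \<Phi> b) = \<Phi> b"
        unfolding scale_right_distrib scale_left_distrib[symmetric] half by simp
      moreover have "\<Phi> (u @ [\<alpha>, \<beta>] @ v) = \<Phi> b" "\<Phi> (u @ [\<beta>, \<alpha>] @ v) = \<Phi> b" using True b by auto
      ultimately show ?thesis using span_scale[OF low, of "1 / 2"] by (simp only:)
    next
      case False
      have "\<Phi> (u @ [\<beta>, \<alpha>] @ v) \<in> span (?T b)"
        using False b 1 by (intro IH) (auto simp: weight_append algebra_simps)
      from span_diff[OF low this] show ?thesis by (simp add: b)
    qed
  qed
qed

end

text \<open>For \<open>k \<ge> 0\<close> the upward strands are \<open>U\<close> and \<open>\<eta> = 1\<close>. For \<open>k \<le> 0\<close> the locale is used in the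
  opposite category, where \<open>U\<close> are the downward strands and \<open>\<eta> = - 1\<close>. The morphism \<open>c\<close> is the cup up to
  a sign.\<close>

locale heisenberg = crossing scale hom one mul wh U sU \<eta> D sD "- \<eta>" t
  for scale :: "'a::field_char_0 \<Rightarrow> 'v::ab_group_add \<Rightarrow> 'v" (infixr \<open>*s\<close> 75)
    and hom :: "'g list \<Rightarrow> 'g list \<Rightarrow> 'v set" and one :: "'g list \<Rightarrow> 'v"
    and mul :: "'v \<Rightarrow> 'v \<Rightarrow> 'v" (infixr \<open>\<bullet>\<close> 70)
    and wh :: "'g list \<Rightarrow> 'v \<Rightarrow> 'g list \<Rightarrow> 'v"
    and U sU \<eta> D sD t +
  fixes x d c :: 'v and \<epsilon> :: 'a and k :: nat and t' :: 'v and uinv :: "nat \<Rightarrow> 'v" and xp :: "nat \<Rightarrow> 'v"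
  assumes x_hom: "x \<in> hom [U] [U]" and d_hom: "d \<in> hom [U, D] []" and c_hom: "c \<in> hom [] [D, U]"
    and xp_0: "xp 0 = one [U]" and xp_Suc: "xp (Suc a) = x \<bullet> xp a"
    and cap_t_D: "wh [D] d [] \<bullet> wh [] t [D] = wh [] d [D] \<bullet> wh [U] sD []"
    and cap_t_U: "wh [] d [U] \<bullet> wh [U] t [] = wh [U] d [] \<bullet> wh [] sU [D]"
    and cap_s: "d \<bullet> wh [U] d [D] \<bullet> wh [] sU [D, D] = d \<bullet> wh [U] d [D] \<bullet> wh [U, U] sD []"
    and t_dot: "t \<bullet> wh [] x [D] = wh [D] x [] \<bullet> t + c \<bullet> d"
    and s_dot: "sU \<bullet> wh [] x [U] = wh [U] x [] \<bullet> sU + \<epsilon> *s one [U, U]"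
    and t'_hom: "t' \<in> hom [D, U] [U, D]" and u_hom: "a < k \<Longrightarrow> uinv a \<in> hom [] [U, D]"
    and t_t': "t \<bullet> t' = one [D, U]" and t_u: "a < k \<Longrightarrow> t \<bullet> uinv a = 0"
    and d_t': "a < k \<Longrightarrow> d \<bullet> wh [] (xp a) [D] \<bullet> t' = 0"
    and d_u: "a < k \<Longrightarrow> b < k \<Longrightarrow> d \<bullet> wh [] (xp a) [D] \<bullet> uinv b = (if a = b then one [] else 0)"
    and complete: "t' \<bullet> t + (\<Sum>a<k. uinv a \<bullet> d \<bullet> wh [] (xp a) [D]) = one [U, D]"
begin

lemma xp_hom: "xp a \<in> hom [U] [U]"
  by (induction a) (auto simp: xp_0 xp_Suc one_hom intro: mul_hom x_hom)

lemma xp_add: "xp a \<bullet> xp b = xp (a + b)"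
  by (induction a) (auto simp: xp_0 xp_Suc mul_assoc one_left[OF xp_hom])

lemma xp_1: "xp (Suc 0) = x"
  by (simp add: xp_0 xp_Suc one_right[OF x_hom])

definition X2 where "X2 i j = wh [] (xp i) [U] \<bullet> wh [U] (xp j) []"

lemma X2_alt: "X2 i j = wh [U] (xp j) [] \<bullet> wh [] (xp i) [U]"
  using exchange[OF xp_hom[of i] xp_hom[of j], of "[]" "[]" "[]"] by (simp add: X2_def)

lemma X2_hom: "X2 i j \<in> hom [U, U] [U, U]"
  unfolding X2_def by (rule mul_hom[of _ _ "[U, U]"]) (auto intro!: wh_homI[OF xp_hom])

lemma X2_mul: "X2 i j \<bullet> X2 i' j' = X2 (i + i') (j + j')"
proof -
  have "X2 i j \<bullet> X2 i' j' = wh [] (xp i) [U] \<bullet> (wh [U] (xp j) [] \<bullet> wh [] (xp i') [U]) \<bullet> wh [U] (xp j') []"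
    by (simp add: X2_def mul_assoc)
  also have "\<dots> = wh [] (xp i \<bullet> xp i') [U] \<bullet> wh [U] (xp j \<bullet> xp j') []"
    using X2_alt[of i' j] by (simp add: X2_def mul_assoc wh_mul flip: X2_alt)
  finally show ?thesis by (simp add: xp_add X2_def)
qed

lemma X2_left: "wh [] (xp i) [U] = X2 i 0" and X2_right: "wh [U] (xp i) [] = X2 0 i"
  using one_right[OF wh_hom[OF xp_hom[of i], of "[]" "[U]"]] one_left[OF wh_hom[OF xp_hom[of i], of "[U]" "[]"]]
  by (simp_all add: X2_def xp_0 wh_one)

text \<open>The total bound \<open>N\<close> drives the later inductions on the number of dots. The
  bound \<open>M\<close> on each strand ensures that no correction carries \<open>k\<close> dots or
  more.\<close>

definition lo where "lo N M = span {X2 i j | i j. i + j < N \<and> i < M \<and> j < M}"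

lemma lo_X2: "v \<in> lo N M \<Longrightarrow> N + i + j \<le> N' \<Longrightarrow> M + max i j \<le> M' \<Longrightarrow> X2 i j \<bullet> v \<in> lo N' M'"
  unfolding lo_def
proof (erule span_map[OF module_hom_mul_right])
  fix y assume N: "N + i + j \<le> N'" and M: "M + max i j \<le> M'"
  assume "y \<in> {X2 i j | i j. i + j < N \<and> i < M \<and> j < M}"
  then obtain a b where y: "y = X2 a b" "a + b < N" "a < M" "b < M" by blast
  then have "X2 i j \<bullet> y = X2 (i + a) (j + b)" "(i + a) + (j + b) < N'" "i + a < M'" "j + b < M'"
    using N M by (auto simp: X2_mul)
  then show "X2 i j \<bullet> y \<in> span {X2 i j | i j. i + j < N' \<and> i < M' \<and> j < M'}"
    by (intro span_base) blast
qed

text \<open>\<open>s_dot\<close> multiplied by the involution \<open>sU\<close> on both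
  sides.\<close>

lemma s_dot_right: "sU \<bullet> wh [U] x [] = wh [] x [U] \<bullet> sU - \<epsilon> *s one [U, U]"
proof -
  have h: "wh [] x [U] \<in> hom [U, U] [U, U]" "wh [U] x [] \<in> hom [U, U] [U, U]" by (auto intro!: wh_homI[OF x_hom])
  have "sU \<bullet> (sU \<bullet> wh [] x [U]) \<bullet> sU = wh [] x [U] \<bullet> sU"
    by (simp add: mul_assoc reassoc[OF L.s_sq] one_left[OF mul_hom[OF L.s_hom h(1)]])
  moreover have "sU \<bullet> (sU \<bullet> wh [] x [U]) \<bullet> sU = sU \<bullet> wh [U] x [] + \<epsilon> *s one [U, U]"
    unfolding s_dot by (simp add: distribs mul_assoc L.s_sq one_right[OF h(2)] one_left[OF L.s_hom])
  ultimately show ?thesis by (simp add: algebra_simps)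
qed

text \<open>The correction is \<open>\<epsilon>\<close> times the divided difference of the
  \<open>a\<close>-th power, a sum of monomials of total degree \<open>a - 1\<close>; only the
  degree bounds are recorded.\<close>

lemma s_X2_left: "sU \<bullet> X2 a 0 - X2 0 a \<bullet> sU \<in> lo a a"
proof (induction a)
  case 0
  then show ?case by (simp add: X2_def xp_0 wh_one lo_def one_left[OF one_hom] one_right[OF L.s_hom] one_left[OF L.s_hom] span_zero)
next
  case (Suc a)
  have 1: "sU \<bullet> X2 (Suc 0) 0 = X2 0 (Suc 0) \<bullet> sU + \<epsilon> *s one [U, U]"
    using s_dot by (simp add: X2_left[symmetric] X2_right[symmetric] xp_1)
  have "sU \<bullet> X2 (Suc a) 0 = sU \<bullet> X2 (Suc 0) 0 \<bullet> X2 a 0" by (simp add: X2_mul)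
  also have "\<dots> = X2 0 (Suc 0) \<bullet> sU \<bullet> X2 a 0 + \<epsilon> *s X2 a 0"
    by (simp add: reassoc[OF 1] distribs mul_assoc one_left[OF X2_hom])
  finally have "sU \<bullet> X2 (Suc a) 0 - X2 0 (Suc a) \<bullet> sU = X2 0 (Suc 0) \<bullet> (sU \<bullet> X2 a 0 - X2 0 a \<bullet> sU) + \<epsilon> *s X2 a 0"
    by (simp add: distribs reassoc[OF X2_mul])
  moreover have "X2 0 (Suc 0) \<bullet> (sU \<bullet> X2 a 0 - X2 0 a \<bullet> sU) \<in> lo (Suc a) (Suc a)"
    by (rule lo_X2[OF Suc]) auto
  moreover have "\<epsilon> *s X2 a 0 \<in> lo (Suc a) (Suc a)"
    unfolding lo_def by (intro span_scale span_base CollectI exI[of _ a] exI[of _ 0]) auto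
  ultimately show ?case by (simp add: lo_def span_add)
qed

lemma s_X2_right: "sU \<bullet> X2 0 a - X2 a 0 \<bullet> sU \<in> lo a a"
proof (induction a)
  case 0
  then show ?case by (simp add: X2_def xp_0 wh_one lo_def one_left[OF one_hom] one_right[OF L.s_hom] one_left[OF L.s_hom] span_zero)
next
  case (Suc a)
  have 1: "sU \<bullet> X2 0 (Suc 0) = X2 (Suc 0) 0 \<bullet> sU - \<epsilon> *s one [U, U]"
    using s_dot_right by (simp add: X2_left[symmetric] X2_right[symmetric] xp_1)
  have "sU \<bullet> X2 0 (Suc a) = sU \<bullet> X2 0 (Suc 0) \<bullet> X2 0 a" by (simp add: X2_mul)
  also have "\<dots> = X2 (Suc 0) 0 \<bullet> sU \<bullet> X2 0 a - \<epsilon> *s X2 0 a"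
    by (simp add: reassoc[OF 1] distribs mul_assoc one_left[OF X2_hom])
  finally have "sU \<bullet> X2 0 (Suc a) - X2 (Suc a) 0 \<bullet> sU = X2 (Suc 0) 0 \<bullet> (sU \<bullet> X2 0 a - X2 a 0 \<bullet> sU) - \<epsilon> *s X2 0 a"
    by (simp add: distribs reassoc[OF X2_mul])
  moreover have "X2 (Suc 0) 0 \<bullet> (sU \<bullet> X2 0 a - X2 a 0 \<bullet> sU) \<in> lo (Suc a) (Suc a)"
    by (rule lo_X2[OF Suc]) auto
  moreover have "\<epsilon> *s X2 0 a \<in> lo (Suc a) (Suc a)"
    unfolding lo_def by (intro span_scale span_base CollectI exI[of _ 0] exI[of _ a]) auto
  ultimately show ?case by (simp add: lo_def span_diff)
qed

text \<open>A symmetric monomial commutes with the crossing because the corrections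
  \<open>\<epsilon>\<close> and \<open>- \<epsilon>\<close> from the two strands cancel.\<close>

lemma s_X2_diag: "sU \<bullet> X2 a a = X2 a a \<bullet> sU"
proof (induction a)
  case 0
  then show ?case by (simp add: X2_def xp_0 wh_one one_left[OF one_hom] one_right[OF L.s_hom] one_left[OF L.s_hom])
next
  case (Suc a)
  have 1: "sU \<bullet> X2 (Suc 0) 0 = X2 0 (Suc 0) \<bullet> sU + \<epsilon> *s one [U, U]"
    using s_dot by (simp add: X2_left[symmetric] X2_right[symmetric] xp_1)
  have 2: "sU \<bullet> X2 0 (Suc 0) = X2 (Suc 0) 0 \<bullet> sU - \<epsilon> *s one [U, U]"
    using s_dot_right by (simp add: X2_left[symmetric] X2_right[symmetric] xp_1)
  have "sU \<bullet> X2 (Suc a) (Suc a) = sU \<bullet> X2 (Suc 0) 0 \<bullet> X2 0 (Suc 0) \<bullet> X2 a a" by (simp add: X2_mul)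
  also have "\<dots> = X2 0 (Suc 0) \<bullet> X2 (Suc 0) 0 \<bullet> sU \<bullet> X2 a a"
    by (simp add: reassoc[OF 1] reassoc[OF 2] distribs mul_assoc one_left[OF X2_hom] one_left[OF mul_hom[OF X2_hom X2_hom]])
  also have "\<dots> = X2 (Suc a) (Suc a) \<bullet> sU" by (simp add: Suc reassoc[OF X2_mul] X2_mul)
  finally show ?case .
qed

text \<open>The symmetric monomial with \<open>min a b\<close> dots on each strand factors out and
  leaves a one-sided case. This is why no correction reaches \<open>max a b\<close> dots on either
  strand.\<close>

lemma s_X2: "sU \<bullet> X2 a b - X2 b a \<bullet> sU \<in> lo (a + b) (max a b)"
proof (cases "a \<le> b")
  case True
  then obtain i where b: "b = a + i" using le_Suc_ex by blast
  have "sU \<bullet> X2 a b - X2 b a \<bullet> sU = X2 a a \<bullet> (sU \<bullet> X2 0 i - X2 i 0 \<bullet> sU)"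
    using reassoc[OF s_X2_diag[of a], of "X2 0 i"] by (simp add: distribs b X2_mul mul_assoc reassoc[OF X2_mul])
  then show ?thesis using lo_X2[OF s_X2_right[of i], of a a "a + b" "max a b"] b by simp
next
  case False
  then obtain i where a: "a = b + i" using le_Suc_ex nat_le_linear by blast
  have "sU \<bullet> X2 a b - X2 b a \<bullet> sU = X2 b b \<bullet> (sU \<bullet> X2 i 0 - X2 0 i \<bullet> sU)"
    using reassoc[OF s_X2_diag[of b], of "X2 i 0"] by (simp add: distribs a X2_mul mul_assoc reassoc[OF X2_mul])
  then show ?thesis using lo_X2[OF s_X2_left[of i], of b b "a + b" "max a b"] a by simp
qed

text \<open>The head of the list belongs to the outermost cap, and the dots sit on the upward
  legs.\<close>

fun cap :: "nat list \<Rightarrow> 'v" where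
  "cap [] = one []"
| "cap (a # l) = d \<bullet> wh [] (xp a) [D] \<bullet> wh [U] (cap l) [D]"

lemma cap_hom: "cap l \<in> hom (up (length l) @ vp (length l)) []"
proof (induction l)
  case Nil then show ?case using one_hom[of "[]"] by simp
next
  case (Cons a l)
  have "wh [U] (cap l) [D] \<in> hom (U # up (length l) @ D # vp (length l)) [U, D]"
    by (rule wh_homI[OF Cons]) simp_all
  moreover have "wh [] (xp a) [D] \<in> hom [U, D] [U, D]" by (rule wh_homI[OF xp_hom]) simp_all
  ultimately show ?case using d_hom by (auto intro: mul_hom)
qed

lemma cap_append: "cap (l @ v) = cap l \<bullet> wh (up (length l)) (cap v) (vp (length l))"
proof (induction l)
  case Nil then show ?case using one_left[OF cap_hom[of v]] by (simp add: wh_Nil[OF cap_hom])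
next
  case (Cons a l)
  then show ?case by (simp add: mul_assoc wh_mul wh_wh)
qed

text \<open>A new outermost cap is added beside a strand that passes: the first index of
  \<open>X2\<close> becomes the dots of the passing strand, the second those of the new cap.\<close>

lemma capX2: "wh [U] d [] \<bullet> wh [] (X2 i j) [D] \<bullet> wh [U, U] (cap b) [D]
   = wh [] (xp i) [] \<bullet> wh [U] (cap (j # b)) []"
proof -
  have "wh [U] d [] \<bullet> wh [] (xp i) [U, D] = wh [] (xp i) [] \<bullet> wh [U] d []"
    using exchange[OF xp_hom[of i] d_hom, of "[]" "[]" "[]"] by simp
  from reassoc[OF this] show ?thesis by (simp add: X2_def wh_mul wh_wh mul_assoc)
qed

lemma cap2: "cap [\<alpha>, \<beta>] = d \<bullet> wh [U] d [D] \<bullet> wh [] (X2 \<alpha> \<beta>) [D, D]"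
proof -
  have 1: "wh [] (xp \<alpha>) [D] \<bullet> wh [U] d [D] = wh [U] d [D] \<bullet> wh [] (xp \<alpha>) [U, D, D]"
    using exchange[OF xp_hom[of \<alpha>] d_hom, of "[]" "[]" "[D]"] by simp
  have 2: "wh [U] (xp \<beta>) [D, D] \<bullet> one [U, U, D, D] = wh [U] (xp \<beta>) [D, D]"
    by (rule one_right[OF wh_homI[OF xp_hom]]) auto
  show ?thesis by (simp add: X2_def wh_mul wh_wh wh_one 2 reassoc[OF 1] mul_assoc)
qed

end

section \<open>Exchanging nested caps, and strands that pass them\<close>

context heisenberg begin

lemma module_hom_comp: "module_hom scale scale F \<Longrightarrow> module_hom scale scale G \<Longrightarrow> module_hom scale scale (\<lambda>x. F (G x))"
  using module_hom_compose[of scale scale G scale F] by (simp add: comp_def)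

text \<open>The existential hides the character value of the word; it reappears as a scalar once a
  projector is attached.\<close>

abbreviation WD where "WD n w \<equiv> \<exists>c. pol D sD (- \<eta>) n w c"
abbreviation WU where "WU n w \<equiv> \<exists>c. pol U sU \<eta> n w c"

text \<open>\<open>cap_s\<close> rotates a crossing from the upward legs of two nested caps to their
  downward legs. Before that it has to slide through the dots, which exchanges the two dot numbers
  up to \<open>lo\<close>.\<close>

lemma cap2_swap: "cap [\<alpha>, \<beta>] \<bullet> wh [] sU [D, D] - cap [\<beta>, \<alpha>] \<bullet> wh [U, U] sD []
   \<in> span {cap [i, j] | i j. i + j < \<alpha> + \<beta> \<and> i < max \<alpha> \<beta> \<and> j < max \<alpha> \<beta>}" (is "?l \<in> span ?S")
proof -
  have 1: "wh [] (X2 \<beta> \<alpha>) [D, D] \<bullet> wh [U, U] sD [] = wh [U, U] sD [] \<bullet> wh [] (X2 \<beta> \<alpha>) [D, D]"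
    using exchange[OF X2_hom[of \<beta> \<alpha>] R.s_hom, of "[]" "[]" "[]"] by simp
  have 2: "cap [\<beta>, \<alpha>] \<bullet> wh [U, U] sD [] = d \<bullet> wh [U] d [D] \<bullet> wh [] (sU \<bullet> X2 \<beta> \<alpha>) [D, D]"
    unfolding cap2 using arg_cong[OF cap_s, of "\<lambda>f. f \<bullet> wh [] (X2 \<beta> \<alpha>) [D, D]"]
    by (simp add: mul_assoc 1 wh_mul)
  have "?l = - (d \<bullet> wh [U] d [D] \<bullet> wh [] (sU \<bullet> X2 \<beta> \<alpha> - X2 \<alpha> \<beta> \<bullet> sU) [D, D])"
    unfolding 2 unfolding cap2 by (simp add: mul_assoc wh_mul distribs)
  moreover have "d \<bullet> wh [U] d [D] \<bullet> wh [] (sU \<bullet> X2 \<beta> \<alpha> - X2 \<alpha> \<beta> \<bullet> sU) [D, D] \<in> span ?S"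
  proof (rule span_map[of "\<lambda>y. d \<bullet> wh [U] d [D] \<bullet> wh [] y [D, D]"])
    show "module_hom scale scale (\<lambda>y. d \<bullet> wh [U] d [D] \<bullet> wh [] y [D, D])"
      by (intro module_hom_comp[OF module_hom_mul_right] module_hom_wh)
    show "sU \<bullet> X2 \<beta> \<alpha> - X2 \<alpha> \<beta> \<bullet> sU \<in> span {X2 i j | i j. i + j < \<beta> + \<alpha> \<and> i < max \<beta> \<alpha> \<and> j < max \<beta> \<alpha>}"
      using s_X2[of \<beta> \<alpha>] by (simp add: lo_def)
    fix y assume "y \<in> {X2 i j | i j. i + j < \<beta> + \<alpha> \<and> i < max \<beta> \<alpha> \<and> j < max \<beta> \<alpha>}"
    then obtain i j where "y = X2 i j" "i + j < \<alpha> + \<beta>" "i < max \<alpha> \<beta>" "j < max \<alpha> \<beta>"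
      by (auto simp: add.commute max.commute)
    then show "d \<bullet> wh [U] d [D] \<bullet> wh [] y [D, D] \<in> span ?S"
      by (intro span_base CollectI exI[of _ i] exI[of _ j]) (simp only: cap2 simp_thms)
  qed
  ultimately show ?thesis by (simp only: span_neg)
qed

text \<open>The two-cap case placed between outer caps \<open>u\<close> and inner caps
  \<open>v\<close>, which the crossings do not meet. The map \<open>F\<close> that does this
  placement is linear, so error terms are carried along.\<close>

lemma cap_swap:
  fixes u v :: "nat list"
  defines "a \<equiv> length u" and "b \<equiv> length v"
  shows "cap (u @ [\<alpha>, \<beta>] @ v) \<bullet> wh (up a) sU (up b @ vp (Suc (Suc (a + b))))
     - cap (u @ [\<beta>, \<alpha>] @ v) \<bullet> wh (up (Suc (Suc (a + b))) @ vp b) sD (vp a)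
   \<in> span {cap (u @ [i, j] @ v) | i j. i + j < \<alpha> + \<beta> \<and> i < max \<alpha> \<beta> \<and> j < max \<alpha> \<beta>}" (is "?l \<in> span ?S")
proof -
  define F where "F y = cap u \<bullet> wh (up a) (y \<bullet> wh [U, U] (cap v) [D, D]) (vp a)" for y
  have F: "module_hom scale scale F" unfolding F_def
    by (intro module_hom_comp[OF module_hom_mul_right]
      module_hom_comp[of "\<lambda>y. wh (up a) y (vp a)", OF module_hom_wh] module_hom_mul_left)
  have Fcap: "F (cap [i, j]) = cap (u @ [i, j] @ v)" for i j
    using cap_append[of "[i, j]" v] cap_append[of u "[i, j] @ v"] by (simp add: F_def a_def)
  have vU: "wh [] sU [D, D] \<bullet> wh [U, U] (cap v) [D, D] = wh [U, U] (cap v) [D, D] \<bullet> wh [] sU (up b @ vp (Suc (Suc b)))"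
    using exchange[OF L.s_hom cap_hom[of v], of "[]" "[]" "[D, D]"] by (simp add: b_def)
  have vD: "wh [U, U] sD [] \<bullet> wh [U, U] (cap v) [D, D] = wh [U, U] (cap v) [D, D] \<bullet> wh (up (Suc (Suc b)) @ vp b) sD []"
    using exchange[OF cap_hom[of v] R.s_hom, of "[U, U]" "[]" "[]"] by (simp add: b_def)
  have FU: "F (y \<bullet> wh [] sU [D, D]) = F y \<bullet> wh (up a) sU (up b @ vp (Suc (Suc (a + b))))" for y
    unfolding F_def by (simp add: mul_assoc vU wh_mul wh_wh add.commute)
  have FD: "F (y \<bullet> wh [U, U] sD []) = F y \<bullet> wh (up (Suc (Suc (a + b))) @ vp b) sD (vp a)" for y
    unfolding F_def by (simp add: mul_assoc vD wh_mul wh_wh add.commute)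
  have "?l = F (cap [\<alpha>, \<beta>] \<bullet> wh [] sU [D, D] - cap [\<beta>, \<alpha>] \<bullet> wh [U, U] sD [])"
    unfolding module_hom.diff[OF F] FU FD Fcap ..
  also have "\<dots> \<in> span ?S"
    by (rule span_map[OF F cap2_swap]) (force intro!: span_base simp: Fcap simp del: cap.simps)
  finally show ?thesis .
qed

text \<open>Crossings are allowed on the downward legs only: in the induction step the
  antisymmetrizer reaches all downward strands, whereas the symmetrizer misses the newest upward
  one.\<close>

definition capspan where "capspan r N M =
  span {cap b \<bullet> wh (up r) w [] | b w. length b = r \<and> set b \<subseteq> {..<M} \<and> sum_list b < N \<and> WD r w}"

lemma capspan_sD: "y \<in> capspan r N M \<Longrightarrow> r = Suc (Suc (a + b)) \<Longrightarrow> y \<bullet> wh (up r @ vp a) sD (vp b) \<in> capspan r N M"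
  unfolding capspan_def
proof (erule span_map[OF module_hom_mul_left])
  fix y assume r: "r = Suc (Suc (a + b))"
  assume "y \<in> {cap b \<bullet> wh (up r) w [] | b w. length b = r \<and> set b \<subseteq> {..<M} \<and> sum_list b < N \<and> WD r w}"
  then obtain b' w where y: "y = cap b' \<bullet> wh (up r) w []" "length b' = r" "set b' \<subseteq> {..<M}" "sum_list b' < N" "WD r w"
    by blast
  have "WD r (w \<bullet> wh (vp a) sD (vp b))" using y(5) R.pol_prod R.pol_s[OF r] by blast
  moreover have "y \<bullet> wh (up r @ vp a) sD (vp b) = cap b' \<bullet> wh (up r) (w \<bullet> wh (vp a) sD (vp b)) []"
    by (simp add: y(1) mul_assoc wh_mul wh_wh)
  ultimately show "y \<bullet> wh (up r @ vp a) sD (vp b) \<in> span {cap b \<bullet> wh (up r) w [] | b w. length b = r \<and> set b \<subseteq> {..<M} \<and> sum_list b < N \<and> WD r w}"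
    using y by (intro span_base) blast
qed

lemma capspan_mono: "y \<in> capspan r N M \<Longrightarrow> N \<le> N' \<Longrightarrow> y \<in> capspan r N' M"
  unfolding capspan_def
proof (erule span_subset)
  fix y assume "N \<le> N'" and y: "y \<in> {cap b \<bullet> wh (up r) w [] | b w. length b = r \<and> set b \<subseteq> {..<M} \<and> sum_list b < N \<and> WD r w}"
  then have "y \<in> {cap b \<bullet> wh (up r) w [] | b w. length b = r \<and> set b \<subseteq> {..<M} \<and> sum_list b < N' \<and> WD r w}"
    by (blast intro: less_le_trans)
  then show "y \<in> span {cap b \<bullet> wh (up r) w [] | b w. length b = r \<and> set b \<subseteq> {..<M} \<and> sum_list b < N' \<and> WD r w}"
    by (rule span_base)
qed

text \<open>The crossings carry one strand through the strands of \<open>v\<close>. Trading them one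
  at a time for downward crossings, by \<open>cap_swap\<close>, moves the cap with
  \<open>\<alpha>\<close> dots inside all caps of \<open>v\<close>.\<close>

lemma cap_cycle:
  "set (u @ \<alpha> # v) \<subseteq> {..<M} \<Longrightarrow> r = Suc (length u + length v) \<Longrightarrow>
   \<exists>w. WD r w \<and> cap (u @ \<alpha> # v) \<bullet> wh (up (length u)) (L.crossings (length v)) (vp r)
      - cap (u @ v @ [\<alpha>]) \<bullet> wh (up r) w [] \<in> capspan r (sum_list (u @ \<alpha> # v)) M"
proof (induction v arbitrary: u \<alpha>)
  case Nil
  have "cap (u @ [\<alpha>]) \<bullet> wh (up (length u)) (one [U]) (vp r) = cap (u @ [\<alpha>])"
    using one_right[OF cap_hom[of "u @ [\<alpha>]"]] Nil by (simp add: wh_one)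
  moreover have "cap (u @ [\<alpha>]) \<bullet> wh (up r) (one (vp r)) [] = cap (u @ [\<alpha>])"
    using one_right[OF cap_hom[of "u @ [\<alpha>]"]] Nil by (simp add: wh_one)
  ultimately have "cap (u @ [\<alpha>]) \<bullet> wh (up (length u)) (L.crossings 0) (vp r)
      - cap (u @ [] @ [\<alpha>]) \<bullet> wh (up r) (one (vp r)) [] \<in> capspan r (sum_list (u @ [\<alpha>])) M"
    by (simp add: capspan_def span_zero)
  then show ?case using pol_one[of D sD "- \<eta>" r] by auto
next
  case (Cons \<beta> v)
  define a where "a = length u"
  define j where "j = length v"
  have r: "r = Suc (Suc (a + j))" using Cons.prems a_def j_def by simp
  define Y where "Y = wh (up (Suc a)) (L.crossings j) (vp r)"
  define SU where "SU = wh (up a) sU (up j @ vp r)"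
  define SD where "SD = wh (up r @ vp j) sD (vp a)"
  have cr: "wh (up a) (L.crossings (Suc j)) (vp r) = SU \<bullet> Y"
    by (simp add: SU_def Y_def wh_mul wh_wh)
  have SDY: "SD \<bullet> Y = Y \<bullet> SD"
    using exchange[OF L.crossings_hom[of j] R.s_hom, of "up (Suc a)" "vp j" "vp a"] r
    by (simp add: SD_def Y_def add_ac)
  \<comment> \<open>The lower terms of the first exchange are still composed with the remaining
    upward crossings \<open>Y\<close>, so they have to be cycled by the induction hypothesis as
    well.\<close>
  have low: "cap (u @ [i', j'] @ v) \<bullet> Y \<in> capspan r (sum_list (u @ \<alpha> # \<beta> # v)) M"
    if "i' + j' < \<alpha> + \<beta>" "i' < M" "j' < M" for i' j'
  proof -
    have "set ((u @ [i']) @ j' # v) \<subseteq> {..<M}" using Cons.prems that by auto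
    from Cons.IH[OF this] r obtain w where w: "WD r w"
      "cap ((u @ [i']) @ j' # v) \<bullet> Y - cap ((u @ [i']) @ v @ [j']) \<bullet> wh (up r) w [] \<in> capspan r (sum_list ((u @ [i']) @ j' # v)) M"
      by (auto simp: a_def j_def Y_def)
    have "cap ((u @ [i']) @ v @ [j']) \<bullet> wh (up r) w [] \<in> capspan r (sum_list (u @ \<alpha> # \<beta> # v)) M"
      unfolding capspan_def using w(1) that Cons.prems r
      by (intro span_base CollectI exI[of _ "(u @ [i']) @ v @ [j']"] exI[of _ w]) (auto simp: a_def j_def)
    moreover have "cap ((u @ [i']) @ j' # v) \<bullet> Y - cap ((u @ [i']) @ v @ [j']) \<bullet> wh (up r) w [] \<in> capspan r (sum_list (u @ \<alpha> # \<beta> # v)) M"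
      by (rule capspan_mono[OF w(2)]) (use that in auto)
    ultimately have "(cap ((u @ [i']) @ j' # v) \<bullet> Y - cap ((u @ [i']) @ v @ [j']) \<bullet> wh (up r) w [])
        + cap ((u @ [i']) @ v @ [j']) \<bullet> wh (up r) w [] \<in> capspan r (sum_list (u @ \<alpha> # \<beta> # v)) M"
      unfolding capspan_def by (blast intro: span_add)
    then show ?thesis by simp
  qed
  have "set ((u @ [\<beta>]) @ \<alpha> # v) \<subseteq> {..<M}" using Cons.prems by auto
  from Cons.IH[OF this] r obtain w where w: "WD r w"
      "cap ((u @ [\<beta>]) @ \<alpha> # v) \<bullet> Y - cap ((u @ [\<beta>]) @ v @ [\<alpha>]) \<bullet> wh (up r) w [] \<in> capspan r (sum_list ((u @ [\<beta>]) @ \<alpha> # v)) M"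
      by (auto simp: a_def j_def Y_def)
  have w': "WD r (w \<bullet> wh (vp j) sD (vp a))"
  proof -
    obtain c where "pol D sD (- \<eta>) r w c" using w(1) by blast
    from R.pol_prod[OF this R.pol_s[of r j a]] show ?thesis using r by (auto simp: add.commute)
  qed
  have 1: "(cap (u @ [\<beta>, \<alpha>] @ v) \<bullet> Y) \<bullet> SD - (cap (u @ \<beta> # v @ [\<alpha>]) \<bullet> wh (up r) w []) \<bullet> SD
      \<in> capspan r (sum_list (u @ \<alpha> # \<beta> # v)) M"
    using capspan_sD[OF w(2), of j a] r by (simp add: SD_def add_ac mul_diff_left)
  have 2: "(cap (u @ [\<alpha>, \<beta>] @ v) \<bullet> SU - cap (u @ [\<beta>, \<alpha>] @ v) \<bullet> SD) \<bullet> Y \<in> capspan r (sum_list (u @ \<alpha> # \<beta> # v)) M"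
    unfolding capspan_def
  proof (rule span_map[OF module_hom_mul_left])
    show "cap (u @ [\<alpha>, \<beta>] @ v) \<bullet> SU - cap (u @ [\<beta>, \<alpha>] @ v) \<bullet> SD
      \<in> span {cap (u @ [i, j] @ v) | i j. i + j < \<alpha> + \<beta> \<and> i < max \<alpha> \<beta> \<and> j < max \<alpha> \<beta>}"
      using cap_swap[of u \<alpha> \<beta> v] unfolding SU_def SD_def r a_def j_def .
    fix y assume "y \<in> {cap (u @ [i, j] @ v) | i j. i + j < \<alpha> + \<beta> \<and> i < max \<alpha> \<beta> \<and> j < max \<alpha> \<beta>}"
    then obtain i' j' where "y = cap (u @ [i', j'] @ v)" "i' + j' < \<alpha> + \<beta>" "i' < M" "j' < M"
      using Cons.prems by auto
    then show "y \<bullet> Y \<in> span {cap b \<bullet> wh (up r) w [] | b w. length b = r \<and> set b \<subseteq> {..<M} \<and> sum_list b < sum_list (u @ \<alpha> # \<beta> # v) \<and> WD r w}"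
      using low[of i' j'] by (simp only: capspan_def)
  qed
  have "cap (u @ \<alpha> # \<beta> # v) \<bullet> SU \<bullet> Y - cap (u @ (\<beta> # v) @ [\<alpha>]) \<bullet> wh (up r) (w \<bullet> wh (vp j) sD (vp a)) []
     = (cap (u @ [\<alpha>, \<beta>] @ v) \<bullet> SU - cap (u @ [\<beta>, \<alpha>] @ v) \<bullet> SD) \<bullet> Y
      + ((cap (u @ [\<beta>, \<alpha>] @ v) \<bullet> Y) \<bullet> SD - (cap (u @ \<beta> # v @ [\<alpha>]) \<bullet> wh (up r) w []) \<bullet> SD)"
    by (simp add: mul_diff_left mul_assoc SDY wh_mul wh_wh SD_def[symmetric] del: cap.simps)
  also have "\<dots> \<in> capspan r (sum_list (u @ \<alpha> # \<beta> # v)) M"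
    using 1 2 unfolding capspan_def by (rule span_add[rotated])
  finally have *: "cap (u @ \<alpha> # \<beta> # v) \<bullet> SU \<bullet> Y - cap (u @ (\<beta> # v) @ [\<alpha>]) \<bullet> wh (up r) (w \<bullet> wh (vp j) sD (vp a)) []
    \<in> capspan r (sum_list (u @ \<alpha> # \<beta> # v)) M" .
  have "wh (up (length u)) (L.crossings (length (\<beta> # v))) (vp r) = SU \<bullet> Y"
    using cr by (simp only: a_def[symmetric] j_def[symmetric] length_Cons)
  with * w' show ?case by (intro exI[of _ "w \<bullet> wh (vp j) sD (vp a)"] conjI) (simp_all only:)
qed

text \<open>The error terms of \<open>pass\<close>: the strand that should have passed is capped,
  and another one leaves with \<open>\<beta>\<close> dots. The words avoid the last upward strand,
  so the available projectors turn them into scalars. \<open>0 < r\<close> records that a cap is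
  present, so that the decomposition for fewer strands applies to what remains.\<close>

definition passspan where "passspan r =
  span {wh [] (xp \<beta>) [] \<bullet> wh [U] (cap b) [] \<bullet> wh [] w (U # vp r) \<bullet> wh (up (Suc r)) w' [] | b \<beta> w w'.
     length b = r \<and> 0 < r \<and> set b \<subseteq> {..<k} \<and> \<beta> < k \<and> WU r w \<and> WD r w'}"

lemma passspanI: "length b = r \<Longrightarrow> 0 < r \<Longrightarrow> set b \<subseteq> {..<k} \<Longrightarrow> \<beta> < k \<Longrightarrow> WU r w \<Longrightarrow> WD r w' \<Longrightarrow>
  wh [] (xp \<beta>) [] \<bullet> wh [U] (cap b) [] \<bullet> wh [] w (U # vp r) \<bullet> wh (up (Suc r)) w' [] \<in> passspan r"
  unfolding passspan_def by (rule span_base) blast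

lemma capspan_passspan:
  assumes "y \<in> capspan r N k" "i < k" "0 < r"
  shows "wh [] (xp i) [] \<bullet> wh [U] y [] \<in> passspan r"
  unfolding passspan_def
proof (rule span_map[of "\<lambda>y. wh [] (xp i) [] \<bullet> wh [U] y []"])
  show "module_hom scale scale (\<lambda>y. wh [] (xp i) [] \<bullet> wh [U] y [])"
    by (intro module_hom_comp[OF module_hom_mul_right] module_hom_wh)
  show "y \<in> span {cap b \<bullet> wh (up r) w [] | b w. length b = r \<and> set b \<subseteq> {..<k} \<and> sum_list b < N \<and> WD r w}"
    using assms(1) by (simp add: capspan_def)
  fix y assume "y \<in> {cap b \<bullet> wh (up r) w [] | b w. length b = r \<and> set b \<subseteq> {..<k} \<and> sum_list b < N \<and> WD r w}"
  then obtain b w where y: "y = cap b \<bullet> wh (up r) w []" "length b = r" "set b \<subseteq> {..<k}" "WD r w" by blast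
  have "w \<in> hom (vp r) (vp r)" using y(4) R.pol_hom by blast
  then have "wh (up (Suc r)) w [] \<in> hom (up r @ U # vp r) (up r @ U # vp r)"
    by (rule wh_homI) simp_all
  from one_left[OF this] have "wh [] (one (up r)) (U # vp r) \<bullet> wh (up (Suc r)) w [] = wh (up (Suc r)) w []"
    by (simp add: wh_one)
  moreover have "wh [] (xp i) [] \<bullet> wh [U] (cap b) [] \<bullet> wh [] (one (up r)) (U # vp r) \<bullet> wh (up (Suc r)) w [] \<in> passspan r"
    using y assms pol_one[of U sU \<eta> r] by (intro passspanI) auto
  ultimately show "wh [] (xp i) [] \<bullet> wh [U] y [] \<in> span {wh [] (xp \<beta>) [] \<bullet> wh [U] (cap b) [] \<bullet> wh [] w (U # vp r) \<bullet> wh (up (Suc r)) w' [] | b \<beta> w w'.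
     length b = r \<and> 0 < r \<and> set b \<subseteq> {..<k} \<and> \<beta> < k \<and> WU r w \<and> WD r w'}"
    by (simp add: y(1) wh_mul wh_wh passspan_def)
qed

text \<open>A strand that crosses all downward strands and then has \<open>r\<close> caps to its left
  is, up to terms in which it is capped, a strand passing to the left of these caps.\<close>

lemma pass: "set l \<subseteq> {..<k} \<Longrightarrow> r = length l \<Longrightarrow>
  wh [] (cap l) [U] \<bullet> wh (up r) (tau r) [] - wh [U] (cap l) [] \<bullet> wh [] (L.crossings r) (vp r) \<in> passspan r"
proof (induction l arbitrary: r)
  case Nil
  then show ?case by (simp add: wh_one passspan_def span_zero)
next
  case (Cons a l)
  define R where "R = length l"
  have r: "r = Suc R" using Cons.prems R_def by simp
  have ak: "a < k" using Cons.prems by simp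
  define PL where "PL = wh [] (cap l) [U] \<bullet> wh (up R) (tau R) []"
  define M where "M = wh [U] (cap l) [] \<bullet> wh [] (L.crossings R) (vp R)"
  \<comment> \<open>By \<open>cap_t_U\<close> the outermost cap turns the last crossing
    \<open>t\<close> of the strand into \<open>sU\<close>. \<open>G\<close> is the effect of this
    cap on the inner part of the diagram.\<close>
  define G where "G y = wh [U] d [] \<bullet> wh [] (sU \<bullet> X2 a 0) [D] \<bullet> wh [U] y [D]" for y
  have G: "module_hom scale scale G" unfolding G_def
    by (intro module_hom_comp[OF module_hom_mul_right] module_hom_wh)
  have IH: "PL - M \<in> passspan R" using Cons.IH[of R] Cons.prems by (simp add: PL_def M_def R_def)
  have A: "wh [] (cap (a # l)) [U] \<bullet> wh (up r) (tau r) [] = G PL"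
  proof -
    have tau: "tau r = wh (vp R) t [] \<bullet> wh [] (tau R) [D]"
      using tau_add[of R "Suc 0"] tau_1 by (simp add: r)
    have 1: "wh [U] (cap l) [D, U] \<bullet> wh (up (Suc R) @ vp R) t [] = wh [U] t [] \<bullet> wh [U] (cap l) [U, D]"
      using exchange[OF cap_hom[of l] t_hom, of "[U]" "[]" "[]"] by (simp add: R_def)
    have 2: "wh [] (xp a) [D, U] \<bullet> wh [U] t [] = wh [U] t [] \<bullet> wh [] (xp a) [U, D]"
      using exchange[OF xp_hom[of a] t_hom, of "[]" "[]" "[]"] by simp
    have 3: "wh [] (X2 a 0) [D] = wh [] (xp a) [U, D]"
      by (simp add: X2_left[symmetric] wh_wh)
    show ?thesis
      unfolding tau G_def PL_def
      by (simp add: r wh_mul wh_wh mul_assoc reassoc[OF 1[simplified]] reassoc[OF 2] reassoc[OF cap_t_U] 3 del: tau.simps)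
  qed
  have sc: "wh [] sU [D] \<bullet> wh [U, U] (cap b) [D] = wh [U, U] (cap b) [D] \<bullet> wh [] sU (up R @ vp R @ [D])"
    if "length b = R" for b
    using exchange[OF L.s_hom cap_hom[of b], of "[]" "[]" "[D]"] that by simp
  \<comment> \<open>On the main inner term the crossing slides past the \<open>a\<close> dots. Its
    leading part is the wanted diagram; in the rest the strand is trapped in a cap, and
    \<open>cap_cycle\<close> trades the remaining upward crossings for downward ones.\<close>
  have B: "G M - wh [U] (cap (a # l)) [] \<bullet> wh [] (L.crossings r) (vp r) \<in> passspan r"
  proof -
    define H where "H y = wh [U] d [] \<bullet> wh [] y [D] \<bullet> wh [U, U] (cap l) [D] \<bullet> wh [U] (L.crossings R) (vp r)" for y
    have H: "module_hom scale scale H" unfolding H_def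
      by (intro module_hom_comp[OF module_hom_mul_right]
        module_hom_comp[of "\<lambda>y. y \<bullet> wh [U, U] (cap l) [D] \<bullet> wh [U] (L.crossings R) (vp r)", OF module_hom_mul_left] module_hom_wh)
    have GM: "G M = H (sU \<bullet> X2 a 0)"
      unfolding G_def M_def H_def by (simp add: wh_mul wh_wh r mul_assoc)
    have HX: "H (X2 i j) = wh [] (xp i) [] \<bullet> wh [U] (cap (j # l) \<bullet> wh [] (L.crossings R) (vp r)) []" for i j
      unfolding H_def using reassoc[OF capX2[of i j l, unfolded mul_assoc[symmetric]]]
      by (simp add: mul_assoc wh_mul wh_wh)
    have "H (X2 0 a \<bullet> sU) = wh [U] d [] \<bullet> wh [] (X2 0 a) [D] \<bullet> wh [U, U] (cap l) [D] \<bullet> wh [] sU (up R @ vp R @ [D]) \<bullet> wh [U] (L.crossings R) (vp r)"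
      unfolding H_def by (simp only: wh_mul mul_assoc reassoc[OF sc[OF R_def[symmetric]]])
    also have "\<dots> = (wh [] (xp 0) [] \<bullet> wh [U] (cap (a # l)) []) \<bullet> wh [] sU (up R @ vp R @ [D]) \<bullet> wh [U] (L.crossings R) (vp r)"
      unfolding capX2[symmetric] by (simp only: mul_assoc)
    also have "wh [] (xp 0) [] \<bullet> wh [U] (cap (a # l)) [] = wh [U] (cap (a # l)) []"
      using one_left[OF wh_homI[OF cap_hom[of "a # l"], of _ "[U]" "[]" "[U]"]] by (simp add: xp_0 wh_one del: cap.simps)
    finally have HM: "H (X2 0 a \<bullet> sU) = wh [U] (cap (a # l)) [] \<bullet> wh [] (L.crossings r) (vp r)"
      by (simp add: r wh_mul wh_wh del: cap.simps)
    have "H (sU \<bullet> X2 a 0 - X2 0 a \<bullet> sU) \<in> passspan r"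
      unfolding passspan_def
    proof (rule span_map[OF H])
      show "sU \<bullet> X2 a 0 - X2 0 a \<bullet> sU \<in> span {X2 i j | i j. i + j < a \<and> i < a \<and> j < a}"
        using s_X2_left[of a] by (simp add: lo_def)
      fix y assume "y \<in> {X2 i j | i j. i + j < a \<and> i < a \<and> j < a}"
      then obtain i j where y: "y = X2 i j" "i < a" "j < a" by blast
      have jk: "set ([] @ j # l) \<subseteq> {..<k}" using y ak Cons.prems by auto
      obtain w where w: "WD r w" "cap (j # l) \<bullet> wh [] (L.crossings R) (vp r) - cap (l @ [j]) \<bullet> wh (up r) w [] \<in> capspan r (sum_list (j # l)) k"
        using cap_cycle[OF jk, of r] r by (auto simp: R_def)
      have "cap (l @ [j]) \<bullet> wh (up r) w [] \<in> capspan r (Suc (sum_list (j # l))) k"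
        unfolding capspan_def using w(1) jk r by (intro span_base CollectI exI[of _ "l @ [j]"] exI[of _ w]) (auto simp: R_def)
      with capspan_mono[OF w(2), of "Suc (sum_list (j # l))"] 
      have "(cap (j # l) \<bullet> wh [] (L.crossings R) (vp r) - cap (l @ [j]) \<bullet> wh (up r) w []) + cap (l @ [j]) \<bullet> wh (up r) w [] \<in> capspan r (Suc (sum_list (j # l))) k"
        unfolding capspan_def by (blast intro: span_add le_SucI)
      then have "H y \<in> passspan r" unfolding y(1) HX using y ak r
        by (intro capspan_passspan[of _ _ "Suc (sum_list (j # l))"]) auto
      then show "H y \<in> span {wh [] (xp \<beta>) [] \<bullet> wh [U] (cap b) [] \<bullet> wh [] w (U # vp r) \<bullet> wh (up (Suc r)) w' [] | b \<beta> w w'.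
         length b = r \<and> 0 < r \<and> set b \<subseteq> {..<k} \<and> \<beta> < k \<and> WU r w \<and> WD r w'}" by (simp only: passspan_def)
    qed
    then show ?thesis by (simp only: GM HM[symmetric] module_hom.diff[OF H])
  qed
  \<comment> \<open>Inner error terms stay error terms: the strand that leaves the inner caps
    carries \<open>\<beta>\<close> dots and crosses the leg of the new cap, and this crossing is
    again slid past the dots.\<close>
  have C: "G (PL - M) \<in> passspan r"
    unfolding passspan_def
  proof (rule span_map[OF G IH[unfolded passspan_def]], fold passspan_def)
    fix y assume "y \<in> {wh [] (xp \<beta>) [] \<bullet> wh [U] (cap b) [] \<bullet> wh [] w (U # vp R) \<bullet> wh (up (Suc R)) w' [] | b \<beta> w w'.
         length b = R \<and> 0 < R \<and> set b \<subseteq> {..<k} \<and> \<beta> < k \<and> WU R w \<and> WD R w'}"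
    then obtain \<beta> b w w' where y: "y = wh [] (xp \<beta>) [] \<bullet> wh [U] (cap b) [] \<bullet> wh [] w (U # vp R) \<bullet> wh (up (Suc R)) w' []"
      and b: "length b = R" "0 < R" "set b \<subseteq> {..<k}" "\<beta> < k" and w: "WU R w" and w': "WD R w'" by blast
    obtain R' where R': "R = Suc R'" using b(2) by (cases R) auto
    have ww: "WU r (wh [U] w [])" using w L.pol_wh[of R w _ r 1 0] r by auto
    have ww': "WD r (wh [] w' [D])" using w' R.pol_wh[of R w' _ r 0 1] r by auto
    have ws: "WU r (wh [] sU (up R'))" using L.pol_s[of r 0 R'] r R' by auto
    have wsw: "WU r (wh [] sU (up R') \<bullet> wh [U] w [])" using ww ws L.pol_prod by blast
    define Z where "Z = wh [U] w (U # vp r) \<bullet> wh (up (Suc r)) w' [D]"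
    define H where "H y = wh [U] d [] \<bullet> wh [] y [D] \<bullet> wh [U, U] (cap b) [D] \<bullet> Z" for y
    have H: "module_hom scale scale H" unfolding H_def
      by (intro module_hom_comp[OF module_hom_mul_right]
        module_hom_comp[of "\<lambda>y. y \<bullet> wh [U, U] (cap b) [D] \<bullet> Z", OF module_hom_mul_left] module_hom_wh)
    have HX: "H (X2 i j) = wh [] (xp i) [] \<bullet> wh [U] (cap (j # b)) [] \<bullet> Z" for i j
      unfolding H_def using reassoc[OF capX2[of i j b, unfolded mul_assoc[symmetric]]]
      by (simp add: mul_assoc)
    have low: "H (X2 i j) \<in> passspan r" if "i < k" "j < k" for i j
    proof -
      have "wh [] (xp i) [] \<bullet> wh [U] (cap (j # b)) [] \<bullet> wh [] (wh [U] w []) (U # vp r) \<bullet> wh (up (Suc r)) (wh [] w' [D]) [] \<in> passspan r"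
        using that b r ww ww' by (intro passspanI) auto
      then show ?thesis unfolding HX Z_def by (simp add: wh_wh)
    qed
    have main: "H (X2 \<beta> a \<bullet> sU) \<in> passspan r"
    proof -
      have "wh [] (xp \<beta>) [] \<bullet> wh [U] (cap (a # b)) [] \<bullet> wh [] (wh [] sU (up R') \<bullet> wh [U] w []) (U # vp r) \<bullet> wh (up (Suc r)) (wh [] w' [D]) [] \<in> passspan r"
        using ak b r wsw ww' by (intro passspanI) auto
      moreover have "H (X2 \<beta> a \<bullet> sU) = wh [U] d [] \<bullet> wh [] (X2 \<beta> a) [D] \<bullet> wh [U, U] (cap b) [D] \<bullet> wh [] sU (up R @ vp R @ [D]) \<bullet> Z"
        unfolding H_def by (simp only: wh_mul mul_assoc reassoc[OF sc[OF b(1)]])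
      moreover have "\<dots> = (wh [] (xp \<beta>) [] \<bullet> wh [U] (cap (a # b)) []) \<bullet> wh [] sU (up R @ vp R @ [D]) \<bullet> Z"
        unfolding capX2[symmetric] by (simp only: mul_assoc)
      ultimately show ?thesis unfolding Z_def by (simp add: wh_wh wh_mul mul_assoc R' r del: cap.simps)
    qed
    have "G y = H (sU \<bullet> X2 a \<beta>)"
    proof -
      have "wh [U] (xp \<beta>) [D] = wh [] (X2 0 \<beta>) [D]" by (simp add: X2_right[symmetric] wh_wh)
      then have "G y = wh [U] d [] \<bullet> wh [] ((sU \<bullet> X2 a 0) \<bullet> X2 0 \<beta>) [D] \<bullet> wh [U, U] (cap b) [D] \<bullet> Z"
        unfolding G_def y Z_def by (simp add: wh_mul wh_wh mul_assoc r)
      then show ?thesis by (simp add: H_def mul_assoc X2_mul)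
    qed
    also have "\<dots> = H (sU \<bullet> X2 a \<beta> - X2 \<beta> a \<bullet> sU) + H (X2 \<beta> a \<bullet> sU)"
      by (simp flip: module_hom.add[OF H])
    also have "\<dots> \<in> passspan r"
    proof -
      have "H (sU \<bullet> X2 a \<beta> - X2 \<beta> a \<bullet> sU) \<in> passspan r"
        unfolding passspan_def
      proof (rule span_map[OF H s_X2[of a \<beta>, unfolded lo_def]], fold passspan_def)
        fix y assume "y \<in> {X2 i j | i j. i + j < a + \<beta> \<and> i < max a \<beta> \<and> j < max a \<beta>}"
        then show "H y \<in> passspan r" using low ak b(4) by auto
      qed
      then show ?thesis using main unfolding passspan_def by (rule span_add)
    qed
    finally show "G y \<in> passspan r" .
  qed
  have "wh [] (cap (a # l)) [U] \<bullet> wh (up r) (tau r) [] - wh [U] (cap (a # l)) [] \<bullet> wh [] (L.crossings r) (vp r)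
    = G (PL - M) + (G M - wh [U] (cap (a # l)) [] \<bullet> wh [] (L.crossings r) (vp r))"
    by (simp add: A module_hom.diff[OF G] del: cap.simps L.crossings.simps)
  also have "\<dots> \<in> passspan r" using C B unfolding passspan_def by (rule span_add)
  finally show ?case .
qed

end

section \<open>Decompositions of idempotents\<close>

context word_category begin

text \<open>The morphisms into \<open>Z\<close> that factor through the family \<open>A\<close>.
  That \<open>e\<close> is one of them replaces an explicit left inverse.\<close>

definition lspan where "lspan Z I Y A = {v. \<exists>G. (\<forall>i\<in>I. G i \<in> hom (Y i) Z) \<and> v = (\<Sum>i\<in>I. G i \<bullet> A i)}"

lemma lspan_subspace: "subspace (lspan Z I Y A)"
proof (rule subspaceI)
  show "0 \<in> lspan Z I Y A" unfolding lspan_def using zero_hom by (auto intro!: exI[of _ "\<lambda>i. 0"])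
next
  fix v w assume "v \<in> lspan Z I Y A" "w \<in> lspan Z I Y A"
  then obtain G H where "\<forall>i\<in>I. G i \<in> hom (Y i) Z" "v = (\<Sum>i\<in>I. G i \<bullet> A i)"
    "\<forall>i\<in>I. H i \<in> hom (Y i) Z" "w = (\<Sum>i\<in>I. H i \<bullet> A i)" unfolding lspan_def by blast
  then show "v + w \<in> lspan Z I Y A" unfolding lspan_def
    by (intro CollectI exI[of _ "\<lambda>i. G i + H i"]) (auto simp: mul_add_left sum.distrib intro: add_hom)
next
  fix a v assume "v \<in> lspan Z I Y A"
  then obtain G where "\<forall>i\<in>I. G i \<in> hom (Y i) Z" "v = (\<Sum>i\<in>I. G i \<bullet> A i)" unfolding lspan_def by blast
  then show "a *s v \<in> lspan Z I Y A" unfolding lspan_def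
    by (intro CollectI exI[of _ "\<lambda>i. a *s G i"]) (auto simp: mul_scale_left scale_sum_right intro: scale_hom)
qed

lemmas lspan_add = subspace_add[OF lspan_subspace]
  and lspan_diff = subspace_diff[OF lspan_subspace]
  and lspan_scale = subspace_scale[OF lspan_subspace]
  and lspan_sum = subspace_sum[OF lspan_subspace]

lemma lspan_mul: "v \<in> lspan Z I Y A \<Longrightarrow> h \<in> hom Z Z' \<Longrightarrow> h \<bullet> v \<in> lspan Z' I Y A"
  unfolding lspan_def
proof clarsimp
  fix G assume "h \<in> hom Z Z'" "\<forall>i\<in>I. G i \<in> hom (Y i) Z"
  then show "\<exists>G'. (\<forall>i\<in>I. G' i \<in> hom (Y i) Z') \<and> h \<bullet> (\<Sum>i\<in>I. G i \<bullet> A i) = (\<Sum>i\<in>I. G' i \<bullet> A i)"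
    by (intro exI[of _ "\<lambda>i. h \<bullet> G i"]) (auto simp: mul_sum_right mul_assoc intro: mul_hom)
qed

lemma lspan_base: "finite I \<Longrightarrow> i \<in> I \<Longrightarrow> g \<in> hom (Y i) Z \<Longrightarrow> g \<bullet> A i \<in> lspan Z I Y A"
  unfolding lspan_def
proof (intro CollectI exI conjI ballI)
  assume "finite I" "i \<in> I" "g \<in> hom (Y i) Z"
  then show "g \<bullet> A i = (\<Sum>j\<in>I. (if j = i then g else 0) \<bullet> A j)"
    by (subst sum.remove[of I i]) auto
qed (auto simp: zero_hom)

lemma lspan_base1: "finite I \<Longrightarrow> i \<in> I \<Longrightarrow> A i \<in> hom X (Y i) \<Longrightarrow> A i \<in> lspan (Y i) I Y A"
  using lspan_base[of I i "one (Y i)" Y "Y i" A] by (simp add: one_hom one_left)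

lemma lspan_span: "v \<in> span S \<Longrightarrow> (\<And>x. x \<in> S \<Longrightarrow> x \<in> lspan Z I Y A) \<Longrightarrow> v \<in> lspan Z I Y A"
  by (meson span_minimal subsetD subsetI lspan_subspace)

lemma lspan_kill: "v \<in> lspan Z I Y A \<Longrightarrow> (\<And>i. i \<in> I \<Longrightarrow> A i \<bullet> B = 0) \<Longrightarrow> v \<bullet> B = 0"
  unfolding lspan_def by (auto simp: mul_sum_left mul_assoc)

text \<open>Applied with a decomposition of a larger idempotent \<open>F\<close> and a summand
  \<open>G\<close> of it: to factor \<open>F \<bullet> G\<close> through the new maps, each
  component of \<open>F\<close> may be treated separately.\<close>

lemma lspan_trans: "v \<in> lspan Z I Y A \<Longrightarrow> (\<And>i. i \<in> I \<Longrightarrow> A i \<bullet> h \<in> lspan (Y i) J Y' A') \<Longrightarrow> v \<bullet> h \<in> lspan Z J Y' A'"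
proof -
  assume "v \<in> lspan Z I Y A" and h: "\<And>i. i \<in> I \<Longrightarrow> A i \<bullet> h \<in> lspan (Y i) J Y' A'"
  then obtain G where G: "\<And>i. i \<in> I \<Longrightarrow> G i \<in> hom (Y i) Z" "v = (\<Sum>i\<in>I. G i \<bullet> A i)" unfolding lspan_def by blast
  have "v \<bullet> h = (\<Sum>i\<in>I. G i \<bullet> A i \<bullet> h)" unfolding G(2) by (simp add: mul_sum_left mul_assoc)
  also have "\<dots> \<in> lspan Z J Y' A'" by (intro lspan_sum lspan_mul[OF h G(1)])
  finally show ?thesis .
qed

text \<open>\<open>dec X e I Y E A\<close>: the morphisms \<open>A i\<close> are the components of an isomorphism from \<open>(X, e)\<close> to the
  direct sum of the \<open>(Y i, E i)\<close> in the Karoubi envelope.\<close>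

definition dec where
  "dec X e I Y E A \<longleftrightarrow> finite I \<and> (\<forall>i\<in>I. A i \<in> hom X (Y i) \<and> A i \<bullet> e = A i \<and> E i \<bullet> A i = A i) \<and>
     (\<exists>B. (\<forall>i\<in>I. B i \<in> hom (Y i) X \<and> e \<bullet> B i = B i \<and> B i \<bullet> E i = B i) \<and>
       (\<forall>i\<in>I. \<forall>j\<in>I. A i \<bullet> B j = (if i = j then E i else 0)) \<and> (\<Sum>i\<in>I. B i \<bullet> A i) = e)"

text \<open>Injectivity and surjectivity are checked separately. If \<open>e\<close> is the sum of
  the \<open>G i \<bullet> A i\<close> and \<open>B j\<close> is a preimage, then
  \<open>e \<bullet> B j \<bullet> E j\<close> equals \<open>G j \<bullet> E j\<close>, so the left
  and the right inverse agree.\<close>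

lemma decI:
  assumes fin: "finite I" and A: "\<And>i. i \<in> I \<Longrightarrow> A i \<in> hom X (Y i)"
    and Ae: "\<And>i. i \<in> I \<Longrightarrow> A i \<bullet> e = A i" and EA: "\<And>i. i \<in> I \<Longrightarrow> E i \<bullet> A i = A i"
    and e: "e \<in> hom X X" "e \<bullet> e = e"
    and E: "\<And>i. i \<in> I \<Longrightarrow> E i \<in> hom (Y i) (Y i)" "\<And>i. i \<in> I \<Longrightarrow> E i \<bullet> E i = E i"
    and mono: "e \<in> lspan X I Y A"
    and epi: "\<And>j. j \<in> I \<Longrightarrow> \<exists>B\<in>hom (Y j) X. \<forall>i\<in>I. A i \<bullet> B = (if i = j then E i else 0)"
  shows "dec X e I Y E A"
proof -
  obtain G where G: "\<And>i. i \<in> I \<Longrightarrow> G i \<in> hom (Y i) X" "e = (\<Sum>i\<in>I. G i \<bullet> A i)"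
    using mono unfolding lspan_def by blast
  have "\<forall>j. \<exists>B. j \<in> I \<longrightarrow> B \<in> hom (Y j) X \<and> (\<forall>i\<in>I. A i \<bullet> B = (if i = j then E i else 0))"
    using epi by blast
  then obtain B where B: "\<And>j. j \<in> I \<Longrightarrow> B j \<in> hom (Y j) X"
    "\<And>i j. i \<in> I \<Longrightarrow> j \<in> I \<Longrightarrow> A i \<bullet> B j = (if i = j then E i else 0)" by metis
  define B' where "B' j = e \<bullet> B j \<bullet> E j" for j
  have AB': "A i \<bullet> B' j = (if i = j then E i else 0)" if "i \<in> I" "j \<in> I" for i j
  proof -
    have "A i \<bullet> B' j = (A i \<bullet> B j) \<bullet> E j" using that by (simp add: B'_def mul_assoc reassoc[OF Ae])
    then show ?thesis using B(2)[OF that] E(2)[OF that(1)] by auto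
  qed
  have B'G: "B' j = G j \<bullet> E j" if "j \<in> I" for j
  proof -
    have "B' j = e \<bullet> B' j" by (simp add: B'_def reassoc[OF e(2)])
    also have "\<dots> = (\<Sum>i\<in>I. G i \<bullet> (A i \<bullet> B' j))" by (subst G(2)) (simp add: mul_sum_left mul_assoc)
    also have "\<dots> = (\<Sum>i\<in>I. if i = j then G i \<bullet> E i else 0)"
      by (rule sum.cong) (auto simp: AB' that)
    also have "\<dots> = G j \<bullet> E j" using fin that by simp
    finally show ?thesis .
  qed
  have "(\<Sum>i\<in>I. B' i \<bullet> A i) = (\<Sum>i\<in>I. G i \<bullet> A i)"
    by (rule sum.cong) (auto simp: B'G mul_assoc EA)
  moreover have "B' i \<in> hom (Y i) X" "e \<bullet> B' i = B' i" "B' i \<bullet> E i = B' i" if "i \<in> I" for i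
    using that mul_hom[OF mul_hom[OF E(1) B(1)] e(1)] E(2) by (simp_all add: B'_def mul_assoc reassoc[OF e(2)])
  ultimately show ?thesis
    unfolding dec_def using fin A Ae EA AB' G(2) by (intro conjI exI[of _ B']) auto
qed

lemma decE:
  assumes "dec X e I Y E A"
  obtains B where "finite I" "\<And>i. i \<in> I \<Longrightarrow> A i \<in> hom X (Y i)" "\<And>i. i \<in> I \<Longrightarrow> A i \<bullet> e = A i"
    "\<And>i. i \<in> I \<Longrightarrow> E i \<bullet> A i = A i" "\<And>i. i \<in> I \<Longrightarrow> B i \<in> hom (Y i) X" "\<And>i. i \<in> I \<Longrightarrow> e \<bullet> B i = B i"
    "\<And>i. i \<in> I \<Longrightarrow> B i \<bullet> E i = B i" "\<And>i j. i \<in> I \<Longrightarrow> j \<in> I \<Longrightarrow> A i \<bullet> B j = (if i = j then E i else 0)"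
    "(\<Sum>i\<in>I. B i \<bullet> A i) = e"
proof -
  obtain B where "\<forall>i\<in>I. B i \<in> hom (Y i) X \<and> e \<bullet> B i = B i \<and> B i \<bullet> E i = B i"
    "\<forall>i\<in>I. \<forall>j\<in>I. A i \<bullet> B j = (if i = j then E i else 0)" "(\<Sum>i\<in>I. B i \<bullet> A i) = e"
    using assms unfolding dec_def by blast
  with assms show ?thesis by (intro that[of B]) (auto simp: dec_def)
qed

lemma dec_mono: "dec X e I Y E A \<Longrightarrow> e \<in> lspan X I Y A"
proof (erule decE)
  fix B assume "\<And>i. i \<in> I \<Longrightarrow> B i \<in> hom (Y i) X" and e: "(\<Sum>i\<in>I. B i \<bullet> A i) = e"
  then show "e \<in> lspan X I Y A" unfolding lspan_def by (intro CollectI exI[of _ B]) auto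
qed

lemma dec_single: "e \<in> hom X X \<Longrightarrow> e \<bullet> e = e \<Longrightarrow> dec X e {i} (\<lambda>_. X) (\<lambda>_. e) (\<lambda>_. e)"
  unfolding dec_def by (auto intro!: exI[of _ "\<lambda>_. e"])

lemma dec_cong: "dec X e I Y E A \<Longrightarrow> (\<And>i. i \<in> I \<Longrightarrow> Y i = Y' i \<and> E i = E' i \<and> A i = A' i) \<Longrightarrow> X = X' \<Longrightarrow> e = e'
   \<Longrightarrow> dec X' e' I Y' E' A'"
  unfolding dec_def by (auto cong: sum.cong)

text \<open>The index set is a \<open>Sigma\<close> because different summands are refined by
  different families: below, what remains depends on whether the strand treated first was
  capped.\<close>

lemma dec_comp:
  assumes d: "dec X e I Y E A" and d': "\<And>i. i \<in> I \<Longrightarrow> dec (Y i) (E i) (J i) (Y' i) (E' i) (A' i)"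
  shows "dec X e (Sigma I J) (\<lambda>(i, j). Y' i j) (\<lambda>(i, j). E' i j) (\<lambda>(i, j). A' i j \<bullet> A i)"
proof -
  obtain B where B: "finite I" "\<And>i. i \<in> I \<Longrightarrow> A i \<in> hom X (Y i)" "\<And>i. i \<in> I \<Longrightarrow> A i \<bullet> e = A i"
    "\<And>i. i \<in> I \<Longrightarrow> E i \<bullet> A i = A i" "\<And>i. i \<in> I \<Longrightarrow> B i \<in> hom (Y i) X" "\<And>i. i \<in> I \<Longrightarrow> e \<bullet> B i = B i"
    "\<And>i. i \<in> I \<Longrightarrow> B i \<bullet> E i = B i" "\<And>i j. i \<in> I \<Longrightarrow> j \<in> I \<Longrightarrow> A i \<bullet> B j = (if i = j then E i else 0)"
    "(\<Sum>i\<in>I. B i \<bullet> A i) = e" by (rule decE[OF d], rule that) blast+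
  have "\<forall>i\<in>I. \<exists>B'. (\<forall>j\<in>J i. B' j \<in> hom (Y' i j) (Y i) \<and> E i \<bullet> B' j = B' j \<and> B' j \<bullet> E' i j = B' j) \<and>
       (\<forall>j\<in>J i. \<forall>l\<in>J i. A' i j \<bullet> B' l = (if j = l then E' i j else 0)) \<and> (\<Sum>j\<in>J i. B' j \<bullet> A' i j) = E i"
    using d' unfolding dec_def by blast
  from bchoice[OF this] obtain B' where "\<forall>i\<in>I. (\<forall>j\<in>J i. B' i j \<in> hom (Y' i j) (Y i) \<and> E i \<bullet> B' i j = B' i j \<and> B' i j \<bullet> E' i j = B' i j) \<and>
       (\<forall>j\<in>J i. \<forall>l\<in>J i. A' i j \<bullet> B' i l = (if j = l then E' i j else 0)) \<and> (\<Sum>j\<in>J i. B' i j \<bullet> A' i j) = E i" ..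
  then have B': "\<And>i. i \<in> I \<Longrightarrow> (\<forall>j\<in>J i. B' i j \<in> hom (Y' i j) (Y i) \<and> E i \<bullet> B' i j = B' i j \<and> B' i j \<bullet> E' i j = B' i j) \<and>
       (\<forall>j\<in>J i. \<forall>l\<in>J i. A' i j \<bullet> B' i l = (if j = l then E' i j else 0)) \<and> (\<Sum>j\<in>J i. B' i j \<bullet> A' i j) = E i" by blast
  have A': "\<And>i. i \<in> I \<Longrightarrow> finite (J i) \<and> (\<forall>j\<in>J i. A' i j \<in> hom (Y i) (Y' i j) \<and> A' i j \<bullet> E i = A' i j \<and> E' i j \<bullet> A' i j = A' i j)"
    using d' unfolding dec_def by blast
  show ?thesis unfolding dec_def
  proof (intro conjI exI[of _ "\<lambda>(i, j). B i \<bullet> B' i j"] ballI)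
    show "finite (Sigma I J)" using B(1) A' by auto
  next
    fix z assume z: "z \<in> Sigma I J"
    then obtain i j where ij: "z = (i, j)" "i \<in> I" "j \<in> J i" by auto
    then show "(case z of (i, j) \<Rightarrow> A' i j \<bullet> A i) \<in> hom X (case z of (i, j) \<Rightarrow> Y' i j)"
      using mul_hom[OF B(2)] A' by auto
    show "(case z of (i, j) \<Rightarrow> A' i j \<bullet> A i) \<bullet> e = (case z of (i, j) \<Rightarrow> A' i j \<bullet> A i)"
      using ij B(3) by (simp add: mul_assoc)
    show "(case z of (i, j) \<Rightarrow> E' i j) \<bullet> (case z of (i, j) \<Rightarrow> A' i j \<bullet> A i) = (case z of (i, j) \<Rightarrow> A' i j \<bullet> A i)"
      using ij A' by (simp add: reassoc)
    show "(case z of (i, j) \<Rightarrow> B i \<bullet> B' i j) \<in> hom (case z of (i, j) \<Rightarrow> Y' i j) X"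
      using mul_hom[OF _ B(5)[OF ij(2)], of "B' i j"] B'[OF ij(2)] ij by auto
    show "e \<bullet> (case z of (i, j) \<Rightarrow> B i \<bullet> B' i j) = (case z of (i, j) \<Rightarrow> B i \<bullet> B' i j)"
      using ij B(6) by (simp add: reassoc)
    show "(case z of (i, j) \<Rightarrow> B i \<bullet> B' i j) \<bullet> (case z of (i, j) \<Rightarrow> E' i j) = (case z of (i, j) \<Rightarrow> B i \<bullet> B' i j)"
      using ij B' by (simp add: mul_assoc)
    fix z' assume z': "z' \<in> Sigma I J"
    then obtain i' j' where ij': "z' = (i', j')" "i' \<in> I" "j' \<in> J i'" by auto
    have "(A' i j \<bullet> A i) \<bullet> (B i' \<bullet> B' i' j') = A' i j \<bullet> (A i \<bullet> B i') \<bullet> B' i' j'"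
      by (simp add: mul_assoc)
    also have "\<dots> = (if z = z' then E' i j else 0)"
      using B(8)[OF ij(2) ij'(2)] B' ij ij' by (cases "i = i'") auto
    finally show "(case z of (i, j) \<Rightarrow> A' i j \<bullet> A i) \<bullet> (case z' of (i, j) \<Rightarrow> B i \<bullet> B' i j) = (if z = z' then case z of (i, j) \<Rightarrow> E' i j else 0)"
      using ij ij' by simp
  next
    have "(\<Sum>z\<in>Sigma I J. (case z of (i, j) \<Rightarrow> B i \<bullet> B' i j) \<bullet> (case z of (i, j) \<Rightarrow> A' i j \<bullet> A i))
      = (\<Sum>(i, j)\<in>Sigma I J. B i \<bullet> (B' i j \<bullet> A' i j) \<bullet> A i)"
      by (rule sum.cong) (auto simp: mul_assoc)
    also have "\<dots> = (\<Sum>i\<in>I. \<Sum>j\<in>J i. B i \<bullet> (B' i j \<bullet> A' i j) \<bullet> A i)"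
      by (rule sum.Sigma[symmetric]) (use B(1) A' in auto)
    also have "\<dots> = (\<Sum>i\<in>I. B i \<bullet> A i)"
    proof (rule sum.cong[OF HOL.refl])
      fix i assume "i \<in> I"
      have "(\<Sum>j\<in>J i. B i \<bullet> (B' i j \<bullet> A' i j) \<bullet> A i) = B i \<bullet> (\<Sum>j\<in>J i. B' i j \<bullet> A' i j) \<bullet> A i"
        by (simp add: mul_sum_left mul_sum_right)
      also have "\<dots> = B i \<bullet> A i" using B' B(4) \<open>i \<in> I\<close> by simp
      finally show "(\<Sum>j\<in>J i. B i \<bullet> (B' i j \<bullet> A' i j) \<bullet> A i) = B i \<bullet> A i" .
    qed
    finally show "(\<Sum>z\<in>Sigma I J. (case z of (i, j) \<Rightarrow> B i \<bullet> B' i j) \<bullet> (case z of (i, j) \<Rightarrow> A' i j \<bullet> A i)) = e"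
      using B(9) by simp
  qed
qed

lemma dec_tensor_right:
  assumes d: "dec X e I Y E A" and g: "g \<in> hom W W" "g \<bullet> g = g"
  shows "dec (X @ W) (wh [] e W \<bullet> wh X g []) I (\<lambda>i. Y i @ W) (\<lambda>i. wh [] (E i) W \<bullet> wh (Y i) g [])
     (\<lambda>i. wh [] (A i) W \<bullet> wh X g [])"
proof -
  obtain B where B: "finite I" "\<And>i. i \<in> I \<Longrightarrow> A i \<in> hom X (Y i)" "\<And>i. i \<in> I \<Longrightarrow> A i \<bullet> e = A i"
    "\<And>i. i \<in> I \<Longrightarrow> E i \<bullet> A i = A i" "\<And>i. i \<in> I \<Longrightarrow> B i \<in> hom (Y i) X" "\<And>i. i \<in> I \<Longrightarrow> e \<bullet> B i = B i"
    "\<And>i. i \<in> I \<Longrightarrow> B i \<bullet> E i = B i" "\<And>i j. i \<in> I \<Longrightarrow> j \<in> I \<Longrightarrow> A i \<bullet> B j = (if i = j then E i else 0)"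
    "(\<Sum>i\<in>I. B i \<bullet> A i) = e" by (rule decE[OF d], rule that) blast+
  have e: "e \<in> hom X X" unfolding B(9)[symmetric] by (intro sum_hom) (auto intro: mul_hom B)
  have E: "E i \<in> hom (Y i) (Y i)" if "i \<in> I" for i using B(8)[OF that that] mul_hom[OF B(5) B(2), OF that that] by simp
  have gg: "wh Z g [] \<bullet> wh Z g [] = wh Z g []" for Z using g(2) by (simp flip: wh_mul)
  have ex: "wh Y1 g [] \<bullet> wh [] h W = wh [] h W \<bullet> wh X1 g []" if "h \<in> hom X1 Y1" for h X1 Y1
    using exchange[OF that g(1), of "[]" "[]" "[]"] by simp
  show ?thesis unfolding dec_def
  proof (intro conjI exI[of _ "\<lambda>i. wh [] (B i) W \<bullet> wh (Y i) g []"] ballI B(1))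
    fix i assume i: "i \<in> I"
    note m = mul_hom[OF wh_homI wh_homI]
    show "wh [] (A i) W \<bullet> wh X g [] \<in> hom (X @ W) (Y i @ W)"
      by (rule m[OF g(1) _ _ B(2)[OF i], of _ X "[]" "X @ W" "[]" W]) simp_all
    show "wh [] (B i) W \<bullet> wh (Y i) g [] \<in> hom (Y i @ W) (X @ W)"
      by (rule m[OF g(1) _ _ B(5)[OF i], of _ "Y i" "[]" "Y i @ W" "[]" W]) simp_all
    show "(wh [] (A i) W \<bullet> wh X g []) \<bullet> wh [] e W \<bullet> wh X g [] = wh [] (A i) W \<bullet> wh X g []"
      using B(3)[OF i] by (simp add: mul_assoc reassoc[OF ex[OF e]] gg) (simp flip: wh_mul mul_assoc)
    show "(wh [] (E i) W \<bullet> wh (Y i) g []) \<bullet> wh [] (A i) W \<bullet> wh X g [] = wh [] (A i) W \<bullet> wh X g []"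
      using B(4)[OF i] by (simp add: mul_assoc reassoc[OF ex[OF B(2)[OF i]]] gg) (simp flip: wh_mul mul_assoc)
    show "(wh [] e W \<bullet> wh X g []) \<bullet> wh [] (B i) W \<bullet> wh (Y i) g [] = wh [] (B i) W \<bullet> wh (Y i) g []"
      using B(6)[OF i] by (simp add: mul_assoc reassoc[OF ex[OF B(5)[OF i]]] gg) (simp flip: wh_mul mul_assoc)
    show "(wh [] (B i) W \<bullet> wh (Y i) g []) \<bullet> wh [] (E i) W \<bullet> wh (Y i) g [] = wh [] (B i) W \<bullet> wh (Y i) g []"
      using B(7)[OF i] by (simp add: mul_assoc reassoc[OF ex[OF E[OF i]]] gg) (simp flip: wh_mul mul_assoc)
    fix j assume j: "j \<in> I"
    have "(wh [] (A i) W \<bullet> wh X g []) \<bullet> wh [] (B j) W \<bullet> wh (Y j) g [] = wh [] (A i \<bullet> B j) W \<bullet> wh (Y j) g []"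
      by (simp add: mul_assoc wh_mul reassoc[OF ex[OF B(5)[OF j]]] gg)
    then show "(wh [] (A i) W \<bullet> wh X g []) \<bullet> wh [] (B j) W \<bullet> wh (Y j) g [] = (if i = j then wh [] (E i) W \<bullet> wh (Y i) g [] else 0)"
      using B(8)[OF i j] by auto
  next
    have "(\<Sum>i\<in>I. (wh [] (B i) W \<bullet> wh (Y i) g []) \<bullet> wh [] (A i) W \<bullet> wh X g []) = (\<Sum>i\<in>I. wh [] (B i \<bullet> A i) W \<bullet> wh X g [])"
      by (rule sum.cong) (simp_all add: mul_assoc wh_mul reassoc[OF ex[OF B(2)]] gg)
    also have "\<dots> = wh [] e W \<bullet> wh X g []" by (simp add: B(9) flip: mul_sum_left wh_sum)
    finally show "(\<Sum>i\<in>I. (wh [] (B i) W \<bullet> wh (Y i) g []) \<bullet> wh [] (A i) W \<bullet> wh X g []) = wh [] e W \<bullet> wh X g []" .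
  qed
qed

lemma dec_tensor_left:
  assumes d: "dec X e I Y E A" and g: "g \<in> hom W W" "g \<bullet> g = g"
  shows "dec (W @ X) (wh W e [] \<bullet> wh [] g X) I (\<lambda>i. W @ Y i) (\<lambda>i. wh W (E i) [] \<bullet> wh [] g (Y i))
     (\<lambda>i. wh W (A i) [] \<bullet> wh [] g X)"
proof -
  obtain B where B: "finite I" "\<And>i. i \<in> I \<Longrightarrow> A i \<in> hom X (Y i)" "\<And>i. i \<in> I \<Longrightarrow> A i \<bullet> e = A i"
    "\<And>i. i \<in> I \<Longrightarrow> E i \<bullet> A i = A i" "\<And>i. i \<in> I \<Longrightarrow> B i \<in> hom (Y i) X" "\<And>i. i \<in> I \<Longrightarrow> e \<bullet> B i = B i"
    "\<And>i. i \<in> I \<Longrightarrow> B i \<bullet> E i = B i" "\<And>i j. i \<in> I \<Longrightarrow> j \<in> I \<Longrightarrow> A i \<bullet> B j = (if i = j then E i else 0)"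
    "(\<Sum>i\<in>I. B i \<bullet> A i) = e" by (rule decE[OF d], rule that) blast+
  have e: "e \<in> hom X X" unfolding B(9)[symmetric] by (intro sum_hom) (auto intro: mul_hom B)
  have E: "E i \<in> hom (Y i) (Y i)" if "i \<in> I" for i using B(8)[OF that that] mul_hom[OF B(5) B(2), OF that that] by simp
  have gg: "wh [] g Z \<bullet> wh [] g Z = wh [] g Z" for Z using g(2) by (simp flip: wh_mul)
  have ex: "wh [] g Y1 \<bullet> wh W h [] = wh W h [] \<bullet> wh [] g X1" if "h \<in> hom X1 Y1" for h X1 Y1
    using exchange[OF g(1) that, of "[]" "[]" "[]"] by simp
  show ?thesis unfolding dec_def
  proof (intro conjI exI[of _ "\<lambda>i. wh W (B i) [] \<bullet> wh [] g (Y i)"] ballI B(1))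
    fix i assume i: "i \<in> I"
    note m = mul_hom[OF wh_homI wh_homI]
    show "wh W (A i) [] \<bullet> wh [] g X \<in> hom (W @ X) (W @ Y i)"
      by (rule m[OF g(1) _ _ B(2)[OF i], of _ "[]" X "W @ X" W "[]"]) simp_all
    show "wh W (B i) [] \<bullet> wh [] g (Y i) \<in> hom (W @ Y i) (W @ X)"
      by (rule m[OF g(1) _ _ B(5)[OF i], of _ "[]" "Y i" "W @ Y i" W "[]"]) simp_all
    show "(wh W (A i) [] \<bullet> wh [] g X) \<bullet> wh W e [] \<bullet> wh [] g X = wh W (A i) [] \<bullet> wh [] g X"
      using B(3)[OF i] by (simp add: mul_assoc reassoc[OF ex[OF e]] gg) (simp flip: wh_mul mul_assoc)
    show "(wh W (E i) [] \<bullet> wh [] g (Y i)) \<bullet> wh W (A i) [] \<bullet> wh [] g X = wh W (A i) [] \<bullet> wh [] g X"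
      using B(4)[OF i] by (simp add: mul_assoc reassoc[OF ex[OF B(2)[OF i]]] gg) (simp flip: wh_mul mul_assoc)
    show "(wh W e [] \<bullet> wh [] g X) \<bullet> wh W (B i) [] \<bullet> wh [] g (Y i) = wh W (B i) [] \<bullet> wh [] g (Y i)"
      using B(6)[OF i] by (simp add: mul_assoc reassoc[OF ex[OF B(5)[OF i]]] gg) (simp flip: wh_mul mul_assoc)
    show "(wh W (B i) [] \<bullet> wh [] g (Y i)) \<bullet> wh W (E i) [] \<bullet> wh [] g (Y i) = wh W (B i) [] \<bullet> wh [] g (Y i)"
      using B(7)[OF i] by (simp add: mul_assoc reassoc[OF ex[OF E[OF i]]] gg) (simp flip: wh_mul mul_assoc)
    fix j assume j: "j \<in> I"
    have "(wh W (A i) [] \<bullet> wh [] g X) \<bullet> wh W (B j) [] \<bullet> wh [] g (Y j) = wh W (A i \<bullet> B j) [] \<bullet> wh [] g (Y j)"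
      by (simp add: mul_assoc wh_mul reassoc[OF ex[OF B(5)[OF j]]] gg)
    then show "(wh W (A i) [] \<bullet> wh [] g X) \<bullet> wh W (B j) [] \<bullet> wh [] g (Y j) = (if i = j then wh W (E i) [] \<bullet> wh [] g (Y i) else 0)"
      using B(8)[OF i j] by auto
  next
    have "(\<Sum>i\<in>I. (wh W (B i) [] \<bullet> wh [] g (Y i)) \<bullet> wh W (A i) [] \<bullet> wh [] g X) = (\<Sum>i\<in>I. wh W (B i \<bullet> A i) [] \<bullet> wh [] g X)"
      by (rule sum.cong) (simp_all add: mul_assoc wh_mul reassoc[OF ex[OF B(2)]] gg)
    also have "\<dots> = wh W e [] \<bullet> wh [] g X" by (simp add: B(9) flip: mul_sum_left wh_sum)
    finally show "(\<Sum>i\<in>I. (wh W (B i) [] \<bullet> wh [] g (Y i)) \<bullet> wh W (A i) [] \<bullet> wh [] g X) = wh W e [] \<bullet> wh [] g X" .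
  qed
qed

end

section \<open>The decomposition theorem\<close>

locale heisenberg_proj = heisenberg scale hom one mul wh U sU \<eta> D sD t x d c \<epsilon> k t' uinv xp
  for scale :: "'a::field_char_0 \<Rightarrow> 'v::ab_group_add \<Rightarrow> 'v" (infixr \<open>*s\<close> 75)
    and hom :: "'g list \<Rightarrow> 'g list \<Rightarrow> 'v set" and one :: "'g list \<Rightarrow> 'v"
    and mul :: "'v \<Rightarrow> 'v \<Rightarrow> 'v" (infixr \<open>\<bullet>\<close> 70)
    and wh :: "'g list \<Rightarrow> 'v \<Rightarrow> 'g list \<Rightarrow> 'v"
    and U sU \<eta> D sD t x d c \<epsilon> k t' uinv xp +
  fixes e f :: "nat \<Rightarrow> 'v"
  assumes e: "\<And>n. proj U sU \<eta> n (e n)" and f: "\<And>n. proj D sD (- \<eta>) n (f n)"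
begin

lemmas e_hom = L.proj_hom[OF e] and f_hom = R.proj_hom[OF f]

definition EF where "EF m n = wh [] (e m) (vp n) \<bullet> wh (up m) (f n) []"
definition FE where "FE q p = wh [] (f q) (up p) \<bullet> wh (vp q) (e p) []"
text \<open>Kept apart from \<open>A\<close>, which includes the idempotent, so that the same
  diagram can be applied to the less symmetric idempotents of the induction steps.\<close>

definition Ap where "Ap p q l = cross p q \<bullet> wh (up p) (cap l) (vp q)"
definition A where "A m n l = Ap (m - length l) (n - length l) l \<bullet> EF m n"
definition Ix where "Ix m n = {l. sorted_wrt (>) l \<and> set l \<subseteq> {..<k} \<and> length l \<le> m \<and> length l \<le> n}"
definition tgt :: "nat \<Rightarrow> nat \<Rightarrow> nat list \<Rightarrow> 'g list" where "tgt m n l = vp (n - length l) @ up (m - length l)"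
definition E :: "nat \<Rightarrow> nat \<Rightarrow> nat list \<Rightarrow> 'v" where "E m n l = FE (n - length l) (m - length l)"
definition T where "T m n \<longleftrightarrow> dec (up m @ vp n) (EF m n) (Ix m n) (tgt m n) (E m n) (A m n)"

lemma finite_Ix: "finite (Ix m n)"
  by (rule finite_subset[OF _ finite_lists_length_le[of "{..<k}" m]]) (auto simp: Ix_def)

lemma EF_alt: "EF m n = wh (up m) (f n) [] \<bullet> wh [] (e m) (vp n)"
  unfolding EF_def using exchange[OF e_hom[of m] f_hom[of n], of "[]" "[]" "[]"] by simp

lemma FE_alt: "FE q p = wh (vp q) (e p) [] \<bullet> wh [] (f q) (up p)"
  unfolding FE_def using exchange[OF f_hom[of q] e_hom[of p], of "[]" "[]" "[]"] by simp

lemma e_idem: "wh Z (e m) W \<bullet> wh Z (e m) W = wh Z (e m) W"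
  using L.proj_idem[OF e[of m]] by (simp flip: wh_mul)

lemma f_idem: "wh Z (f m) W \<bullet> wh Z (f m) W = wh Z (f m) W"
  using R.proj_idem[OF f[of m]] by (simp flip: wh_mul)

lemma EF_hom: "EF m n \<in> hom (up m @ vp n) (up m @ vp n)"
  unfolding EF_def by (rule mul_hom[of _ _ "up m @ vp n"]) (auto intro!: wh_homI[OF e_hom] wh_homI[OF f_hom])

lemma FE_hom: "FE q p \<in> hom (vp q @ up p) (vp q @ up p)"
  unfolding FE_def by (rule mul_hom[of _ _ "vp q @ up p"]) (auto intro!: wh_homI[OF e_hom] wh_homI[OF f_hom])

lemma EF_idem: "EF m n \<bullet> EF m n = EF m n"
proof -
  have "wh (up m) (f n) [] \<bullet> wh [] (e m) (vp n) = wh [] (e m) (vp n) \<bullet> wh (up m) (f n) []"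
    using EF_alt[of m n] by (simp add: EF_def)
  from reassoc[OF this] show ?thesis by (simp add: EF_def mul_assoc reassoc[OF e_idem] f_idem)
qed

lemma FE_idem: "FE q p \<bullet> FE q p = FE q p"
proof -
  have "wh (vp q) (e p) [] \<bullet> wh [] (f q) (up p) = wh [] (f q) (up p) \<bullet> wh (vp q) (e p) []"
    using FE_alt[of q p] by (simp add: FE_def)
  from reassoc[OF this] show ?thesis by (simp add: FE_def mul_assoc reassoc[OF f_idem] e_idem)
qed

lemma cross_EF: "cross p q \<bullet> EF p q = FE q p \<bullet> cross p q"
proof -
  have 1: "wh (vp q) (e p) [] \<bullet> cross p q = cross p q \<bullet> wh [] (e p) (vp q)"
    using e[of p] unfolding proj_def by (blast intro: cross_polU)
  have 2: "wh [] (f q) (up p) \<bullet> cross p q = cross p q \<bullet> wh (up p) (f q) []"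
    using f[of q] unfolding proj_def by (blast intro: cross_polV)
  show ?thesis unfolding EF_alt FE_def by (simp add: mul_assoc 1 reassoc[OF 2])
qed

lemma Ap_hom: "r = length l \<Longrightarrow> m = p + r \<Longrightarrow> n = r + q \<Longrightarrow> Ap p q l \<in> hom (up m @ vp n) (vp q @ up p)"
  unfolding Ap_def by (rule mul_hom[OF wh_homI[OF cap_hom] cross_hom]) auto

lemma e_absorb: "m = a + p + b \<Longrightarrow> wh (Z @ up a) (e p) (up b @ W) \<bullet> wh Z (e m) W = wh Z (e m) W"
  by (rule L.proj_absorb_left[OF e e])

lemma f_absorb: "m = a + p + b \<Longrightarrow> wh (Z @ vp a) (f p) (vp b @ W) \<bullet> wh Z (f m) W = wh Z (f m) W"
  by (rule R.proj_absorb_left[OF f f])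

lemma f_absorb': "m = a + p + b \<Longrightarrow> wh Z (f m) W \<bullet> wh (Z @ vp a) (f p) (vp b @ W) = wh Z (f m) W"
  by (rule R.proj_absorb_right[OF f f])

text \<open>The idempotent of the target slides back through the crossing and past the caps to the
  strands that are not capped, where \<open>\<xi>\<close> absorbs it.\<close>

lemma FE_Ap:
  assumes "m = p + length l" "n = length l + q"
    and \<xi>: "wh [] (e p) (up (length l) @ vp n) \<bullet> \<xi> = \<xi>" "wh (up m @ vp (length l)) (f q) [] \<bullet> \<xi> = \<xi>"
  shows "FE q p \<bullet> Ap p q l \<bullet> \<xi> = Ap p q l \<bullet> \<xi>"
proof -
  have 1: "wh [] (e p) (vp q) \<bullet> wh (up p) (cap l) (vp q) = wh (up p) (cap l) (vp q) \<bullet> wh [] (e p) (up (length l) @ vp n)"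
    using exchange[OF e_hom[of p] cap_hom[of l], of "[]" "[]" "vp q"] assms(2) by simp
  have 2: "wh (up p) (f q) [] \<bullet> wh (up p) (cap l) (vp q) = wh (up p) (cap l) (vp q) \<bullet> wh (up m @ vp (length l)) (f q) []"
    using exchange[OF cap_hom[of l] f_hom[of q], of "up p" "[]" "[]"] assms(1) by simp
  have "FE q p \<bullet> Ap p q l \<bullet> \<xi> = cross p q \<bullet> EF p q \<bullet> wh (up p) (cap l) (vp q) \<bullet> \<xi>"
    unfolding Ap_def by (simp add: mul_assoc reassoc[OF cross_EF[symmetric]])
  also have "\<dots> = Ap p q l \<bullet> \<xi>" unfolding EF_def Ap_def
    by (simp add: mul_assoc reassoc[OF 2] reassoc[OF 1] \<xi>)
  finally show ?thesis .
qed

lemma A_facts: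
  assumes "l \<in> Ix m n"
  shows A_hom: "A m n l \<in> hom (up m @ vp n) (tgt m n l)" and A_EF: "A m n l \<bullet> EF m n = A m n l"
    and E_A: "E m n l \<bullet> A m n l = A m n l"
    and E_hom: "E m n l \<in> hom (tgt m n l) (tgt m n l)" and E_idem: "E m n l \<bullet> E m n l = E m n l"
proof -
  let ?r = "length l"
  have l: "?r \<le> m" "?r \<le> n" using assms by (auto simp: Ix_def)
  show "A m n l \<in> hom (up m @ vp n) (tgt m n l)"
    unfolding A_def tgt_def by (rule mul_hom[OF EF_hom Ap_hom]) (use l in auto)
  show "A m n l \<bullet> EF m n = A m n l" by (simp add: A_def mul_assoc EF_idem)
  show "E m n l \<in> hom (tgt m n l) (tgt m n l)" unfolding E_def tgt_def by (rule FE_hom)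
  show "E m n l \<bullet> E m n l = E m n l" by (simp add: E_def FE_idem)
  have 1: "wh [] (e (m - ?r)) (up ?r @ vp n) \<bullet> EF m n = EF m n"
    unfolding EF_def using e_absorb[of m 0 "m - ?r" ?r "[]" "vp n", THEN reassoc] l by simp
  have 2: "wh (up m @ vp ?r) (f (n - ?r)) [] \<bullet> EF m n = EF m n"
    unfolding EF_alt using f_absorb[of n ?r "n - ?r" 0 "up m" "[]", THEN reassoc] l by simp
  show "E m n l \<bullet> A m n l = A m n l" unfolding E_def A_def
    by (rule FE_Ap[OF _ _ 1 2]) (use l in auto)
qed

lemma TI:
  assumes "EF m n \<in> lspan (up m @ vp n) (Ix m n) (tgt m n) (A m n)"
    and "\<And>j. j \<in> Ix m n \<Longrightarrow> \<exists>B\<in>hom (tgt m n j) (up m @ vp n). \<forall>i\<in>Ix m n. A m n i \<bullet> B = (if i = j then E m n i else 0)"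
  shows "T m n"
  unfolding T_def by (rule decI[OF finite_Ix A_hom A_EF E_A EF_hom EF_idem E_hom E_idem assms])

lemma e_0: "e 0 = one []" and e_1: "e (Suc 0) = one [U]"
  using L.proj_0[OF e] L.proj_1[OF e] by auto
lemma f_0: "f 0 = one []" and f_1: "f (Suc 0) = one [D]"
  using R.proj_0[OF f] R.proj_1[OF f] by auto

lemma Ix_0: "Ix 0 n = {[]}" "Ix m 0 = {[]}"
  by (auto simp: Ix_def)

lemma cross_0: "cross p 0 = one (up p)"
  by (induction p) (auto simp: wh_one one_left[OF one_hom])

lemma T_0: "T 0 n"
proof -
  have "EF 0 n = f n" using one_left[OF f_hom[of n]]
    by (simp add: EF_def e_0 wh_one wh_Nil[OF f_hom])
  moreover have "E 0 n [] = f n" using one_right[OF f_hom[of n]]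
    by (simp add: E_def FE_def e_0 wh_one wh_Nil[OF f_hom])
  moreover have "A 0 n [] = f n"
    by (simp add: A_def Ap_def \<open>EF 0 n = f n\<close> wh_one mul_assoc one_left[OF f_hom])
  ultimately show ?thesis unfolding T_def Ix_0
    by (intro dec_cong[OF dec_single[OF f_hom R.proj_idem[OF f], of n "[]"]]) (auto simp: tgt_def)
qed

lemma T_m_0: "T m 0"
proof -
  have "EF m 0 = e m" using one_right[OF e_hom[of m]]
    by (simp add: EF_def f_0 wh_one wh_Nil[OF e_hom])
  moreover have "E m 0 [] = e m" using one_left[OF e_hom[of m]]
    by (simp add: E_def FE_def f_0 wh_one wh_Nil[OF e_hom])
  moreover have "A m 0 [] = e m"
    by (simp add: A_def Ap_def cross_0 \<open>EF m 0 = e m\<close> wh_one mul_assoc one_left[OF e_hom])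
  ultimately show ?thesis unfolding T_def Ix_0
    by (intro dec_cong[OF dec_single[OF e_hom L.proj_idem[OF e], of m "[]"]]) (auto simp: tgt_def)
qed

subsection \<open>One upward strand\<close>

definition kap where "kap a = d \<bullet> wh [] (xp a) [D]"

lemma kap_hom: "kap a \<in> hom [U, D] []"
  unfolding kap_def by (rule mul_hom[OF wh_homI[OF xp_hom] d_hom]) simp_all

lemma cap_single: "cap [a] = kap a"
proof -
  have "wh [] (xp a) [D] \<bullet> one [U, D] = wh [] (xp a) [D]"
    by (rule one_right[OF wh_homI[OF xp_hom]]) simp_all
  then show ?thesis by (simp add: kap_def wh_one)
qed

lemma EF_1: "EF (Suc 0) n = wh [U] (f n) []"
proof -
  have "wh [U] (f n) [] \<in> hom (U # vp n) (U # vp n)" by (rule wh_homI[OF f_hom]) simp_all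
  from one_left[OF this] show ?thesis by (simp add: EF_def e_1 wh_one)
qed

lemma FE_q1: "FE q (Suc 0) = wh [] (f q) [U]"
proof -
  have "wh [] (f q) [U] \<in> hom (vp q @ [U]) (vp q @ [U])" by (rule wh_homI[OF f_hom]) simp_all
  from one_right[OF this] show ?thesis by (simp add: FE_def e_1 wh_one)
qed

lemma FE_q0: "FE q 0 = f q"
  unfolding FE_def using one_right[OF f_hom[of q]] by (simp add: e_0 wh_one wh_Nil[OF f_hom])

lemma A_1_Nil: "A (Suc 0) n [] = tau n \<bullet> wh [U] (f n) []"
proof -
  have "one (vp n @ [U]) \<bullet> tau n = tau n" by (rule one_left[OF tau_hom])
  moreover have "one (U # vp n) \<bullet> wh [U] (f n) [] = wh [U] (f n) []"
    by (rule one_left[OF wh_homI[OF f_hom]]) simp_all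
  ultimately show ?thesis
    by (simp add: A_def Ap_def EF_1 wh_one tau_Nil mul_assoc)
qed

lemma A_1_single: "A (Suc 0) (Suc n) [a] = wh [] (kap a) (vp n) \<bullet> wh [U] (f (Suc n)) []"
proof -
  have "one (vp n) \<bullet> wh [] (kap a) (vp n) = wh [] (kap a) (vp n)"
    by (rule one_left[OF wh_homI[OF kap_hom]]) simp_all
  then show ?thesis unfolding A_def Ap_def EF_1 cap_single by simp
qed

lemma Ix_1: "Ix (Suc 0) (Suc n) = insert [] ((\<lambda>a. [a]) ` {..<k})"
  unfolding Ix_def by (auto simp: le_Suc_eq length_Suc_conv)

text \<open>For one strand of each colour the maps are \<open>t\<close> and the single dotted caps,
  and the inversion relation supplies their inverses \<open>t'\<close> and
  \<open>uinv a\<close>.\<close>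

lemma T_1_1: "T (Suc 0) (Suc 0)"
proof -
  define B where "B l = (case l of [] \<Rightarrow> t' | a # _ \<Rightarrow> uinv a)" for l
  have EF: "EF (Suc 0) (Suc 0) = one [U, D]" by (simp add: EF_1 f_1 wh_one)
  have A0: "A (Suc 0) (Suc 0) [] = t" by (simp only: A_1_Nil f_1) (simp add: wh_one tau_1 one_right[OF t_hom] del: tau.simps)
  have Aa: "A (Suc 0) (Suc 0) [a] = kap a" for a
    using one_right[OF kap_hom] by (simp add: A_1_single f_1 wh_one wh_Nil[OF kap_hom])
  have E0: "E (Suc 0) (Suc 0) [] = one [D, U]" by (simp add: E_def FE_q1 f_1 wh_one)
  have Ea: "E (Suc 0) (Suc 0) [a] = one []" for a by (simp add: E_def FE_q0 f_0)
  have B: "B l \<in> hom (tgt (Suc 0) (Suc 0) l) [U, D]" if "l \<in> Ix (Suc 0) (Suc 0)" for l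
    using that t'_hom u_hom by (auto simp: B_def tgt_def Ix_1)
  show ?thesis
  proof (rule TI)
    have inj: "inj_on (\<lambda>a. [a]) {..<k}" by (auto simp: inj_on_def)
    have "(\<Sum>l\<in>Ix (Suc 0) (Suc 0). B l \<bullet> A (Suc 0) (Suc 0) l) = t' \<bullet> t + (\<Sum>a<k. uinv a \<bullet> kap a)"
      unfolding Ix_1 by (subst sum.insert) (auto simp: sum.reindex[OF inj] B_def A0 Aa)
    also have "\<dots> = one [U, D]" using complete by (simp add: kap_def)
    finally show "EF (Suc 0) (Suc 0) \<in> lspan (up (Suc 0) @ vp (Suc 0)) (Ix (Suc 0) (Suc 0)) (tgt (Suc 0) (Suc 0)) (A (Suc 0) (Suc 0))"
      unfolding EF lspan_def using B by (auto intro!: exI[of _ B])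
  next
    fix j assume j: "j \<in> Ix (Suc 0) (Suc 0)"
    show "\<exists>B\<in>hom (tgt (Suc 0) (Suc 0) j) (up (Suc 0) @ vp (Suc 0)).
       \<forall>i\<in>Ix (Suc 0) (Suc 0). A (Suc 0) (Suc 0) i \<bullet> B = (if i = j then E (Suc 0) (Suc 0) i else 0)"
    proof (intro bexI[of _ "B j"] ballI)
      show "B j \<in> hom (tgt (Suc 0) (Suc 0) j) (up (Suc 0) @ vp (Suc 0))" using B[OF j] by simp
      fix i assume "i \<in> Ix (Suc 0) (Suc 0)"
      then show "A (Suc 0) (Suc 0) i \<bullet> B j = (if i = j then E (Suc 0) (Suc 0) i else 0)"
        using j d_t' d_u t_u t_t' unfolding Ix_1
        by (auto simp: A0 Aa E0 Ea B_def kap_def mul_assoc split: if_splits)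
    qed
  qed
qed

text \<open>\<open>t_dot\<close> breaks the crossing into a cup and a cap. Dots already moved stay
  on the cup and those still to be moved on the cap, so the cap always has fewer than
  \<open>a\<close>.\<close>

lemma t_dots: "t \<bullet> wh [] (xp a) [D] - wh [D] (xp a) [] \<bullet> t \<in> span {wh [D] (xp j) [] \<bullet> c \<bullet> kap b | b j. b < a}"
proof (induction a)
  case 0
  have "t \<bullet> wh [] (xp 0) [D] = t" "wh [D] (xp 0) [] \<bullet> t = t"
    by (simp_all add: xp_0 wh_one one_left[OF t_hom] one_right[OF t_hom])
  then show ?case by (simp add: span_zero)
next
  case (Suc a)
  let ?S = "{wh [D] (xp j) [] \<bullet> c \<bullet> kap b | b j. b < Suc a}"
  have "t \<bullet> wh [] (xp (Suc a)) [D] - wh [D] (xp (Suc a)) [] \<bullet> t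
     = wh [D] x [] \<bullet> (t \<bullet> wh [] (xp a) [D] - wh [D] (xp a) [] \<bullet> t) + c \<bullet> kap a"
    by (simp add: xp_Suc wh_mul reassoc[OF t_dot] distribs kap_def mul_assoc)
  moreover have "c \<bullet> kap a \<in> span ?S"
  proof (rule span_base)
    have "c \<bullet> kap a = wh [D] (xp 0) [] \<bullet> c \<bullet> kap a"
      using one_left[OF mul_hom[OF kap_hom[of a] c_hom]] by (simp add: xp_0 wh_one)
    then show "c \<bullet> kap a \<in> ?S" by blast
  qed
  moreover have "wh [D] x [] \<bullet> (t \<bullet> wh [] (xp a) [D] - wh [D] (xp a) [] \<bullet> t) \<in> span ?S"
  proof (rule span_map[OF module_hom_mul_right Suc])
    fix y assume "y \<in> {wh [D] (xp j) [] \<bullet> c \<bullet> kap b | b j. b < a}"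
    then obtain b j where y: "y = wh [D] (xp j) [] \<bullet> c \<bullet> kap b" "b < a" by blast
    have "wh [D] x [] \<bullet> y = wh [D] (xp (Suc j)) [] \<bullet> c \<bullet> kap b" by (simp add: y(1) xp_Suc wh_mul mul_assoc)
    then show "wh [D] x [] \<bullet> y \<in> span ?S" using y(2) by (intro span_base CollectI exI[of _ b] exI[of _ "Suc j"]) simp
  qed
  ultimately show ?case by (simp add: span_add)
qed

text \<open>\<open>cap_t_D\<close> trades the downward crossing under the cap for \<open>t\<close>,
  but leaves the dots below \<open>t\<close>. Moving them up to the cap costs the terms of
  \<open>t_dots\<close>.\<close>

lemma kap_sD: "wh [] (kap a) [D] \<bullet> wh [U] sD [] - wh [D] (kap a) [] \<bullet> wh [] t [D]
   \<in> span {g \<bullet> wh [] (kap b) [D] | g b. g \<in> hom [D] [D] \<and> b < a}"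
proof -
  define G where "G y = wh [D] d [] \<bullet> wh [] y [D]" for y
  have G: "module_hom scale scale G" unfolding G_def
    by (intro module_hom_comp[OF module_hom_mul_right] module_hom_wh)
  have ex: "wh [] (xp a) [D, D] \<bullet> wh [U] sD [] = wh [U] sD [] \<bullet> wh [] (xp a) [D, D]"
    using exchange[OF xp_hom[of a] R.s_hom, of "[]" "[]" "[]"] by simp
  have 1: "wh [] (kap a) [D] \<bullet> wh [U] sD [] = G (t \<bullet> wh [] (xp a) [D])"
    unfolding kap_def G_def by (simp add: wh_mul wh_wh mul_assoc ex reassoc[OF cap_t_D])
  have 2: "wh [D] (kap a) [] \<bullet> wh [] t [D] = G (wh [D] (xp a) [] \<bullet> t)"
    unfolding kap_def G_def by (simp add: wh_mul wh_wh mul_assoc)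
  show ?thesis unfolding 1 2 module_hom.diff[OF G, symmetric]
  proof (rule span_map[OF G t_dots])
    fix y assume "y \<in> {wh [D] (xp j) [] \<bullet> c \<bullet> kap b | b j. b < a}"
    then obtain b j where y: "y = wh [D] (xp j) [] \<bullet> c \<bullet> kap b" "b < a" by blast
    have "wh [D] (xp j) [] \<bullet> c \<in> hom [] [D, U]" by (rule mul_hom[OF c_hom wh_homI[OF xp_hom]]) simp_all
    then have "wh [D] d [] \<bullet> wh [] (wh [D] (xp j) [] \<bullet> c) [D] \<in> hom [D] [D]"
      by (intro mul_hom[OF wh_homI wh_homI[OF d_hom]]) simp_all
    moreover have "G y = (wh [D] d [] \<bullet> wh [] (wh [D] (xp j) [] \<bullet> c) [D]) \<bullet> wh [] (kap b) [D]"
      unfolding G_def y(1) by (simp add: wh_mul wh_wh mul_assoc)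
    ultimately show "G y \<in> span {g \<bullet> wh [] (kap b) [D] | g b. g \<in> hom [D] [D] \<and> b < a}"
      using y(2) by (intro span_base) blast
  qed
qed

end

context heisenberg_proj begin

lemma A_lspan: "l \<in> Ix m n \<Longrightarrow> A m n l \<in> lspan (tgt m n l) (Ix m n) (tgt m n) (A m n)"
  using lspan_base1[of "Ix m n" l "A m n" "up m @ vp n" "tgt m n"] finite_Ix A_hom by blast

lemma cross_1: "cross (Suc 0) q = tau q"
  by (simp add: wh_one tau_Nil one_left[OF tau_hom])

text \<open>The upward strand first meets the nearest downward strand, by \<open>T_1_1\<close>; if
  it crosses, it meets the other \<open>n\<close>, by hypothesis. This decomposes \<open>F\<close>.
  The wanted idempotent \<open>G\<close> is a summand of \<open>F\<close>, and the maps for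
  \<open>G\<close> are compared with the components \<open>\<Omega>\<close> of
  \<open>F\<close>.\<close>

lemma T_1_step:
  assumes IH: "T (Suc 0) (Suc n')"
  shows "T (Suc 0) (Suc (Suc n'))"
proof -
  define n where "n = Suc n'"
  define X where "X = U # D # vp n"
  define F where "F = wh [U, D] (f n) []"
  define G where "G = wh [U] (f (Suc n)) []"
  define S where "S = wh [U] sD (vp n')"
  \<comment> \<open>The first entry tells whether the nearest downward strand is capped, the second
    whether another one is. After a cap at the first strand nothing is left to choose, hence the
    singleton \<open>{[]}\<close>.\<close>
  define I where "I = Sigma (Ix (Suc 0) (Suc 0)) (\<lambda>i. if i = [] then Ix (Suc 0) n else {[]})"
  define Y where "Y = (\<lambda>(i :: nat list, j). if i = [] then D # tgt (Suc 0) n j else vp n)"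
  define EE where "EE = (\<lambda>(i :: nat list, j). if i = [] then wh [D] (E (Suc 0) n j) [] else f n)"
  define \<Omega> where "\<Omega> = (\<lambda>(i, j). if i = [] then wh [D] (A (Suc 0) n j) [] \<bullet> wh [] t (vp n) \<bullet> F
     else wh [] (kap (hd i)) (vp n) \<bullet> F)"
  have Fh: "F \<in> hom X X" unfolding F_def X_def by (rule wh_homI[OF f_hom]) simp_all
  have Gh: "G \<in> hom X X" unfolding G_def X_def by (rule wh_homI[OF f_hom]) (simp_all add: n_def)
  have FG: "F \<bullet> G = G" unfolding F_def G_def using f_absorb[of "Suc n" 1 n 0 "[U]" "[]"] by simp
  have GF: "G \<bullet> F = G" unfolding F_def G_def using f_absorb'[of "Suc n" 1 n 0 "[U]" "[]"] by simp
  have FF: "F \<bullet> F = F" unfolding F_def by (rule f_idem)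
  have GG: "G \<bullet> G = G" unfolding G_def by (rule f_idem)
  have kF: "wh [] (kap a) (vp n) \<bullet> F = f n \<bullet> wh [] (kap a) (vp n)" for a
    using exchange[OF kap_hom[of a] f_hom[of n], of "[]" "[]" "[]"] by (simp add: F_def wh_Nil[OF f_hom])
  have tF: "wh [] t (vp n) \<bullet> F = wh [D, U] (f n) [] \<bullet> wh [] t (vp n)"
    using exchange[OF t_hom f_hom[of n], of "[]" "[]" "[]"] by (simp add: F_def)
  have d1: "dec X F (Ix (Suc 0) (Suc 0)) (\<lambda>i. if i = [] then D # U # vp n else vp n)
     (\<lambda>i. if i = [] then wh [D, U] (f n) [] else f n)
     (\<lambda>i. if i = [] then wh [] t (vp n) \<bullet> F else wh [] (kap (hd i)) (vp n) \<bullet> F)"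
  proof (rule dec_cong[OF dec_tensor_right[OF T_1_1[unfolded T_def] f_hom R.proj_idem[OF f]]])
    have EF: "EF (Suc 0) (Suc 0) = one [U, D]" by (simp add: EF_1 f_1 wh_one)
    show "(up (Suc 0) @ vp (Suc 0)) @ vp n = X" by (simp add: X_def)
    show "wh [] (EF (Suc 0) (Suc 0)) (vp n) \<bullet> wh (up (Suc 0) @ vp (Suc 0)) (f n) [] = F"
      using one_left[OF Fh] by (simp add: EF wh_one F_def X_def)
    fix i assume i: "i \<in> Ix (Suc 0) (Suc 0)"
    have A0: "A (Suc 0) (Suc 0) [] = t" by (simp only: A_1_Nil f_1) (simp add: wh_one tau_1 one_right[OF t_hom] del: tau.simps)
    have Aa: "A (Suc 0) (Suc 0) [a] = kap a" for a
      using one_right[OF kap_hom] by (simp add: A_1_single f_1 wh_one wh_Nil[OF kap_hom])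
    have E0: "E (Suc 0) (Suc 0) [] = one [D, U]" by (simp add: E_def FE_q1 f_1 wh_one)
    have Ea: "E (Suc 0) (Suc 0) [a] = one []" for a by (simp add: E_def FE_q0 f_0)
    have o1: "one (D # U # vp n) \<bullet> wh [D, U] (f n) [] = wh [D, U] (f n) []"
      by (rule one_left[OF wh_homI[OF f_hom]]) simp_all
    have o2: "one (vp n) \<bullet> f n = f n" by (rule one_left[OF f_hom])
    show "tgt (Suc 0) (Suc 0) i @ vp n = (if i = [] then D # U # vp n else vp n) \<and>
      wh [] (E (Suc 0) (Suc 0) i) (vp n) \<bullet> wh (tgt (Suc 0) (Suc 0) i) (f n) [] = (if i = [] then wh [D, U] (f n) [] else f n) \<and>
      wh [] (A (Suc 0) (Suc 0) i) (vp n) \<bullet> wh (up (Suc 0) @ vp (Suc 0)) (f n) [] =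
        (if i = [] then wh [] t (vp n) \<bullet> F else wh [] (kap (hd i)) (vp n) \<bullet> F)"
      using i o1 o2 by (auto simp: Ix_1 tgt_def A0 Aa E0 Ea wh_one F_def wh_Nil[OF f_hom])
  qed
  have dl: "dec (D # U # vp n) (wh [D, U] (f n) []) (Ix (Suc 0) n) (\<lambda>j. D # tgt (Suc 0) n j)
     (\<lambda>j. wh [D] (E (Suc 0) n j) []) (\<lambda>j. wh [D] (A (Suc 0) n j) [])"
  proof (rule dec_cong[OF dec_tensor_left[OF IH[folded n_def, unfolded T_def] one_hom[of "[D]"] one_left[OF one_hom]]])
    show "[D] @ up (Suc 0) @ vp n = D # U # vp n" by simp
    show "wh [D] (EF (Suc 0) n) [] \<bullet> wh [] (one [D]) (up (Suc 0) @ vp n) = wh [D, U] (f n) []"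
    proof -
      have "wh [D] (EF (Suc 0) n) [] \<in> hom (D # U # vp n) (D # U # vp n)" by (rule wh_homI[OF EF_hom]) simp_all
      from one_right[OF this] show ?thesis by (simp add: wh_one EF_1 wh_wh)
    qed
    fix j assume j: "j \<in> Ix (Suc 0) n"
    show "[D] @ tgt (Suc 0) n j = D # tgt (Suc 0) n j \<and>
      wh [D] (E (Suc 0) n j) [] \<bullet> wh [] (one [D]) (tgt (Suc 0) n j) = wh [D] (E (Suc 0) n j) [] \<and>
      wh [D] (A (Suc 0) n j) [] \<bullet> wh [] (one [D]) (up (Suc 0) @ vp n) = wh [D] (A (Suc 0) n j) []"
      using one_right[OF wh_hom[OF E_hom[OF j], of "[D]" "[]"]] one_right[OF wh_hom[OF A_hom[OF j], of "[D]" "[]"]]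
      by (simp add: wh_one)
  qed
  have d2: "dec X F I Y EE \<Omega>"
  proof (rule dec_cong[OF dec_comp[OF d1, where J = "\<lambda>i. if i = [] then Ix (Suc 0) n else {[]}"
      and Y' = "\<lambda>i j. if i = [] then D # tgt (Suc 0) n j else vp n"
      and E' = "\<lambda>i j. if i = [] then wh [D] (E (Suc 0) n j) [] else f n"
      and A' = "\<lambda>i j. if i = [] then wh [D] (A (Suc 0) n j) [] else f n"], folded I_def])
    fix i assume "i \<in> Ix (Suc 0) (Suc 0)"
    show "dec (if i = [] then D # U # vp n else vp n) (if i = [] then wh [D, U] (f n) [] else f n)
          (if i = [] then Ix (Suc 0) n else {[]}) (\<lambda>j. if i = [] then D # tgt (Suc 0) n j else vp n)
          (\<lambda>j. if i = [] then wh [D] (E (Suc 0) n j) [] else f n) (\<lambda>j. if i = [] then wh [D] (A (Suc 0) n j) [] else f n)"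
      using dl dec_single[OF f_hom R.proj_idem[OF f], of n "[]"] by (cases "i = []") simp_all
  next
    fix z assume "z \<in> I"
    have "f n \<bullet> wh [] (kap a) (vp n) \<bullet> F = wh [] (kap a) (vp n) \<bullet> F" for a
      using reassoc[OF kF[symmetric], of a F] by (simp add: mul_assoc FF)
    then show "(case z of (i, j) \<Rightarrow> if i = [] then D # tgt (Suc 0) n j else vp n) = Y z \<and>
      (case z of (i, j) \<Rightarrow> if i = [] then wh [D] (E (Suc 0) n j) [] else f n) = EE z \<and>
      (case z of (i, j) \<Rightarrow> (if i = [] then wh [D] (A (Suc 0) n j) [] else f n) \<bullet> (if i = [] then wh [] t (vp n) \<bullet> F else wh [] (kap (hd i)) (vp n) \<bullet> F)) = \<Omega> z"
      by (auto simp: Y_def EE_def \<Omega>_def split: prod.splits)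
  qed simp_all
  have I: "I = insert ([], []) ((\<lambda>a. ([], [a])) ` {..<k} \<union> (\<lambda>a. ([a], [])) ` {..<k})"
    unfolding I_def n_def Ix_1 by auto
  have \<Omega>0: "\<Omega> ([], []) = tau (Suc n) \<bullet> F"
  proof -
    have "wh [D, U] (f n) [] \<bullet> wh [] t (vp n) \<bullet> F = wh [] t (vp n) \<bullet> F"
      using reassoc[OF tF[symmetric], of F] by (simp add: mul_assoc FF)
    then show ?thesis by (simp add: \<Omega>_def A_1_Nil wh_mul wh_wh mul_assoc)
  qed
  have \<Omega>1: "\<Omega> ([], [a]) = wh [D] (kap a) (vp n') \<bullet> wh [] t (vp n) \<bullet> F" for a
  proof -
    have "wh [D, U] (f n) [] \<bullet> wh [] t (vp n) \<bullet> F = wh [] t (vp n) \<bullet> F"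
      using reassoc[OF tF[symmetric], of F] by (simp add: mul_assoc FF)
    then show ?thesis by (simp add: \<Omega>_def A_1_single wh_mul wh_wh mul_assoc n_def)
  qed
  have \<Omega>2: "\<Omega> ([a], []) = wh [] (kap a) (vp n) \<bullet> F" for a by (simp add: \<Omega>_def)
  have A0: "A (Suc 0) (Suc n) [] = tau (Suc n) \<bullet> G" by (simp only: A_1_Nil G_def)
  have A1: "A (Suc 0) (Suc n) [a] = wh [] (kap a) (vp n) \<bullet> G" for a by (simp only: A_1_single G_def)
  have XT: "up (Suc 0) @ vp (Suc n) = X" by (simp add: X_def)
  \<comment> \<open>Crossing the first downward strand and capping the second agrees, up to caps
    with fewer dots, with applying \<open>S\<close> and capping the first. \<open>G\<close> absorbs
    \<open>S\<close> as the scalar \<open>- \<eta>\<close>.\<close>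
  have slide: "wh [] (kap a) (vp n) \<bullet> S - wh [D] (kap a) (vp n') \<bullet> wh [] t (vp n)
     \<in> span {g \<bullet> wh [] (kap b) (vp n) | g b. g \<in> hom (vp n) (vp n) \<and> b < a}" for a
  proof -
    have "wh [] (wh [] (kap a) [D] \<bullet> wh [U] sD [] - wh [D] (kap a) [] \<bullet> wh [] t [D]) (vp n')
       \<in> span {g \<bullet> wh [] (kap b) (vp n) | g b. g \<in> hom (vp n) (vp n) \<and> b < a}"
    proof (rule span_map[OF module_hom_wh kap_sD])
      fix y assume "y \<in> {g \<bullet> wh [] (kap b) [D] | g b. g \<in> hom [D] [D] \<and> b < a}"
      then obtain g b where y: "y = g \<bullet> wh [] (kap b) [D]" "g \<in> hom [D] [D]" "b < a" by blast
      have "wh [] g (vp n') \<in> hom (vp n) (vp n)" by (rule wh_homI[OF y(2)]) (simp_all add: n_def)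
      moreover have "wh [] y (vp n') = wh [] g (vp n') \<bullet> wh [] (kap b) (vp n)"
        by (simp add: y(1) wh_mul wh_wh n_def)
      ultimately show "wh [] y (vp n') \<in> span {g \<bullet> wh [] (kap b) (vp n) | g b. g \<in> hom (vp n) (vp n) \<and> b < a}"
        using y(3) by (intro span_base) blast
    qed
    then show ?thesis by (simp add: wh_diff wh_mul wh_wh S_def n_def)
  qed
  have "T (Suc 0) (Suc n)"
  proof (rule TI, unfold XT)
    let ?L = "\<lambda>Z. lspan Z (Ix (Suc 0) (Suc n)) (tgt (Suc 0) (Suc n)) (A (Suc 0) (Suc n))"
    have LA: "A (Suc 0) (Suc n) l \<in> ?L (tgt (Suc 0) (Suc n) l)" if "l \<in> Ix (Suc 0) (Suc n)" for l
      by (rule A_lspan[OF that])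
    have ka: "wh [] (kap a) (vp n) \<bullet> G \<in> ?L (vp n)" if "a < k" for a
      using LA[of "[a]"] that by (simp add: Ix_1 A1 tgt_def)
    have gk: "y \<bullet> G \<in> ?L (vp n)" if "y \<in> span {g \<bullet> wh [] (kap b) (vp n) | g b. g \<in> hom (vp n) (vp n) \<and> b < a}" "a < k" for y a
    proof (rule lspan_span)
      show "y \<bullet> G \<in> span {(g \<bullet> wh [] (kap b) (vp n)) \<bullet> G | g b. g \<in> hom (vp n) (vp n) \<and> b < a}"
        by (rule span_map[OF module_hom_mul_left that(1)]) (auto intro: span_base)
      fix x assume "x \<in> {(g \<bullet> wh [] (kap b) (vp n)) \<bullet> G | g b. g \<in> hom (vp n) (vp n) \<and> b < a}"
      then show "x \<in> ?L (vp n)" using that(2) by (auto simp: mul_assoc intro!: lspan_mul[OF ka])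
    qed
    have SG: "S \<bullet> G = - \<eta> *s G"
      using R.proj_labs[OF f, of "Suc n" "[U]" "[]", unfolded labs_def, rule_format, of 0 n']
      by (simp add: S_def G_def n_def)
    have "F \<bullet> G \<in> ?L X"
    proof (rule lspan_trans[OF dec_mono[OF d2]])
      fix z assume "z \<in> I"
      then consider "z = ([], [])" | a where "z = ([], [a])" "a < k" | a where "z = ([a], [])" "a < k"
        unfolding I by auto
      then show "\<Omega> z \<bullet> G \<in> ?L (Y z)"
      proof cases
        case 1
        then show ?thesis using LA[of "[]"] by (simp add: Ix_1 A0 \<Omega>0 mul_assoc FG Y_def tgt_def del: tau.simps)
      next
        case (2 a)
        have "wh [] (kap a) (vp n) \<bullet> S \<bullet> G - (wh [] (kap a) (vp n) \<bullet> S - wh [D] (kap a) (vp n') \<bullet> wh [] t (vp n)) \<bullet> G \<in> ?L (vp n)"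
        proof (intro lspan_diff gk[OF slide])
          show "wh [] (kap a) (vp n) \<bullet> S \<bullet> G \<in> ?L (vp n)"
            unfolding SG mul_scale_right by (rule lspan_scale[OF ka[OF 2(2)]])
        qed (use 2 in auto)
        then show ?thesis using 2 by (simp add: \<Omega>1 Y_def tgt_def mul_assoc FG distribs n_def)
      next
        case (3 a)
        then show ?thesis using ka[of a] by (simp add: \<Omega>2 Y_def mul_assoc FG)
      qed
    qed
    then show "EF (Suc 0) (Suc n) \<in> ?L X" unfolding FG EF_1 G_def[symmetric] .
  next
    obtain B where B: "finite I" "\<And>i. i \<in> I \<Longrightarrow> \<Omega> i \<in> hom X (Y i)" "\<And>i. i \<in> I \<Longrightarrow> \<Omega> i \<bullet> F = \<Omega> i"
      "\<And>i. i \<in> I \<Longrightarrow> EE i \<bullet> \<Omega> i = \<Omega> i" "\<And>i. i \<in> I \<Longrightarrow> B i \<in> hom (Y i) X" "\<And>i. i \<in> I \<Longrightarrow> F \<bullet> B i = B i"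
      "\<And>i. i \<in> I \<Longrightarrow> B i \<bullet> EE i = B i" "\<And>i j. i \<in> I \<Longrightarrow> j \<in> I \<Longrightarrow> \<Omega> i \<bullet> B j = (if i = j then EE i else 0)"
      "(\<Sum>i\<in>I. B i \<bullet> \<Omega> i) = F" by (rule decE[OF d2], rule that) blast+
    \<comment> \<open>The components that cap the nearest downward strand. All preimages are built
      from some \<open>B ([], _)\<close>, which every component in \<open>?J\<close>
      annihilates.\<close>
    let ?J = "(\<lambda>a. ([a], [] :: nat list)) ` {..<k}"
    let ?N = "of_nat (n + 1) :: 'a"
    have N0: "?N \<noteq> 0" by (metis of_nat_eq_0_iff Suc_eq_plus1 nat.distinct(1))
    have n0: "(of_nat n :: 'a) \<noteq> 0" by (simp add: n_def del: of_nat_Suc)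
    \<comment> \<open>Of the two double cosets, the one without \<open>S\<close> contributes to the
      dotted caps only terms in \<open>?J\<close>. The other one, by \<open>slide\<close>, leads to
      \<open>\<Omega> ([], [a])\<close>.\<close>
    have Gexp: "?N *s G = F + (of_nat n * - \<eta>) *s (F \<bullet> S \<bullet> F)"
      using arg_cong[OF R.proj_Suc_left[OF f, of n'], of "\<lambda>y. wh [U] y []"]
      by (simp add: wh_scale wh_add wh_diff wh_mul wh_wh G_def F_def S_def n_def)
    have \<Omega>J: "g \<bullet> wh [] (kap b) (vp n) \<bullet> F \<in> lspan Z ?J Y \<Omega>" if "g \<in> hom (vp n) Z" "b < k" for g b Z
      using lspan_base[of ?J "([b], [])" g Y Z \<Omega>] that by (simp add: \<Omega>2 Y_def)
    have R: "?N *s A (Suc 0) (Suc n) [a] - (of_nat n * - \<eta>) *s (f n \<bullet> \<Omega> ([], [a])) \<in> lspan (vp n) ?J Y \<Omega>" if a: "a < k" for a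
    proof -
      have "?N *s A (Suc 0) (Suc n) [a] = wh [] (kap a) (vp n) \<bullet> (?N *s G)" by (simp add: A1 mul_scale_right)
      also have "\<dots> = wh [] (kap a) (vp n) \<bullet> F + (of_nat n * - \<eta>) *s (f n \<bullet> wh [] (kap a) (vp n) \<bullet> S \<bullet> F)"
        unfolding Gexp by (simp add: distribs reassoc[OF kF] mul_assoc)
      finally have "?N *s A (Suc 0) (Suc n) [a] - (of_nat n * - \<eta>) *s (f n \<bullet> \<Omega> ([], [a]))
        = one (vp n) \<bullet> wh [] (kap a) (vp n) \<bullet> F + (of_nat n * - \<eta>) *s (f n \<bullet> ((wh [] (kap a) (vp n) \<bullet> S - wh [D] (kap a) (vp n') \<bullet> wh [] t (vp n)) \<bullet> F))"
        by (simp add: \<Omega>1 distribs mul_assoc kF one_left[OF mul_hom[OF _ f_hom]] reassoc[OF one_left[OF f_hom]])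
      also have "\<dots> \<in> lspan (vp n) ?J Y \<Omega>"
      proof (intro lspan_add lspan_scale lspan_mul[OF _ f_hom] \<Omega>J[OF one_hom a])
        show "(wh [] (kap a) (vp n) \<bullet> S - wh [D] (kap a) (vp n') \<bullet> wh [] t (vp n)) \<bullet> F \<in> lspan (vp n) ?J Y \<Omega>"
        proof (rule lspan_span)
          show "(wh [] (kap a) (vp n) \<bullet> S - wh [D] (kap a) (vp n') \<bullet> wh [] t (vp n)) \<bullet> F \<in> span {(g \<bullet> wh [] (kap b) (vp n)) \<bullet> F | g b. g \<in> hom (vp n) (vp n) \<and> b < a}"
            by (rule span_map[OF module_hom_mul_left slide]) (auto intro: span_base)
          fix x assume "x \<in> {(g \<bullet> wh [] (kap b) (vp n)) \<bullet> F | g b. g \<in> hom (vp n) (vp n) \<and> b < a}"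
          then show "x \<in> lspan (vp n) ?J Y \<Omega>" using a by (auto simp: mul_assoc intro!: \<Omega>J)
        qed
      qed
      finally show ?thesis .
    qed
    have AJ: "A (Suc 0) (Suc n) [a] \<bullet> C = (1 / ?N) *s (of_nat n * - \<eta>) *s (f n \<bullet> \<Omega> ([], [a]) \<bullet> C)"
      if "a < k" and C: "\<And>z. z \<in> ?J \<Longrightarrow> \<Omega> z \<bullet> C = 0" for a C
    proof -
      have "(?N *s A (Suc 0) (Suc n) [a] - (of_nat n * - \<eta>) *s (f n \<bullet> \<Omega> ([], [a]))) \<bullet> C = 0"
        by (rule lspan_kill[OF R[OF that(1)] C])
      then have "?N *s (A (Suc 0) (Suc n) [a] \<bullet> C) = (of_nat n * - \<eta>) *s (f n \<bullet> \<Omega> ([], [a]) \<bullet> C)"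
        by (simp only: mul_diff_left mul_scale_left mul_assoc right_minus_eq)
      from arg_cong[OF this, of "\<lambda>y. (1 / ?N) *s y"] show ?thesis using N0 by simp
    qed
    have AG: "A (Suc 0) (Suc n) l \<bullet> G = A (Suc 0) (Suc n) l" if "l \<in> Ix (Suc 0) (Suc n)" for l
      using A_EF[OF that] by (simp add: EF_1 G_def)
    have A0\<Omega>: "A (Suc 0) (Suc n) [] = wh [] (f (Suc n)) [U] \<bullet> \<Omega> ([], [])"
    proof -
      have "tau (Suc n) \<bullet> G = wh [] (f (Suc n)) [U] \<bullet> tau (Suc n)"
        using cross_EF[of "Suc 0" "Suc n"] unfolding cross_1 EF_1 FE_q1 G_def .
      from reassoc[OF this, of F] show ?thesis by (simp add: A0 \<Omega>0 mul_assoc GF del: tau.simps)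
    qed
    have fU: "wh [] (f (Suc n)) [U] \<in> hom (vp (Suc n) @ [U]) (vp (Suc n) @ [U])" by (rule wh_homI[OF f_hom]) simp_all
    have tgt0: "tgt (Suc 0) (Suc n) [] = vp (Suc n) @ [U]" and tgt1: "tgt (Suc 0) (Suc n) [a] = vp n" for a
      by (simp_all add: tgt_def)
    have Ein: "E (Suc 0) (Suc n) [] = wh [] (f (Suc n)) [U]" "E (Suc 0) (Suc n) [a] = f n" for a
      by (simp_all add: E_def FE_q1 FE_q0)
    have EE0: "EE ([], []) = wh [D] (f n) [U]" and EE1: "EE ([], [a]) = wh [D] (f n') []" for a
      by (simp_all add: EE_def E_def FE_q1 FE_q0 wh_wh n_def)
    fix j assume j: "j \<in> Ix (Suc 0) (Suc n)"
    then consider "j = []" | a where "j = [a]" "a < k" by (auto simp: Ix_1)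
    then show "\<exists>B\<in>hom (tgt (Suc 0) (Suc n) j) X. \<forall>i\<in>Ix (Suc 0) (Suc n). A (Suc 0) (Suc n) i \<bullet> B = (if i = j then E (Suc 0) (Suc n) i else 0)"
    proof cases
      case 1
      have z: "([], []) \<in> I" by (simp add: I)
      have B0: "B ([], []) \<in> hom (vp (Suc n) @ [U]) X" using B(5)[OF z] by (simp add: Y_def tgt_def)
      show ?thesis
      proof (intro bexI[of _ "B ([], []) \<bullet> wh [] (f (Suc n)) [U]"] ballI)
        show "B ([], []) \<bullet> wh [] (f (Suc n)) [U] \<in> hom (tgt (Suc 0) (Suc n) j) X"
          unfolding 1 tgt0 by (rule mul_hom[OF fU B0])
        fix i assume "i \<in> Ix (Suc 0) (Suc n)"
        then consider "i = []" | a where "i = [a]" "a < k" by (auto simp: Ix_1)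
        then show "A (Suc 0) (Suc n) i \<bullet> B ([], []) \<bullet> wh [] (f (Suc n)) [U] = (if i = j then E (Suc 0) (Suc n) i else 0)"
        proof cases
          assume i: "i = []"
          have "wh [] (f (Suc n)) [U] \<bullet> wh [D] (f n) [U] \<bullet> wh [] (f (Suc n)) [U] = wh [] (f (Suc n)) [U]"
            using f_absorb[of "Suc n" 1 n 0 "[]" "[U]"] f_idem[of "[]" "Suc n" "[U]"] by simp
          moreover have "A (Suc 0) (Suc n) i \<bullet> B ([], []) \<bullet> wh [] (f (Suc n)) [U]
             = wh [] (f (Suc n)) [U] \<bullet> (\<Omega> ([], []) \<bullet> B ([], [])) \<bullet> wh [] (f (Suc n)) [U]"
            unfolding i A0\<Omega> by (simp only: mul_assoc)
          moreover have "\<Omega> ([], []) \<bullet> B ([], []) = wh [D] (f n) [U]" using B(8)[OF z z] by (simp add: EE0)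
          ultimately show ?thesis using 1 i by (simp only: Ein if_True simp_thms)
        next
          fix a assume a: "i = [a]" "a < k"
          have "\<Omega> w \<bullet> B ([], []) = 0" if "w \<in> ?J \<or> w = ([], [a])" for w
            using B(8)[of w "([], [])"] z that a by (auto simp: I)
          then have "A (Suc 0) (Suc n) [a] \<bullet> B ([], []) = 0" using AJ[OF a(2), of "B ([], [])"] by simp
          from reassoc[OF this] show ?thesis using a 1 by simp
        qed
      qed
    next
      case (2 a)
      \<comment> \<open>The inverse of the factor \<open>n * - \<eta> / (n + 1)\<close> that the
        double coset expansion puts in front of \<open>\<Omega> ([], [a])\<close>; here
        \<open>n\<close> is positive and \<open>\<eta> * \<eta> = 1\<close>.\<close>
      let ?c = "?N * (1 / of_nat n) * - \<eta>"
      have z: "([], [a]) \<in> I" using 2 by (simp add: I)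
      have B0: "B ([], [a]) \<in> hom (vp n) X" using B(5)[OF z] by (simp add: Y_def tgt_def n_def)
      show ?thesis
      proof (intro bexI[of _ "?c *s (B ([], [a]) \<bullet> f n)"] ballI)
        show "?c *s (B ([], [a]) \<bullet> f n) \<in> hom (tgt (Suc 0) (Suc n) j) X"
          unfolding 2 tgt1 by (rule scale_hom[OF mul_hom[OF f_hom B0]])
        fix i assume "i \<in> Ix (Suc 0) (Suc n)"
        then consider "i = []" | b where "i = [b]" "b < k" by (auto simp: Ix_1)
        then show "A (Suc 0) (Suc n) i \<bullet> ?c *s (B ([], [a]) \<bullet> f n) = (if i = j then E (Suc 0) (Suc n) i else 0)"
        proof cases
          assume i: "i = []"
          have "\<Omega> ([], []) \<bullet> B ([], [a]) = 0" using B(8)[of "([], [])" "([], [a])"] z by (auto simp: I)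
          from reassoc[OF this, of "f n"] have "A (Suc 0) (Suc n) i \<bullet> B ([], [a]) \<bullet> f n = 0"
            unfolding i A0\<Omega> by (simp add: mul_assoc)
          then show ?thesis unfolding mul_scale_right using 2 i by simp
        next
          fix b assume b: "i = [b]" "b < k"
          have "\<Omega> w \<bullet> B ([], [a]) \<bullet> f n = 0" if "w \<in> ?J" for w
          proof -
            have "\<Omega> w \<bullet> B ([], [a]) = 0" using B(8)[of w "([], [a])"] z that by (auto simp: I)
            from reassoc[OF this] show ?thesis by simp
          qed
          from AJ[OF b(2) this] 
          have "A (Suc 0) (Suc n) i \<bullet> B ([], [a]) \<bullet> f n = (1 / ?N) *s (of_nat n * - \<eta>) *s (f n \<bullet> (\<Omega> ([], [b]) \<bullet> B ([], [a])) \<bullet> f n)"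
            by (simp add: b mul_assoc)
          also have "\<Omega> ([], [b]) \<bullet> B ([], [a]) = (if a = b then EE ([], [a]) else 0)"
            using B(8)[of "([], [b])" "([], [a])"] z b by (auto simp: I)
          also have "f n \<bullet> (if a = b then EE ([], [a]) else 0) \<bullet> f n = (if a = b then f n else 0)"
            using f_absorb[of n 1 n' 0 "[]" "[]"] R.proj_idem[OF f, of n] by (auto simp: EE1 n_def wh_Nil[OF f_hom])
          finally have *: "A (Suc 0) (Suc n) i \<bullet> B ([], [a]) \<bullet> f n = (1 / ?N) *s (of_nat n * - \<eta>) *s (if a = b then f n else 0)" .
          have "N * (1 / m) * - h * (1 / N * (m * - h)) = h * h" if "N \<noteq> 0" "m \<noteq> 0" for N m h :: 'a
            using that by (simp add: field_simps)
          from this[OF N0 n0, of \<eta>] have c: "?c * (1 / ?N * (of_nat n * - \<eta>)) = 1"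
            using L.char_sq by (simp only:)
          show ?thesis unfolding mul_scale_right * scale_scale c scale_one using b 2 by (auto simp: Ein)
        qed
      qed
    qed
  qed
  then show ?thesis by (simp add: n_def)
qed

lemma T_1: "T (Suc 0) n"
proof (induction n rule: less_induct)
  case (less n)
  consider "n = 0" | "n = Suc 0" | n' where "n = Suc (Suc n')" by (cases n; cases "n - 1") auto
  then show ?case using T_m_0 T_1_1 T_1_step less by cases auto
qed

end

section \<open>Solving a triangular system of preimages\<close>

context word_category begin

text \<open>Back substitution starting from the largest \<open>\<mu>\<close>. \<open>C\<close> has
  the right value at \<open>j\<close> and errors only at indices of larger \<open>\<mu>\<close>,
  whose exact preimages are already known and can be subtracted.\<close>

lemma triangular_epi:
  fixes \<mu> :: "'i \<Rightarrow> nat"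
  assumes fin: "finite I" and A: "\<And>i. i \<in> I \<Longrightarrow> A i \<in> hom X (Y i)" and EA: "\<And>i. i \<in> I \<Longrightarrow> E i \<bullet> A i = A i"
    and C: "\<And>j. j \<in> I \<Longrightarrow> \<exists>C\<in>hom (Y j) X. A j \<bullet> C = E j \<and> (\<forall>i\<in>I. i \<noteq> j \<longrightarrow> \<mu> i \<le> \<mu> j \<longrightarrow> A i \<bullet> C = 0)"
    and j: "j \<in> I"
  shows "\<exists>B\<in>hom (Y j) X. \<forall>i\<in>I. A i \<bullet> B = (if i = j then E i else 0)"
  using j
proof (induction "Max (\<mu> ` I) - \<mu> j" arbitrary: j rule: less_induct)
  case less
  let ?K = "{i \<in> I. \<mu> j < \<mu> i}"
  have finK: "finite ?K" using fin by simp
  have "\<forall>i\<in>?K. \<exists>B. B \<in> hom (Y i) X \<and> (\<forall>i'\<in>I. A i' \<bullet> B = (if i' = i then E i' else 0))"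
  proof
    fix i assume i: "i \<in> ?K"
    have "\<mu> i \<le> Max (\<mu> ` I)" using fin i by (intro Max_ge) auto
    then have "Max (\<mu> ` I) - \<mu> i < Max (\<mu> ` I) - \<mu> j" using i by auto
    from less.hyps[OF this] i show "\<exists>B. B \<in> hom (Y i) X \<and> (\<forall>i'\<in>I. A i' \<bullet> B = (if i' = i then E i' else 0))" by blast
  qed
  from bchoice[OF this] obtain B where B: "\<And>i. i \<in> ?K \<Longrightarrow> B i \<in> hom (Y i) X"
    "\<And>i i'. i \<in> ?K \<Longrightarrow> i' \<in> I \<Longrightarrow> A i' \<bullet> B i = (if i' = i then E i' else 0)" by blast
  obtain C where C: "C \<in> hom (Y j) X" "A j \<bullet> C = E j" "\<And>i. i \<in> I \<Longrightarrow> i \<noteq> j \<Longrightarrow> \<mu> i \<le> \<mu> j \<Longrightarrow> A i \<bullet> C = 0"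
    using assms(4)[OF less.prems] by blast
  show ?case
  proof (intro bexI[of _ "C - (\<Sum>i\<in>?K. B i \<bullet> A i \<bullet> C)"] ballI)
    have "B i \<bullet> A i \<bullet> C \<in> hom (Y j) X" if "i \<in> ?K" for i
      by (rule mul_hom[OF mul_hom[OF C(1) A] B(1)[OF that]]) (use that in simp)
    then show "C - (\<Sum>i\<in>?K. B i \<bullet> A i \<bullet> C) \<in> hom (Y j) X" by (intro diff_hom C(1) sum_hom)
    fix i assume i: "i \<in> I"
    have "(\<Sum>i'\<in>?K. A i \<bullet> B i' \<bullet> A i' \<bullet> C) = (\<Sum>i'\<in>?K. if i' = i then A i \<bullet> C else 0)"
    proof (rule sum.cong[OF HOL.refl])
      fix i' assume i': "i' \<in> ?K"
      have "A i \<bullet> B i' \<bullet> A i' \<bullet> C = (if i = i' then E i else 0) \<bullet> A i' \<bullet> C"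
        by (rule reassoc[OF B(2)[OF i' i]])
      also have "\<dots> = (if i' = i then A i \<bullet> C else 0)" using EA[OF i] by (auto simp flip: mul_assoc)
      finally show "A i \<bullet> B i' \<bullet> A i' \<bullet> C = (if i' = i then A i \<bullet> C else 0)" .
    qed
    then have "A i \<bullet> (C - (\<Sum>i\<in>?K. B i \<bullet> A i \<bullet> C)) = A i \<bullet> C - (if i \<in> ?K then A i \<bullet> C else 0)"
      using finK by (simp add: mul_diff_right mul_sum_right)
    then show "A i \<bullet> (C - (\<Sum>i\<in>?K. B i \<bullet> A i \<bullet> C)) = (if i = j then E i else 0)"
      using i C(2) C(3)[OF i] by auto
  qed
qed

end

section \<open>Dotted caps on partially symmetrized strands\<close>

context heisenberg_proj begin

text \<open>All downward strands are antisymmetrized but only the first \<open>M\<close> upward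
  strands are symmetrized. The induction step needs \<open>M = m\<close> and also
  \<open>M = m - 1\<close>, for the idempotent to which the new strand has not yet been
  joined.\<close>

definition good where "good M m n \<xi> \<longleftrightarrow> M \<le> m \<and> (\<exists>Z. \<xi> \<in> hom Z (up m @ vp n)) \<and>
   labs U sU \<eta> M [] (up (m - M) @ vp n) \<xi> \<and> labs D sD (- \<eta>) n (up m) [] \<xi>"

lemma good_polU: "good M m n \<xi> \<Longrightarrow> pol U sU \<eta> r w \<kappa> \<Longrightarrow> a + r \<le> M \<Longrightarrow> b = m - (a + r) \<Longrightarrow>
   wh (up a) w (up b @ vp n) \<bullet> \<xi> = \<kappa> *s \<xi>"
proof -
  assume g: "good M m n \<xi>" and w: "pol U sU \<eta> r w \<kappa>" and a: "a + r \<le> M" "b = m - (a + r)"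
  have "labs U sU \<eta> r ([] @ up a) (up (M - (a + r)) @ up (m - M) @ vp n) \<xi>"
    by (rule L.labs_sub[of M]) (use g a in \<open>auto simp: good_def\<close>)
  moreover have "M - (a + r) + (m - M) = b" using g a by (auto simp: good_def)
  ultimately have l: "labs U sU \<eta> r (up a) (up b @ vp n) \<xi>" by simp
  obtain Z where "\<xi> \<in> hom Z (up m @ vp n)" using g by (auto simp: good_def)
  moreover have "up m @ vp n = up a @ up r @ up b @ vp n" using g a by (auto simp: good_def)
  ultimately show ?thesis using L.pol_labs[OF w l, of Z] by simp
qed

lemma good_polD: "good M m n \<xi> \<Longrightarrow> pol D sD (- \<eta>) r w \<kappa> \<Longrightarrow> n = a + r + b \<Longrightarrow>
   wh (up m @ vp a) w (vp b) \<bullet> \<xi> = \<kappa> *s \<xi>"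
proof -
  assume g: "good M m n \<xi>" and w: "pol D sD (- \<eta>) r w \<kappa>" and n: "n = a + r + b"
  have l: "labs D sD (- \<eta>) r (up m @ vp a) (vp b @ []) \<xi>"
    by (rule R.labs_sub[OF _ n]) (use g in \<open>auto simp: good_def\<close>)
  obtain Z where "\<xi> \<in> hom Z (up m @ vp n)" using g by (auto simp: good_def)
  then show ?thesis using R.pol_labs[OF w l, of Z] n by (simp add: add.assoc)
qed

lemma good_e: "good M m n \<xi> \<Longrightarrow> p \<le> M \<Longrightarrow> wh [] (e p) (up (m - p) @ vp n) \<bullet> \<xi> = \<xi>"
  using good_polU[of M m n \<xi> p "e p" 1 0 "m - p"] e[of p] by (simp add: proj_def)

lemma good_f: "good M m n \<xi> \<Longrightarrow> n = a + q \<Longrightarrow> wh (up m @ vp a) (f q) [] \<bullet> \<xi> = \<xi>"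
  using good_polD[of M m n \<xi> q "f q" 1 a 0] f[of q] by (simp add: proj_def)

text \<open>On \<open>\<xi>\<close> the upward crossing of \<open>cap_swap\<close> becomes
  \<open>\<eta>\<close> and the downward one \<open>- \<eta>\<close>, so the difference there
  becomes a sum here: the caps alternate. The bound on \<open>M\<close> puts both upward strands of
  the exchanged caps among the symmetrized ones.\<close>

lemma Ap_swap:
  assumes g: "good M (p + r) (r + q) \<xi>" and r: "r = Suc (Suc (length u + length v))"
    and M: "p + length u + 2 \<le> M"
  shows "Ap p q (u @ [\<alpha>, \<beta>] @ v) \<bullet> \<xi> + Ap p q (u @ [\<beta>, \<alpha>] @ v) \<bullet> \<xi>
    \<in> span {Ap p q (u @ [i, j] @ v) \<bullet> \<xi> | i j. i + j < \<alpha> + \<beta> \<and> i < max \<alpha> \<beta> \<and> j < max \<alpha> \<beta>}" (is "_ \<in> span ?S")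
proof -
  define a where "a = length u"
  define b where "b = length v"
  define F where "F y = cross p q \<bullet> wh (up p) y (vp q) \<bullet> \<xi>" for y
  have F: "module_hom scale scale F" unfolding F_def
    by (intro module_hom_comp[OF module_hom_mul_right]
      module_hom_comp[of "\<lambda>y. y \<bullet> \<xi>", OF module_hom_mul_left] module_hom_wh)
  have Fcap: "F (cap l) = Ap p q l \<bullet> \<xi>" for l by (simp add: F_def Ap_def mul_assoc)
  have sU: "wh (up (p + a)) sU (up b @ vp (r + q)) \<bullet> \<xi> = \<eta> *s \<xi>"
  proof -
    have "wh (up (p + a)) (wh (up 0) sU (up 0)) (up b @ vp (r + q)) \<bullet> \<xi> = \<eta> *s \<xi>"
      by (rule good_polU[OF g L.pol_s[of 2 0 0]]) (use M r in \<open>auto simp: a_def b_def\<close>)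
    then show ?thesis by (simp add: wh_wh)
  qed
  have sD: "wh (up (p + r) @ vp b) sD (vp (a + q)) \<bullet> \<xi> = - \<eta> *s \<xi>"
  proof -
    have "wh (up (p + r) @ vp b) (wh (vp 0) sD (vp 0)) (vp (a + q)) \<bullet> \<xi> = - \<eta> *s \<xi>"
      by (rule good_polD[OF g R.pol_s[of 2 0 0]]) (use M r in \<open>auto simp: a_def b_def\<close>)
    then show ?thesis by (simp add: wh_wh)
  qed
  have FU: "F (y \<bullet> wh (up a) sU (up b @ vp (Suc (Suc (a + b))))) = \<eta> *s F y" for y
    using sU r by (simp add: F_def wh_mul wh_wh mul_assoc a_def b_def mul_scale_right)
  have FD: "F (y \<bullet> wh (up (Suc (Suc (a + b))) @ vp b) sD (vp a)) = (- \<eta>) *s F y" for y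
    using sD r by (simp add: F_def wh_mul wh_wh mul_assoc a_def b_def mul_scale_right mul_minus_right)
  have "F (cap (u @ [\<alpha>, \<beta>] @ v) \<bullet> wh (up a) sU (up b @ vp (Suc (Suc (a + b))))
     - cap (u @ [\<beta>, \<alpha>] @ v) \<bullet> wh (up (Suc (Suc (a + b))) @ vp b) sD (vp a)) \<in> span ?S"
    unfolding a_def b_def
  proof (rule span_map[OF F cap_swap])
    fix y assume "y \<in> {cap (u @ [i, j] @ v) | i j. i + j < \<alpha> + \<beta> \<and> i < max \<alpha> \<beta> \<and> j < max \<alpha> \<beta>}"
    then obtain i j where y: "y = cap (u @ [i, j] @ v)" "i + j < \<alpha> + \<beta> \<and> i < max \<alpha> \<beta> \<and> j < max \<alpha> \<beta>" by blast
    show "F y \<in> span ?S" unfolding y(1) Fcap using y(2) by (intro span_base) blast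
  qed
  then have "\<eta> *s F (cap (u @ [\<alpha>, \<beta>] @ v)) - (- \<eta>) *s F (cap (u @ [\<beta>, \<alpha>] @ v)) \<in> span ?S"
    unfolding module_hom.diff[OF F] FU FD .
  from span_scale[OF this, of \<eta>] show ?thesis
    by (simp add: scale_right_diff_distrib scale_right_distrib L.char_sq Fcap del: cap.simps)
qed

text \<open>Only the outer caps \<open>b\<close> are sorted, because the upward strands of
  \<open>v\<close> may lie beyond \<open>M\<close>. In the induction step \<open>v\<close> is empty
  or the single cap on the new strand.\<close>

lemma Ap_sort:
  assumes g: "good M (p + r) (r + q) \<xi>" and r: "r = length b + length v" and M: "p + length b \<le> M" and b: "set b \<subseteq> {..<k}"
  shows "Ap p q (b @ v) \<bullet> \<xi> \<in> span {Ap p q (l @ v) \<bullet> \<xi> | l. length l = length b \<and> sorted_wrt (>) l \<and>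
     set l \<subseteq> {..<k} \<and> sum_list l \<le> sum_list b}"
proof (rule sort_span[where r = "length b" and \<Phi> = "\<lambda>b. Ap p q (b @ v) \<bullet> \<xi>", OF _ HOL.refl b])
  fix u v' :: "nat list" and \<alpha> \<beta> assume "Suc (Suc (length u + length v')) = length b"
  then show "Ap p q ((u @ [\<alpha>, \<beta>] @ v') @ v) \<bullet> \<xi> + Ap p q ((u @ [\<beta>, \<alpha>] @ v') @ v) \<bullet> \<xi>
     \<in> span {Ap p q ((u @ [i, j] @ v') @ v) \<bullet> \<xi> | i j. i + j < \<alpha> + \<beta> \<and> i < max \<alpha> \<beta> \<and> j < max \<alpha> \<beta>}"
    using Ap_swap[OF g, of u "v' @ v" \<alpha> \<beta>] r M by simp
qed

text \<open>In contrast to sorting, this works when the new strand is not symmetrized: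
  \<open>cap_cycle\<close> shifts the crossings to the downward strands, where they act by the
  scalar \<open>\<kappa>\<close>.\<close>

lemma Ap_cycle:
  assumes g: "good M (p + r) (r + q) \<xi>" and r: "r = Suc (length u + length v)" and b: "set (u @ \<alpha> # v) \<subseteq> {..<k}"
  shows "\<exists>\<kappa>. Ap p q (u @ \<alpha> # v) \<bullet> wh (up (p + length u)) (L.crossings (length v)) (vp (r + q)) \<bullet> \<xi>
    - \<kappa> *s (Ap p q (u @ v @ [\<alpha>]) \<bullet> \<xi>) \<in> span {Ap p q b \<bullet> \<xi> | b. length b = r \<and> set b \<subseteq> {..<k} \<and> sum_list b < sum_list (u @ \<alpha> # v)}"
    (is "\<exists>\<kappa>. _ \<in> span ?S")
proof -
  define F where "F y = cross p q \<bullet> wh (up p) y (vp q) \<bullet> \<xi>" for y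
  have F: "module_hom scale scale F" unfolding F_def
    by (intro module_hom_comp[OF module_hom_mul_right]
      module_hom_comp[of "\<lambda>y. y \<bullet> \<xi>", OF module_hom_mul_left] module_hom_wh)
  have W: "\<exists>\<kappa>. \<forall>l. F (cap l \<bullet> wh (up r) w []) = \<kappa> *s (Ap p q l \<bullet> \<xi>)" if wd: "WD r w" for w
  proof -
    obtain c0 where "pol D sD (- \<eta>) r w c0" using wd by blast
    from good_polD[OF g this, of 0 q] have "wh (up (p + r)) w (vp q) \<bullet> \<xi> = c0 *s \<xi>" by simp
    then have "F (cap l \<bullet> wh (up r) w []) = c0 *s (Ap p q l \<bullet> \<xi>)" for l
      by (simp add: F_def Ap_def wh_mul wh_wh mul_assoc mul_scale_right)
    then show ?thesis by blast
  qed
  obtain w where w: "WD r w" "cap (u @ \<alpha> # v) \<bullet> wh (up (length u)) (L.crossings (length v)) (vp r)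
      - cap (u @ v @ [\<alpha>]) \<bullet> wh (up r) w [] \<in> capspan r (sum_list (u @ \<alpha> # v)) k"
    using cap_cycle[OF b r] by blast
  obtain \<kappa> where \<kappa>: "\<And>l. F (cap l \<bullet> wh (up r) w []) = \<kappa> *s (Ap p q l \<bullet> \<xi>)" using W[OF w(1)] by blast
  have "F (cap (u @ \<alpha> # v) \<bullet> wh (up (length u)) (L.crossings (length v)) (vp r)
      - cap (u @ v @ [\<alpha>]) \<bullet> wh (up r) w []) \<in> span ?S"
  proof (rule span_map[OF F w(2)[unfolded capspan_def]])
    fix y assume "y \<in> {cap b \<bullet> wh (up r) w [] | b w. length b = r \<and> set b \<subseteq> {..<k} \<and> sum_list b < sum_list (u @ \<alpha> # v) \<and> WD r w}"
    then obtain b w' where y: "y = cap b \<bullet> wh (up r) w' []" "length b = r" "set b \<subseteq> {..<k}" "sum_list b < sum_list (u @ \<alpha> # v)" "WD r w'" by blast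
    obtain c' where "F y = c' *s (Ap p q b \<bullet> \<xi>)" using W[OF y(5)] y(1) by blast
    moreover have "Ap p q b \<bullet> \<xi> \<in> span ?S" using y by (intro span_base) blast
    ultimately show "F y \<in> span ?S" by (simp add: span_scale)
  qed
  then show ?thesis unfolding module_hom.diff[OF F] \<kappa>
    by (intro exI[of _ \<kappa>]) (simp add: F_def Ap_def wh_mul wh_wh mul_assoc)
qed

lemma Ap_append:
  assumes "P = p + length l" "Q = q + length l"
  shows "Ap p q l \<bullet> wh (up P) (cap b) (vp Q) = Ap p q (l @ b)"
  using assms by (simp add: Ap_def cap_append wh_mul wh_wh mul_assoc add.commute)

lemma EF_cap:
  assumes g: "good M (P + r) (r + Q) \<xi>" and r: "r = length b" and P: "P \<le> M"
  shows "EF P Q \<bullet> wh (up P) (cap b) (vp Q) \<bullet> \<xi> = wh (up P) (cap b) (vp Q) \<bullet> \<xi>"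
proof -
  have 1: "wh [] (e P) (vp Q) \<bullet> wh (up P) (cap b) (vp Q) = wh (up P) (cap b) (vp Q) \<bullet> wh [] (e P) (up r @ vp (r + Q))"
    using exchange[OF e_hom[of P] cap_hom[of b], of "[]" "[]" "vp Q"] r by simp
  have 2: "wh (up P) (f Q) [] \<bullet> wh (up P) (cap b) (vp Q) = wh (up P) (cap b) (vp Q) \<bullet> wh (up (P + r) @ vp r) (f Q) []"
    using exchange[OF cap_hom[of b] f_hom[of Q], of "up P" "[]" "[]"] r by simp
  show ?thesis
    unfolding EF_def using good_e[OF g P] good_f[OF g, of r Q]
    by (simp add: mul_assoc reassoc[OF 2] reassoc[OF 1])
qed

text \<open>Applying the decomposition for fewer strands after the caps avoids sliding dots along the passing strands.\<close>

lemma cap_span: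
  assumes T: "T P Q" and g: "good M (P + r) (r + Q) \<xi>" and r: "r = length b" and P: "P \<le> M"
    and h: "h \<in> hom (up P @ vp Q) Z"
  shows "\<exists>G. (\<forall>l\<in>Ix P Q. G l \<in> hom (tgt P Q l) Z) \<and>
    h \<bullet> wh (up P) (cap b) (vp Q) \<bullet> \<xi> = (\<Sum>l\<in>Ix P Q. G l \<bullet> Ap (P - length l) (Q - length l) (l @ b) \<bullet> \<xi>)"
proof -
  obtain G where G: "\<forall>l\<in>Ix P Q. G l \<in> hom (tgt P Q l) (up P @ vp Q)" "EF P Q = (\<Sum>l\<in>Ix P Q. G l \<bullet> A P Q l)"
    using dec_mono[OF T[unfolded T_def]] unfolding lspan_def by blast
  let ?\<zeta> = "wh (up P) (cap b) (vp Q) \<bullet> \<xi>"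
  have E\<zeta>: "EF P Q \<bullet> ?\<zeta> = ?\<zeta>" by (rule EF_cap[OF g r P])
  have "h \<bullet> ?\<zeta> = h \<bullet> EF P Q \<bullet> ?\<zeta>" by (simp only: E\<zeta>)
  also have "\<dots> = (\<Sum>l\<in>Ix P Q. (h \<bullet> G l) \<bullet> A P Q l \<bullet> ?\<zeta>)"
    by (simp add: G(2) mul_sum_left mul_sum_right mul_assoc)
  also have "\<dots> = (\<Sum>l\<in>Ix P Q. (h \<bullet> G l) \<bullet> Ap (P - length l) (Q - length l) (l @ b) \<bullet> \<xi>)"
  proof (rule sum.cong[OF HOL.refl])
    fix l assume l: "l \<in> Ix P Q"
    have "A P Q l \<bullet> ?\<zeta> = Ap (P - length l) (Q - length l) l \<bullet> ?\<zeta>" by (simp only: A_def mul_assoc E\<zeta>)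
    also have "\<dots> = Ap (P - length l) (Q - length l) (l @ b) \<bullet> \<xi>"
      by (rule reassoc[OF Ap_append]) (use l in \<open>auto simp: Ix_def\<close>)
    finally show "(h \<bullet> G l) \<bullet> A P Q l \<bullet> ?\<zeta> = (h \<bullet> G l) \<bullet> Ap (P - length l) (Q - length l) (l @ b) \<bullet> \<xi>" by simp
  qed
  finally show ?thesis using G(1) h by (intro exI[of _ "\<lambda>l. h \<bullet> G l"]) (auto intro: mul_hom)
qed

lemma good_mono: "good M m n \<xi> \<Longrightarrow> M' \<le> M \<Longrightarrow> good M' m n \<xi>"
proof -
  assume g: "good M m n \<xi>" and M: "M' \<le> M"
  have "labs U sU \<eta> M' ([] @ up 0) (up (M - M') @ up (m - M) @ vp n) \<xi>"
    by (rule L.labs_sub[of M]) (use g M in \<open>auto simp: good_def\<close>)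
  moreover have "M - M' + (m - M) = m - M'" using g M by (auto simp: good_def)
  ultimately show ?thesis using g M by (auto simp: good_def)
qed

text \<open>\<open>pass\<close> in the presence of \<open>p\<close> further upward and
  \<open>q\<close> further downward strands. On \<open>\<xi>\<close> the words of the error terms
  become scalars, and the dots and crossings after the caps are hidden in an arbitrary morphism
  \<open>h\<close>.\<close>

lemma pass_Ap:
  assumes g: "good m (Suc m) n \<xi>" and l: "set l \<subseteq> {..<k}" and r: "r = length l" and m: "m = p + r" and n: "n = r + q"
  shows "wh [] (Ap p q l) [U] \<bullet> wh (up m) (tau n) [] \<bullet> \<xi> - Ap (Suc p) q l \<bullet> wh (up p) (L.crossings r) (vp n) \<bullet> \<xi>
    \<in> span {h \<bullet> wh (up (Suc p)) (cap b) (vp q) \<bullet> \<xi> | h b.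
        h \<in> hom (up (Suc p) @ vp q) (vp q @ up (Suc p)) \<and> length b = r \<and> 0 < r \<and> set b \<subseteq> {..<k}}" (is "_ \<in> span ?S")
proof -
  define V where "V y = cross (Suc p) q \<bullet> wh (up p) y (vp q) \<bullet> \<xi>" for y
  have V: "module_hom scale scale V" unfolding V_def
    by (intro module_hom_comp[OF module_hom_mul_right]
      module_hom_comp[of "\<lambda>y. y \<bullet> \<xi>", OF module_hom_mul_left] module_hom_wh)
  have ex: "wh (up p) (cap l) (vp q @ [U]) \<bullet> wh (up m @ vp r) (tau q) [] = wh (up p) (tau q) [] \<bullet> wh (up p) (cap l) (U # vp q)"
    using exchange[OF cap_hom[of l] tau_hom[of q], of "up p" "[]" "[]"] by (simp add: r m)
  have 1: "wh [] (Ap p q l) [U] \<bullet> wh (up m) (tau n) [] \<bullet> \<xi> = V (wh [] (cap l) [U] \<bullet> wh (up r) (tau r) [])"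
    unfolding Ap_def V_def n tau_add
    by (simp add: wh_mul wh_wh mul_assoc reassoc[OF ex[unfolded m]] m)
  have 2: "Ap (Suc p) q l \<bullet> wh (up p) (L.crossings r) (vp n) \<bullet> \<xi> = V (wh [U] (cap l) [] \<bullet> wh [] (L.crossings r) (vp r))"
    unfolding Ap_def V_def n by (simp add: wh_mul wh_wh mul_assoc)
  have "V (wh [] (cap l) [U] \<bullet> wh (up r) (tau r) [] - wh [U] (cap l) [] \<bullet> wh [] (L.crossings r) (vp r)) \<in> span ?S"
  proof (rule span_map[OF V pass[OF l r, unfolded passspan_def]])
    fix y assume "y \<in> {wh [] (xp \<beta>) [] \<bullet> wh [U] (cap b) [] \<bullet> wh [] w (U # vp r) \<bullet> wh (up (Suc r)) w' [] | b \<beta> w w'.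
       length b = r \<and> 0 < r \<and> set b \<subseteq> {..<k} \<and> \<beta> < k \<and> WU r w \<and> WD r w'}"
    then obtain b \<beta> w w' \<kappa> \<kappa>' where y: "y = wh [] (xp \<beta>) [] \<bullet> wh [U] (cap b) [] \<bullet> wh [] w (U # vp r) \<bullet> wh (up (Suc r)) w' []"
      and b: "length b = r" "0 < r" "set b \<subseteq> {..<k}" and w: "pol U sU \<eta> r w \<kappa>" and w': "pol D sD (- \<eta>) r w' \<kappa>'" by blast
    define h where "h = cross (Suc p) q \<bullet> wh (up p) (xp \<beta>) (vp q)"
    have h: "h \<in> hom (up (Suc p) @ vp q) (vp q @ up (Suc p))"
      unfolding h_def by (rule mul_hom[OF wh_homI[OF xp_hom] cross_hom]) simp_all
    have 3: "wh (up (Suc m)) w' (vp q) \<bullet> \<xi> = \<kappa>' *s \<xi>" using good_polD[OF g w', of 0 q] n by simp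
    have 4: "wh (up p) w (U # vp n) \<bullet> \<xi> = \<kappa> *s \<xi>" using good_polU[OF g w, of p 1] m by simp
    have "V y = h \<bullet> wh (up (Suc p)) (cap b) (vp q) \<bullet> wh (up p) w (U # vp n) \<bullet> wh (up (Suc m)) w' (vp q) \<bullet> \<xi>"
      unfolding V_def y h_def by (simp add: wh_mul wh_wh mul_assoc m n b(1) del: cross.simps)
    also have "\<dots> = \<kappa>' *s \<kappa> *s (h \<bullet> wh (up (Suc p)) (cap b) (vp q) \<bullet> \<xi>)"
      by (simp only: 3 4 mul_scale_right)
    also have "\<dots> \<in> span ?S" using h b by (intro span_scale span_base) blast
    finally show "V y \<in> span ?S" .
  qed
  then show ?thesis unfolding 1 2 module_hom.diff[OF V] .
qed

end

section \<open>The induction step: one more upward strand\<close>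

context heisenberg_proj begin

text \<open>\<open>proj_Suc\<close> transported to the target, where it produces the factor
  \<open>Suc p\<close> by which the preimages are divided.\<close>

lemma coset_FE: "wh (vp q) (L.coset p) [] \<bullet> wh [] (FE q p) [U] = of_nat (Suc p) *s FE q (Suc p)"
proof -
  have ex: "wh (vp q) (L.coset p) [] \<bullet> wh [] (f q) (up (Suc p)) = wh [] (f q) (up (Suc p)) \<bullet> wh (vp q) (L.coset p) []"
    using exchange[OF f_hom[of q] L.coset_hom[of p], of "[]" "[]" "[]"] by simp
  have "wh (vp q) (L.coset p) [] \<bullet> wh [] (FE q p) [U] = wh [] (f q) (up (Suc p)) \<bullet> wh (vp q) (L.coset p \<bullet> wh [] (e p) [U]) []"
    using reassoc[OF ex] by (simp add: FE_def wh_mul wh_wh mul_assoc)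
  then show ?thesis unfolding L.coset_proj[OF e] by (simp add: FE_def wh_scale mul_scale_right)
qed

text \<open>\<open>F\<close> symmetrizes only the old strands. The new strand, rightmost among the
  upward ones, is decomposed against the downward strands by \<open>T_1\<close>: it either crosses
  them all or takes one of them away in a cap. Then the hypothesis decomposes the old strands.
  \<open>G\<close> is a summand of \<open>F\<close>, and \<open>proj_Suc\<close> relates the maps
  for \<open>G\<close> to the components of \<open>F\<close>.\<close>

lemma T_step:
  assumes IH: "\<And>P Q. P \<le> m \<Longrightarrow> T P Q"
  shows "T (Suc m) (Suc n')"
proof -
  define n where "n = Suc n'"
  define X where "X = up (Suc m) @ vp n"
  define F where "F = wh [] (e m) (U # vp n) \<bullet> wh (up (Suc m)) (f n) []"
  define G where "G = EF (Suc m) n"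
  \<comment> \<open>The first entry is empty if the new strand crosses everything and otherwise
    holds the dots on its cap, which is the innermost one; the second entry lists the caps on old
    strands.\<close>
  define I where "I = Sigma (Ix (Suc 0) n) (\<lambda>i. if i = [] then Ix m n else Ix m n')"
  define Y where "Y = (\<lambda>(i :: nat list, l). if i = [] then tgt m n l @ [U] else tgt m n' l)"
  define EE where "EE = (\<lambda>(i :: nat list, l). if i = [] then wh [] (E m n l) [U] else E m n' l)"
  define \<Omega> where "\<Omega> = (\<lambda>(i, l). if i = [] then wh [] (Ap (m - length l) (n - length l) l) [U] \<bullet> wh (up m) (tau n) [] \<bullet> F
     else Ap (m - length l) (n' - length l) (l @ i) \<bullet> F)"
  define J where "J = {z \<in> I. fst z \<noteq> []}"
  have F_alt: "F = wh (up (Suc m)) (f n) [] \<bullet> wh [] (e m) (U # vp n)"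
    unfolding F_def using exchange[OF e_hom[of m] f_hom[of n], of "[]" "[U]" "[]"] by simp
  have Fh: "F \<in> hom X X" unfolding F_def X_def
    by (rule mul_hom[of _ _ "up (Suc m) @ vp n"]) (auto intro!: wh_homI[OF e_hom] wh_homI[OF f_hom])
  have Gh: "G \<in> hom X X" unfolding G_def X_def by (rule EF_hom)
  have eF: "wh [] (e m) (U # vp n) \<bullet> F = F" unfolding F_def by (rule reassoc[OF e_idem])
  have fF: "wh (up (Suc m)) (f n) [] \<bullet> F = F" unfolding F_alt by (rule reassoc[OF f_idem])
  have GG: "G \<bullet> G = G" unfolding G_def by (rule EF_idem)
  have goodF: "good m (Suc m) n F"
    unfolding good_def
  proof (intro conjI exI)
    show "labs U sU \<eta> m [] (up (Suc m - m) @ vp n) F"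
      unfolding F_def using L.labs_mul[OF L.proj_labs[OF e, of m "[]" "U # vp n"]] by simp
    show "labs D sD (- \<eta>) n (up (Suc m)) [] F"
      unfolding F_alt by (rule R.labs_mul[OF R.proj_labs[OF f]])
    show "F \<in> hom X (up (Suc m) @ vp n)" using Fh by (simp only: X_def)
  qed simp
  have goodG: "good (Suc m) (Suc m) n G"
    unfolding good_def
  proof (intro conjI exI)
    show "labs U sU \<eta> (Suc m) [] (up (Suc m - Suc m) @ vp n) G"
      unfolding G_def EF_def using L.labs_mul[OF L.proj_labs[OF e, of "Suc m" "[]" "vp n"]] by simp
    show "labs D sD (- \<eta>) n (up (Suc m)) [] G"
      unfolding G_def EF_alt by (rule R.labs_mul[OF R.proj_labs[OF f]])
    show "G \<in> hom X (up (Suc m) @ vp n)" using Gh by (simp only: X_def)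
  qed simp
  have eG: "wh [] (e m) (U # vp n) \<bullet> G = G" using good_e[OF goodG, of m] by simp
  have fG: "wh (up (Suc m)) (f n) [] \<bullet> G = G" using good_f[OF goodG, of 0 n] by simp
  have FG: "F \<bullet> G = G" unfolding F_def by (simp only: mul_assoc fG eG)
  have tauf: "tau n \<bullet> wh [U] (f n) [] = wh [] (f n) [U] \<bullet> tau n"
    using cross_EF[of "Suc 0" n] unfolding cross_1 EF_1 FE_q1 .
  have d1: "dec X F (Ix (Suc 0) n) (\<lambda>i. up m @ tgt (Suc 0) n i)
     (\<lambda>i. wh (up m) (E (Suc 0) n i) [] \<bullet> wh [] (e m) (tgt (Suc 0) n i))
     (\<lambda>i. wh (up m) (A (Suc 0) n i) [] \<bullet> wh [] (e m) (U # vp n))"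
  proof (rule dec_cong[OF dec_tensor_left[OF T_1[of n, unfolded T_def] e_hom[of m] L.proj_idem[OF e]]])
    show "up m @ up (Suc 0) @ vp n = X" by (simp add: X_def)
    show "wh (up m) (EF (Suc 0) n) [] \<bullet> wh [] (e m) (up (Suc 0) @ vp n) = F"
      unfolding EF_1 F_alt by (simp add: wh_wh)
  qed simp
  have dN: "dec (up m @ vp n @ [U]) (wh [] (EF m n) [U]) (Ix m n) (\<lambda>l. tgt m n l @ [U])
     (\<lambda>l. wh [] (E m n l) [U]) (\<lambda>l. wh [] (A m n l) [U])"
  proof (rule dec_cong[OF dec_tensor_right[OF IH[of m n, unfolded T_def] one_hom[of "[U]"] one_left[OF one_hom]]])
    show "(up m @ vp n) @ [U] = up m @ vp n @ [U]" by simp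
    show "wh [] (EF m n) [U] \<bullet> wh (up m @ vp n) (one [U]) [] = wh [] (EF m n) [U]"
      using one_right[OF wh_hom[OF EF_hom[of m n], of "[]" "[U]"]] by (simp add: wh_one)
    fix l assume l: "l \<in> Ix m n"
    show "tgt m n l @ [U] = tgt m n l @ [U] \<and>
      wh [] (E m n l) [U] \<bullet> wh (tgt m n l) (one [U]) [] = wh [] (E m n l) [U] \<and>
      wh [] (A m n l) [U] \<bullet> wh (up m @ vp n) (one [U]) [] = wh [] (A m n l) [U]"
      using one_right[OF wh_hom[OF E_hom[OF l], of "[]" "[U]"]] one_right[OF wh_hom[OF A_hom[OF l], of "[]" "[U]"]]
      by (simp add: wh_one)
  qed simp
  have tgt0: "tgt (Suc 0) n [] = vp n @ [U]" and tgt1: "tgt (Suc 0) n [a] = vp n'" for a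
    by (simp_all add: tgt_def n_def)
  have E0: "E (Suc 0) n [] = wh [] (f n) [U]" and E1: "E (Suc 0) n [a] = f n'" for a
    by (simp_all add: E_def FE_q1 FE_q0 n_def)
  have Ix1: "i \<in> Ix (Suc 0) n \<longleftrightarrow> i = [] \<or> (\<exists>a<k. i = [a])" for i by (auto simp: n_def Ix_1)
  have \<Omega>N: "wh [] (A m n l) [U] \<bullet> wh (up m) (A (Suc 0) n []) [] \<bullet> wh [] (e m) (U # vp n) = \<Omega> ([], l)" for l
  proof -
    have 1: "wh (up m) (f n) [U] \<bullet> wh (up m) (tau n) [] = wh (up m) (tau n) [] \<bullet> wh (up (Suc m)) (f n) []"
      using arg_cong[OF tauf, of "\<lambda>y. wh (up m) y []"] by (simp add: wh_mul wh_wh)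
    have 2: "wh [] (e m) (vp n @ [U]) \<bullet> wh (up m) (tau n) [] = wh (up m) (tau n) [] \<bullet> wh [] (e m) (U # vp n)"
      using exchange[OF e_hom[of m] tau_hom[of n], of "[]" "[]" "[]"] by simp
    have "wh [] (A m n l) [U] \<bullet> wh (up m) (A (Suc 0) n []) [] \<bullet> wh [] (e m) (U # vp n)
       = wh [] (Ap (m - length l) (n - length l) l) [U] \<bullet> wh [] (e m) (vp n @ [U]) \<bullet> wh (up m) (f n) [U] \<bullet> wh (up m) (tau n) [] \<bullet> F"
      unfolding A_1_Nil unfolding A_def EF_def F_alt by (simp add: wh_mul wh_wh mul_assoc)
    also have "\<dots> = \<Omega> ([], l)" by (simp add: \<Omega>_def reassoc[OF 1] mul_assoc fF[simplified] reassoc[OF 2] eF)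
    finally show ?thesis .
  qed
  have \<Omega>C: "A m n' l \<bullet> wh (up m) (A (Suc 0) n [a]) [] \<bullet> wh [] (e m) (U # vp n) = \<Omega> ([a], l)" if l: "l \<in> Ix m n'" for a l
  proof -
    have "A m n' l \<bullet> wh (up m) (A (Suc 0) n [a]) [] \<bullet> wh [] (e m) (U # vp n)
       = Ap (m - length l) (n' - length l) l \<bullet> EF m n' \<bullet> wh (up m) (cap [a]) (vp n') \<bullet> F"
      unfolding n_def A_1_single cap_single unfolding A_def F_alt n_def by (simp add: wh_mul wh_wh mul_assoc)
    also have "EF m n' \<bullet> wh (up m) (cap [a]) (vp n') \<bullet> F = wh (up m) (cap [a]) (vp n') \<bullet> F"
      by (rule EF_cap[where M = m and r = "Suc 0"]) (use goodF in \<open>simp_all add: n_def\<close>)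
    also have "Ap (m - length l) (n' - length l) l \<bullet> wh (up m) (cap [a]) (vp n') \<bullet> F = Ap (m - length l) (n' - length l) (l @ [a]) \<bullet> F"
      by (rule reassoc[OF Ap_append]) (use l in \<open>auto simp: Ix_def\<close>)
    finally show ?thesis by (simp add: \<Omega>_def)
  qed
  have d2: "dec X F I Y EE \<Omega>"
  proof (rule dec_cong[OF dec_comp[OF d1, where J = "\<lambda>i. if i = [] then Ix m n else Ix m n'"
      and Y' = "\<lambda>i l. if i = [] then tgt m n l @ [U] else tgt m n' l"
      and E' = "\<lambda>i l. if i = [] then wh [] (E m n l) [U] else E m n' l"
      and A' = "\<lambda>i l. if i = [] then wh [] (A m n l) [U] else A m n' l"], folded I_def])
    fix i assume "i \<in> Ix (Suc 0) n"
    then consider "i = []" | a where "i = [a]" "a < k" unfolding Ix1 by blast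
    then show "dec (up m @ tgt (Suc 0) n i) (wh (up m) (E (Suc 0) n i) [] \<bullet> wh [] (e m) (tgt (Suc 0) n i))
        (if i = [] then Ix m n else Ix m n') (\<lambda>l. if i = [] then tgt m n l @ [U] else tgt m n' l)
        (\<lambda>l. if i = [] then wh [] (E m n l) [U] else E m n' l) (\<lambda>l. if i = [] then wh [] (A m n l) [U] else A m n' l)"
    proof cases
      case 1
      have "wh (up m) (E (Suc 0) n []) [] \<bullet> wh [] (e m) (tgt (Suc 0) n []) = wh [] (EF m n) [U]"
        unfolding E0 tgt0 EF_alt by (simp add: wh_mul wh_wh)
      then show ?thesis using 1 dN by (simp add: tgt0)
    next
      case (2 a)
      have "wh (up m) (E (Suc 0) n [a]) [] \<bullet> wh [] (e m) (tgt (Suc 0) n [a]) = EF m n'"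
        unfolding E1 tgt1 EF_alt ..
      then show ?thesis using 2 IH[of m n', unfolded T_def] by (simp add: tgt1)
    qed
  next
    fix z assume z: "z \<in> I"
    obtain i l where il: "z = (i, l)" by force
    show "(case z of (i, l) \<Rightarrow> if i = [] then tgt m n l @ [U] else tgt m n' l) = Y z \<and>
      (case z of (i, l) \<Rightarrow> if i = [] then wh [] (E m n l) [U] else E m n' l) = EE z \<and>
      (case z of (i, l) \<Rightarrow> (if i = [] then wh [] (A m n l) [U] else A m n' l) \<bullet> wh (up m) (A (Suc 0) n i) [] \<bullet> wh [] (e m) (U # vp n)) = \<Omega> z"
    proof (cases "i = []")
      case True then show ?thesis using il \<Omega>N by (simp add: Y_def EE_def)
    next
      case False
      then obtain a where "i = [a]" "l \<in> Ix m n'" using z il unfolding I_def by (auto simp: Ix1)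
      then show ?thesis using il \<Omega>C by (simp add: Y_def EE_def)
    qed
  qed simp_all
  obtain B where B: "finite I" "\<And>i. i \<in> I \<Longrightarrow> \<Omega> i \<in> hom X (Y i)" "\<And>i. i \<in> I \<Longrightarrow> \<Omega> i \<bullet> F = \<Omega> i"
      "\<And>i. i \<in> I \<Longrightarrow> EE i \<bullet> \<Omega> i = \<Omega> i" "\<And>i. i \<in> I \<Longrightarrow> B i \<in> hom (Y i) X" "\<And>i. i \<in> I \<Longrightarrow> F \<bullet> B i = B i"
      "\<And>i. i \<in> I \<Longrightarrow> B i \<bullet> EE i = B i" "\<And>i j. i \<in> I \<Longrightarrow> j \<in> I \<Longrightarrow> \<Omega> i \<bullet> B j = (if i = j then EE i else 0)"
      "(\<Sum>i\<in>I. B i \<bullet> \<Omega> i) = F" by (rule decE[OF d2], rule that) blast+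
  have finJ: "finite J" using B(1) by (simp add: J_def)
  have JI: "J \<subseteq> I" by (auto simp: J_def)
  have IN: "([], l) \<in> I \<longleftrightarrow> l \<in> Ix m n" for l by (simp add: I_def Ix1)
  have IC: "([a], l) \<in> I \<longleftrightarrow> a < k \<and> l \<in> Ix m n'" for a l by (simp add: I_def Ix1)
  let ?L = "\<lambda>Z. lspan Z (Ix (Suc m) n) (tgt (Suc m) n) (A (Suc m) n)"
  \<comment> \<open>In \<open>G\<close> all upward strands are symmetrized, so every list of dots
    can be sorted completely.\<close>
  have LA: "Ap p q b \<bullet> G \<in> ?L (vp q @ up p)" if b: "set b \<subseteq> {..<k}" "p + length b = Suc m" "length b + q = n" for p q b
  proof (rule lspan_span)
    show "Ap p q b \<bullet> G \<in> span {Ap p q l \<bullet> G | l. length l = length b \<and> sorted_wrt (>) l \<and> set l \<subseteq> {..<k} \<and> sum_list l \<le> sum_list b}"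
    proof -
      have g: "good (Suc m) (p + length b) (length b + q) G" using goodG by (simp only: b)
      show ?thesis by (rule Ap_sort[OF g _ _ b(1), where v = "[]", unfolded append_Nil2]) (simp_all add: b(2))
    qed
    fix y assume "y \<in> {Ap p q l \<bullet> G | l. length l = length b \<and> sorted_wrt (>) l \<and> set l \<subseteq> {..<k} \<and> sum_list l \<le> sum_list b}"
    then obtain l where l: "y = Ap p q l \<bullet> G" "length l = length b" "sorted_wrt (>) l" "set l \<subseteq> {..<k}" by auto
    have "l \<in> Ix (Suc m) n" using l b by (auto simp: Ix_def)
    moreover have mm: "Suc m - length l = p" "n - length l = q" using l(2) b by auto
    moreover have "y = A (Suc m) n l" by (simp only: A_def G_def l(1) mm)
    moreover have "tgt (Suc m) n l = vp q @ up p" by (simp only: tgt_def mm)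
    ultimately show "y \<in> ?L (vp q @ up p)" using A_lspan by metis
  qed
  \<comment> \<open>In \<open>F\<close> the new strand is not symmetrized, so its cap with
    \<open>a\<close> dots stays innermost and only the others are sorted. The bound on the sum is
    kept for the triangularity below.\<close>
  have LC: "Ap p q (b @ [a]) \<bullet> F \<in> lspan (vp q @ up p) {([a], l) | l. l \<in> Ix m n' \<and> length l = length b \<and> sum_list l \<le> sum_list b} Y \<Omega>"
    if b: "set b \<subseteq> {..<k}" "a < k" "p + length b = m" "length b + q = n'" for p q b a
  proof (rule lspan_span)
    let ?K = "{([a], l) | l. l \<in> Ix m n' \<and> length l = length b \<and> sum_list l \<le> sum_list b}"
    have KI: "?K \<subseteq> I" using b(2) by (auto simp: IC)
    then have finK: "finite ?K" using B(1) finite_subset by blast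
    show "Ap p q (b @ [a]) \<bullet> F \<in> span {Ap p q (l @ [a]) \<bullet> F | l. length l = length b \<and> sorted_wrt (>) l \<and> set l \<subseteq> {..<k} \<and> sum_list l \<le> sum_list b}"
      by (rule Ap_sort[of m p "Suc (length b)" q F]) (use goodF b n_def in auto)
    fix y assume "y \<in> {Ap p q (l @ [a]) \<bullet> F | l. length l = length b \<and> sorted_wrt (>) l \<and> set l \<subseteq> {..<k} \<and> sum_list l \<le> sum_list b}"
    then obtain l where l: "y = Ap p q (l @ [a]) \<bullet> F" "length l = length b" "sorted_wrt (>) l" "set l \<subseteq> {..<k}" "sum_list l \<le> sum_list b" by blast
    have lI: "l \<in> Ix m n'" using l b by (auto simp: Ix_def)
    have mm: "m - length l = p" "n' - length l = q" using l(2) b by auto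
    have "y = \<Omega> ([a], l)" by (simp add: \<Omega>_def l(1) mm)
    moreover have "Y ([a], l) = vp q @ up p" by (simp add: Y_def tgt_def mm)
    moreover have "([a], l) \<in> ?K" using lI l by blast
    ultimately show "y \<in> lspan (vp q @ up p) ?K Y \<Omega>"
      using lspan_base1[OF finK, of "([a], l)" \<Omega> X Y] B(2) KI by (metis (no_types, lifting) subsetD)
  qed
  have lspan_mono: "v \<in> lspan Z K' Y \<Omega>" if v: "v \<in> lspan Z K Y \<Omega>" and K: "K \<subseteq> K'" "K' \<subseteq> I" for v Z K K'
  proof -
    obtain g where g: "\<forall>i\<in>K. g i \<in> hom (Y i) Z" "v = (\<Sum>i\<in>K. g i \<bullet> \<Omega> i)" using v unfolding lspan_def by blast
    have "v = (\<Sum>i\<in>K'. (if i \<in> K then g i else 0) \<bullet> \<Omega> i)"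
      unfolding g(2) using K B(1) by (intro sum.mono_neutral_cong_left) (auto intro: finite_subset)
    then show ?thesis using g(1) zero_hom unfolding lspan_def
      by (intro CollectI exI[of _ "\<lambda>i. if i \<in> K then g i else 0"]) auto
  qed
  have LCJ: "Ap p q b \<bullet> F \<in> lspan (vp q @ up p) J Y \<Omega>"
    if b: "set b \<subseteq> {..<k}" "b \<noteq> []" "p + length b = Suc m" "length b + q = n" for p q b
  proof -
    obtain b' a where b': "b = b' @ [a]" using b(2) rev_exhaust by blast
    have "Ap p q (b' @ [a]) \<bullet> F \<in> lspan (vp q @ up p) {([a], l) | l. l \<in> Ix m n' \<and> length l = length b' \<and> sum_list l \<le> sum_list b'} Y \<Omega>"
      by (rule LC) (use b b' n_def in auto)
    then show ?thesis unfolding b' by (rule lspan_mono) (use b(1) b' in \<open>auto simp: J_def IC\<close>)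
  qed
  \<comment> \<open>A nonempty \<open>b\<close> leaves at most \<open>m\<close> upward strands, so
    the hypothesis decomposes them after the caps, whatever \<open>h\<close> is.\<close>
  have HA: "h \<bullet> wh (up P) (cap b) (vp Q) \<bullet> G \<in> ?L Z"
    if b: "set b \<subseteq> {..<k}" "b \<noteq> []" "P + length b = Suc m" "length b + Q = n" and h: "h \<in> hom (up P @ vp Q) Z" for h b P Q Z
  proof -
    have P: "P \<le> m" using b by (cases b) auto
    obtain g where g: "\<forall>l\<in>Ix P Q. g l \<in> hom (tgt P Q l) Z"
      "h \<bullet> wh (up P) (cap b) (vp Q) \<bullet> G = (\<Sum>l\<in>Ix P Q. g l \<bullet> Ap (P - length l) (Q - length l) (l @ b) \<bullet> G)"
      using cap_span[OF IH[OF P], of "Suc m" "length b" Q G b h Z] goodG P b h by auto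
    have "g l \<bullet> Ap (P - length l) (Q - length l) (l @ b) \<bullet> G \<in> ?L Z" if l: "l \<in> Ix P Q" for l
    proof (rule lspan_mul)
      show "g l \<in> hom (vp (Q - length l) @ up (P - length l)) Z" using g(1) l by (simp add: tgt_def)
      show "Ap (P - length l) (Q - length l) (l @ b) \<bullet> G \<in> ?L (vp (Q - length l) @ up (P - length l))"
        by (rule LA) (use l b in \<open>auto simp: Ix_def\<close>)
    qed
    then show ?thesis unfolding g(2) by (rule lspan_sum)
  qed
  have HC: "h \<bullet> wh (up P) (cap b) (vp Q) \<bullet> F \<in> lspan Z J Y \<Omega>"
    if b: "set b \<subseteq> {..<k}" "b \<noteq> []" "P + length b = Suc m" "length b + Q = n" and h: "h \<in> hom (up P @ vp Q) Z" for h b P Q Z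
  proof -
    have P: "P \<le> m" using b by (cases b) auto
    obtain g where g: "\<forall>l\<in>Ix P Q. g l \<in> hom (tgt P Q l) Z"
      "h \<bullet> wh (up P) (cap b) (vp Q) \<bullet> F = (\<Sum>l\<in>Ix P Q. g l \<bullet> Ap (P - length l) (Q - length l) (l @ b) \<bullet> F)"
      using cap_span[OF IH[OF P], of m "length b" Q F b h Z] goodF P b h by auto
    have "g l \<bullet> Ap (P - length l) (Q - length l) (l @ b) \<bullet> F \<in> lspan Z J Y \<Omega>" if l: "l \<in> Ix P Q" for l
    proof (rule lspan_mul)
      show "g l \<in> hom (vp (Q - length l) @ up (P - length l)) Z" using g(1) l by (simp add: tgt_def)
      show "Ap (P - length l) (Q - length l) (l @ b) \<bullet> F \<in> lspan (vp (Q - length l) @ up (P - length l)) J Y \<Omega>"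
        by (rule LCJ) (use l b in \<open>auto simp: Ix_def\<close>)
    qed
    then show ?thesis unfolding g(2) by (rule lspan_sum)
  qed
  have goodG': "good m (Suc m) n G" by (rule good_mono[OF goodG]) simp
  have XT: "up (Suc m) @ vp n = X" by (simp add: X_def)
  have pass_h: "y \<in> lspan (vp q @ up (Suc p)) J Y \<Omega>"
    if "y \<in> span {h \<bullet> wh (up (Suc p)) (cap b) (vp q) \<bullet> F | h b.
        h \<in> hom (up (Suc p) @ vp q) (vp q @ up (Suc p)) \<and> length b = r \<and> 0 < r \<and> set b \<subseteq> {..<k}}"
      "m = p + r" "n = r + q" for y p q r
  proof (rule lspan_span[OF that(1)])
    fix x assume "x \<in> {h \<bullet> wh (up (Suc p)) (cap b) (vp q) \<bullet> F | h b.
        h \<in> hom (up (Suc p) @ vp q) (vp q @ up (Suc p)) \<and> length b = r \<and> 0 < r \<and> set b \<subseteq> {..<k}}"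
    then obtain h b where x: "x = h \<bullet> wh (up (Suc p)) (cap b) (vp q) \<bullet> F" and hb: "h \<in> hom (up (Suc p) @ vp q) (vp q @ up (Suc p))"
      "length b = r" "0 < r" "set b \<subseteq> {..<k}" by blast
    show "x \<in> lspan (vp q @ up (Suc p)) J Y \<Omega>" unfolding x by (rule HC) (use hb that(2,3) in auto)
  qed
  have "T (Suc m) n"
  proof (rule TI, unfold XT)
    have "F \<bullet> G \<in> ?L X"
    proof (rule lspan_trans[OF dec_mono[OF d2]])
      fix z assume z: "z \<in> I"
      obtain i l where il: "z = (i, l)" by force
      show "\<Omega> z \<bullet> G \<in> ?L (Y z)"
      proof (cases "i = []")
        case True
        then have l: "l \<in> Ix m n" using z il IN by simp
        define r where "r = length l"
        define p where "p = m - r"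
        define q where "q = n - r"
        have pq: "m = p + r" "n = r + q" and lk: "set l \<subseteq> {..<k}" using l by (auto simp: p_def q_def r_def Ix_def)
        \<comment> \<open>By \<open>pass_Ap\<close> a component in which the new strand crosses
          everything is, up to terms treated by \<open>HA\<close>, a new map preceded by crossings,
          and \<open>G\<close> absorbs these as a scalar.\<close>
        have "wh [] (Ap p q l) [U] \<bullet> wh (up m) (tau n) [] \<bullet> G - Ap (Suc p) q l \<bullet> wh (up p) (L.crossings r) (vp n) \<bullet> G \<in> ?L (vp q @ up (Suc p))"
        proof (rule lspan_span[OF pass_Ap[OF goodG' lk r_def pq]])
          fix x assume "x \<in> {h \<bullet> wh (up (Suc p)) (cap b) (vp q) \<bullet> G | h b.
             h \<in> hom (up (Suc p) @ vp q) (vp q @ up (Suc p)) \<and> length b = r \<and> 0 < r \<and> set b \<subseteq> {..<k}}"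
          then obtain h b where x: "x = h \<bullet> wh (up (Suc p)) (cap b) (vp q) \<bullet> G" and hb: "h \<in> hom (up (Suc p) @ vp q) (vp q @ up (Suc p))"
            "length b = r" "0 < r" "set b \<subseteq> {..<k}" by blast
          show "x \<in> ?L (vp q @ up (Suc p))" unfolding x by (rule HA) (use hb pq in auto)
        qed
        moreover have "Ap (Suc p) q l \<bullet> wh (up p) (L.crossings r) (vp n) \<bullet> G \<in> ?L (vp q @ up (Suc p))"
        proof -
          obtain \<kappa> where "pol U sU \<eta> (Suc r) (L.crossings r) \<kappa>" using L.pol_crossings by blast
          from good_polU[OF goodG this, of p 0] pq have "wh (up p) (L.crossings r) (vp n) \<bullet> G = \<kappa> *s G" by simp
          then show ?thesis by (simp only: mul_scale_right) (rule lspan_scale[OF LA], use lk pq r_def in auto)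
        qed
        ultimately have "(wh [] (Ap p q l) [U] \<bullet> wh (up m) (tau n) [] \<bullet> G - Ap (Suc p) q l \<bullet> wh (up p) (L.crossings r) (vp n) \<bullet> G)
           + Ap (Suc p) q l \<bullet> wh (up p) (L.crossings r) (vp n) \<bullet> G \<in> ?L (vp q @ up (Suc p))" by (rule lspan_add)
        moreover have "Y z = vp q @ up (Suc p)" using True by (simp add: il Y_def tgt_def p_def q_def r_def)
        moreover have "\<Omega> z \<bullet> G = wh [] (Ap p q l) [U] \<bullet> wh (up m) (tau n) [] \<bullet> G"
          using True by (simp add: il \<Omega>_def p_def q_def r_def mul_assoc FG)
        ultimately show ?thesis by simp
      next
        case False
        then obtain a where a: "i = [a]" "a < k" "l \<in> Ix m n'" using z il unfolding I_def by (auto simp: Ix1)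
        have "\<Omega> z \<bullet> G = Ap (m - length l) (n' - length l) (l @ [a]) \<bullet> G" using a by (simp add: il \<Omega>_def mul_assoc FG)
        also have "\<dots> \<in> ?L (vp (n' - length l) @ up (m - length l))"
          by (rule LA) (use a in \<open>auto simp: Ix_def n_def\<close>)
        finally show ?thesis using a by (simp add: il Y_def tgt_def)
      qed
    qed
    then have "G \<in> ?L X" by (simp only: FG)
    then show "EF (Suc m) n \<in> ?L X" by (simp only: G_def)
  next
    let ?M = "of_nat (Suc m) :: 'a"
    have M0: "?M \<noteq> 0" by (metis of_nat_eq_0_iff nat.distinct(1))
    have MG: "?M *s G = wh [] (L.coset m) (vp n) \<bullet> F"
    proof -
      have "?M *s G = wh [] (?M *s e (Suc m)) (vp n) \<bullet> wh (up (Suc m)) (f n) []"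
        unfolding G_def EF_def wh_scale mul_scale_left ..
      also have "\<dots> = wh [] (L.coset m) (vp n) \<bullet> F"
        unfolding L.proj_Suc[OF e] F_def by (simp add: wh_mul wh_wh mul_assoc)
      finally show ?thesis .
    qed
    have cyc: "\<exists>\<kappa>. Ap p q l \<bullet> wh (up (Suc m - Suc (length v))) (L.crossings (length v)) (vp n) \<bullet> F - \<kappa> *s (Ap p q (u @ v @ [\<alpha>]) \<bullet> F)
       \<in> span {Ap p q b \<bullet> F | b. length b = length l \<and> set b \<subseteq> {..<k} \<and> sum_list b < sum_list l}"
      if "l = u @ \<alpha> # v" "set l \<subseteq> {..<k}" "p + length l = Suc m" "n = length l + q" for p q l u \<alpha> v
    proof -
      have g: "good m (p + length l) (length l + q) F" using goodF that by simp
      have pu: "Suc m - Suc (length v) = p + length u" using that by simp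
      have "length l = Suc (length u + length v)" using that(1) by simp
      from Ap_cycle[OF g this that(2)[unfolded that(1)]] show ?thesis unfolding pu that(1) that(4) by simp
    qed
    \<comment> \<open>Counted from the end of the list, because the representative with index
      \<open>j\<close> moves only the last \<open>j + 1\<close> upward strands.\<close>
    have split: "\<exists>u \<alpha> v. l = u @ \<alpha> # v \<and> length v = j" if "j < length l" for j and l :: "nat list"
      using id_take_nth_drop[of "length l - Suc j" l] that
      by (intro exI[of _ "take (length l - Suc j) l"] exI[of _ "l ! (length l - Suc j)"] exI[of _ "drop (Suc (length l - Suc j)) l"]) auto
    \<comment> \<open>If an upward strand passes, the representatives inside the caps are cycled and
      yield components in \<open>J\<close>. The others carry a passing strand over the caps, which
      is \<open>\<Omega> ([], l)\<close> up to \<open>J\<close> by \<open>pass_Ap\<close>.\<close>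
    have small: "?M *s A (Suc m) n l - \<eta> ^ length l *s (wh (vp (n - length l)) (L.coset (m - length l)) [] \<bullet> \<Omega> ([], l)) \<in> lspan (tgt (Suc m) n l) J Y \<Omega>"
      if l: "l \<in> Ix (Suc m) n" "length l \<le> m" for l
    proof -
      define r where "r = length l"
      define p where "p = m - r"
      define q where "q = n - r"
      have pq: "m = p + r" "n = r + q" and lk: "set l \<subseteq> {..<k}" using l by (auto simp: p_def q_def r_def Ix_def)
      let ?Z = "vp q @ up (Suc p)"
      have tgt: "tgt (Suc m) n l = ?Z" using l(2) by (simp add: tgt_def p_def q_def r_def Suc_diff_le)
      have A: "A (Suc m) n l = Ap (Suc p) q l \<bullet> G" using l(2) by (simp add: A_def G_def p_def q_def r_def Suc_diff_le)
      have jr: "Ap (Suc p) q l \<bullet> wh (up (m - j)) (L.crossings j) (vp n) \<bullet> F \<in> lspan ?Z J Y \<Omega>" if j: "j < r" for j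
      proof -
        obtain u \<alpha> v where uv: "l = u @ \<alpha> # v" "length v = j" using split[of j l] j r_def by auto
        obtain \<kappa> where k: "Ap (Suc p) q l \<bullet> wh (up (m - j)) (L.crossings j) (vp n) \<bullet> F - \<kappa> *s (Ap (Suc p) q (u @ v @ [\<alpha>]) \<bullet> F)
            \<in> span {Ap (Suc p) q b \<bullet> F | b. length b = length l \<and> set b \<subseteq> {..<k} \<and> sum_list b < sum_list l}"
          using cyc[OF uv(1) lk, of "Suc p" q] pq uv(2) r_def by auto
        have "Ap (Suc p) q l \<bullet> wh (up (m - j)) (L.crossings j) (vp n) \<bullet> F - \<kappa> *s (Ap (Suc p) q (u @ v @ [\<alpha>]) \<bullet> F) \<in> lspan ?Z J Y \<Omega>"
        proof (rule lspan_span[OF k])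
          fix x assume "x \<in> {Ap (Suc p) q b \<bullet> F | b. length b = length l \<and> set b \<subseteq> {..<k} \<and> sum_list b < sum_list l}"
          then obtain b where x: "x = Ap (Suc p) q b \<bullet> F" and b: "length b = length l" "set b \<subseteq> {..<k}" by blast
          show "x \<in> lspan ?Z J Y \<Omega>" unfolding x by (rule LCJ) (use pq r_def j b in auto)
        qed
        moreover have "\<kappa> *s (Ap (Suc p) q (u @ v @ [\<alpha>]) \<bullet> F) \<in> lspan ?Z J Y \<Omega>"
          by (intro lspan_scale LCJ) (use pq r_def uv lk in auto)
        ultimately show ?thesis using lspan_add by fastforce
      qed
      have sl: "Ap (Suc p) q l \<bullet> wh [] (L.coset p) (up r @ vp n) = wh (vp q) (L.coset p) [] \<bullet> Ap (Suc p) q l"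
      proof -
        have 1: "wh (up (Suc p)) (cap l) (vp q) \<bullet> wh [] (L.coset p) (up r @ vp n) = wh [] (L.coset p) (vp q) \<bullet> wh (up (Suc p)) (cap l) (vp q)"
          using exchange[OF L.coset_hom[of p] cap_hom[of l], of "[]" "[]" "vp q"] by (simp add: pq r_def)
        show ?thesis unfolding Ap_def
          by (simp only: mul_assoc 1 reassoc[OF cross_polU[OF L.pol_coset[of p], of q]])
      qed
      have main: "wh [] (Ap p q l) [U] \<bullet> wh (up m) (tau n) [] \<bullet> F = \<Omega> ([], l)" by (simp add: \<Omega>_def p_def q_def r_def)
      have c: "L.coset m = L.coset (p + r)" by (simp only: pq(1))
      have "?M *s A (Suc m) n l = Ap (Suc p) q l \<bullet> wh [] (L.coset (p + r)) (vp n) \<bullet> F"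
        unfolding A mul_scale_right[symmetric] MG c ..
      also have "\<dots> = (\<Sum>j<r. \<eta> ^ j *s (Ap (Suc p) q l \<bullet> wh (up (m - j)) (L.crossings j) (vp n) \<bullet> F))
         + \<eta> ^ r *s (wh (vp q) (L.coset p) [] \<bullet> Ap (Suc p) q l \<bullet> wh (up p) (L.crossings r) (vp n) \<bullet> F)"
        unfolding L.coset_split
        by (simp add: wh_add wh_sum wh_scale wh_wh wh_mul mul_add_left mul_add_right mul_sum_left mul_sum_right
            mul_scale_left mul_scale_right mul_assoc reassoc[OF sl] pq(1))
      finally have "?M *s A (Suc m) n l - \<eta> ^ r *s (wh (vp q) (L.coset p) [] \<bullet> \<Omega> ([], l))
        = (\<Sum>j<r. \<eta> ^ j *s (Ap (Suc p) q l \<bullet> wh (up (m - j)) (L.crossings j) (vp n) \<bullet> F))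
         - \<eta> ^ r *s (wh (vp q) (L.coset p) [] \<bullet> (\<Omega> ([], l) - Ap (Suc p) q l \<bullet> wh (up p) (L.crossings r) (vp n) \<bullet> F))"
        by (simp add: mul_diff_right scale_right_diff_distrib)
      also have "\<dots> \<in> lspan ?Z J Y \<Omega>"
      proof (intro lspan_diff lspan_sum lspan_scale)
        show "wh (vp q) (L.coset p) [] \<bullet> (\<Omega> ([], l) - Ap (Suc p) q l \<bullet> wh (up p) (L.crossings r) (vp n) \<bullet> F) \<in> lspan ?Z J Y \<Omega>"
          unfolding main[symmetric]
          by (rule lspan_mul[OF pass_h[OF pass_Ap[OF goodF lk r_def pq] pq]])
            (auto intro!: wh_homI[OF L.coset_hom])
      qed (use jr in auto)
      finally show "?M *s A (Suc m) n l - \<eta> ^ length l *s (wh (vp (n - length l)) (L.coset (m - length l)) [] \<bullet> \<Omega> ([], l)) \<in> lspan (tgt (Suc m) n l) J Y \<Omega>"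
        unfolding tgt by (simp only: p_def q_def r_def)
    qed
    \<comment> \<open>What may occur besides the leading component when all upward strands are
      capped: components with a smaller total, or the same caps with an entry other than the last
      one on the new strand. The condition \<open>v \<noteq> []\<close> excludes the leading
      component.\<close>
    define K where "K l = {z \<in> J. length (snd z) = m \<and> (sum_list (snd z) + hd (fst z) < sum_list l \<or>
       (\<exists>u v \<alpha>. v \<noteq> [] \<and> l = u @ \<alpha> # v \<and> z = ([\<alpha>], u @ v)))}" for l
    have KJ: "K l \<subseteq> J" "K l \<subseteq> I" for l using JI by (auto simp: K_def)
    \<comment> \<open>With all upward strands capped, the trivial representative gives the leading
      component, in which the new strand has \<open>last l\<close> dots. The others are cycled by
      \<open>cyc\<close>.\<close>
    have big: "?M *s A (Suc m) n l - \<Omega> ([last l], butlast l) \<in> lspan (tgt (Suc m) n l) (K l) Y \<Omega>"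
      if l: "l \<in> Ix (Suc m) n" "length l = Suc m" for l
    proof -
      define q where "q = n - Suc m"
      have nq: "n = length l + q" "n' = m + q" and lk: "set l \<subseteq> {..<k}" and ls: "sorted_wrt (>) l"
        using l by (auto simp: q_def n_def Ix_def)
      have tgt: "tgt (Suc m) n l = vp q" using l(2) by (simp add: tgt_def q_def)
      have A: "A (Suc m) n l = Ap 0 q l \<bullet> G" using l(2) by (simp add: A_def G_def q_def)
      have lb: "l = butlast l @ [last l]" using l(2) by (cases l rule: rev_cases) auto
      have low: "Ap 0 q b \<bullet> F \<in> lspan (vp q) (K l) Y \<Omega>" if b: "length b = length l" "set b \<subseteq> {..<k}" "sum_list b < sum_list l" for b
      proof -
        obtain b' a where b': "b = b' @ [a]" using b(1) l(2) by (cases b rule: rev_cases) auto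
        have "Ap 0 q (b' @ [a]) \<bullet> F \<in> lspan (vp q @ up 0) {([a], l) | l. l \<in> Ix m n' \<and> length l = length b' \<and> sum_list l \<le> sum_list b'} Y \<Omega>"
          by (rule LC) (use b b' l(2) nq in auto)
        then have "Ap 0 q b \<bullet> F \<in> lspan (vp q @ up 0) (K l) Y \<Omega>" unfolding b'
          by (rule lspan_mono) (use b b' l(2) KJ in \<open>auto simp: K_def J_def IC\<close>)
        then show ?thesis by simp
      qed
      have jr: "Ap 0 q l \<bullet> wh (up (m - j)) (L.crossings j) (vp n) \<bullet> F \<in> lspan (vp q) (K l) Y \<Omega>" if j: "0 < j" "j \<le> m" for j
      proof -
        obtain u \<alpha> v where uv: "l = u @ \<alpha> # v" "length v = j" using split[of j l] j l(2) by auto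
        obtain \<kappa> where k: "Ap 0 q l \<bullet> wh (up (m - j)) (L.crossings j) (vp n) \<bullet> F - \<kappa> *s (Ap 0 q (u @ v @ [\<alpha>]) \<bullet> F)
            \<in> span {Ap 0 q b \<bullet> F | b. length b = length l \<and> set b \<subseteq> {..<k} \<and> sum_list b < sum_list l}"
          using cyc[OF uv(1) lk, of 0 q] nq uv(2) l(2) by auto
        have "Ap 0 q l \<bullet> wh (up (m - j)) (L.crossings j) (vp n) \<bullet> F - \<kappa> *s (Ap 0 q (u @ v @ [\<alpha>]) \<bullet> F) \<in> lspan (vp q) (K l) Y \<Omega>"
          by (rule lspan_span[OF k]) (auto intro!: low)
        moreover have "\<kappa> *s (Ap 0 q (u @ v @ [\<alpha>]) \<bullet> F) \<in> lspan (vp q) (K l) Y \<Omega>"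
        proof (rule lspan_scale)
          have uvI: "u @ v \<in> Ix m n'" using ls uv l nq lk by (auto simp: Ix_def sorted_wrt_append)
          have "v \<noteq> []" using uv j by auto
          then have ex: "\<exists>u' v' \<alpha>'. v' \<noteq> [] \<and> l = u' @ \<alpha>' # v' \<and> ([\<alpha>], u @ v) = ([\<alpha>'], u' @ v')" using uv by blast
          have uJ: "([\<alpha>], u @ v) \<in> J" using uvI uv lk by (auto simp: J_def IC)
          have ul: "length (snd ([\<alpha>], u @ v)) = m" using uv l(2) by simp
          have "([\<alpha>], u @ v) \<in> K l" unfolding K_def by (intro CollectI conjI disjI2 uJ ul ex)
          moreover have "Ap 0 q (u @ v @ [\<alpha>]) \<bullet> F = \<Omega> ([\<alpha>], u @ v)" using uv l(2) nq by (simp add: \<Omega>_def)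
          moreover have "Y ([\<alpha>], u @ v) = vp q" using uv l(2) nq by (simp add: Y_def tgt_def)
          ultimately show "Ap 0 q (u @ v @ [\<alpha>]) \<bullet> F \<in> lspan (vp q) (K l) Y \<Omega>"
            using lspan_base1[of "K l" "([\<alpha>], u @ v)" \<Omega> X Y] B(1,2) KJ(2)[of l] finite_subset by (metis subsetD)
        qed
        ultimately show ?thesis using lspan_add by fastforce
      qed
      have main: "Ap 0 q l \<bullet> F = \<Omega> ([last l], butlast l)"
        using lb l(2) nq by (simp add: \<Omega>_def)
      have 0: "wh (up m) (one [U]) (vp n) \<bullet> F = F" using one_left[OF Fh] by (simp add: wh_one X_def)
      have c0: "L.coset m = (\<Sum>j<Suc m. \<eta> ^ j *s wh (up (m - j)) (L.crossings j) [])"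
        using L.coset_split[of 0 m] one_left[OF L.crossings_hom[of m]]
        by (simp add: wh_one wh_Nil[OF L.crossings_hom])
      have "?M *s A (Suc m) n l = Ap 0 q l \<bullet> wh [] (L.coset m) (vp n) \<bullet> F"
        unfolding A mul_scale_right[symmetric] MG ..
      also have "\<dots> = (\<Sum>j<Suc m. \<eta> ^ j *s (Ap 0 q l \<bullet> wh (up (m - j)) (L.crossings j) (vp n) \<bullet> F))"
        unfolding c0 by (simp add: wh_sum wh_scale wh_wh mul_sum_left mul_sum_right mul_scale_left mul_scale_right wh_add mul_add_left mul_add_right del: L.crossings.simps)
      also have "\<dots> = \<Omega> ([last l], butlast l) + (\<Sum>j<m. \<eta> ^ Suc j *s (Ap 0 q l \<bullet> wh (up (m - Suc j)) (L.crossings (Suc j)) (vp n) \<bullet> F))"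
        unfolding sum.lessThan_Suc_shift using 0 main by simp
      finally have "?M *s A (Suc m) n l - \<Omega> ([last l], butlast l) = (\<Sum>j<m. \<eta> ^ Suc j *s (Ap 0 q l \<bullet> wh (up (m - Suc j)) (L.crossings (Suc j)) (vp n) \<bullet> F))"
        by (simp del: L.crossings.simps)
      also have "\<dots> \<in> lspan (vp q) (K l) Y \<Omega>" by (intro lspan_sum lspan_scale jr) auto
      finally show ?thesis unfolding tgt .
    qed
    \<comment> \<open>Lists that leave an upward strand free are placed above all others: their
      preimages annihilate every other map, whereas the preimages for full-length lists are
      controlled only on full-length lists of no larger sum.\<close>
    define \<mu> where "\<mu> l = (if length l \<le> m then Suc (Max (sum_list ` Ix (Suc m) n)) else sum_list l)" for l
    fix j assume j: "j \<in> Ix (Suc m) n"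
    show "\<exists>B\<in>hom (tgt (Suc m) n j) X. \<forall>i\<in>Ix (Suc m) n. A (Suc m) n i \<bullet> B = (if i = j then E (Suc m) n i else 0)"
    proof (rule triangular_epi[where \<mu> = \<mu> and I = "Ix (Suc m) n" and A = "A (Suc m) n" and E = "E (Suc m) n"])
      show "finite (Ix (Suc m) n)" by (rule finite_Ix)
      show "j \<in> Ix (Suc m) n" by (rule j)
    next
      fix i assume "i \<in> Ix (Suc m) n"
      then show "A (Suc m) n i \<in> hom X (tgt (Suc m) n i)" "E (Suc m) n i \<bullet> A (Suc m) n i = A (Suc m) n i"
        using A_hom[of i "Suc m" n] E_A[of i "Suc m" n] by (simp_all only: XT)
    next
      fix l assume l: "l \<in> Ix (Suc m) n"
      have len: "length i \<le> m \<or> length i = Suc m" if "i \<in> Ix (Suc m) n" for i using that by (auto simp: Ix_def)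
      have zJ: "([last i], butlast i) \<in> J" and ib: "butlast i @ [last i] = i"
        if i: "i \<in> Ix (Suc m) n" and li: "length i = Suc m" for i
      proof -
        obtain a b where ab: "i = b @ [a]" using li by (cases i rule: rev_cases) auto
        then have "a < k" "b \<in> Ix m n'" using i li by (auto simp: Ix_def n_def sorted_wrt_append)
        then show "([last i], butlast i) \<in> J" by (simp add: J_def IC ab)
        show "butlast i @ [last i] = i" by (simp add: ab)
      qed
      have scale_cancel: "A (Suc m) n i \<bullet> C = 0" if "(?M *s A (Suc m) n i) \<bullet> C = 0" for i C
        using that M0 by (simp add: mul_scale_left del: of_nat_Suc)
      show "\<exists>C\<in>hom (tgt (Suc m) n l) X. A (Suc m) n l \<bullet> C = E (Suc m) n l \<and>
        (\<forall>i\<in>Ix (Suc m) n. i \<noteq> l \<longrightarrow> \<mu> i \<le> \<mu> l \<longrightarrow> A (Suc m) n i \<bullet> C = 0)"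
      proof (cases "length l \<le> m")
        case True
        define r where "r = length l"
        define p where "p = m - r"
        define q where "q = n - r"
        have tgt: "tgt (Suc m) n l = vp q @ up (Suc p)" using True by (simp add: tgt_def p_def q_def r_def Suc_diff_le)
        have El: "E (Suc m) n l = FE q (Suc p)" using True by (simp add: E_def p_def q_def r_def Suc_diff_le)
        have lI: "([], l) \<in> I" using l True by (auto simp: IN Ix_def)
        have Yl: "Y ([], l) = vp q @ up (Suc p)" by (simp add: Y_def tgt_def p_def q_def r_def)
        have EEl: "EE ([], l) = wh [] (FE q p) [U]" by (simp add: EE_def E_def p_def q_def r_def)
        have kill: "y \<bullet> B ([], l) = 0" if "y \<in> lspan Z J Y \<Omega>" for y Z
        proof (rule lspan_kill[OF that])
          fix z assume "z \<in> J"
          then show "\<Omega> z \<bullet> B ([], l) = 0" using B(8)[of z "([], l)"] lI by (auto simp: J_def)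
        qed
        \<comment> \<open>The inverse of the scalar in
          \<open>A (Suc m) n l \<bullet> B ([], l)\<close>: \<open>1 / ?M\<close> comes from
          \<open>MG\<close>, \<open>\<eta> ^ r\<close> from \<open>small\<close> and
          \<open>Suc p\<close> from \<open>coset_FE\<close>.\<close>
        let ?c = "?M * (1 / of_nat (Suc p)) * \<eta> ^ r"
        let ?C = "?c *s (B ([], l) \<bullet> FE q (Suc p))"
        have p0: "(of_nat (Suc p) :: 'a) \<noteq> 0" by (metis of_nat_eq_0_iff nat.distinct(1))
        have sm: "(?M *s A (Suc m) n i) \<bullet> B ([], l) = \<eta> ^ length i *s (wh (vp (n - length i)) (L.coset (m - length i)) [] \<bullet> \<Omega> ([], i) \<bullet> B ([], l))"
          if i: "i \<in> Ix (Suc m) n" "length i \<le> m" for i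
        proof -
          have "?M *s A (Suc m) n i - \<eta> ^ length i *s (wh (vp (n - length i)) (L.coset (m - length i)) [] \<bullet> \<Omega> ([], i)) \<in> lspan (tgt (Suc m) n i) J Y \<Omega>"
            by (rule small[OF i])
          from kill[OF this] show ?thesis by (simp only: mul_diff_left mul_scale_left mul_assoc right_minus_eq)
        qed
        show ?thesis
        proof (intro bexI[of _ ?C] conjI ballI impI)
          show "?C \<in> hom (tgt (Suc m) n l) X"
            unfolding tgt using B(5)[OF lI] by (intro scale_hom mul_hom[OF FE_hom]) (simp add: Yl)
          have "(?M *s A (Suc m) n l) \<bullet> B ([], l) = \<eta> ^ r *s (of_nat (Suc p) *s FE q (Suc p))"
            using sm[OF l True] B(8)[OF lI lI] coset_FE[of q p] by (simp add: EEl r_def p_def q_def del: of_nat_Suc)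
          then have "?M *s (A (Suc m) n l \<bullet> B ([], l)) = (\<eta> ^ r * of_nat (Suc p)) *s FE q (Suc p)"
            by (simp only: mul_scale_left scale_scale)
          from arg_cong[OF this, of "\<lambda>y. (1 / ?M) *s y"]
          have 1: "A (Suc m) n l \<bullet> B ([], l) = (1 / ?M * (\<eta> ^ r * of_nat (Suc p))) *s FE q (Suc p)"
            using M0 by (simp del: of_nat_Suc)
          have "\<eta> ^ r * \<eta> ^ r = 1" using L.char_sq by (simp flip: power_mult_distrib)
          then have 2: "?c * (1 / ?M * (\<eta> ^ r * of_nat (Suc p))) = 1"
          proof -
            have "M * (1 / P) * h * (1 / M * (h * P)) = h * h" if "M \<noteq> 0" "P \<noteq> 0" for M P h :: 'a
              using that by (simp add: field_simps)
            from this[OF M0 p0, of "\<eta> ^ r"] show ?thesis using \<open>\<eta> ^ r * \<eta> ^ r = 1\<close> by (simp only:)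
          qed
          have "A (Suc m) n l \<bullet> ?C = ?c *s ((A (Suc m) n l \<bullet> B ([], l)) \<bullet> FE q (Suc p))"
            by (simp only: mul_scale_right mul_assoc)
          also have "\<dots> = FE q (Suc p)"
            unfolding 1 mul_scale_left FE_idem scale_scale 2 scale_one ..
          finally show "A (Suc m) n l \<bullet> ?C = E (Suc m) n l" by (simp only: El)
        next
          fix i assume i: "i \<in> Ix (Suc m) n" "i \<noteq> l" "\<mu> i \<le> \<mu> l"
          have "A (Suc m) n i \<bullet> B ([], l) = 0"
          proof (rule scale_cancel)
            from len[OF i(1)] show "(?M *s A (Suc m) n i) \<bullet> B ([], l) = 0"
            proof
              assume li: "length i \<le> m"
              then have "([], i) \<in> I" using i(1) by (auto simp: IN Ix_def)
              then show ?thesis using sm[OF i(1) li] B(8)[of "([], i)" "([], l)"] lI i(2) by auto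
            next
              assume li: "length i = Suc m"
              have "\<Omega> ([last i], butlast i) \<bullet> B ([], l) = 0" using B(8)[of "([last i], butlast i)" "([], l)"] lI zJ[OF i(1) li] JI by auto
              moreover have "(?M *s A (Suc m) n i - \<Omega> ([last i], butlast i)) \<bullet> B ([], l) = 0"
                by (rule kill[OF lspan_mono[OF big[OF i(1) li] KJ(1) JI]])
              ultimately show ?thesis by (simp only: mul_diff_left right_minus_eq)
            qed
          qed
          from reassoc[OF this] show "A (Suc m) n i \<bullet> ?C = 0" by (simp add: mul_scale_right)
        qed
      next
        case False
        then have ll: "length l = Suc m" using len[OF l] by simp
        let ?z = "([last l], butlast l)"
        note zl = zJ[OF l ll]
        have zI: "?z \<in> I" using zl JI by blast
        have nm: "n - Suc m = n' - m" by (simp add: n_def)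
        have Yz: "Y ?z = tgt (Suc m) n l" using ll by (simp add: Y_def tgt_def nm)
        have EEz: "EE ?z = E (Suc m) n l" using ll by (simp add: EE_def E_def nm)
        have sl: "sum_list (butlast l) + last l = sum_list l"
          using arg_cong[OF ib[OF l ll], of sum_list] by simp
        have key: "(?M *s A (Suc m) n i) \<bullet> B ?z = (if i = l then E (Suc m) n l else 0)"
          if i: "i \<in> Ix (Suc m) n" "length i = Suc m" "sum_list i \<le> sum_list l" for i
        proof -
          \<comment> \<open>Otherwise \<open>l\<close> has a smaller sum than \<open>i\<close>, or
            \<open>l\<close> arises from \<open>i\<close> by moving an entry to the end past a
            nonempty \<open>v\<close>, which two strictly decreasing lists do not allow.\<close>
          have "?z \<notin> K i"
          proof
            assume "?z \<in> K i"
            then obtain u v \<alpha> where "v \<noteq> []" "i = u @ \<alpha> # v" "last l = \<alpha>" "butlast l = u @ v"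
              using i(3) sl by (auto simp: K_def)
            then have "sorted_wrt (>) (u @ \<alpha> # v)" "sorted_wrt (>) (u @ v @ [\<alpha>])" "v \<noteq> []"
              using i(1) l ib[OF l ll] by (auto simp: Ix_def)
            then show False by (cases v) (auto simp: sorted_wrt_append)
          qed
          then have "(?M *s A (Suc m) n i - \<Omega> ([last i], butlast i)) \<bullet> B ?z = 0"
          proof (intro lspan_kill[OF big[OF i(1,2)]])
            fix w assume "?z \<notin> K i" "w \<in> K i"
            then show "\<Omega> w \<bullet> B ?z = 0" using B(8)[of w ?z] zI KJ(2)[of i] by auto
          qed
          then have "(?M *s A (Suc m) n i) \<bullet> B ?z = \<Omega> ([last i], butlast i) \<bullet> B ?z"
            by (simp only: mul_diff_left right_minus_eq)
          also have "\<dots> = (if ([last i], butlast i) = ?z then EE ([last i], butlast i) else 0)"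
            using B(8)[OF _ zI] zJ[OF i(1,2)] JI by blast
          also have "\<dots> = (if i = l then E (Suc m) n l else 0)"
            using ib[OF i(1,2)] ib[OF l ll] EEz by (metis list.inject prod.inject)
          finally show ?thesis .
        qed
        have \<mu>l: "\<mu> l \<le> Max (sum_list ` Ix (Suc m) n)"
          using l ll finite_Ix by (auto simp: \<mu>_def intro!: Max_ge)
        show ?thesis
        proof (intro bexI[of _ "?M *s B ?z"] conjI ballI impI)
          show "?M *s B ?z \<in> hom (tgt (Suc m) n l) X" using B(5)[OF zI] Yz by (intro scale_hom) simp
          show "A (Suc m) n l \<bullet> (?M *s B ?z) = E (Suc m) n l"
            using key[OF l ll] by (simp add: mul_scale_left mul_scale_right del: of_nat_Suc)
          fix i assume i: "i \<in> Ix (Suc m) n" "i \<noteq> l" "\<mu> i \<le> \<mu> l"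
          have li: "length i = Suc m" using len[OF i(1)] i(3) \<mu>l by (auto simp: \<mu>_def)
          have "sum_list i \<le> sum_list l" using i(3) li ll by (simp add: \<mu>_def)
          from key[OF i(1) li this] i(2) show "A (Suc m) n i \<bullet> (?M *s B ?z) = 0"
            by (simp add: mul_scale_left mul_scale_right del: of_nat_Suc)
        qed
      qed
    qed
  qed
  then show ?thesis by (simp only: n_def)
qed

theorem T_all: "T m n"
proof (induction m arbitrary: n rule: less_induct)
  case (less m)
  show ?case
  proof (cases m)
    case 0 then show ?thesis using T_0 by simp
  next
    case (Suc m')
    then show ?thesis using T_m_0 T_step[of m'] less by (cases n) auto
  qed
qed

end

section \<open>Categories on words as word categories\<close>

definition word_cat :: "('g list, 'm, 'a::field) linmon \<Rightarrow> bool" where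
  "word_cat C \<longleftrightarrow> strict_linear_monoidal C \<and> obs C = UNIV \<and> unt C = [] \<and> tob C = (@)"

lemma zer_in_hom: "word_cat C \<Longrightarrow> zer C X Y \<in> hom C X Y"
  using strict_linear_monoidal.zer_hom[of C X Y] by (simp add: word_cat_def)

text \<open>
  Families of morphisms with finite support are taken over all categories on words at once, so that the type
  depends neither on the category nor on the parameter of the Heisenberg category.
\<close>

typedef (overloaded) ('g, 'm, 'a::field) fam =
  "{v :: ('g list, 'm, 'a) linmon \<Rightarrow> 'g list \<Rightarrow> 'g list \<Rightarrow> 'm.
     (\<forall>C. word_cat C \<longrightarrow> (\<forall>X Y. v C X Y \<in> hom C X Y) \<and> finite {(X, Y). v C X Y \<noteq> zer C X Y}) \<and>
     (\<forall>C. \<not> word_cat C \<longrightarrow> v C = (\<lambda>_ _. undefined))}"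
  morphisms comp fam
proof
  let ?z = "\<lambda>C X Y. if word_cat C then zer C X Y else undefined"
  show "?z \<in> {v. (\<forall>C. word_cat C \<longrightarrow> (\<forall>X Y. v C X Y \<in> hom C X Y) \<and> finite {(X, Y). v C X Y \<noteq> zer C X Y}) \<and>
     (\<forall>C. \<not> word_cat C \<longrightarrow> v C = (\<lambda>_ _. undefined))}"
    by (auto simp: zer_in_hom)
qed

definition supp where "supp C v = {(X, Y). comp v C X Y \<noteq> zer C X Y}"

lemma comp_hom: "word_cat C \<Longrightarrow> comp v C X Y \<in> hom C X Y"
  using comp[of v] by auto

lemma finite_supp: "word_cat C \<Longrightarrow> finite (supp C v)"
  using comp[of v] by (auto simp: supp_def)

text \<open>Outside the categories on words every family is \<open>undefined\<close>, so only those
  categories have to be compared.\<close>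

lemma fam_eqI: "(\<And>C X Y. word_cat C \<Longrightarrow> comp v C X Y = comp w C X Y) \<Longrightarrow> v = w"
proof -
  assume *: "\<And>C X Y. word_cat C \<Longrightarrow> comp v C X Y = comp w C X Y"
  have "comp v C X Y = comp w C X Y" for C X Y
    using * comp[of v] comp[of w] by (cases "word_cat C") auto
  then show ?thesis by (intro comp_inject[THEN iffD1] ext)
qed

lemma comp_fam:
  assumes "\<And>C X Y. word_cat C \<Longrightarrow> v C X Y \<in> hom C X Y"
    and "\<And>C. word_cat C \<Longrightarrow> finite {(X, Y). v C X Y \<noteq> zer C X Y}" and "word_cat C"
  shows "comp (fam (\<lambda>C X Y. if word_cat C then v C X Y else undefined)) C X Y = v C X Y"
  using assms by (subst fam_inverse) auto

context
  fixes C :: "('g list, 'm, 'a::field) linmon"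
  assumes C: "word_cat C"
begin

interpretation S: strict_linear_monoidal C using C by (simp add: word_cat_def)

lemma obs_C: "X \<in> obs C" using C by (simp add: word_cat_def)

lemmas hadd_hom = S.add_hom[OF obs_C obs_C] and hzer_hom = S.zer_hom[OF obs_C obs_C]
  and hscl_hom = S.scl_hom[OF obs_C obs_C] and hcmp_hom = S.cmp_hom[OF obs_C obs_C obs_C]
  and hidm_hom = S.idm_hom[OF obs_C]
  and hadd_assoc = S.add_assoc[OF obs_C obs_C] and hadd_comm = S.add_comm[OF obs_C obs_C]
  and hadd_zer = S.add_zer[OF obs_C obs_C]

lemma htmo_hom: "f \<in> hom C X Y \<Longrightarrow> f' \<in> hom C X' Y' \<Longrightarrow> tmo C f f' \<in> hom C (X @ X') (Y @ Y')"
  using S.tmo_hom[OF obs_C obs_C obs_C obs_C] C by (simp add: word_cat_def)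

lemma hscl_zer: "scl C a (zer C X Y) = zer C X Y"
  by (metis S.scl_mult S.scl_zero hzer_hom mult_zero_right obs_C)

lemma hadd_zer_right: "f \<in> hom C X Y \<Longrightarrow> add C f (zer C X Y) = f"
  using hadd_comm hadd_zer hzer_hom by metis

lemma hadd_neg: "f \<in> hom C X Y \<Longrightarrow> add C (scl C (- 1) f) f = zer C X Y"
  by (metis S.scl_add_left S.scl_one S.scl_zero add.left_inverse obs_C)

lemma hzer_cmp: "f \<in> hom C X Y \<Longrightarrow> cmp C (zer C Y Z) f = zer C X Z"
  by (metis S.cmp_scl_left S.scl_zero hcmp_hom hzer_hom obs_C)

lemma hcmp_zer: "g \<in> hom C Y Z \<Longrightarrow> cmp C g (zer C X Y) = zer C X Z"
  by (metis S.cmp_scl_right S.scl_zero hcmp_hom hzer_hom obs_C)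

end

instantiation fam :: (type, type, field) ab_group_add
begin

definition "0 = fam (\<lambda>C X Y. if word_cat C then zer C X Y else undefined)"
definition "v + w = fam (\<lambda>C X Y. if word_cat C then add C (comp v C X Y) (comp w C X Y) else undefined)"
definition "- v = fam (\<lambda>C X Y. if word_cat C then scl C (- 1) (comp v C X Y) else undefined)"
definition "v - w = v + - (w :: ('a, 'b, 'c) fam)"

lemma comp_zero: "word_cat C \<Longrightarrow> comp 0 C X Y = zer C X Y"
  unfolding zero_fam_def by (rule comp_fam) (auto simp: hzer_hom)

lemma comp_plus: "word_cat C \<Longrightarrow> comp (v + w) C X Y = add C (comp v C X Y) (comp w C X Y)"
  unfolding plus_fam_def
proof (rule comp_fam)
  fix C :: "('a list, 'b, 'c) linmon" assume C: "word_cat C"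
  show "add C (comp v C X Y) (comp w C X Y) \<in> hom C X Y" for X Y by (intro hadd_hom C comp_hom)
  show "finite {(X, Y). add C (comp v C X Y) (comp w C X Y) \<noteq> zer C X Y}"
    by (rule finite_subset[OF _ finite_UnI[OF finite_supp[OF C, of v] finite_supp[OF C, of w]]])
      (auto simp: supp_def hadd_zer[OF C] hzer_hom[OF C])
qed

lemma comp_uminus: "word_cat C \<Longrightarrow> comp (- v) C X Y = scl C (- 1) (comp v C X Y)"
  unfolding uminus_fam_def
proof (rule comp_fam)
  fix C :: "('a list, 'b, 'c) linmon" assume C: "word_cat C"
  show "scl C (- 1) (comp v C X Y) \<in> hom C X Y" for X Y by (intro hscl_hom C comp_hom)
  show "finite {(X, Y). scl C (- 1) (comp v C X Y) \<noteq> zer C X Y}"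
    by (rule finite_subset[OF _ finite_supp[OF C, of v]]) (auto simp: supp_def hscl_zer[OF C])
qed

instance
proof
  fix u v w :: "('a, 'b, 'c) fam"
  show "(u + v) + w = u + (v + w)" by (rule fam_eqI) (simp add: comp_plus hadd_assoc[OF _ comp_hom comp_hom comp_hom])
  show "u + v = v + u" by (rule fam_eqI) (metis comp_plus hadd_comm comp_hom)
  show "0 + v = v" by (rule fam_eqI) (simp add: comp_plus comp_zero hadd_zer comp_hom)
  show "- v + v = 0" by (rule fam_eqI) (simp add: comp_plus comp_zero comp_uminus hadd_neg comp_hom)
qed (simp add: minus_fam_def)

end

definition scale :: "'a::field \<Rightarrow> ('g, 'm, 'a) fam \<Rightarrow> ('g, 'm, 'a) fam" where
  "scale a v = fam (\<lambda>C X Y. if word_cat C then scl C a (comp v C X Y) else undefined)"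

lemma comp_scale:
  fixes v :: "('g, 'm, 'a::field) fam"
  shows "word_cat C \<Longrightarrow> comp (scale a v) C X Y = scl C a (comp v C X Y)"
  unfolding scale_def
proof (rule comp_fam)
  fix C :: "('g list, 'm, 'a) linmon" assume C: "word_cat C"
  show "scl C a (comp v C X Y) \<in> hom C X Y" for X Y by (intro hscl_hom C comp_hom)
  show "finite {(X, Y). scl C a (comp v C X Y) \<noteq> zer C X Y}"
    by (rule finite_subset[OF _ finite_supp[OF C, of v]]) (auto simp: supp_def hscl_zer[OF C])
qed

lemma vector_space_scale: "vector_space (scale :: 'a::field \<Rightarrow> ('g, 'm, 'a) fam \<Rightarrow> _)"
proof
  fix a b :: "'a::field" and v w :: "('g, 'm, 'a::field) fam"
  note S = strict_linear_monoidal.scl_add_right strict_linear_monoidal.scl_add_left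
    strict_linear_monoidal.scl_mult strict_linear_monoidal.scl_one
  show "scale a (v + w) = scale a v + scale a w"
  proof (rule fam_eqI)
    fix C :: "('g list, 'm, 'a::field) linmon" and X Y assume C: "word_cat C"
    then interpret strict_linear_monoidal C by (simp add: word_cat_def)
    show "comp (scale a (v + w)) C X Y = comp (scale a v + scale a w) C X Y"
      using scl_add_right[OF obs_C[OF C] obs_C[OF C] comp_hom[OF C] comp_hom[OF C]] by (simp add: comp_plus comp_scale C)
  qed
  show "scale (a + b) v = scale a v + scale b v"
  proof (rule fam_eqI)
    fix C :: "('g list, 'm, 'a::field) linmon" and X Y assume C: "word_cat C"
    then interpret strict_linear_monoidal C by (simp add: word_cat_def)
    show "comp (scale (a + b) v) C X Y = comp (scale a v + scale b v) C X Y"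
      using scl_add_left[OF obs_C[OF C] obs_C[OF C] comp_hom[OF C]] by (simp add: comp_plus comp_scale C)
  qed
  show "scale a (scale b v) = scale (a * b) v"
  proof (rule fam_eqI)
    fix C :: "('g list, 'm, 'a::field) linmon" and X Y assume C: "word_cat C"
    then interpret strict_linear_monoidal C by (simp add: word_cat_def)
    show "comp (scale a (scale b v)) C X Y = comp (scale (a * b) v) C X Y"
      using scl_mult[OF obs_C[OF C] obs_C[OF C] comp_hom[OF C]] by (simp add: comp_scale C)
  qed
  show "scale 1 v = v"
  proof (rule fam_eqI)
    fix C :: "('g list, 'm, 'a::field) linmon" and X Y assume C: "word_cat C"
    then interpret strict_linear_monoidal C by (simp add: word_cat_def)
    show "comp (scale 1 v) C X Y = comp v C X Y"
      using scl_one[OF obs_C[OF C] obs_C[OF C] comp_hom[OF C]] by (simp add: comp_scale C)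
  qed
qed

interpretation fam: vector_space scale by (rule vector_space_scale)

text \<open>Embeds the morphism spaces of one category into the common vector space; by
  \<open>single_inject\<close> nothing is lost.\<close>

definition single :: "('g list, 'm, 'a::field) linmon \<Rightarrow> 'g list \<Rightarrow> 'g list \<Rightarrow> 'm \<Rightarrow> ('g, 'm, 'a) fam" where
  "single C X Y F = fam (\<lambda>C' X' Y'. if word_cat C' then (if C' = C \<and> X' = X \<and> Y' = Y then F else zer C' X' Y') else undefined)"

lemma comp_single: "F \<in> hom C X Y \<Longrightarrow> word_cat C' \<Longrightarrow>
  comp (single C X Y F) C' X' Y' = (if C' = C \<and> X' = X \<and> Y' = Y then F else zer C' X' Y')"
  unfolding single_def
  by (rule comp_fam) (auto simp: hzer_hom intro: finite_subset[of _ "{(X, Y)}"])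

text \<open>Operations on families are extended additively from single morphisms, the finite support
  making the sum finite. Only the component at \<open>C\<close> is read.\<close>

definition lin where "lin C \<phi> v = (\<Sum>(X, Y)\<in>supp C v. \<phi> X Y (comp v C X Y))"

section \<open>Total composition and whiskering on families\<close>

context
  fixes C :: "('g list, 'm, 'a::field) linmon"
  assumes C: "word_cat C"
begin

interpretation S: strict_linear_monoidal C using C by (simp add: word_cat_def)

lemma single_add: "F \<in> hom C X Y \<Longrightarrow> G \<in> hom C X Y \<Longrightarrow> single C X Y (add C F G) = single C X Y F + single C X Y G"
  by (rule fam_eqI) (auto simp: comp_single comp_plus hadd_hom[OF C] hadd_zer hzer_hom)

lemma single_zer: "single C X Y (zer C X Y) = 0"
  by (rule fam_eqI) (auto simp: comp_single comp_zero hzer_hom[OF C])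

lemma single_scl: "F \<in> hom C X Y \<Longrightarrow> single C X Y (scl C a F) = scale a (single C X Y F)"
  by (rule fam_eqI) (auto simp: comp_single comp_scale hscl_hom[OF C] hscl_zer)

lemma single_inject: "F \<in> hom C X Y \<Longrightarrow> G \<in> hom C X Y \<Longrightarrow> single C X Y F = single C X Y G \<longleftrightarrow> F = G"
  using comp_single[of F C X Y C X Y] comp_single[of G C X Y C X Y] C by metis

definition additive_on where "additive_on \<phi> \<longleftrightarrow> (\<forall>X Y. \<phi> X Y (zer C X Y) = 0) \<and>
  (\<forall>X Y. \<forall>F\<in>hom C X Y. \<forall>G\<in>hom C X Y. \<phi> X Y (add C F G) = \<phi> X Y F + (\<phi> X Y G :: ('g, 'm, 'a) fam))"

lemma lin_eq: "additive_on \<phi> \<Longrightarrow> finite T \<Longrightarrow> supp C v \<subseteq> T \<Longrightarrow> lin C \<phi> v = (\<Sum>(X, Y)\<in>T. \<phi> X Y (comp v C X Y))"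
  unfolding lin_def by (rule sum.mono_neutral_left) (auto simp: supp_def additive_on_def)

lemma lin_add: assumes "additive_on \<phi>" shows "lin C \<phi> (v + w) = lin C \<phi> v + lin C \<phi> w"
proof -
  let ?T = "supp C v \<union> supp C w"
  have fin: "finite ?T" using finite_supp[OF C] by blast
  have "supp C (v + w) \<subseteq> ?T" by (auto simp: supp_def comp_plus C hadd_zer[OF C] hzer_hom[OF C])
  from lin_eq[OF assms fin this] lin_eq[OF assms fin, of v] lin_eq[OF assms fin, of w] show ?thesis
    using assms comp_hom[OF C] by (simp add: comp_plus C additive_on_def sum.distrib split_def)
qed

lemma lin_single: "additive_on \<phi> \<Longrightarrow> F \<in> hom C X Y \<Longrightarrow> lin C \<phi> (single C X Y F) = \<phi> X Y F"
proof -
  assume \<phi>: "additive_on \<phi>" and F: "F \<in> hom C X Y"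
  have "supp C (single C X Y F) \<subseteq> {(X, Y)}" using F by (auto simp: supp_def comp_single C)
  from lin_eq[OF \<phi> _ this] show ?thesis using F by (simp add: comp_single C)
qed

lemma lin_cong: "comp v C = comp w C \<Longrightarrow> lin C \<phi> v = lin C \<phi> w"
  by (simp add: lin_def supp_def)

text \<open>A family also has components in the other categories, which the operations of
  \<open>C\<close> ignore. Dropping them leaves a finite sum of single morphisms.\<close>

definition part :: "('g, 'm, 'a) fam \<Rightarrow> ('g, 'm, 'a) fam" where "part = lin C (single C)"

lemma comp_part: "comp (part v) C = comp v C"
proof -
  have "comp (\<Sum>(X, Y)\<in>T. single C X Y (comp v C X Y)) C A B = (if (A, B) \<in> T then comp v C A B else zer C A B)"
    if "finite T" for T A B
    using that
  proof (induction T)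
    case empty then show ?case by (simp add: comp_zero C)
  next
    case (insert z T)
    obtain X Y where z: "z = (X, Y)" by force
    show ?case using insert comp_hom[OF C, of v] hzer_hom[OF C]
      by (auto simp: z comp_plus C comp_single hadd_zer[OF C] hadd_zer_right[OF C])
  qed
  from this[OF finite_supp[OF C]] show ?thesis unfolding part_def lin_def
    by (intro ext) (auto simp: supp_def)
qed

text \<open>Only \<open>part v\<close> is a sum of single morphisms. The last premise returns from
  it to \<open>v\<close>; for the operations of \<open>C\<close> it follows from
  \<open>lin_cong\<close>.\<close>

lemma part_induct:
  assumes "\<And>X Y F. F \<in> hom C X Y \<Longrightarrow> P (single C X Y F)" "\<And>v w. P v \<Longrightarrow> P w \<Longrightarrow> P (v + w)" "P 0"
    "P (part v) \<Longrightarrow> P v"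
  shows "P v"
proof -
  have "P (\<Sum>(X, Y)\<in>T. single C X Y (comp v C X Y))" if "finite T" for T
    using that by (induction T) (auto intro!: assms(1-3) comp_hom C)
  then show ?thesis using finite_supp[OF C] by (auto intro!: assms(4) simp: part_def lin_def)
qed

text \<open>Components whose middle objects differ contribute zero, which makes composition total,
  bilinear and associative without typing.\<close>

definition fmul :: "('g, 'm, 'a) fam \<Rightarrow> ('g, 'm, 'a) fam \<Rightarrow> ('g, 'm, 'a) fam" where
  "fmul g f = lin C (\<lambda>X Y F. lin C (\<lambda>Y' Z G. if Y' = Y then single C X Z (cmp C G F) else 0) g) f"

definition fwh :: "'g list \<Rightarrow> ('g, 'm, 'a) fam \<Rightarrow> 'g list \<Rightarrow> ('g, 'm, 'a) fam" where
  "fwh Z f W = lin C (\<lambda>X Y F. single C (Z @ X @ W) (Z @ Y @ W) (tmo C (tmo C (idm C Z) F) (idm C W))) f"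

definition fone where "fone X = single C X X (idm C X)"
definition fhom where "fhom X Y = single C X Y ` hom C X Y"

lemma tob_C: "tob C X Y = X @ Y" and unt_C: "unt C = []"
  using C by (auto simp: word_cat_def)

lemma inner_additive: "F \<in> hom C X Y \<Longrightarrow> additive_on (\<lambda>Y' Z G. if Y' = Y then single C X Z (cmp C G F) else 0)"
  unfolding additive_on_def
  by (auto simp: hzer_cmp[OF C] single_zer S.cmp_add_left[OF obs_C[OF C] obs_C[OF C] obs_C[OF C]] single_add hcmp_hom[OF C])

lemma outer_additive: "additive_on (\<lambda>X Y F. lin C (\<lambda>Y' Z G. if Y' = Y then single C X Z (cmp C G F) else 0) g)"
  unfolding additive_on_def
proof (intro conjI allI ballI)
  fix X Y
  have "lin C (\<lambda>Y' Z G. if Y' = Y then single C X Z (cmp C G (zer C X Y)) else 0) g = (\<Sum>z\<in>supp C g. 0)"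
    unfolding lin_def by (rule sum.cong) (auto simp: hcmp_zer[OF C comp_hom[OF C]] single_zer)
  then show "lin C (\<lambda>Y' Z G. if Y' = Y then single C X Z (cmp C G (zer C X Y)) else 0) g = 0" by simp
  fix F G assume "F \<in> hom C X Y" "G \<in> hom C X Y"
  then show "lin C (\<lambda>Y' Z Ga. if Y' = Y then single C X Z (cmp C Ga (add C F G)) else 0) g =
       lin C (\<lambda>Y' Z G. if Y' = Y then single C X Z (cmp C G F) else 0) g + lin C (\<lambda>Y' Z Ga. if Y' = Y then single C X Z (cmp C Ga G) else 0) g"
    unfolding lin_def sum.distrib[symmetric]
    by (intro sum.cong) (auto simp: S.cmp_add_right[OF obs_C[OF C] obs_C[OF C] obs_C[OF C] _ _ comp_hom[OF C]] single_add hcmp_hom[OF C] comp_hom[OF C])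
qed

lemma fmul_single: "F \<in> hom C X Y \<Longrightarrow> G \<in> hom C Y' Z \<Longrightarrow>
  fmul (single C Y' Z G) (single C X Y F) = (if Y' = Y then single C X Z (cmp C G F) else 0)"
  unfolding fmul_def by (simp add: lin_single[OF outer_additive] lin_single[OF inner_additive])

lemma fmul_add_right: "fmul g (f + f') = fmul g f + fmul g f'"
  unfolding fmul_def by (rule lin_add[OF outer_additive])

lemma fmul_add_left: "fmul (g + g') f = fmul g f + fmul g' f"
  unfolding fmul_def lin_def[of C _ f]
  by (simp add: sum.distrib[symmetric] split_def lin_add[OF inner_additive] comp_hom[OF C])

lemma fmul_zero: "fmul g 0 = 0" "fmul 0 f = 0"
  using fmul_add_right[of g 0 0] fmul_add_left[of 0 0 f] by simp_all

lemma fmul_part: "fmul (part g) f = fmul g f" "fmul g (part f) = fmul g f"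
  unfolding fmul_def lin_cong[OF comp_part] by (rule HOL.refl)+

lemma wh_additive: "additive_on (\<lambda>X Y F. single C (Z @ X @ W) (Z @ Y @ W) (tmo C (tmo C (idm C Z) F) (idm C W)))"
proof -
  have z: "tmo C (tmo C (idm C Z) (zer C X Y)) (idm C W) = zer C (Z @ X @ W) (Z @ Y @ W)" for X Y
    using S.tmo_scl_right[OF obs_C[OF C] obs_C[OF C] obs_C[OF C] obs_C[OF C] hidm_hom[OF C, of Z] hzer_hom[OF C, of X Y], of 0]
      S.tmo_scl_left[OF obs_C[OF C] obs_C[OF C] obs_C[OF C] obs_C[OF C] htmo_hom[OF C hidm_hom[OF C, of Z] hzer_hom[OF C, of X Y]] hidm_hom[OF C, of W], of 0]
      S.scl_zero[OF obs_C[OF C] obs_C[OF C] hzer_hom[OF C, of X Y]]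
      S.scl_zero[OF obs_C[OF C] obs_C[OF C] htmo_hom[OF C hidm_hom[OF C, of Z] hzer_hom[OF C, of X Y]]]
      S.scl_zero[OF obs_C[OF C] obs_C[OF C] htmo_hom[OF C htmo_hom[OF C hidm_hom[OF C, of Z] hzer_hom[OF C, of X Y]] hidm_hom[OF C, of W]]]
    by simp
  have a: "tmo C (tmo C (idm C Z) (add C F G)) (idm C W)
     = add C (tmo C (tmo C (idm C Z) F) (idm C W)) (tmo C (tmo C (idm C Z) G) (idm C W))"
    if "F \<in> hom C X Y" "G \<in> hom C X Y" for X Y F G
    using S.tmo_add_right[OF obs_C[OF C] obs_C[OF C] obs_C[OF C] obs_C[OF C] hidm_hom[OF C, of Z] that]
      S.tmo_add_left[OF obs_C[OF C] obs_C[OF C] obs_C[OF C] obs_C[OF C] htmo_hom[OF C hidm_hom[OF C, of Z] that(1)]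
        htmo_hom[OF C hidm_hom[OF C, of Z] that(2)] hidm_hom[OF C, of W]] by simp
  have h: "tmo C (tmo C (idm C Z) F) (idm C W) \<in> hom C (Z @ X @ W) (Z @ Y @ W)" if "F \<in> hom C X Y" for X Y F
    using htmo_hom[OF C htmo_hom[OF C hidm_hom[OF C] that] hidm_hom[OF C]] by simp
  show ?thesis unfolding additive_on_def using h by (simp add: z a single_zer single_add)
qed

lemma fwh_single: "F \<in> hom C X Y \<Longrightarrow>
  fwh Z (single C X Y F) W = single C (Z @ X @ W) (Z @ Y @ W) (tmo C (tmo C (idm C Z) F) (idm C W))"
  unfolding fwh_def by (rule lin_single[OF wh_additive])

lemma fwh_add: "fwh Z (f + f') W = fwh Z f W + fwh Z f' W"
  unfolding fwh_def by (rule lin_add[OF wh_additive])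

lemma fwh_zero: "fwh Z 0 W = 0"
  using fwh_add[of Z 0 0 W] by simp

lemma fwh_part: "fwh Z (part f) W = fwh Z f W"
  unfolding fwh_def by (rule lin_cong[OF comp_part])

lemma fwh_hom0: "F \<in> hom C X Y \<Longrightarrow> tmo C (tmo C (idm C Z) F) (idm C W) \<in> hom C (Z @ X @ W) (Z @ Y @ W)"
  using htmo_hom[OF C htmo_hom[OF C hidm_hom[OF C] ] hidm_hom[OF C]] by simp

end

context
  fixes C :: "('g list, 'm, 'a::field_char_0) linmon"
  assumes C: "word_cat C"
begin

interpretation S: strict_linear_monoidal C using C by (simp add: word_cat_def)

lemmas aux = obs_C[OF C] hidm_hom[OF C] hcmp_hom[OF C] htmo_hom[OF C] fwh_hom0[OF C]

lemma fmul_cong: "comp g C = comp g' C \<Longrightarrow> comp f C = comp f' C \<Longrightarrow> fmul C g f = fmul C g' f'"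
  unfolding fmul_def[OF C] by (simp only: lin_cong[OF C, of g g'] lin_cong[OF C, of f f'])

lemma fwh_cong: "comp f C = comp f' C \<Longrightarrow> fwh C Z f W = fwh C Z f' W"
  unfolding fwh_def[OF C] by (rule lin_cong[OF C])

lemma comp_scale_part: "comp (scale a (part C v)) C = comp (scale a v) C"
  by (intro ext) (simp add: comp_scale C comp_part)

lemma fmul_scale_left: "fmul C (scale a g) f = scale a (fmul C g f)"
proof (rule part_induct[OF C, of _ g])
  fix X Y F assume F: "F \<in> hom C X Y"
  show "fmul C (scale a (single C X Y F)) f = scale a (fmul C (single C X Y F) f)"
  proof (rule part_induct[OF C, of _ f])
    fix X' Y' F' assume F': "F' \<in> hom C X' Y'"
    show "fmul C (scale a (single C X Y F)) (single C X' Y' F') = scale a (fmul C (single C X Y F) (single C X' Y' F'))"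
      using F F' S.cmp_scl_left[OF obs_C[OF C] obs_C[OF C] obs_C[OF C] F'] hcmp_hom[OF C]
      by (auto simp: single_scl[OF C, symmetric] fmul_single[OF C] hscl_hom[OF C])
  qed (simp_all add: fmul_add_right[OF C] fam.scale_right_distrib fmul_zero[OF C] fmul_part[OF C])
next
  fix v w assume "fmul C (scale a v) f = scale a (fmul C v f)" "fmul C (scale a w) f = scale a (fmul C w f)"
  then show "fmul C (scale a (v + w)) f = scale a (fmul C (v + w) f)"
    by (simp add: fmul_add_left[OF C] fam.scale_right_distrib)
next
  assume "fmul C (scale a (part C g)) f = scale a (fmul C (part C g) f)"
  then show "fmul C (scale a g) f = scale a (fmul C g f)"
    using fmul_cong[OF comp_scale_part HOL.refl, of a g f] by (simp add: fmul_part[OF C])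
qed (simp add: fmul_zero[OF C])

lemma fmul_scale_right: "fmul C g (scale a f) = scale a (fmul C g f)"
proof (rule part_induct[OF C, of _ f])
  fix X Y F assume F: "F \<in> hom C X Y"
  show "fmul C g (scale a (single C X Y F)) = scale a (fmul C g (single C X Y F))"
  proof (rule part_induct[OF C, of _ g])
    fix X' Y' F' assume F': "F' \<in> hom C X' Y'"
    show "fmul C (single C X' Y' F') (scale a (single C X Y F)) = scale a (fmul C (single C X' Y' F') (single C X Y F))"
      using F F' S.cmp_scl_right[OF obs_C[OF C] obs_C[OF C] obs_C[OF C] F] hcmp_hom[OF C]
      by (auto simp: single_scl[OF C, symmetric] fmul_single[OF C] hscl_hom[OF C])
  qed (simp_all add: fmul_add_left[OF C] fam.scale_right_distrib fmul_zero[OF C] fmul_part[OF C])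
next
  fix v w assume "fmul C g (scale a v) = scale a (fmul C g v)" "fmul C g (scale a w) = scale a (fmul C g w)"
  then show "fmul C g (scale a (v + w)) = scale a (fmul C g (v + w))"
    by (simp add: fmul_add_right[OF C] fam.scale_right_distrib)
next
  assume "fmul C g (scale a (part C f)) = scale a (fmul C g (part C f))"
  then show "fmul C g (scale a f) = scale a (fmul C g f)"
    using fmul_cong[OF HOL.refl comp_scale_part, of g a f] by (simp add: fmul_part[OF C])
qed (simp add: fmul_zero[OF C])

lemma tmo_scl: "F \<in> hom C X Y \<Longrightarrow> tmo C (tmo C (idm C Z) (scl C a F)) (idm C W) = scl C a (tmo C (tmo C (idm C Z) F) (idm C W))"
  using S.tmo_scl_right[OF obs_C[OF C] obs_C[OF C] obs_C[OF C] obs_C[OF C] hidm_hom[OF C, of Z], of F X Y a]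
    S.tmo_scl_left[OF obs_C[OF C] obs_C[OF C] obs_C[OF C] obs_C[OF C] htmo_hom[OF C hidm_hom[OF C, of Z], of F X Y] hidm_hom[OF C, of W], of a]
  by simp

lemma fwh_scale: "fwh C Z (scale a f) W = scale a (fwh C Z f W)"
proof (rule part_induct[OF C, of _ f])
  fix X Y F assume F: "F \<in> hom C X Y"
  show "fwh C Z (scale a (single C X Y F)) W = scale a (fwh C Z (single C X Y F) W)"
    using F by (simp add: single_scl[OF C, symmetric] fwh_single[OF C] hscl_hom[OF C] tmo_scl fwh_hom0[OF C])
next
  fix v w assume "fwh C Z (scale a v) W = scale a (fwh C Z v W)" "fwh C Z (scale a w) W = scale a (fwh C Z w W)"
  then show "fwh C Z (scale a (v + w)) W = scale a (fwh C Z (v + w) W)"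
    by (simp add: fwh_add[OF C] fam.scale_right_distrib)
next
  assume "fwh C Z (scale a (part C f)) W = scale a (fwh C Z (part C f) W)"
  then show "fwh C Z (scale a f) W = scale a (fwh C Z f W)"
    using fwh_cong[OF comp_scale_part, of Z a f W] by (simp add: fwh_part[OF C])
qed (simp add: fwh_zero[OF C])

lemma fmul_assoc: "fmul C (fmul C h g) f = fmul C h (fmul C g f)"
proof (rule part_induct[OF C, of _ h])
  fix X3 Y3 F3 assume F3: "F3 \<in> hom C X3 Y3"
  show "fmul C (fmul C (single C X3 Y3 F3) g) f = fmul C (single C X3 Y3 F3) (fmul C g f)"
  proof (rule part_induct[OF C, of _ g])
    fix X2 Y2 F2 assume F2: "F2 \<in> hom C X2 Y2"
    show "fmul C (fmul C (single C X3 Y3 F3) (single C X2 Y2 F2)) f = fmul C (single C X3 Y3 F3) (fmul C (single C X2 Y2 F2) f)"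
    proof (rule part_induct[OF C, of _ f])
      fix X1 Y1 F1 assume F1: "F1 \<in> hom C X1 Y1"
      show "fmul C (fmul C (single C X3 Y3 F3) (single C X2 Y2 F2)) (single C X1 Y1 F1)
        = fmul C (single C X3 Y3 F3) (fmul C (single C X2 Y2 F2) (single C X1 Y1 F1))"
        using F1 F2 F3 S.cmp_assoc[OF obs_C[OF C] obs_C[OF C] obs_C[OF C] obs_C[OF C] F1]
        by (auto simp: fmul_single[OF C] hcmp_hom[OF C] fmul_zero[OF C])
    qed (simp_all add: fmul_add_right[OF C] fmul_zero[OF C] fmul_part[OF C])
  qed (simp_all add: fmul_add_right[OF C] fmul_add_left[OF C] fmul_zero[OF C] fmul_part[OF C])
qed (simp_all add: fmul_add_left[OF C] fmul_zero[OF C] fmul_part[OF C])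

lemma tmo_tmo_cmp: "F \<in> hom C X Y \<Longrightarrow> G \<in> hom C Y Y' \<Longrightarrow>
  tmo C (tmo C (idm C Z) (cmp C G F)) (idm C W) = cmp C (tmo C (tmo C (idm C Z) G) (idm C W)) (tmo C (tmo C (idm C Z) F) (idm C W))"
proof -
  assume F: "F \<in> hom C X Y" and G: "G \<in> hom C Y Y'"
  have i: "cmp C (idm C Z) (idm C Z) = idm C Z" for Z using S.idm_left[OF obs_C[OF C] obs_C[OF C] hidm_hom[OF C]] .
  have 1: "tmo C (idm C Z) (cmp C G F) = cmp C (tmo C (idm C Z) G) (tmo C (idm C Z) F)"
    using S.tmo_cmp[OF obs_C[OF C] obs_C[OF C] obs_C[OF C] obs_C[OF C] obs_C[OF C] obs_C[OF C] hidm_hom[OF C, of Z] hidm_hom[OF C, of Z] F G] by (simp add: i)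
  show ?thesis unfolding 1
    using S.tmo_cmp[OF obs_C[OF C] obs_C[OF C] obs_C[OF C] obs_C[OF C] obs_C[OF C] obs_C[OF C]
      htmo_hom[OF C hidm_hom[OF C, of Z] F] htmo_hom[OF C hidm_hom[OF C, of Z] G] hidm_hom[OF C, of W] hidm_hom[OF C, of W]] by (simp add: i)
qed

lemma fwh_mul: "fwh C Z (fmul C g f) W = fmul C (fwh C Z g W) (fwh C Z f W)"
proof (rule part_induct[OF C, of _ g])
  fix X2 Y2 F2 assume F2: "F2 \<in> hom C X2 Y2"
  show "fwh C Z (fmul C (single C X2 Y2 F2) f) W = fmul C (fwh C Z (single C X2 Y2 F2) W) (fwh C Z f W)"
  proof (rule part_induct[OF C, of _ f])
    fix X1 Y1 F1 assume F1: "F1 \<in> hom C X1 Y1"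
    show "fwh C Z (fmul C (single C X2 Y2 F2) (single C X1 Y1 F1)) W = fmul C (fwh C Z (single C X2 Y2 F2) W) (fwh C Z (single C X1 Y1 F1) W)"
      using F1 F2 tmo_tmo_cmp[OF F1, of F2]
      by (auto simp: fmul_single[OF C] hcmp_hom[OF C] fwh_zero[OF C] fwh_single[OF C] fwh_hom0[OF C])
  qed (simp_all add: fmul_add_right[OF C] fmul_zero[OF C] fmul_part[OF C] fwh_add[OF C] fwh_zero[OF C] fwh_part[OF C])
qed (simp_all add: fmul_add_left[OF C] fmul_zero[OF C] fmul_part[OF C] fwh_add[OF C] fwh_zero[OF C] fwh_part[OF C])

lemma tmo_idm_C: "tmo C (idm C X) (idm C Y) = idm C (X @ Y)"
  using S.tmo_idm[OF obs_C[OF C] obs_C[OF C]] by (simp add: tob_C[OF C])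

lemma tmo_assoc_C: "f \<in> hom C X Y \<Longrightarrow> f' \<in> hom C X' Y' \<Longrightarrow> f'' \<in> hom C X'' Y'' \<Longrightarrow>
  tmo C (tmo C f f') f'' = tmo C f (tmo C f' f'')"
  by (rule S.tmo_assoc[OF obs_C[OF C] obs_C[OF C] obs_C[OF C] obs_C[OF C] obs_C[OF C] obs_C[OF C]])

lemma fwh_fwh: "fwh C Z (fwh C Z' f W') W = fwh C (Z @ Z') f (W' @ W)"
proof (rule part_induct[OF C, of _ f])
  fix X Y F assume F: "F \<in> hom C X Y"
  note i = hidm_hom[OF C]
  have "tmo C (tmo C (idm C Z) (tmo C (tmo C (idm C Z') F) (idm C W'))) (idm C W)
    = tmo C (tmo C (tmo C (tmo C (idm C Z) (idm C Z')) F) (idm C W')) (idm C W)"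
    using tmo_assoc_C[OF i[of Z] htmo_hom[OF C i[of Z'] F] i[of W']] tmo_assoc_C[OF i[of Z] i[of Z'] F] by simp
  also have "\<dots> = tmo C (tmo C (idm C (Z @ Z')) F) (idm C (W' @ W))"
    using tmo_assoc_C[OF htmo_hom[OF C i[of "Z @ Z'"] F] i[of W'] i[of W]] by (simp add: tmo_idm_C)
  finally show "fwh C Z (fwh C Z' (single C X Y F) W') W = fwh C (Z @ Z') (single C X Y F) (W' @ W)"
    using F fwh_hom0[OF C F, of Z' W'] by (simp add: fwh_single[OF C])
qed (simp_all add: fwh_add[OF C] fwh_zero[OF C] fwh_part[OF C])

lemma tmo_unit_C: "F \<in> hom C X Y \<Longrightarrow> tmo C (idm C []) F = F" "F \<in> hom C X Y \<Longrightarrow> tmo C F (idm C []) = F"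
  using S.tmo_unt_left[OF obs_C[OF C] obs_C[OF C]] S.tmo_unt_right[OF obs_C[OF C] obs_C[OF C]] by (simp_all add: unt_C[OF C])

text \<open>The laws without typing premises are multilinear and were checked on single morphisms by
  \<open>part_induct\<close>. Unit laws and interchange hold on \<open>fhom\<close>, whose elements
  are single morphisms.\<close>

theorem word_category_fam: "word_category scale (fhom C) (fone C) (fmul C) (fwh C)"
proof (intro word_category.intro vector_space_scale word_category_axioms.intro)
  fix X Y
  show "fam.subspace (fhom C X Y)"
  proof (rule fam.subspaceI)
    show "0 \<in> fhom C X Y" unfolding fhom_def[OF C] using hzer_hom[OF C] single_zer[OF C] by (metis image_eqI)
    fix v w assume "v \<in> fhom C X Y" "w \<in> fhom C X Y"
    then show "v + w \<in> fhom C X Y" unfolding fhom_def[OF C]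
      by (auto simp: single_add[OF C, symmetric] intro!: imageI hadd_hom[OF C])
  next
    fix a v assume "v \<in> fhom C X Y"
    then show "scale a v \<in> fhom C X Y" unfolding fhom_def[OF C]
      by (auto simp: single_scl[OF C, symmetric] intro!: imageI hscl_hom[OF C])
  qed
next
  fix X show "fone C X \<in> fhom C X X" unfolding fhom_def[OF C] fone_def[OF C] by (intro imageI hidm_hom[OF C])
next
  fix f g X Y Z assume "f \<in> fhom C X Y" "g \<in> fhom C Y Z"
  then show "fmul C g f \<in> fhom C X Z" unfolding fhom_def[OF C]
    by (auto simp: fmul_single[OF C] intro!: imageI hcmp_hom[OF C])
next
  fix f X Y Z W assume "f \<in> fhom C X Y"
  then show "fwh C Z f W \<in> fhom C (Z @ X @ W) (Z @ Y @ W)" unfolding fhom_def[OF C]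
    by (auto simp: fwh_single[OF C] intro!: imageI fwh_hom0[OF C])
next
  fix f X Y assume "f \<in> fhom C X Y"
  then obtain F where F: "f = single C X Y F" "F \<in> hom C X Y" by (auto simp: fhom_def[OF C])
  show "fmul C (fone C Y) f = f" "fmul C f (fone C X) = f" "fwh C [] f [] = f"
    using F(2) S.idm_left[OF obs_C[OF C] obs_C[OF C] F(2)] S.idm_right[OF obs_C[OF C] obs_C[OF C] F(2)] htmo_hom[OF C hidm_hom[OF C, of "[]"] F(2)]
    by (simp_all add: F(1) fone_def[OF C] fmul_single[OF C] hidm_hom[OF C] fwh_single[OF C] tmo_unit_C)
next
  fix X Z W show "fwh C Z (fone C X) W = fone C (Z @ X @ W)"
    by (simp add: fone_def[OF C] fwh_single[OF C] hidm_hom[OF C] tmo_idm_C)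
next
  fix f g X Y X' Y' assume "f \<in> fhom C X Y" "g \<in> fhom C X' Y'"
  then obtain F G where F: "f = single C X Y F" "F \<in> hom C X Y" and G: "g = single C X' Y' G" "G \<in> hom C X' Y'"
    by (auto simp: fhom_def[OF C])
  note o = obs_C[OF C] and i = hidm_hom[OF C]
  have "cmp C (tmo C F (idm C Y')) (tmo C (idm C X) G) = tmo C F G" "cmp C (tmo C (idm C Y) G) (tmo C F (idm C X')) = tmo C F G"
    using S.tmo_cmp[OF o o o o o o i[of X] F(2) G(2) i[of Y']] S.tmo_cmp[OF o o o o o o F(2) i[of Y] i[of X'] G(2)]
      S.idm_left[OF o o F(2)] S.idm_right[OF o o F(2)] S.idm_left[OF o o G(2)] S.idm_right[OF o o G(2)] by simp_all
  then show "fmul C (fwh C [] f Y') (fwh C X g []) = fmul C (fwh C Y g []) (fwh C [] f X')"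
    using htmo_hom[OF C i[of X] G(2)] htmo_hom[OF C i[of Y] G(2)] htmo_hom[OF C F(2) i[of X']] htmo_hom[OF C F(2) i[of Y']]
      htmo_hom[OF C i[of "[]"] F(2)]
    by (simp add: F(1) G(1) fwh_single[OF C] F(2) G(2) tmo_unit_C[OF F(2)] tmo_unit_C[OF G(2)]
      tmo_unit_C(2)[OF htmo_hom[OF C i[of X] G(2)]] tmo_unit_C(2)[OF htmo_hom[OF C i[of Y] G(2)]] fmul_single[OF C])
qed (simp_all add: fmul_assoc fmul_add_left[OF C] fmul_add_right[OF C] fmul_scale_left fmul_scale_right
  fwh_add[OF C] fwh_scale fwh_mul fwh_fwh)

end

section \<open>Consequences of the Heisenberg relations\<close>

locale duality = word_category scale hom one mul wh
  for scale :: "'a::field_char_0 \<Rightarrow> 'v::ab_group_add \<Rightarrow> 'v" (infixr \<open>*s\<close> 75)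
    and hom :: "'g list \<Rightarrow> 'g list \<Rightarrow> 'v set" and one :: "'g list \<Rightarrow> 'v"
    and mul :: "'v \<Rightarrow> 'v \<Rightarrow> 'v" (infixr \<open>\<bullet>\<close> 70)
    and wh :: "'g list \<Rightarrow> 'v \<Rightarrow> 'g list \<Rightarrow> 'v" +
  fixes U D :: 'g and c d :: 'v
  assumes c_hom: "c \<in> hom [] [D, U]" and d_hom: "d \<in> hom [U, D] []"
    and zig_up: "wh [] d [U] \<bullet> wh [U] c [] = one [U]"
    and zig_down: "wh [D] d [] \<bullet> wh [] c [D] = one [D]"
begin

abbreviation up where "up n \<equiv> replicate n U"
abbreviation dn where "dn n \<equiv> replicate n D"

primrec cupn :: "nat \<Rightarrow> 'v" where
  "cupn 0 = one []"
| "cupn (Suc n) = wh [D] (cupn n) [U] \<bullet> c"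

primrec capn :: "nat \<Rightarrow> 'v" where
  "capn 0 = one []"
| "capn (Suc n) = d \<bullet> wh [U] (capn n) [D]"

lemma cupn_hom: "cupn n \<in> hom [] (dn n @ up n)"
proof (induction n)
  case 0 then show ?case using one_hom[of "[]"] by simp
next
  case (Suc n)
  show ?case unfolding cupn.simps by (rule mul_hom[OF c_hom]) (auto intro!: wh_homI[OF Suc])
qed

lemma capn_hom: "capn n \<in> hom (up n @ dn n) []"
proof (induction n)
  case 0 then show ?case using one_hom[of "[]"] by simp
next
  case (Suc n)
  show ?case unfolding capn.simps by (rule mul_hom[OF _ d_hom]) (auto intro!: wh_homI[OF Suc])
qed

text \<open>The recursion splits off the outermost cup. The zigzag proofs need the innermost one
  split off, so that the inner caps can be cancelled by induction.\<close>

lemma cupn_alt: "cupn (Suc n) = wh (dn n) c (up n) \<bullet> cupn n"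
proof (induction n)
  case 0
  then show ?case using one_left[OF c_hom] one_right[OF c_hom] by (simp add: wh_one wh_Nil[OF c_hom])
next
  case (Suc n)
  have "cupn (Suc (Suc n)) = wh [D] (cupn (Suc n)) [U] \<bullet> c" by simp
  also have "\<dots> = wh [D] (wh (dn n) c (up n) \<bullet> cupn n) [U] \<bullet> c" by (simp only: Suc)
  also have "\<dots> = wh (dn (Suc n)) c (up (Suc n)) \<bullet> cupn (Suc n)" by (simp add: wh_mul wh_wh mul_assoc)
  finally show ?case .
qed

lemma cup_1: "cupn (Suc 0) = c"
  using one_left[OF c_hom] by (simp add: wh_one)

lemma cup_2: "cupn (Suc (Suc 0)) = wh [D] c [U] \<bullet> c"
  using one_left[OF c_hom] by (simp add: wh_one)

lemma cap_2: "capn (Suc (Suc 0)) = d \<bullet> wh [U] d [D]"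
  using one_right[OF d_hom] by (simp add: wh_one)

lemma zigzag_up: "wh [] (capn n) (up n) \<bullet> wh (up n) (cupn n) [] = one (up n)"
proof (induction n)
  case 0 then show ?case by (simp add: wh_one one_left[OF one_hom])
next
  case (Suc n)
  have 1: "wh [U] (capn n) (D # U # up n) \<bullet> wh (U # up n @ dn n) c (up n)
      = wh [U] c (up n) \<bullet> wh [U] (capn n) (up n)"
    using exchange[OF capn_hom[of n] c_hom, of "[U]" "[]" "up n"] by simp
  have 2: "wh [U] (capn n) (up n) \<bullet> wh (U # up n) (cupn n) [] = one (U # up n)"
    using arg_cong[OF Suc, of "\<lambda>f. wh [U] f []"] by (simp add: wh_mul wh_wh wh_one)
  have 3: "wh [] d (U # up n) \<bullet> wh [U] c (up n) = one (U # up n)"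
    using arg_cong[OF zig_up, of "\<lambda>f. wh [] f (up n)"] by (simp add: wh_mul wh_wh wh_one)
  have 4: "wh [U] c (up n) \<bullet> one (U # up n) = wh [U] c (up n)"
    by (rule one_right[of _ _ "U # D # U # up n"], rule wh_homI[OF c_hom]) simp_all
  show ?case unfolding cupn_alt
    by (simp add: wh_mul wh_wh mul_assoc reassoc[OF 1] 2 3 4 del: cupn.simps)
qed

lemma zigzag_down: "wh (dn n) (capn n) [] \<bullet> wh [] (cupn n) (dn n) = one (dn n)"
proof (induction n)
  case 0 then show ?case by (simp add: wh_one one_left[OF one_hom])
next
  case (Suc n)
  have 1: "wh (D # dn n @ [U]) (capn n) [D] \<bullet> wh (dn n) c (up n @ D # dn n)
      = wh (dn n) c [D] \<bullet> wh (dn n) (capn n) [D]"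
    using exchange[OF c_hom capn_hom[of n], of "dn n" "[]" "[D]"] by simp
  have 2: "wh (dn n) (capn n) [D] \<bullet> wh [] (cupn n) (D # dn n) = one (D # dn n)"
    using arg_cong[OF Suc, of "\<lambda>f. wh [] f [D]"] by (simp add: wh_mul wh_wh wh_one)
  have 3: "wh (D # dn n) d [] \<bullet> wh (dn n) c [D] = one (D # dn n)"
    using arg_cong[OF zig_down, of "\<lambda>f. wh (dn n) f []"] by (simp add: wh_mul wh_wh wh_one)
  have 4: "wh (dn n) c [D] \<bullet> one (D # dn n) = wh (dn n) c [D]"
    by (rule one_right[of _ _ "dn n @ [D, U, D]"], rule wh_homI[OF c_hom]) simp_all
  show ?case unfolding cupn_alt
    by (simp add: wh_mul wh_wh mul_assoc reassoc[OF 1] 2 3 4 del: cupn.simps)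
qed

text \<open>Morphisms with downward source strands are compared by bending these strands to the target.\<close>

lemma bend:
  assumes F: "F \<in> hom (X @ dn n) Y" and G: "G \<in> hom (X @ dn n) Y"
    and eq: "wh [] F (up n) \<bullet> wh X (cupn n) [] = wh [] G (up n) \<bullet> wh X (cupn n) []"
  shows "F = G"
proof -
  have *: "H = wh Y (capn n) [] \<bullet> wh [] (wh [] H (up n) \<bullet> wh X (cupn n) []) (dn n)"
    if H: "H \<in> hom (X @ dn n) Y" for H
  proof -
    have "H = wh [] H [] \<bullet> wh X (wh (dn n) (capn n) [] \<bullet> wh [] (cupn n) (dn n)) []"
      by (simp add: zigzag_down wh_one wh_Nil[OF H] one_right[OF H])
    also have "\<dots> = (wh [] H [] \<bullet> wh (X @ dn n) (capn n) []) \<bullet> wh X (cupn n) (dn n)"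
      by (simp add: wh_mul wh_wh mul_assoc)
    also have "\<dots> = (wh Y (capn n) [] \<bullet> wh [] H (up n @ dn n)) \<bullet> wh X (cupn n) (dn n)"
      using interchange[OF H capn_hom[of n]] by simp
    finally show ?thesis by (simp add: wh_mul wh_wh mul_assoc)
  qed
  show ?thesis using *[OF F] *[OF G] eq by simp
qed

text \<open>The mate with respect to nested cups and caps. It reverses products and also the order
  of the strands.\<close>

definition dual where
  "dual n f = wh (dn n) (capn n) [] \<bullet> wh (dn n) f (dn n) \<bullet> wh [] (cupn n) (dn n)"

lemma dual_hom: "f \<in> hom (up n) (up n) \<Longrightarrow> dual n f \<in> hom (dn n) (dn n)"
  unfolding dual_def
  by (intro mul_hom[of _ _ "dn n @ up n @ dn n"]) (auto intro!: wh_homI[OF cupn_hom] wh_homI[OF capn_hom] wh_homI)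

lemma dual_cup:
  assumes f: "f \<in> hom (up n) (up n)"
  shows "wh [] (dual n f) (up n) \<bullet> cupn n = wh (dn n) f [] \<bullet> cupn n"
proof -
  have 1: "wh [] (cupn n) (dn n @ up n) \<bullet> cupn n = wh (dn n @ up n) (cupn n) [] \<bullet> cupn n"
    using interchange[OF cupn_hom[of n] cupn_hom[of n]] by (simp add: wh_Nil[OF cupn_hom])
  have 2: "wh (dn n) f (dn n @ up n) \<bullet> wh (dn n @ up n) (cupn n) [] = wh (dn n @ up n) (cupn n) [] \<bullet> wh (dn n) f []"
    using exchange[OF f cupn_hom[of n], of "dn n" "[]" "[]"] by simp
  have 3: "wh (dn n) (capn n) (up n) \<bullet> wh (dn n @ up n) (cupn n) [] = one (dn n @ up n)"
    using arg_cong[OF zigzag_up[of n], of "\<lambda>f. wh (dn n) f []"] by (simp add: wh_mul wh_wh wh_one)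
  have 4: "one (dn n @ up n) \<bullet> wh (dn n) f [] = wh (dn n) f []"
    by (rule one_left[of _ "dn n @ up n"], rule wh_homI[OF f]) simp_all
  show ?thesis unfolding dual_def
    by (simp add: wh_mul wh_wh mul_assoc 1 reassoc[OF 2] reassoc[OF 3] reassoc[OF 4])
qed

lemma dual_cap:
  assumes f: "f \<in> hom (up n) (up n)"
  shows "capn n \<bullet> wh (up n) (dual n f) [] = capn n \<bullet> wh [] f (dn n)"
proof -
  have 1: "capn n \<bullet> wh (up n @ dn n) (capn n) [] = capn n \<bullet> wh [] (capn n) (up n @ dn n)"
    using interchange[OF capn_hom[of n] capn_hom[of n]] by (simp add: wh_Nil[OF capn_hom])
  have 2: "wh [] (capn n) (up n @ dn n) \<bullet> wh (up n @ dn n) f (dn n) = wh [] f (dn n) \<bullet> wh [] (capn n) (up n @ dn n)"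
    using exchange[OF capn_hom[of n] f, of "[]" "[]" "dn n"] by simp
  have 3: "wh [] (capn n) (up n @ dn n) \<bullet> wh (up n) (cupn n) (dn n) = one (up n @ dn n)"
    using arg_cong[OF zigzag_up[of n], of "\<lambda>f. wh [] f (dn n)"] by (simp add: wh_mul wh_wh wh_one)
  have 4: "wh [] f (dn n) \<bullet> one (up n @ dn n) = wh [] f (dn n)"
    by (rule one_right[of _ _ "up n @ dn n"], rule wh_homI[OF f]) simp_all
  show ?thesis unfolding dual_def
    by (simp add: wh_mul wh_wh mul_assoc reassoc[OF 1] reassoc[OF 2] 3 4)
qed

text \<open>By \<open>bend\<close> a mate is determined by its effect on the nested cups; the rules
  for products and tensor factors below are all verified there.\<close>

lemma dual_eqI:
  assumes "f \<in> hom (up n) (up n)" "g \<in> hom (dn n) (dn n)"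
    and "wh [] g (up n) \<bullet> cupn n = wh (dn n) f [] \<bullet> cupn n"
  shows "dual n f = g"
  using bend[of "dual n f" "[]" n "dn n" g] dual_hom[OF assms(1)] assms(2,3) dual_cup[OF assms(1)]
  by (simp add: wh_Nil[OF cupn_hom])

lemma dual_one: "dual n (one (up n)) = one (dn n)"
  by (rule dual_eqI) (auto simp: one_hom wh_one)

lemma dual_add: "dual n (f + g) = dual n f + dual n g"
  and dual_scale: "dual n (a *s f) = a *s dual n f"
  unfolding dual_def by (simp_all add: distribs)

lemma dual_mul:
  assumes f: "f \<in> hom (up n) (up n)" and g: "g \<in> hom (up n) (up n)"
  shows "dual n (g \<bullet> f) = dual n f \<bullet> dual n g"
proof (rule dual_eqI)
  have 1: "wh [] (dual n f) (up n) \<bullet> wh (dn n) g [] = wh (dn n) g [] \<bullet> wh [] (dual n f) (up n)"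
    using exchange[OF dual_hom[OF f] g, of "[]" "[]" "[]"] by simp
  show "wh [] (dual n f \<bullet> dual n g) (up n) \<bullet> cupn n = wh (dn n) (g \<bullet> f) [] \<bullet> cupn n"
    by (simp add: wh_mul mul_assoc dual_cup f g reassoc[OF 1])
qed (auto intro: mul_hom f g dual_hom)

lemma dual_right:
  assumes f: "f \<in> hom (up n) (up n)"
  shows "dual (Suc n) (wh [] f [U]) = wh [D] (dual n f) []"
proof (rule dual_eqI)
  show "wh [] f [U] \<in> hom (up (Suc n)) (up (Suc n))" by (rule wh_homI[OF f]) simp_all
  show "wh [D] (dual n f) [] \<in> hom (dn (Suc n)) (dn (Suc n))" by (rule wh_homI[OF dual_hom[OF f]]) simp_all
  have 1: "wh [D] (dual n f) (U # up n) \<bullet> wh [D] (cupn n) [U] = wh (D # dn n) f [U] \<bullet> wh [D] (cupn n) [U]"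
    using arg_cong[OF dual_cup[OF f], of "\<lambda>f. wh [D] f [U]"] by (simp add: wh_mul wh_wh)
  show "wh [] (wh [D] (dual n f) []) (up (Suc n)) \<bullet> cupn (Suc n) = wh (dn (Suc n)) (wh [] f [U]) [] \<bullet> cupn (Suc n)"
    by (simp add: wh_mul wh_wh mul_assoc reassoc[OF 1])
qed

lemma dual_left:
  assumes f: "f \<in> hom (up n) (up n)"
  shows "dual (Suc n) (wh [U] f []) = wh [] (dual n f) [D]"
proof (rule dual_eqI)
  show "wh [U] f [] \<in> hom (up (Suc n)) (up (Suc n))" by (rule wh_homI[OF f]) simp_all
  show "wh [] (dual n f) [D] \<in> hom (dn (Suc n)) (dn (Suc n))" by (rule wh_homI[OF dual_hom[OF f]]) simp_all
  have 1: "wh [] (dual n f) (D # U # up n) \<bullet> wh (dn n) c (up n) = wh (dn n) c (up n) \<bullet> wh [] (dual n f) (up n)"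
    using exchange[OF dual_hom[OF f] c_hom, of "[]" "[]" "up n"] by simp
  have 2: "wh (dn n) c (up n) \<bullet> wh (dn n) f [] = wh (D # dn n @ [U]) f [] \<bullet> wh (dn n) c (up n)"
    using exchange[OF c_hom f, of "dn n" "[]" "[]"] by simp
  show "wh [] (wh [] (dual n f) [D]) (up (Suc n)) \<bullet> cupn (Suc n) = wh (dn (Suc n)) (wh [U] f []) [] \<bullet> cupn (Suc n)"
    unfolding cupn_alt by (simp add: wh_mul wh_wh mul_assoc reassoc[OF 1] dual_cup[OF f] reassoc[OF 2])
qed

end

locale heis_rels = duality scale hom one mul wh U D c d
  for scale :: "'a::field_char_0 \<Rightarrow> 'v::ab_group_add \<Rightarrow> 'v" (infixr \<open>*s\<close> 75)
    and hom :: "'g list \<Rightarrow> 'g list \<Rightarrow> 'v set" and one :: "'g list \<Rightarrow> 'v"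
    and mul :: "'v \<Rightarrow> 'v \<Rightarrow> 'v" (infixr \<open>\<bullet>\<close> 70)
    and wh :: "'g list \<Rightarrow> 'v \<Rightarrow> 'g list \<Rightarrow> 'v"
    and U D c d +
  fixes x s :: 'v
  assumes x_hom: "x \<in> hom [U] [U]" and s_hom: "s \<in> hom [U, U] [U, U]"
    and s_sq: "s \<bullet> s = one [U, U]"
    and braid: "wh [] s [U] \<bullet> wh [U] s [] \<bullet> wh [] s [U] = wh [U] s [] \<bullet> wh [] s [U] \<bullet> wh [U] s []"
    and s_dot: "s \<bullet> wh [] x [U] = wh [U] x [] \<bullet> s + one [U, U]"
begin

lemma strandsU: "\<chi> * \<chi> = 1 \<Longrightarrow> strands scale hom one mul wh U s \<chi>"
  by unfold_locales (use s_hom s_sq braid in auto)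

definition t where "t = wh [D, U] d [] \<bullet> wh [D] s [D] \<bullet> wh [] c [U, D]"
definition sD where "sD = dual (Suc (Suc 0)) s"
definition xD where "xD = dual (Suc 0) x"

lemma t_hom: "t \<in> hom [U, D] [D, U]"
  unfolding t_def
  by (rule mul_hom[of _ _ "[D, U, U, D]"], rule mul_hom[of _ _ "[D, U, U, D]"])
    (auto intro!: wh_homI[OF c_hom] wh_homI[OF d_hom] wh_homI[OF s_hom])

lemma s_hom': "s \<in> hom (up (Suc (Suc 0))) (up (Suc (Suc 0)))" using s_hom by simp
lemma x_hom': "x \<in> hom (up (Suc 0)) (up (Suc 0))" using x_hom by simp

lemma sD_hom: "sD \<in> hom [D, D] [D, D]" using dual_hom[OF s_hom'] by (simp add: sD_def)
lemma xD_hom: "xD \<in> hom [D] [D]" using dual_hom[OF x_hom'] by (simp add: xD_def)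

lemma sD_cup: "wh [] sD [U, U] \<bullet> wh [D] c [U] \<bullet> c = wh [D, D] s [] \<bullet> wh [D] c [U] \<bullet> c"
  using dual_cup[OF s_hom'] by (simp add: sD_def[symmetric] cup_2 del: cupn.simps)

lemma xD_cup: "wh [] xD [U] \<bullet> c = wh [D] x [] \<bullet> c"
  using dual_cup[OF x_hom'] by (simp add: xD_def[symmetric] cup_1 del: cupn.simps)

lemma cap_s: "d \<bullet> wh [U] d [D] \<bullet> wh [] s [D, D] = d \<bullet> wh [U] d [D] \<bullet> wh [U, U] sD []"
  using dual_cap[OF s_hom'] by (simp add: sD_def[symmetric] cap_2 mul_assoc del: capn.simps)

lemma bend1:
  assumes "F \<in> hom (X @ [D]) Y" "G \<in> hom (X @ [D]) Y"
    and "wh [] F [U] \<bullet> wh X c [] = wh [] G [U] \<bullet> wh X c []"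
  shows "F = G"
  using bend[of F X "Suc 0" Y G] assms by (simp add: cup_1 del: cupn.simps)

lemma bend2:
  assumes "F \<in> hom (X @ [D, D]) Y" "G \<in> hom (X @ [D, D]) Y"
    and "wh [] F [U, U] \<bullet> wh (X @ [D]) c [U] \<bullet> wh X c [] = wh [] G [U, U] \<bullet> wh (X @ [D]) c [U] \<bullet> wh X c []"
  shows "F = G"
  using bend[of F X "Suc (Suc 0)" Y G] assms by (simp add: cup_2 wh_mul wh_wh del: cupn.simps)

text \<open>Nested duality reverses the order of the strands, hence \<open>a\<close> and
  \<open>b\<close> change sides.\<close>

lemma dual_s: "dual (Suc (Suc (a + b))) (wh (up a) s (up b)) = wh (dn b) sD (dn a)"
proof (induction b)
  case 0
  show ?case
  proof (induction a)
    case 0 then show ?case by (simp add: sD_def[symmetric] wh_Nil[OF s_hom] wh_Nil[OF sD_hom])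
  next
    case (Suc a)
    have "wh (up a) s [] \<in> hom (up (Suc (Suc a))) (up (Suc (Suc a)))" by (rule wh_homI[OF s_hom]) simp_all
    from dual_left[OF this] show ?case using Suc by (simp add: wh_wh)
  qed
next
  case (Suc b)
  have "wh (up a) s (up b) \<in> hom (up (Suc (Suc (a + b)))) (up (Suc (Suc (a + b))))" by (rule wh_homI[OF s_hom]) simp_all
  from dual_right[OF this] show ?case using Suc by (simp add: wh_wh)
qed

lemma sD_sq: "sD \<bullet> sD = one [D, D]"
  using dual_mul[OF s_hom' s_hom'] dual_one[of "Suc (Suc 0)"] s_sq by (simp add: sD_def)

text \<open>Both sides of the braid relation are palindromes, so reversing products does nothing to
  them, and reversing the strands exchanges the two sides.\<close>

lemma sD_braid: "wh [] sD [D] \<bullet> wh [D] sD [] \<bullet> wh [] sD [D] = wh [D] sD [] \<bullet> wh [] sD [D] \<bullet> wh [D] sD []"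
proof -
  let ?n = "Suc (Suc (Suc 0))"
  have h: "wh [] s [U] \<in> hom (up ?n) (up ?n)" "wh [U] s [] \<in> hom (up ?n) (up ?n)"
    by (rule wh_homI[OF s_hom]; simp)+
  have e: "dual ?n (wh [] s [U]) = wh [D] sD []" "dual ?n (wh [U] s []) = wh [] sD [D]"
    using dual_s[of 0 "Suc 0"] dual_s[of "Suc 0" 0] by simp_all
  have "dual ?n (wh [] s [U] \<bullet> wh [U] s [] \<bullet> wh [] s [U]) = dual ?n (wh [U] s [] \<bullet> wh [] s [U] \<bullet> wh [U] s [])"
    by (simp only: braid)
  then show ?thesis
    by (simp only: dual_mul[OF mul_hom[OF h(1) h(2)] h(1)] dual_mul[OF mul_hom[OF h(2) h(1)] h(2)]
      dual_mul[OF h(1) h(2)] dual_mul[OF h(2) h(1)] e mul_assoc)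
qed

lemma strandsD: "\<chi> * \<chi> = 1 \<Longrightarrow> strands scale hom one mul wh D sD \<chi>"
  by unfold_locales (use sD_hom sD_sq sD_braid in auto)

text \<open>Mates send a word to a reversed word with the same character value and exchange left
  with right absorption.\<close>

lemma proj_dual:
  assumes \<chi>: "\<chi> * \<chi> = 1" and e: "proj U s \<chi> n e"
  shows "proj D sD \<chi> n (dual n e)"
proof -
  interpret L: strands scale hom one mul wh U s \<chi> by (rule strandsU[OF \<chi>])
  interpret R: strands scale hom one mul wh D sD \<chi> by (rule strandsD[OF \<chi>])
  have pol: "pol D sD \<chi> n (dual n w) \<kappa>" if "pol U s \<chi> n w \<kappa>" for w \<kappa> using that
  proof (induction rule: pol.induct)
    case (pol_one n) then show ?case by (simp add: dual_one pol.pol_one)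
  next
    case (pol_mul n w \<kappa> a b)
    have S: "wh (up a) s (up b) \<in> hom (up n) (up n)" using L.s_homI[OF pol_mul.hyps(2)] .
    have "dual n (wh (up a) s (up b) \<bullet> w) = dual n w \<bullet> wh (dn b) sD (dn a)"
      using dual_mul[OF L.pol_hom[OF pol_mul.hyps(1)] S] dual_s[of a b] pol_mul.hyps(2) by simp
    moreover have "pol D sD \<chi> n (wh (dn b) sD (dn a)) \<chi>" using pol_mul.hyps(2) by (intro R.pol_s) simp
    ultimately show ?case using R.pol_prod[OF pol_mul.IH, of "wh (dn b) sD (dn a)" \<chi>] by (simp add: mult.commute)
  qed (auto simp: dual_add dual_scale intro: pol.intros)
  have e_hom: "e \<in> hom (up n) (up n)" using L.proj_hom[OF e] .
  have S: "wh (up b) s (up a) \<in> hom (up n) (up n)" "dual n (wh (up b) s (up a)) = wh (dn a) sD (dn b)"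
    if "n = Suc (Suc (a + b))" for a b
    using L.s_homI[of n b a] dual_s[of b a] that by (simp_all add: add.commute)
  show ?thesis unfolding proj_def labs_def rabs_def
  proof (intro conjI allI impI)
    show "pol D sD \<chi> n (dual n e) 1" using pol e by (simp add: proj_def)
    fix a b assume n: "n = Suc (Suc (a + b))"
    have 1: "wh (up b) s (up a) \<bullet> e = \<chi> *s e" "e \<bullet> wh (up b) s (up a) = \<chi> *s e"
      using e n by (auto simp: proj_def labs_def rabs_def add.commute)
    show "wh ([] @ dn a) sD (dn b @ []) \<bullet> dual n e = \<chi> *s dual n e"
      using dual_mul[OF S(1)[OF n] e_hom] by (simp add: 1 S(2)[OF n] dual_scale)
    show "dual n e \<bullet> wh ([] @ dn a) sD (dn b @ []) = \<chi> *s dual n e"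
      using dual_mul[OF e_hom S(1)[OF n]] by (simp add: 1 S(2)[OF n] dual_scale)
  qed
qed

text \<open>One zigzag undoes the rotation by which \<open>t\<close> was made from \<open>s\<close>.
  Bending strands and applying this reduces relations for \<open>t\<close> to relations for
  \<open>s\<close>.\<close>

lemma cross_cup: "wh [] t [U] \<bullet> wh [U] c [] = wh [D] s [] \<bullet> wh [] c [U]"
proof -
  have 1: "wh [] c [U, D, U] \<bullet> wh [U] c [] = wh [D, U, U] c [] \<bullet> wh [] c [U]"
    using exchange[OF c_hom c_hom, of "[]" "[U]" "[]"] by simp
  have 2: "wh [D] s [D, U] \<bullet> wh [D, U, U] c [] = wh [D, U, U] c [] \<bullet> wh [D] s []"
    using exchange[OF s_hom c_hom, of "[D]" "[]" "[]"] by simp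
  have 3: "wh [D, U] d [U] \<bullet> wh [D, U, U] c [] = one [D, U, U]"
    using arg_cong[OF zig_up, of "\<lambda>f. wh [D, U] f []"] by (simp add: wh_mul wh_wh wh_one)
  have "wh [D] s [] \<in> hom [D, U, U] [D, U, U]" by (rule wh_homI[OF s_hom]) simp_all
  note 4 = one_left[OF this]
  show ?thesis by (simp add: t_def wh_mul wh_wh mul_assoc 1 reassoc[OF 2] reassoc[OF 3] reassoc[OF 4])
qed

lemma wh_cong: assumes "f = g" shows "wh Z f W = wh Z g W" using assms by simp

lemma t_homI: "A = Z @ [U, D] @ W \<Longrightarrow> B = Z @ [D, U] @ W \<Longrightarrow> wh Z t W \<in> hom A B" by (rule wh_homI[OF t_hom])

lemmas homs = wh_homI[OF s_hom] wh_homI[OF sD_hom] wh_homI[OF x_hom] wh_homI[OF xD_hom]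
  wh_homI[OF c_hom] wh_homI[OF d_hom] t_homI s_hom sD_hom x_hom xD_hom c_hom d_hom t_hom

text \<open>With the downward strand bent, both sides become three crossings of upward strands after
  a cup, and the claim is the braid relation.\<close>

lemma slideU: "wh [D] s [] \<bullet> wh [] t [U] \<bullet> wh [U] t [] = wh [] t [U] \<bullet> wh [U] t [] \<bullet> wh [] s [D]"
proof (rule bend1[of _ "[U, U]" "[D, U, U]"])
  show "wh [D] s [] \<bullet> wh [] t [U] \<bullet> wh [U] t [] \<in> hom ([U, U] @ [D]) [D, U, U]"
    by (rule mul_hom[of _ _ "[D, U, U]"], rule mul_hom[of _ _ "[U, D, U]"]) (auto intro!: homs)
  show "wh [] t [U] \<bullet> wh [U] t [] \<bullet> wh [] s [D] \<in> hom ([U, U] @ [D]) [D, U, U]"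
    by (rule mul_hom[of _ _ "[U, D, U]"], rule mul_hom[of _ _ "[U, U, D]"]) (auto intro!: homs)
  have K1: "wh [U] t [U] \<bullet> wh [U, U] c [] = wh [U, D] s [] \<bullet> wh [U] c [U]"
    and K2: "wh [] t [U, U] \<bullet> wh [U] c [U] = wh [D] s [U] \<bullet> wh [] c [U, U]"
    using wh_cong[OF cross_cup, of "[U]" "[]"] wh_cong[OF cross_cup, of "[]" "[U]"] by (simp_all add: wh_mul wh_wh)
  have e1: "wh [] t [U, U] \<bullet> wh [U, D] s [] = wh [D, U] s [] \<bullet> wh [] t [U, U]"
    using exchange[OF t_hom s_hom, of "[]" "[]" "[]"] by simp
  have e2: "wh [] s [D, U] \<bullet> wh [U, U] c [] = wh [U, U] c [] \<bullet> s"
    using exchange[OF s_hom c_hom, of "[]" "[]" "[]"] by (simp add: wh_Nil[OF s_hom])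
  have e3: "wh [] c [U, U] \<bullet> s = wh [D, U] s [] \<bullet> wh [] c [U, U]"
    using exchange[OF c_hom s_hom, of "[]" "[]" "[]"] by (simp add: wh_Nil[OF s_hom])
  have b: "wh [D] s [U] \<bullet> wh [D, U] s [] \<bullet> wh [D] s [U] = wh [D, U] s [] \<bullet> wh [D] s [U] \<bullet> wh [D, U] s []"
    using wh_cong[OF braid, of "[D]" "[]"] by (simp add: wh_mul wh_wh)
  have "wh [] (wh [D] s [] \<bullet> wh [] t [U] \<bullet> wh [U] t []) [U] \<bullet> wh [U, U] c []
      = (wh [D] s [U] \<bullet> wh [D, U] s [] \<bullet> wh [D] s [U]) \<bullet> wh [] c [U, U]"
    by (simp add: wh_mul wh_wh mul_assoc K1 reassoc[OF e1] K2)
  also have "\<dots> = wh [] (wh [] t [U] \<bullet> wh [U] t [] \<bullet> wh [] s [D]) [U] \<bullet> wh [U, U] c []"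
    unfolding b by (simp add: wh_mul wh_wh mul_assoc e2 reassoc[OF K1] reassoc[OF e1] reassoc[OF K2] e3)
  finally show "wh [] (wh [D] s [] \<bullet> wh [] t [U] \<bullet> wh [U] t []) [U] \<bullet> wh [U, U] c []
      = wh [] (wh [] t [U] \<bullet> wh [U] t [] \<bullet> wh [] s [D]) [U] \<bullet> wh [U, U] c []" .
qed

text \<open>Here two downward strands are bent; \<open>sD_cup\<close> turns \<open>sD\<close> into
  \<open>s\<close>, and the braid relation decides again.\<close>

lemma slideV: "wh [] sD [U] \<bullet> wh [D] t [] \<bullet> wh [] t [D] = wh [D] t [] \<bullet> wh [] t [D] \<bullet> wh [U] sD []"
proof (rule bend2[of _ "[U]" "[D, D, U]"])
  show "wh [] sD [U] \<bullet> wh [D] t [] \<bullet> wh [] t [D] \<in> hom ([U] @ [D, D]) [D, D, U]"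
    by (rule mul_hom[of _ _ "[D, D, U]"], rule mul_hom[of _ _ "[D, U, D]"]) (auto intro!: homs)
  show "wh [D] t [] \<bullet> wh [] t [D] \<bullet> wh [U] sD [] \<in> hom ([U] @ [D, D]) [D, D, U]"
    by (rule mul_hom[of _ _ "[D, U, D]"], rule mul_hom[of _ _ "[U, D, D]"]) (auto intro!: homs)
  have e1: "wh [] t [D, U, U] \<bullet> wh [U, D] c [U] = wh [D, U] c [U] \<bullet> wh [] t [U]"
    using exchange[OF t_hom c_hom, of "[]" "[]" "[U]"] by simp
  have K: "wh [D] t [U, U] \<bullet> wh [D, U] c [U] = wh [D, D] s [U] \<bullet> wh [D] c [U, U]"
    using wh_cong[OF cross_cup, of "[D]" "[U]"] by (simp add: wh_mul wh_wh)
  have e2: "wh [D] c [U, U] \<bullet> wh [D] s [] = wh [D, D, U] s [] \<bullet> wh [D] c [U, U]"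
    using exchange[OF c_hom s_hom, of "[D]" "[]" "[]"] by simp
  have T: "wh [D] t [U, U] \<bullet> wh [] t [D, U, U] \<bullet> wh [U, D] c [U] \<bullet> wh [U] c []
      = wh [D, D] s [U] \<bullet> wh [D, D, U] s [] \<bullet> wh [D] c [U, U] \<bullet> wh [] c [U]"
    by (simp add: reassoc[OF e1] cross_cup reassoc[OF K] reassoc[OF e2] mul_assoc)
  have e3: "wh [] sD [U, U, U] \<bullet> wh [D, D] s [U] = wh [D, D] s [U] \<bullet> wh [] sD [U, U, U]"
    using exchange[OF sD_hom s_hom, of "[]" "[]" "[U]"] by simp
  have e4: "wh [] sD [U, U, U] \<bullet> wh [D, D, U] s [] = wh [D, D, U] s [] \<bullet> wh [] sD [U, U, U]"
    using exchange[OF sD_hom s_hom, of "[]" "[U]" "[]"] by simp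
  have S1: "wh [] sD [U, U, U] \<bullet> wh [D] c [U, U] \<bullet> wh [] c [U] = wh [D, D] s [U] \<bullet> wh [D] c [U, U] \<bullet> wh [] c [U]"
    using wh_cong[OF sD_cup, of "[]" "[U]"] by (simp add: wh_mul wh_wh)
  have S2: "wh [U] sD [U, U] \<bullet> wh [U, D] c [U] \<bullet> wh [U] c [] = wh [U, D, D] s [] \<bullet> wh [U, D] c [U] \<bullet> wh [U] c []"
    using wh_cong[OF sD_cup, of "[U]" "[]"] by (simp add: wh_mul wh_wh)
  have e5: "wh [] t [D, U, U] \<bullet> wh [U, D, D] s [] = wh [D, U, D] s [] \<bullet> wh [] t [D, U, U]"
    using exchange[OF t_hom s_hom, of "[]" "[D]" "[]"] by simp
  have e6: "wh [D] t [U, U] \<bullet> wh [D, U, D] s [] = wh [D, D, U] s [] \<bullet> wh [D] t [U, U]"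
    using exchange[OF t_hom s_hom, of "[D]" "[]" "[]"] by simp
  have b: "wh [D, D] s [U] \<bullet> wh [D, D, U] s [] \<bullet> wh [D, D] s [U] = wh [D, D, U] s [] \<bullet> wh [D, D] s [U] \<bullet> wh [D, D, U] s []"
    using wh_cong[OF braid, of "[D, D]" "[]"] by (simp add: wh_mul wh_wh)
  have "wh [] (wh [] sD [U] \<bullet> wh [D] t [] \<bullet> wh [] t [D]) [U, U] \<bullet> wh ([U] @ [D]) c [U] \<bullet> wh [U] c []
     = (wh [D, D] s [U] \<bullet> wh [D, D, U] s [] \<bullet> wh [D, D] s [U]) \<bullet> wh [D] c [U, U] \<bullet> wh [] c [U]"
    by (simp add: wh_mul wh_wh mul_assoc T reassoc[OF e3] reassoc[OF e4] S1)
  also have "\<dots> = wh [] (wh [D] t [] \<bullet> wh [] t [D] \<bullet> wh [U] sD []) [U, U] \<bullet> wh ([U] @ [D]) c [U] \<bullet> wh [U] c []"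
    unfolding b by (simp add: wh_mul wh_wh mul_assoc S2 reassoc[OF e5] reassoc[OF e6] T)
  finally show "wh [] (wh [] sD [U] \<bullet> wh [D] t [] \<bullet> wh [] t [D]) [U, U] \<bullet> wh ([U] @ [D]) c [U] \<bullet> wh [U] c []
    = wh [] (wh [D] t [] \<bullet> wh [] t [D] \<bullet> wh [U] sD []) [U, U] \<bullet> wh ([U] @ [D]) c [U] \<bullet> wh [U] c []" .
qed

text \<open>After bending both downward strands, each side is one crossing \<open>s\<close> beside a
  downward strand, following a cup.\<close>

lemma cap_t_D: "wh [D] d [] \<bullet> wh [] t [D] = wh [] d [D] \<bullet> wh [U] sD []"
proof (rule bend2[of _ "[U]" "[D]"])
  show "wh [D] d [] \<bullet> wh [] t [D] \<in> hom ([U] @ [D, D]) [D]"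
    by (rule mul_hom[of _ _ "[D, U, D]"]) (auto intro!: homs)
  show "wh [] d [D] \<bullet> wh [U] sD [] \<in> hom ([U] @ [D, D]) [D]"
    by (rule mul_hom[of _ _ "[U, D, D]"]) (auto intro!: homs)
  have e1: "wh [] t [D, U, U] \<bullet> wh [U, D] c [U] = wh [D, U] c [U] \<bullet> wh [] t [U]"
    using exchange[OF t_hom c_hom, of "[]" "[]" "[U]"] by simp
  have z: "wh [D] d [U, U] \<bullet> wh [D, U] c [U] = one [D, U, U]"
    using wh_cong[OF zig_up, of "[D]" "[U]"] by (simp add: wh_mul wh_wh wh_one)
  have h: "wh [D] s [] \<in> hom [D, U, U] [D, U, U]" by (auto intro!: homs)
  have S2: "wh [U] sD [U, U] \<bullet> wh [U, D] c [U] \<bullet> wh [U] c [] = wh [U, D, D] s [] \<bullet> wh [U, D] c [U] \<bullet> wh [U] c []"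
    using wh_cong[OF sD_cup, of "[U]" "[]"] by (simp add: wh_mul wh_wh)
  have e2: "wh [] d [D, U, U] \<bullet> wh [U, D, D] s [] = wh [D] s [] \<bullet> wh [] d [D, U, U]"
    using exchange[OF d_hom s_hom, of "[]" "[D]" "[]"] by simp
  have e3: "wh [] d [D, U, U] \<bullet> wh [U, D] c [U] = wh [] c [U] \<bullet> wh [] d [U]"
    using exchange[OF d_hom c_hom, of "[]" "[]" "[U]"] by simp
  have o: "wh [] c [U] \<bullet> one [U] = wh [] c [U]" by (rule one_right[of _ _ "[D, U, U]"]) (auto intro!: homs)
  show "wh [] (wh [D] d [] \<bullet> wh [] t [D]) [U, U] \<bullet> wh ([U] @ [D]) c [U] \<bullet> wh [U] c []
    = wh [] (wh [] d [D] \<bullet> wh [U] sD []) [U, U] \<bullet> wh ([U] @ [D]) c [U] \<bullet> wh [U] c []"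
    by (simp add: wh_mul wh_wh mul_assoc reassoc[OF e1] cross_cup reassoc[OF z] reassoc[OF one_left[OF h]] S2
      reassoc[OF e2] reassoc[OF e3] zig_up o)
qed

lemma cap_t_U: "wh [] d [U] \<bullet> wh [U] t [] = wh [U] d [] \<bullet> wh [] s [D]"
proof (rule bend1[of _ "[U, U]" "[U]"])
  show "wh [] d [U] \<bullet> wh [U] t [] \<in> hom ([U, U] @ [D]) [U]"
    by (rule mul_hom[of _ _ "[U, D, U]"]) (auto intro!: homs)
  show "wh [U] d [] \<bullet> wh [] s [D] \<in> hom ([U, U] @ [D]) [U]"
    by (rule mul_hom[of _ _ "[U, U, D]"]) (auto intro!: homs)
  have K: "wh [U] t [U] \<bullet> wh [U, U] c [] = wh [U, D] s [] \<bullet> wh [U] c [U]"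
    using wh_cong[OF cross_cup, of "[U]" "[]"] by (simp add: wh_mul wh_wh)
  have e1: "wh [] d [U, U] \<bullet> wh [U, D] s [] = s \<bullet> wh [] d [U, U]"
    using exchange[OF d_hom s_hom, of "[]" "[]" "[]"] by (simp add: wh_Nil[OF s_hom])
  have e2: "wh [] s [D, U] \<bullet> wh [U, U] c [] = wh [U, U] c [] \<bullet> s"
    using exchange[OF s_hom c_hom, of "[]" "[]" "[]"] by (simp add: wh_Nil[OF s_hom])
  have z1: "wh [] d [U, U] \<bullet> wh [U] c [U] = one [U, U]"
    using wh_cong[OF zig_up, of "[]" "[U]"] by (simp add: wh_mul wh_wh wh_one)
  have z2: "wh [U] d [U] \<bullet> wh [U, U] c [] = one [U, U]"
    using wh_cong[OF zig_up, of "[U]" "[]"] by (simp add: wh_mul wh_wh wh_one)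
  show "wh [] (wh [] d [U] \<bullet> wh [U] t []) [U] \<bullet> wh [U, U] c [] = wh [] (wh [U] d [] \<bullet> wh [] s [D]) [U] \<bullet> wh [U, U] c []"
    by (simp add: wh_mul wh_wh mul_assoc K reassoc[OF e1] z1 e2 reassoc[OF z2] one_left[OF s_hom] one_right[OF s_hom])
qed

lemma s_dot': "s \<bullet> wh [U] x [] = wh [] x [U] \<bullet> s - one [U, U]"
proof -
  have h: "wh [] x [U] \<in> hom [U, U] [U, U]" "wh [U] x [] \<in> hom [U, U] [U, U]" by (auto intro!: homs)
  have "wh [] x [U] \<bullet> s = (s \<bullet> s) \<bullet> wh [] x [U] \<bullet> s"
    using one_left[OF mul_hom[OF s_hom h(1)]] by (simp add: s_sq)
  also have "\<dots> = s \<bullet> (s \<bullet> wh [] x [U]) \<bullet> s" by (simp add: mul_assoc)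
  also have "\<dots> = s \<bullet> wh [U] x [] \<bullet> (s \<bullet> s) + s \<bullet> s"
    unfolding s_dot by (simp add: distribs mul_assoc one_left[OF s_hom])
  also have "\<dots> = s \<bullet> wh [U] x [] + one [U, U]" by (simp add: s_sq one_right[OF h(2)])
  finally show ?thesis by simp
qed

text \<open>Bending gives \<open>s_dot'\<close>, whose correction \<open>- one [U, U]\<close>
  becomes \<open>- c \<bullet> d\<close> when the strand is bent back.\<close>

lemma t_dot: "t \<bullet> wh [] x [D] = wh [D] x [] \<bullet> t - c \<bullet> d"
proof (rule bend1[of _ "[U]" "[D, U]"])
  show "t \<bullet> wh [] x [D] \<in> hom ([U] @ [D]) [D, U]"
    by (rule mul_hom[of _ _ "[U, D]"]) (auto intro!: homs)
  show "wh [D] x [] \<bullet> t - c \<bullet> d \<in> hom ([U] @ [D]) [D, U]"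
    by (rule diff_hom, rule mul_hom[of _ _ "[D, U]"]) (auto intro!: homs mul_hom[of d "[U, D]" "[]" c])
  have e1: "wh [] x [D, U] \<bullet> wh [U] c [] = wh [U] c [] \<bullet> x"
    using exchange[OF x_hom c_hom, of "[]" "[]" "[]"] by (simp add: wh_Nil[OF x_hom])
  have e2: "wh [] c [U] \<bullet> x = wh [D, U] x [] \<bullet> wh [] c [U]"
    using exchange[OF c_hom x_hom, of "[]" "[]" "[]"] by (simp add: wh_Nil[OF x_hom])
  have S: "wh [D] s [] \<bullet> wh [D, U] x [] = wh [D] x [U] \<bullet> wh [D] s [] - one [D, U, U]"
    using wh_cong[OF s_dot', of "[D]" "[]"] by (simp add: wh_mul wh_wh wh_diff wh_one)
  have h: "wh [] c [U] \<in> hom [U] [D, U, U]" by (auto intro!: homs)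
  show "wh [] (t \<bullet> wh [] x [D]) [U] \<bullet> wh [U] c [] = wh [] (wh [D] x [] \<bullet> t - c \<bullet> d) [U] \<bullet> wh [U] c []"
    by (simp add: distribs wh_mul wh_wh mul_assoc e1 reassoc[OF cross_cup] e2 reassoc[OF S] cross_cup zig_up
       one_right[OF h] one_left[OF h])
qed

lemma cup_t_D: "wh [D] t [] \<bullet> wh [] c [D] = wh [] sD [U] \<bullet> wh [D] c []"
proof (rule bend1[of _ "[]" "[D, D, U]"])
  show "wh [D] t [] \<bullet> wh [] c [D] \<in> hom ([] @ [D]) [D, D, U]"
    by (rule mul_hom[of _ _ "[D, U, D]"]) (auto intro!: homs)
  show "wh [] sD [U] \<bullet> wh [D] c [] \<in> hom ([] @ [D]) [D, D, U]"
    by (rule mul_hom[of _ _ "[D, D, U]"]) (auto intro!: homs)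
  have e1: "wh [] c [D, U] \<bullet> c = wh [D, U] c [] \<bullet> c"
    using exchange[OF c_hom c_hom, of "[]" "[]" "[]"] by (simp add: wh_Nil[OF c_hom])
  have K: "wh [D] t [U] \<bullet> wh [D, U] c [] = wh [D, D] s [] \<bullet> wh [D] c [U]"
    using wh_cong[OF cross_cup, of "[D]" "[]"] by (simp add: wh_mul wh_wh)
  show "wh [] (wh [D] t [] \<bullet> wh [] c [D]) [U] \<bullet> wh [] c [] = wh [] (wh [] sD [U] \<bullet> wh [D] c []) [U] \<bullet> wh [] c []"
    by (simp add: wh_mul wh_wh mul_assoc wh_Nil[OF c_hom] e1 reassoc[OF K] sD_cup)
qed

lemma t_dot_dual: "wh [] xD [U] \<bullet> t = t \<bullet> wh [U] xD [] + c \<bullet> d"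
proof (rule bend1[of _ "[U]" "[D, U]"])
  show "wh [] xD [U] \<bullet> t \<in> hom ([U] @ [D]) [D, U]"
    by (rule mul_hom[of _ _ "[D, U]"]) (auto intro!: homs)
  show "t \<bullet> wh [U] xD [] + c \<bullet> d \<in> hom ([U] @ [D]) [D, U]"
    by (rule add_hom, rule mul_hom[of _ _ "[U, D]"]) (auto intro!: homs mul_hom[of d "[U, D]" "[]" c])
  have e1: "wh [] xD [U, U] \<bullet> wh [D] s [] = wh [D] s [] \<bullet> wh [] xD [U, U]"
    using exchange[OF xD_hom s_hom, of "[]" "[]" "[]"] by simp
  have X1: "wh [] xD [U, U] \<bullet> wh [] c [U] = wh [D] x [U] \<bullet> wh [] c [U]"
    using wh_cong[OF xD_cup, of "[]" "[U]"] by (simp add: wh_mul wh_wh)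
  have X2: "wh [U] xD [U] \<bullet> wh [U] c [] = wh [U, D] x [] \<bullet> wh [U] c []"
    using wh_cong[OF xD_cup, of "[U]" "[]"] by (simp add: wh_mul wh_wh)
  have e2: "wh [] t [U] \<bullet> wh [U, D] x [] = wh [D, U] x [] \<bullet> wh [] t [U]"
    using exchange[OF t_hom x_hom, of "[]" "[]" "[]"] by simp
  have S: "wh [D] s [] \<bullet> wh [D] x [U] = wh [D, U] x [] \<bullet> wh [D] s [] + one [D, U, U]"
    using wh_cong[OF s_dot, of "[D]" "[]"] by (simp add: wh_mul wh_wh wh_add wh_one)
  have h: "wh [] c [U] \<in> hom [U] [D, U, U]" by (auto intro!: homs)
  show "wh [] (wh [] xD [U] \<bullet> t) [U] \<bullet> wh [U] c [] = wh [] (t \<bullet> wh [U] xD [] + c \<bullet> d) [U] \<bullet> wh [U] c []"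
    by (simp add: distribs wh_mul wh_wh mul_assoc reassoc[OF e1] X1 X2 reassoc[OF e2] reassoc[OF S] cross_cup zig_up
       one_right[OF h] one_left[OF h])
qed

lemma s_dot_dual: "wh [] xD [D] \<bullet> sD = sD \<bullet> wh [D] xD [] - one [D, D]"
proof -
  let ?n = "Suc (Suc 0)"
  have h: "wh [] x [U] \<in> hom (up ?n) (up ?n)" "wh [U] x [] \<in> hom (up ?n) (up ?n)" by (auto intro!: homs)
  have "dual ?n (wh [] x [U] \<bullet> s) = dual ?n (s \<bullet> wh [U] x [] + one (up ?n))"
    by (simp add: s_dot')
  then have "sD \<bullet> wh [D] xD [] = wh [] xD [D] \<bullet> sD + one (dn ?n)"
    by (simp only: dual_mul[OF s_hom' h(1)] dual_add dual_mul[OF h(2) s_hom'] dual_one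
      dual_right[OF x_hom'] dual_left[OF x_hom'] flip: sD_def xD_def)
  then show ?thesis by simp
qed

text \<open>The correction in \<open>t_dot\<close> has the sign opposite to the one of the locale,
  so the cup is passed as \<open>- c\<close>.\<close>

lemma heisenberg_pos:
  assumes xp: "xp 0 = one [U]" "\<And>a. xp (Suc a) = x \<bullet> xp a"
    and t'_hom: "t' \<in> hom [D, U] [U, D]" and u_hom: "\<And>a. a < k \<Longrightarrow> u a \<in> hom [] [U, D]"
    and t_t': "t \<bullet> t' = one [D, U]" and t_u: "\<And>a. a < k \<Longrightarrow> t \<bullet> u a = 0"
    and d_t': "\<And>a. a < k \<Longrightarrow> d \<bullet> wh [] (xp a) [D] \<bullet> t' = 0"
    and d_u: "\<And>a b. a < k \<Longrightarrow> b < k \<Longrightarrow> d \<bullet> wh [] (xp a) [D] \<bullet> u b = (if a = b then one [] else 0)"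
    and complete: "t' \<bullet> t + (\<Sum>a<k. u a \<bullet> d \<bullet> wh [] (xp a) [D]) = one [U, D]"
  shows "heisenberg scale hom one mul wh U s 1 D sD t x d (- c) 1 k t' u xp"
proof -
  have c': "- c \<in> hom [] [D, U]" using subspace_neg[OF subspace_hom c_hom] .
  interpret L: strands scale hom one mul wh U s 1 by (rule strandsU) simp
  interpret R: strands scale hom one mul wh D sD "- 1" by (rule strandsD) simp
  show ?thesis
    by unfold_locales (use t_hom slideU slideV x_hom d_hom c' xp cap_t_D cap_t_U cap_s t_dot s_dot t'_hom u_hom t_t' t_u d_t' d_u complete
      in \<open>auto simp: mul_minus_left\<close>)
qed

lemma xp_cup:
  assumes "xp 0 = one [U]" "\<And>a. xp (Suc a) = x \<bullet> xp a" "xq 0 = one [D]" "\<And>a. xq (Suc a) = xq a \<bullet> xD"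
  shows "xq a \<in> hom [D] [D] \<and> wh [] (xq a) [U] \<bullet> c = wh [D] (xp a) [] \<bullet> c"
proof (induction a)
  case 0 then show ?case by (simp add: assms wh_one one_hom)
next
  case (Suc a)
  have e: "wh [] (xq a) [U] \<bullet> wh [D] x [] = wh [D] x [] \<bullet> wh [] (xq a) [U]"
    using exchange[of "xq a" "[D]" "[D]" x "[U]" "[U]" "[]" "[]" "[]"] Suc x_hom by simp
  show ?case using Suc by (auto simp: assms(2,4) wh_mul mul_assoc xD_cup reassoc[OF e] intro: mul_hom xD_hom)
qed

text \<open>In the opposite category the cup \<open>c\<close> serves as the cap, its downward strand
  coming first, so the downward strands take the role of \<open>U\<close>; they carry the
  antisymmetrizer, whence \<open>\<eta> = - 1\<close>. The dots of the inversion relation sit on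
  upward strands and are moved along the cup by \<open>xp_cup\<close>.\<close>

lemma heisenberg_neg:
  assumes xp: "xp 0 = one [U]" "\<And>a. xp (Suc a) = x \<bullet> xp a"
    and t'_hom: "t' \<in> hom [D, U] [U, D]" and v_hom: "\<And>a. a < k \<Longrightarrow> v a \<in> hom [D, U] []"
    and t'_t: "t' \<bullet> t = one [U, D]" and t'_c: "\<And>a. a < k \<Longrightarrow> t' \<bullet> wh [D] (xp a) [] \<bullet> c = 0"
    and v_t: "\<And>a. a < k \<Longrightarrow> v a \<bullet> t = 0"
    and v_c: "\<And>a b. a < k \<Longrightarrow> b < k \<Longrightarrow> v a \<bullet> wh [D] (xp b) [] \<bullet> c = (if a = b then one [] else 0)"
    and complete: "t \<bullet> t' + (\<Sum>a<k. (wh [D] (xp a) [] \<bullet> c) \<bullet> v a) = one [D, U]"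
  shows "\<exists>xq. heisenberg scale (\<lambda>X Y. hom Y X) one (\<lambda>g f. f \<bullet> g) wh D sD (- 1) U s t xD c d (- 1) k t' v xq"
proof -
  define xq where "xq = rec_nat (one [D]) (\<lambda>_ g. g \<bullet> xD)"
  have xq: "xq 0 = one [D]" "\<And>a. xq (Suc a) = xq a \<bullet> xD" by (simp_all add: xq_def)
  have xqc: "wh [] (xq a) [U] \<bullet> c = wh [D] (xp a) [] \<bullet> c" for a using xp_cup[OF xp xq] by simp
  interpret O: word_category scale "\<lambda>X Y. hom Y X" one "\<lambda>g f. f \<bullet> g" wh by (rule opposite)
  interpret L: strands scale "\<lambda>X Y. hom Y X" one "\<lambda>g f. f \<bullet> g" wh D sD "- 1"
    by unfold_locales (use sD_hom sD_sq sD_braid in \<open>auto simp: mul_assoc\<close>)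
  interpret R: strands scale "\<lambda>X Y. hom Y X" one "\<lambda>g f. f \<bullet> g" wh U s "- (- 1)"
    by unfold_locales (use s_hom s_sq braid in \<open>auto simp: mul_assoc\<close>)
  show ?thesis
    by (rule exI[of _ xq], unfold_locales)
      (use t_hom slideU slideV xD_hom d_hom c_hom xq cross_cup cup_t_D sD_cup t_dot_dual s_dot_dual t'_hom v_hom t'_t t'_c v_t v_c complete
      in \<open>auto simp: mul_assoc xqc\<close>)
qed

end

section \<open>The presented category\<close>

lemma tmo_single:
  fixes C :: "('g list, 'm, 'a::field_char_0) linmon"
  assumes C: "word_cat C" and F: "F \<in> hom C X Y" and G: "G \<in> hom C X' Y'"
  shows "single C (X @ X') (Y @ Y') (tmo C F G)
    = fmul C (fwh C [] (single C X Y F) Y') (fwh C X (single C X' Y' G) [])"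
proof -
  interpret S: strict_linear_monoidal C using C by (simp add: word_cat_def)
  note o = obs_C[OF C] and i = hidm_hom[OF C]
  have "cmp C (tmo C F (idm C Y')) (tmo C (idm C X) G) = tmo C F G"
    using S.tmo_cmp[OF o o o o o o i[of X] F G i[of Y']] S.idm_right[OF o o F] S.idm_left[OF o o G] by simp
  then show ?thesis
    using htmo_hom[OF C i[of X] G] htmo_hom[OF C F i[of Y']]
    by (simp add: fwh_single[OF C] F G tmo_unit_C[OF C F] tmo_unit_C(2)[OF C htmo_hom[OF C i[of X] G]] fmul_single[OF C])
qed

text \<open>Total functions on raw terms, because \<open>ev\<close> has no typing derivation at
  hand; \<open>ev_single\<close> shows that they are correct on typed terms.\<close>

fun tm_src :: "'a heis_tm \<Rightarrow> updown list" and tm_tgt :: "'a heis_tm \<Rightarrow> updown list" where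
  "tm_src (Gen g) = heis_src g" | "tm_src (Idt X) = X" | "tm_src (Cmp g f) = tm_src f"
| "tm_src (Ten f g) = tm_src f @ tm_src g" | "tm_src (Zer X Y) = X" | "tm_src (Add f g) = tm_src f"
| "tm_src (Scl a f) = tm_src f"
| "tm_tgt (Gen g) = heis_tgt g" | "tm_tgt (Idt X) = X" | "tm_tgt (Cmp g f) = tm_tgt g"
| "tm_tgt (Ten f g) = tm_tgt f @ tm_tgt g" | "tm_tgt (Zer X Y) = Y" | "tm_tgt (Add f g) = tm_tgt f"
| "tm_tgt (Scl a f) = tm_tgt f"

lemma single_comp:
  fixes C :: "('g list, 'm, 'a::field_char_0) linmon"
  shows "word_cat C \<Longrightarrow> v \<in> fhom C X Y \<Longrightarrow> single C X Y (comp v C X Y) = v"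
  by (auto simp: fhom_def comp_single)

locale heis_cat =
  fixes k :: int and C :: "(updown list, 'a::field_char_0 heis_mor, 'a) linmon"
  assumes C_def: "C = Heis k"
begin

abbreviation "typ \<equiv> typed (heis_signat k) :: 'a heis_tm \<Rightarrow> _"

lemma word_cat_C: "word_cat C"
  using presented_strict_linear_monoidal[of "heis_signat k" "heis_rel k"]
  by (auto simp: word_cat_def C_def Heis_def presented_def)

sublocale word_category scale "fhom C" "fone C" "fmul C" "fwh C"
  by (rule word_category_fam[OF word_cat_C])

abbreviation mul_C (infixr \<open>\<bullet>\<close> 70) where "f \<bullet> g \<equiv> fmul C f g"

abbreviation cls :: "'a heis_tm \<Rightarrow> 'a heis_mor" where "cls f \<equiv> heis_class k f"

text \<open>A tensor factor that is an identity is evaluated to a bare whiskering, so that the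
  defining relations turn literally into the equations required by the locales.\<close>

fun ev :: "'a heis_tm \<Rightarrow> (updown, 'a heis_mor, 'a) fam" where
  "ev (Gen g) = single C (heis_src g) (heis_tgt g) (cls (Gen g))"
| "ev (Idt X) = fone C X"
| "ev (Cmp g f) = ev g \<bullet> ev f"
| "ev (Ten f g) = (case f of Idt Z \<Rightarrow> fwh C Z (ev g) [] | _ \<Rightarrow> (case g of Idt Z \<Rightarrow> fwh C [] (ev f) Z
     | _ \<Rightarrow> fwh C [] (ev f) (tm_tgt g) \<bullet> fwh C (tm_src f) (ev g) []))"
| "ev (Zer X Y) = 0"
| "ev (Add f g) = ev f + ev g"
| "ev (Scl a f) = scale a (ev f)"

lemma ev_Ten_Idt: "ev (Ten (Idt Z) g) = fwh C Z (ev g) []" "ev (Ten f (Idt Z)) = fwh C [] (ev f) Z"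
  by (simp, cases f) (simp_all add: wh_one)

lemma cls_reps: "typ f X Y \<Longrightarrow> reps (heis_signat k) (heis_rel k) (cls f) f X Y"
  by (simp add: reps_def heis_class_def)

lemma repsD: "reps (heis_signat k) (heis_rel k) F f X Y \<Longrightarrow> F = cls f"
  by (simp add: reps_def heis_class_def)

lemma cls_hom: "typ f X Y \<Longrightarrow> cls f \<in> hom C X Y"
  unfolding C_def Heis_def by (rule presented_homI[OF cls_reps])

lemma cls_Cmp: "typ f X Y \<Longrightarrow> typ g Y Z \<Longrightarrow> cmp C (cls g) (cls f) = cls (Cmp g f)"
  unfolding C_def Heis_def by (rule repsD[OF reps_cmp[OF cls_reps cls_reps]])

lemma cls_Ten: "typ f X Y \<Longrightarrow> typ g X' Y' \<Longrightarrow> tmo C (cls f) (cls g) = cls (Ten f g)"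
  unfolding C_def Heis_def by (rule repsD[OF reps_tmo[OF cls_reps cls_reps]])

lemma cls_Add: "typ f X Y \<Longrightarrow> typ g X Y \<Longrightarrow> add C (cls f) (cls g) = cls (Add f g)"
  unfolding C_def Heis_def by (rule repsD[OF reps_add[OF cls_reps cls_reps]])

lemma cls_Scl: "typ f X Y \<Longrightarrow> scl C a (cls f) = cls (Scl a f)"
  unfolding C_def Heis_def by (rule repsD[OF reps_scl[OF cls_reps]])

lemma cls_Idt: "idm C X = cls (Idt X)" and cls_Zer: "zer C X Y = cls (Zer X Y)"
  unfolding C_def Heis_def by (rule repsD[OF reps_idm], rule repsD[OF reps_zer])

lemma hom_cls: "F \<in> hom C X Y \<Longrightarrow> \<exists>f. typ f X Y \<and> F = cls f"
  unfolding C_def Heis_def presented_hom by (auto simp: reps_def heis_class_def)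

text \<open>Equal classes thus have equal evaluations, which is how each defining relation becomes
  an equation between families in \<open>ev_rel\<close>.\<close>

lemma ev_single: "typ f X Y \<Longrightarrow> tm_src f = X \<and> tm_tgt f = Y \<and> ev f = single C X Y (cls f)"
proof (induction rule: typed.induct)
  case (1 g) then show ?case by (simp add: heis_signat_def)
next
  case (2 X) then show ?case by (simp add: fone_def[OF word_cat_C] cls_Idt)
next
  case (3 f X Y g Z)
  then show ?case using cls_hom[of f X Y] cls_hom[of g Y Z]
    by (simp add: fmul_single[OF word_cat_C] cls_Cmp)
next
  case (4 f X Y f' X' Y')
  have h: "ev f \<in> fhom C X Y" "ev f' \<in> fhom C X' Y'" using 4 cls_hom by (auto simp: fhom_def[OF word_cat_C])
  have m: "single C (X @ X') (Y @ Y') (cls (Ten f f')) = fwh C [] (ev f) Y' \<bullet> fwh C X (ev f') []"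
    using tmo_single[OF word_cat_C cls_hom[OF 4(1)] cls_hom[OF 4(2)]] 4 by (simp add: cls_Ten)
  have l: "fwh C Z (ev f') [] = fwh C [] (ev f) Y' \<bullet> fwh C X (ev f') []" if "f = Idt Z" for Z
  proof -
    from that 4 have "Z = X" "X = Y" by (auto elim: typed.cases)
    moreover have "fwh C X (ev f') [] \<in> fhom C (X @ X') (X @ Y')" by (rule wh_homI[OF h(2)]) simp_all
    ultimately show ?thesis using that by (simp add: wh_one one_left)
  qed
  have r: "fwh C [] (ev f) Z = fwh C [] (ev f) Y' \<bullet> fwh C X (ev f') []" if "f' = Idt Z" for Z
  proof -
    from that 4 have "Z = X'" "X' = Y'" by (auto elim: typed.cases)
    moreover have "fwh C [] (ev f) X' \<in> fhom C (X @ X') (Y @ X')" by (rule wh_homI[OF h(1)]) simp_all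
    ultimately show ?thesis using that by (simp add: wh_one one_right)
  qed
  have "ev (Ten f f') = fwh C [] (ev f) Y' \<bullet> fwh C X (ev f') []"
  proof (cases "(\<exists>Z. f = Idt Z) \<or> (\<exists>Z. f' = Idt Z)")
    case True
    then show ?thesis
    proof
      assume "\<exists>Z. f = Idt Z" then obtain Z where "f = Idt Z" by blast
      with l[OF this] show ?thesis by (simp only: ev_Ten_Idt)
    next
      assume "\<exists>Z. f' = Idt Z" then obtain Z where "f' = Idt Z" by blast
      with r[OF this] show ?thesis by (simp only: ev_Ten_Idt)
    qed
  next
    case False
    then have "ev (Ten f f') = fwh C [] (ev f) (tm_tgt f') \<bullet> fwh C (tm_src f) (ev f') []"
      by (cases f; cases f'; simp)
    then show ?thesis using 4 by simp
  qed
  then show ?case using 4 m by simp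
next
  case (5 X Y) then show ?case using single_zer[OF word_cat_C] by (simp add: cls_Zer)
next
  case (6 f X Y g)
  then show ?case using cls_hom by (simp add: single_add[OF word_cat_C, symmetric] cls_Add)
next
  case (7 f X Y a)
  then show ?case using cls_hom by (simp add: single_scl[OF word_cat_C, symmetric] cls_Scl)
qed

lemma ev_hom: "typ f X Y \<Longrightarrow> ev f \<in> fhom C X Y"
  using ev_single cls_hom by (auto simp: fhom_def[OF word_cat_C])

lemma ev_rel: "heis_rel k f g \<Longrightarrow> typ f X Y \<Longrightarrow> typ g X Y \<Longrightarrow> ev f = ev g"
  using ev_single[of f X Y] ev_single[of g X Y] tmeq_class_eq[OF tmeq.rel[of "heis_rel k" f g "heis_signat k" X Y]]
  by (simp add: heis_class_def)

lemma typed_Ten: "typ f X Y \<Longrightarrow> typ g X' Y' \<Longrightarrow> A = X @ X' \<Longrightarrow> B = Y @ Y' \<Longrightarrow> typ (Ten f g) A B"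
  using typed.intros(4) by fast

lemma typed_Gen: "g \<in> gens (heis_signat k) \<Longrightarrow> typ (Gen g) (heis_src g) (heis_tgt g)"
  using typed.intros(1)[of g "heis_signat k"] by (simp add: heis_signat_def)

lemma typed_gens:
  "typ (Gen Gx) [Up] [Up]" "typ (Gen Gs) [Up, Up] [Up, Up]" "typ (Gen Gc) [] [Down, Up]"
  "typ (Gen Gd) [Up, Down] []" "typ (Gen Gt') [Down, Up] [Up, Down]"
  "int a < k \<Longrightarrow> typ (Gen (Gu a)) [] [Up, Down]" "int a < - k \<Longrightarrow> typ (Gen (Gv a)) [Down, Up] []"
  using typed_Gen[of Gx] typed_Gen[of Gs] typed_Gen[of Gc] typed_Gen[of Gd] typed_Gen[of Gt'] typed_Gen[of "Gu a"] typed_Gen[of "Gv a"]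
  by (simp_all add: heis_signat_def)

lemmas typed_basic = typed_gens typed.intros(2,3,5,6,7) typed_Ten

lemma typed_xpow: "typ (xpow a) [Up] [Up]"
  by (induction a) (auto intro: typed_basic)

lemma typed_t: "typ t_tm [Up, Down] [Down, Up]"
  unfolding t_tm_def by (rule typed_basic | simp)+

lemma typed_dx: "typ (dx a) [Up, Down] []" and typed_xc: "typ (xc a) [] [Down, Up]"
  unfolding dx_def xc_def by (rule typed_basic typed_xpow | simp)+

lemma typed_sum: "(\<And>f. f \<in> set fs \<Longrightarrow> typ f X Y) \<Longrightarrow> typ (tm_sum X Y fs) X Y"
  unfolding tm_sum_def by (induction fs) (auto intro: typed_basic)

lemma ev_sum: "ev (tm_sum X Y (map f [0..<n])) = (\<Sum>a<n. ev (f a))"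
proof -
  have "ev (tm_sum X Y fs) = sum_list (map ev fs)" for fs unfolding tm_sum_def by (induction fs) auto
  then show ?thesis by (simp add: interv_sum_list_conv_sum_set_nat atLeast0LessThan comp_def)
qed

lemmas ev_simps = ev.simps(2,3,5,6,7) ev_Ten_Idt

sublocale H: heis_rels scale "fhom C" "fone C" "fmul C" "fwh C" Up Down "ev (Gen Gc)" "ev (Gen Gd)" "ev (Gen Gx)" "ev (Gen Gs)"
proof unfold_locales
  show "ev (Gen Gc) \<in> fhom C [] [Down, Up]" "ev (Gen Gd) \<in> fhom C [Up, Down] []" "ev (Gen Gx) \<in> fhom C [Up] [Up]"
    "ev (Gen Gs) \<in> fhom C [Up, Up] [Up, Up]"
    by (rule ev_hom, rule typed_gens)+
  show "fwh C [] (ev (Gen Gd)) [Up] \<bullet> fwh C [Up] (ev (Gen Gc)) [] = fone C [Up]"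
    by (rule ev_rel[OF zigzag_up, of "[Up]" "[Up]", unfolded ev_simps]) ((rule typed_basic | simp)+)
  show "fwh C [Down] (ev (Gen Gd)) [] \<bullet> fwh C [] (ev (Gen Gc)) [Down] = fone C [Down]"
    by (rule ev_rel[OF zigzag_down, of "[Down]" "[Down]", unfolded ev_simps]) ((rule typed_basic | simp)+)
  show "ev (Gen Gs) \<bullet> ev (Gen Gs) = fone C [Up, Up]"
    by (rule ev_rel[OF s_square, of "[Up, Up]" "[Up, Up]", unfolded ev_simps]) ((rule typed_basic | simp)+)
  show "fwh C [] (ev (Gen Gs)) [Up] \<bullet> fwh C [Up] (ev (Gen Gs)) [] \<bullet> fwh C [] (ev (Gen Gs)) [Up]
     = fwh C [Up] (ev (Gen Gs)) [] \<bullet> fwh C [] (ev (Gen Gs)) [Up] \<bullet> fwh C [Up] (ev (Gen Gs)) []"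
    by (rule ev_rel[OF s_braid, of "[Up, Up, Up]" "[Up, Up, Up]", unfolded ev_simps]) ((rule typed_basic | simp)+)
  show "ev (Gen Gs) \<bullet> fwh C [] (ev (Gen Gx)) [Up] = fwh C [Up] (ev (Gen Gx)) [] \<bullet> ev (Gen Gs) + fone C [Up, Up]"
    by (rule ev_rel[OF Defs.heis_rel.s_dot, of "[Up, Up]" "[Up, Up]", unfolded ev_simps]) ((rule typed_basic | simp)+)
qed

end

section \<open>Extending the braid relations to the symmetric group\<close>

text \<open>Since \<open>iota\<close> is selected by \<open>SOME\<close>, a homomorphism with its
  properties must be shown to exist. The Coxeter relations are treated abstractly because they are
  used both for the crossings and for the transpositions themselves.\<close>

locale coxeter =
  fixes mul :: "'m \<Rightarrow> 'm \<Rightarrow> 'm" (infixr \<open>\<cdot>\<close> 70) and e :: 'm and \<sigma> :: "nat \<Rightarrow> 'm" and N :: nat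
  assumes assoc: "(f \<cdot> g) \<cdot> h = f \<cdot> (g \<cdot> h)" and e_e: "e \<cdot> e = e"
    and e_left: "1 \<le> i \<Longrightarrow> i < N \<Longrightarrow> e \<cdot> \<sigma> i = \<sigma> i" and e_right: "1 \<le> i \<Longrightarrow> i < N \<Longrightarrow> \<sigma> i \<cdot> e = \<sigma> i"
    and square: "1 \<le> i \<Longrightarrow> i < N \<Longrightarrow> \<sigma> i \<cdot> \<sigma> i = e"
    and far: "1 \<le> i \<Longrightarrow> Suc i < j \<Longrightarrow> j < N \<Longrightarrow> \<sigma> i \<cdot> \<sigma> j = \<sigma> j \<cdot> \<sigma> i"
    and braid: "1 \<le> i \<Longrightarrow> Suc i < N \<Longrightarrow> \<sigma> i \<cdot> \<sigma> (Suc i) \<cdot> \<sigma> i = \<sigma> (Suc i) \<cdot> \<sigma> i \<cdot> \<sigma> (Suc i)"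
begin

definition word where "word is v = foldr (\<lambda>i f. \<sigma> i \<cdot> f) is v"
text \<open>The product of the generators from \<open>j\<close> up to \<open>n\<close>, the shortest
  representative of a coset of the symmetric group on \<open>n\<close> letters in the next one. For
  transpositions it sends \<open>Suc n\<close> to \<open>j\<close>.\<close>

definition cyc where "cyc n j = word [j..<Suc n] e"

lemma word_simps [simp]: "word [] v = v" "word (i # is) v = \<sigma> i \<cdot> word is v"
  by (simp_all add: word_def)

lemma word_mul: "word is (u \<cdot> v) = word is u \<cdot> v"
  by (induction "is") (simp_all add: assoc)

lemma word_append: "word (is @ js) v = word is (word js v)"
  by (simp add: word_def)

lemma cyc_end: "cyc n (Suc n) = e"
  by (simp add: cyc_def)

lemma cyc_step: "j \<le> n \<Longrightarrow> cyc n j = \<sigma> j \<cdot> cyc n (Suc j)"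
  unfolding cyc_def by (subst upt_conv_Cons) auto

lemma e_word: "set is \<subseteq> {1..<N} \<Longrightarrow> e \<cdot> word is e = word is e"
  by (cases "is") (auto simp: e_e simp flip: assoc intro!: arg_cong2[of _ _ _ _ mul] e_left)

lemma cyc_far: "j \<le> Suc n \<Longrightarrow> n < N \<Longrightarrow> 1 \<le> i \<Longrightarrow> Suc i < j \<Longrightarrow> \<sigma> i \<cdot> cyc n j = cyc n j \<cdot> \<sigma> i"
proof (induction rule: inc_induct)
  case base then show ?case by (simp add: cyc_end e_left e_right)
next
  case (step j)
  have "\<sigma> i \<cdot> cyc n j = (\<sigma> i \<cdot> \<sigma> j) \<cdot> cyc n (Suc j)" using step by (simp add: cyc_step assoc)
  also have "\<dots> = \<sigma> j \<cdot> \<sigma> i \<cdot> cyc n (Suc j)" using step far[of i j] by (simp add: assoc)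
  also have "\<dots> = cyc n j \<cdot> \<sigma> i" using step by (simp add: cyc_step assoc)
  finally show ?case .
qed

text \<open>\<open>\<sigma> i\<close> commutes with the factors before
  \<open>\<sigma> (i - 1)\<close>; there a braid move turns it into \<open>\<sigma> (i - 1)\<close>,
  which commutes with all factors after \<open>\<sigma> i\<close>.\<close>

lemma cyc_braid: "j \<le> n \<Longrightarrow> n < N \<Longrightarrow> 1 \<le> j \<Longrightarrow> j < i \<Longrightarrow> i \<le> n \<Longrightarrow> \<sigma> i \<cdot> cyc n j = cyc n j \<cdot> \<sigma> (i - 1)"
proof (induction rule: inc_induct)
  case base then show ?case by simp
next
  case (step j)
  show ?case
  proof (cases "i = Suc j")
    case True
    have "\<sigma> i \<cdot> cyc n j = (\<sigma> (Suc j) \<cdot> \<sigma> j \<cdot> \<sigma> (Suc j)) \<cdot> cyc n (Suc (Suc j))"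
      using True step by (simp add: cyc_step assoc)
    also have "\<dots> = (\<sigma> j \<cdot> \<sigma> (Suc j) \<cdot> \<sigma> j) \<cdot> cyc n (Suc (Suc j))"
      using True step by (subst braid) simp_all
    also have "\<dots> = \<sigma> j \<cdot> \<sigma> (Suc j) \<cdot> (\<sigma> j \<cdot> cyc n (Suc (Suc j)))" by (simp only: assoc)
    also have "\<dots> = cyc n j \<cdot> \<sigma> j"
      using True step cyc_far[of "Suc (Suc j)" n j] by (simp add: cyc_step assoc)
    finally show ?thesis using True by simp
  next
    case False
    have "\<sigma> i \<cdot> cyc n j = (\<sigma> i \<cdot> \<sigma> j) \<cdot> cyc n (Suc j)" using step by (simp add: cyc_step assoc)
    also have "\<dots> = (\<sigma> j \<cdot> \<sigma> i) \<cdot> cyc n (Suc j)" using step False by (subst far[of j i]) simp_all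
    also have "\<dots> = \<sigma> j \<cdot> \<sigma> i \<cdot> cyc n (Suc j)" by (rule assoc)
    also have "\<dots> = cyc n j \<cdot> \<sigma> (i - 1)" using step False by (simp add: cyc_step assoc)
    finally show ?thesis .
  qed
qed

end

lemma transposition_coxeter: "coxeter (\<circ>) id simple_transp N"
  by unfold_locales (auto simp: simple_transp_def fun_eq_iff transpose_def)

global_interpretation sym: coxeter "(\<circ>)" id simple_transp N for N
  defines perm_of = "coxeter.word (\<circ>) simple_transp" and shift_cycle = "coxeter.cyc (\<circ>) id simple_transp"
  by (rule transposition_coxeter)

lemma simple_transp_permutes: "1 \<le> i \<Longrightarrow> i < n \<Longrightarrow> simple_transp i permutes {1..n}"
  unfolding simple_transp_def by (rule permutes_swap_id) auto

lemma perm_of_permutes: "set is \<subseteq> {1..<n} \<Longrightarrow> \<rho> permutes {1..n} \<Longrightarrow> perm_of is \<rho> permutes {1..n}"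
proof (induction "is")
  case (Cons i "is")
  have "simple_transp i \<circ> perm_of is \<rho> permutes {1..n}"
    by (rule permutes_compose[OF Cons.IH simple_transp_permutes]) (use Cons.prems in auto)
  then show ?case by (simp only: sym.word_simps)
qed simp

lemma cycle_permutes: "1 \<le> j \<Longrightarrow> shift_cycle n j permutes {1..Suc n}"
  unfolding sym.cyc_def by (rule perm_of_permutes) (auto simp: permutes_id)

lemma cycle_last: "j \<le> Suc n \<Longrightarrow> shift_cycle n j (Suc n) = j"
proof (induction rule: inc_induct)
  case (step j) then show ?case by (simp add: sym.cyc_step simple_transp_def)
qed (simp add: sym.cyc_end)

lemma permutes_shrink:
  assumes "\<rho> permutes {1..Suc n}" "\<rho> (Suc n) = Suc n" shows "\<rho> permutes {1..n}"
  using permutes_superset[OF assms(1), of "{1..n}"] assms(2) by (auto simp: le_Suc_eq)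

text \<open>\<open>j\<close> is the image of \<open>Suc n\<close>; undoing it by the cycle leaves a
  permutation that fixes \<open>Suc n\<close>.\<close>

lemma cycle_split:
  assumes "\<pi> permutes {1..Suc n}"
  obtains j \<rho> where "1 \<le> j" "j \<le> Suc n" "\<rho> permutes {1..n}" "\<pi> = shift_cycle n j \<circ> \<rho>"
proof
  let ?j = "\<pi> (Suc n)"
  have j: "?j \<in> {1..Suc n}" using permutes_in_image[OF assms] by simp
  then show "1 \<le> ?j" "?j \<le> Suc n" by auto
  have c: "shift_cycle n ?j permutes {1..Suc n}" using j by (intro cycle_permutes) simp
  have "(inv (shift_cycle n ?j) \<circ> \<pi>) (Suc n) = Suc n"
    using permutes_inverses(2)[OF c, of "Suc n"] cycle_last[of ?j n] j by simp
  then show "inv (shift_cycle n ?j) \<circ> \<pi> permutes {1..n}"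
    using permutes_shrink[OF permutes_compose[OF assms permutes_inv[OF c]]] by simp
  show "\<pi> = shift_cycle n ?j \<circ> (inv (shift_cycle n ?j) \<circ> \<pi>)"
    using permutes_inverses(1)[OF c] by (auto simp: fun_eq_iff)
qed

lemma ex_perm_of: "\<pi> permutes {1..n} \<Longrightarrow> \<exists>is. set is \<subseteq> {1..<n} \<and> \<pi> = perm_of is id"
proof (induction n arbitrary: \<pi>)
  case 0 then show ?case by (intro exI[of _ "[]"]) simp
next
  case (Suc n)
  obtain j \<rho> where j: "1 \<le> j" "j \<le> Suc n" "\<rho> permutes {1..n}" "\<pi> = shift_cycle n j \<circ> \<rho>"
    by (rule cycle_split[OF Suc.prems])
  from Suc.IH[OF j(3)] obtain "is" where "set is \<subseteq> {1..<n}" "\<rho> = perm_of is id" by blast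
  moreover have "perm_of [j..<Suc n] id \<circ> perm_of is id = perm_of ([j..<Suc n] @ is) id"
    by (simp only: sym.word_append id_comp flip: sym.word_mul)
  ultimately have "\<pi> = perm_of ([j..<Suc n] @ is) id" by (simp only: j(4) sym.cyc_def)
  moreover have "set ([j..<Suc n] @ is) \<subseteq> {1..<Suc n}" using \<open>set is \<subseteq> {1..<n}\<close> j(1) by auto
  ultimately show ?case by blast
qed

context coxeter begin

text \<open>Defined through the unique factorization into a cycle and a permutation of fewer
  letters, not through reduced words. Well-definedness is then automatic, and multiplicativity is
  what has to be proved.\<close>

primrec Phi :: "nat \<Rightarrow> (nat \<Rightarrow> nat) \<Rightarrow> 'm" where
  "Phi 0 \<pi> = e"
| "Phi (Suc n) \<pi> = cyc n (\<pi> (Suc n)) \<cdot> Phi n (inv (shift_cycle n (\<pi> (Suc n))) \<circ> \<pi>)"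

lemma Phi_cycle:
  assumes "1 \<le> j" "j \<le> Suc n" "\<rho> permutes {1..n}"
  shows "Phi (Suc n) (shift_cycle n j \<circ> \<rho>) = cyc n j \<cdot> Phi n \<rho>"
proof -
  have "\<rho> (Suc n) = Suc n" using assms(3) by (simp add: permutes_def)
  moreover have "inv (shift_cycle n j) \<circ> (shift_cycle n j \<circ> \<rho>) = \<rho>"
    using permutes_inverses(2)[OF cycle_permutes[OF assms(1)], of n] by (auto simp: fun_eq_iff)
  ultimately show ?thesis using cycle_last[OF assms(2)] by simp
qed

text \<open>A generator to the left of the cycle passes it unchanged, lengthens it, shortens it, or
  passes it with its index lowered by one. The same relations hold for the \<open>\<sigma> i\<close>
  and for transpositions, so both sides follow the same case.\<close>

lemma Phi_step:
  "n \<le> N \<Longrightarrow> \<pi> permutes {1..n} \<Longrightarrow> 1 \<le> i \<Longrightarrow> i < n \<Longrightarrow> Phi n (simple_transp i \<circ> \<pi>) = \<sigma> i \<cdot> Phi n \<pi>"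
proof (induction n arbitrary: \<pi> i)
  case 0 then show ?case by simp
next
  case (Suc n)
  obtain j \<rho> where j: "1 \<le> j" "j \<le> Suc n" "\<rho> permutes {1..n}" "\<pi> = shift_cycle n j \<circ> \<rho>"
    by (rule cycle_split[OF Suc.prems(2)])
  note i = Suc.prems(3,4)
  have n: "n < N" using Suc.prems(1) by simp
  have P: "Phi (Suc n) \<pi> = cyc n j \<cdot> Phi n \<rho>" using Phi_cycle[OF j(1-3)] j(4) by simp
  have slide: ?case if i': "1 \<le> i'" "i' < n" and s: "simple_transp i \<circ> shift_cycle n j = shift_cycle n j \<circ> simple_transp i'"
      "\<sigma> i \<cdot> cyc n j = cyc n j \<cdot> \<sigma> i'" for i'
  proof -
    have "simple_transp i \<circ> \<pi> = shift_cycle n j \<circ> (simple_transp i' \<circ> \<rho>)"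
      using s(1) by (simp add: j(4) flip: o_assoc) (simp add: o_assoc)
    then have "Phi (Suc n) (simple_transp i \<circ> \<pi>) = cyc n j \<cdot> Phi n (simple_transp i' \<circ> \<rho>)"
      using Phi_cycle[OF j(1,2) permutes_compose[OF j(3) simple_transp_permutes[OF i']]] by simp
    also have "\<dots> = (cyc n j \<cdot> \<sigma> i') \<cdot> Phi n \<rho>" by (simp only: Suc.IH[OF less_imp_le[OF n] j(3) i'] assoc)
    also have "\<dots> = \<sigma> i \<cdot> Phi (Suc n) \<pi>" by (simp only: s(2)[symmetric] P assoc)
    finally show ?thesis .
  qed
  consider "Suc i < j" | "j = Suc i" | "i = j" | "j < i" by linarith
  then show ?case
  proof cases
    case 1
    then show ?thesis using slide[of i] i j n cyc_far[of j n i] sym.cyc_far[of j n "Suc n" i] by simp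
  next
    case 2
    have "simple_transp i \<circ> \<pi> = shift_cycle n i \<circ> \<rho>"
      using i sym.cyc_step[of i n] by (simp add: j(4) 2 o_assoc)
    moreover have "i \<le> Suc n" "i \<le> n" using i by simp_all
    ultimately show ?thesis
      by (simp only: Phi_cycle[OF i(1) _ j(3)] cyc_step[of i n] P 2 assoc)
  next
    case 3
    then have c: "cyc n j = \<sigma> i \<cdot> cyc n (Suc j)" "shift_cycle n j = simple_transp i \<circ> shift_cycle n (Suc j)"
      using i cyc_step[of j n] sym.cyc_step[of j n] by simp_all
    have "simple_transp i \<circ> \<pi> = shift_cycle n (Suc j) \<circ> \<rho>"
      by (simp add: j(4) c(2) fun_eq_iff simple_transp_def)
    then have "Phi (Suc n) (simple_transp i \<circ> \<pi>) = cyc n (Suc j) \<cdot> Phi n \<rho>"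
      using Phi_cycle[OF _ _ j(3), of "Suc j"] i 3 by simp
    moreover have "e \<cdot> cyc n (Suc j) = cyc n (Suc j)" unfolding cyc_def by (rule e_word) (use n in auto)
    moreover have "\<sigma> i \<cdot> Phi (Suc n) \<pi> = ((\<sigma> i \<cdot> \<sigma> i) \<cdot> cyc n (Suc j)) \<cdot> Phi n \<rho>"
      by (simp only: P c(1) assoc)
    ultimately show ?thesis using square[of i] i n by (simp only:)
  next
    case 4
    then show ?thesis using slide[of "i - 1"] i j n cyc_braid[of j n i] sym.cyc_braid[of j n "Suc n" i] by simp
  qed
qed

lemma Phi_id: "n \<le> N \<Longrightarrow> Phi n id = e"
proof (induction n)
  case (Suc n)
  then show ?case using sym.cyc_end[of n] by (simp add: cyc_end e_e)
qed simp

lemma Phi_perm_of: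
  "n \<le> N \<Longrightarrow> set is \<subseteq> {1..<n} \<Longrightarrow> \<rho> permutes {1..n} \<Longrightarrow> Phi n (perm_of is \<rho>) = word is (Phi n \<rho>)"
proof (induction "is")
  case (Cons i "is")
  have "Phi n (perm_of (i # is) \<rho>) = \<sigma> i \<cdot> Phi n (perm_of is \<rho>)"
    unfolding sym.word_simps by (rule Phi_step[OF _ perm_of_permutes]) (use Cons.prems in auto)
  moreover have "Phi n (perm_of is \<rho>) = word is (Phi n \<rho>)" using Cons by simp
  ultimately show ?case by (simp only: word_simps)
qed simp

lemma e_Phi: "n \<le> N \<Longrightarrow> \<pi> permutes {1..n} \<Longrightarrow> e \<cdot> Phi n \<pi> = Phi n \<pi>"
  using ex_perm_of[of \<pi> n] Phi_perm_of[of n _ id] e_word by (force simp: Phi_id permutes_id)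

text \<open>Every permutation is a word in simple transpositions, so the rule for one generator on
  the left can be iterated.\<close>

lemma Phi_mul:
  assumes "n \<le> N" "\<pi> permutes {1..n}" "\<rho> permutes {1..n}"
  shows "Phi n (\<pi> \<circ> \<rho>) = Phi n \<pi> \<cdot> Phi n \<rho>"
proof -
  obtain "is" where w: "set is \<subseteq> {1..<n}" "\<pi> = perm_of is id" using ex_perm_of[OF assms(2)] by blast
  have "\<pi> \<circ> \<rho> = perm_of is \<rho>" using sym.word_mul[of "is" id \<rho>] w by simp
  then have "Phi n (\<pi> \<circ> \<rho>) = word is (e \<cdot> Phi n \<rho>)" using assms w by (simp add: Phi_perm_of e_Phi)
  also have "\<dots> = Phi n \<pi> \<cdot> Phi n \<rho>" using assms w by (simp add: word_mul Phi_perm_of permutes_id Phi_id)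
  finally show ?thesis .
qed

lemma Phi_simple: "n \<le> N \<Longrightarrow> 1 \<le> i \<Longrightarrow> i < n \<Longrightarrow> Phi n (simple_transp i) = \<sigma> i"
  using Phi_step[of n id i] by (simp add: permutes_id Phi_id e_right)

end

lemma coxeter_length_word:
  assumes "\<pi> permutes {1..n}"
  obtains "is" where "length is = coxeter_length n \<pi>" "set is \<subseteq> {1..<n}" "\<pi> = perm_of is id"
proof -
  have w: "foldr (\<circ>) (map simple_transp is) id = perm_of is id" for "is"
    by (induction "is") (simp_all only: list.map foldr.simps sym.word_simps o_apply id_apply)
  have "\<exists>is. length is = coxeter_length n \<pi> \<and> set is \<subseteq> {1..<n} \<and> \<pi> = perm_of is id"
    unfolding coxeter_length_def w by (rule LeastI_ex) (use ex_perm_of[OF assms] in blast)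
  then show ?thesis using that by blast
qed

lemma sign_perm_of: "permutation (perm_of is id) \<and> sign (perm_of is id) = (- 1) ^ length is"
proof (induction "is")
  case (Cons i "is")
  let ?t = "transpose i (Suc i)"
  have t: "permutation ?t" by (rule permutation_swap_id)
  have s: "sign ?t = - 1" by (simp add: sign_swap_id)
  have e: "perm_of (i # is) id = ?t \<circ> perm_of is id" by (simp only: sym.word_simps simple_transp_def)
  show ?case unfolding e using permutation_compose[OF t] sign_compose[OF t] Cons by (simp only: s) simp
qed (simp_all only: sym.word_simps permutation_id sign_id list.size power_0 simp_thms)

text \<open>The length is a minimum over words, but all words for one permutation have the same
  parity. With \<open>sign\<close> in its place, multiplicativity becomes available.\<close>

lemma coxeter_length_sign: "\<pi> permutes {1..n} \<Longrightarrow> (- 1) ^ coxeter_length n \<pi> = sign \<pi>"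
  by (rule coxeter_length_word, assumption) (simp only: sign_perm_of)

context word_category begin

lemma pol_sum:
  "finite T \<Longrightarrow> (\<And>i. i \<in> T \<Longrightarrow> pol V s \<chi> n (g i) (\<kappa> i)) \<Longrightarrow> pol V s \<chi> n (sum g T) (sum \<kappa> T)"
proof (induction T rule: finite_induct)
  case empty
  show ?case using pol_scale[OF pol_one[of V s \<chi> n], of 0] by simp
next
  case (insert i T)
  then show ?case by (simp add: pol_add)
qed

end

section \<open>The symmetric group acting on parallel strands\<close>

context strands begin

text \<open>Strands are numbered from the right, matching the convention of
  \<open>iota\<close>.\<close>

abbreviation crossing_at where "crossing_at n i \<equiv> wh (P (n - i - 1)) s (P (i - 1))"

lemma coxeter_strands: "coxeter (\<bullet>) (one (P n)) (crossing_at n) n"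
proof unfold_locales
  fix i :: nat assume i: "1 \<le> i" "i < n"
  have h: "crossing_at n i \<in> hom (P n) (P n)" by (rule s_homI) (use i in simp)
  show "one (P n) \<bullet> crossing_at n i = crossing_at n i" "crossing_at n i \<bullet> one (P n) = crossing_at n i"
    by (rule one_left[OF h], rule one_right[OF h])
  have "crossing_at n i \<bullet> crossing_at n i = one (P (n - i - 1) @ [V, V] @ P (i - 1))"
    by (simp only: wh_mul[symmetric] s_sq wh_one)
  moreover have "P (n - i - 1) @ [V, V] @ P (i - 1) = P n"
  proof -
    have "n = Suc (Suc (n - i - 1 + (i - 1)))" using i by simp
    then show ?thesis by (metis append_Cons append_Nil replicate_Suc rep_rep(1,3))
  qed
  ultimately show "crossing_at n i \<bullet> crossing_at n i = one (P n)" by simp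
next
  fix i j :: nat assume ij: "1 \<le> i" "Suc i < j" "j < n"
  obtain m where m: "j = Suc (Suc (m + (i - 1))) + 1" using ij less_imp_Suc_add[of "Suc i" j]
    by (metis add.commute add_Suc_right le_add_diff_inverse plus_1_eq_Suc add_Suc)
  have e: "n - i - 1 = n - j - 1 + Suc (Suc m)" "j - 1 = m + Suc (Suc (i - 1))" using m ij by simp_all
  show "crossing_at n i \<bullet> crossing_at n j = crossing_at n j \<bullet> crossing_at n i"
    unfolding e using exchange[OF s_hom s_hom, of "P (n - j - 1)" "P m" "P (i - 1)"] by (simp add: add.commute)
next
  fix i :: nat assume i: "1 \<le> i" "Suc i < n"
  have e: "n - i - 1 = Suc (n - Suc i - 1)" "Suc i - 1 = Suc (i - 1)" using i by simp_all
  show "crossing_at n i \<bullet> crossing_at n (Suc i) \<bullet> crossing_at n i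
    = crossing_at n (Suc i) \<bullet> crossing_at n i \<bullet> crossing_at n (Suc i)"
    unfolding e using arg_cong[OF braid, of "\<lambda>f. wh (P (n - Suc i - 1)) f (P (i - 1))"]
    by (simp add: wh_mul wh_wh)
qed (simp_all add: mul_assoc one_left[OF one_hom])

definition symm_rep where
  "symm_rep n \<Phi> \<longleftrightarrow> \<Phi> id = one (P n) \<and>
     (\<forall>\<pi> \<rho>. \<pi> permutes {1..n} \<longrightarrow> \<rho> permutes {1..n} \<longrightarrow> \<Phi> (\<pi> \<circ> \<rho>) = \<Phi> \<pi> \<bullet> \<Phi> \<rho>) \<and>
     (\<forall>i. 1 \<le> i \<longrightarrow> i < n \<longrightarrow> \<Phi> (simple_transp i) = crossing_at n i)"

lemma ex_symm_rep: "\<exists>\<Phi>. symm_rep n \<Phi>"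
proof -
  interpret cx: coxeter "(\<bullet>)" "one (P n)" "crossing_at n" n by (rule coxeter_strands)
  show ?thesis unfolding symm_rep_def
    by (intro exI[of _ "cx.Phi n"]) (use cx.Phi_id[of n] cx.Phi_mul[of n] cx.Phi_simple[of n] in blast)
qed

lemma symm_rep_pol:
  assumes \<Phi>: "symm_rep n \<Phi>" and \<pi>: "\<pi> permutes {1..n}"
  shows "pol V s \<chi> n (\<Phi> \<pi>) (\<chi> ^ coxeter_length n \<pi>)"
proof -
  have "pol V s \<chi> n (\<Phi> (perm_of is id)) (\<chi> ^ length is)" if "set is \<subseteq> {1..<n}" for "is" using that
  proof (induction "is")
    case Nil
    show ?case using \<Phi> pol_one[of V s \<chi> n] by (simp only: symm_rep_def sym.word_simps) simp
  next
    case (Cons i "is")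
    have i: "1 \<le> i" "i < n" using Cons.prems by auto
    have "perm_of is id permutes {1..n}" by (rule perm_of_permutes) (use Cons.prems in \<open>auto simp: permutes_id\<close>)
    then have "\<Phi> (perm_of (i # is) id) = crossing_at n i \<bullet> \<Phi> (perm_of is id)"
      unfolding sym.word_simps using \<Phi> simple_transp_permutes[OF i] i unfolding symm_rep_def by metis
    moreover have "pol V s \<chi> n (\<Phi> (perm_of is id)) (\<chi> ^ length is)" by (rule Cons.IH) (use Cons.prems in auto)
    moreover have "n = Suc (Suc (n - i - 1 + (i - 1)))" using i by simp
    ultimately show ?case using pol_mul[of V s \<chi> n _ "\<chi> ^ length is" "n - i - 1" "i - 1"]
      by (simp only: list.size power_Suc add_0_right add_Suc_right)
  qed
  then show ?thesis using coxeter_length_word[OF \<pi>] by metis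
qed

lemma symm_rep_hom: "symm_rep n \<Phi> \<Longrightarrow> \<pi> permutes {1..n} \<Longrightarrow> \<Phi> \<pi> \<in> hom (P n) (P n)"
  using pol_hom[OF symm_rep_pol] by blast

text \<open>Multiplication by a generator permutes the summands and changes the coefficients by
  \<open>\<chi>\<close>; for \<open>\<chi> = - 1\<close> this is multiplicativity of
  \<open>sign\<close>. The value is 1 because each of the \<open>fact n\<close> permutations
  contributes \<open>1 / fact n\<close>.\<close>

lemma proj_symm_rep:
  assumes \<Phi>: "symm_rep n \<Phi>" and \<chi>: "\<chi> = 1 \<or> \<chi> = - 1"
  shows "proj V s \<chi> n (\<Sum>\<pi> | \<pi> permutes {1..n}. (\<chi> ^ coxeter_length n \<pi> / fact n) *s \<Phi> \<pi>)"
proof -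
  let ?S = "{\<pi>. \<pi> permutes {1..n}}" and ?w = "\<lambda>\<pi>. \<chi> ^ coxeter_length n \<pi>"
  let ?e = "\<Sum>\<pi>\<in>?S. (?w \<pi> / fact n) *s \<Phi> \<pi>"
  have fin: "finite ?S" by (rule finite_permutations) simp
  have card: "card ?S = fact n" by (rule card_permutations) simp_all
  have perm: "permutation \<pi>" if "\<pi> \<in> ?S" for \<pi> using that unfolding permutation_permutes by blast
  have st: "simple_transp i \<in> ?S" if "1 \<le> i" "i < n" for i using simple_transp_permutes that by simp
  have inv: "simple_transp i \<circ> (simple_transp i \<circ> \<pi>) = \<pi>" "(\<pi> \<circ> simple_transp i) \<circ> simple_transp i = \<pi>" for i \<pi>
    by (simp_all add: fun_eq_iff simple_transp_def)
  have w: "?w (simple_transp i \<circ> \<pi>) = \<chi> * ?w \<pi> \<and> ?w (\<pi> \<circ> simple_transp i) = \<chi> * ?w \<pi>"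
    if i: "1 \<le> i" "i < n" and \<pi>: "\<pi> \<in> ?S" for i \<pi>
  proof (cases "\<chi> = 1")
    case False
    then have "?w \<rho> = of_int (sign \<rho>)" if "\<rho> \<in> ?S" for \<rho>
      using coxeter_length_sign[of \<rho> n] \<chi> that by (metis (mono_tags) mem_Collect_eq of_int_1 of_int_minus of_int_power)
    moreover have "sign (simple_transp i) = - 1" by (simp add: simple_transp_def sign_swap_id)
    moreover have "simple_transp i \<circ> \<pi> \<in> ?S" "\<pi> \<circ> simple_transp i \<in> ?S"
      using st[OF i] \<pi> by (auto intro: permutes_compose simp del: o_apply)
    ultimately show ?thesis using False \<chi> \<pi>
      by (simp only: sign_compose[OF perm[OF st[OF i]] perm[OF \<pi>]] sign_compose[OF perm[OF \<pi>] perm[OF st[OF i]]]) simp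
  qed simp
  have "(\<Sum>\<pi>\<in>?S. ?w \<pi> / fact n * ?w \<pi>) = (\<Sum>\<pi>\<in>?S. 1 / fact n)"
    using \<chi> by (intro sum.cong) (auto simp flip: power_mult_distrib)
  also have "\<dots> = 1" using card by simp
  finally have pol: "pol V s \<chi> n ?e 1"
    using pol_sum[OF fin pol_scale[OF symm_rep_pol[OF \<Phi>]], of "\<lambda>\<pi>. \<pi>" "\<lambda>\<pi>. ?w \<pi> / fact n"] by simp
  have key: "crossing_at n i \<bullet> ?e = \<chi> *s ?e \<and> ?e \<bullet> crossing_at n i = \<chi> *s ?e" if i: "1 \<le> i" "i < n" for i
  proof
    have \<Phi>i: "crossing_at n i \<bullet> \<Phi> \<pi> = \<Phi> (simple_transp i \<circ> \<pi>)" "\<Phi> \<pi> \<bullet> crossing_at n i = \<Phi> (\<pi> \<circ> simple_transp i)"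
      if "\<pi> \<in> ?S" for \<pi>
      using \<Phi> that i simple_transp_permutes[OF i] unfolding symm_rep_def by (metis mem_Collect_eq)+
    have "crossing_at n i \<bullet> ?e = (\<Sum>\<pi>\<in>?S. (?w \<pi> / fact n) *s \<Phi> (simple_transp i \<circ> \<pi>))"
      using \<Phi>i(1) by (simp add: mul_sum_right mul_scale_right)
    also have "\<dots> = (\<Sum>\<pi>\<in>?S. (?w (simple_transp i \<circ> \<pi>) / fact n) *s \<Phi> \<pi>)"
      by (rule sum.reindex_bij_witness[of _ "\<lambda>\<pi>. simple_transp i \<circ> \<pi>" "\<lambda>\<pi>. simple_transp i \<circ> \<pi>"])
        (use st[OF i] in \<open>auto simp only: inv mem_Collect_eq intro!: permutes_compose\<close>)
    also have "\<dots> = \<chi> *s ?e" using w[OF i] by (simp add: scale_sum_right)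
    finally show "crossing_at n i \<bullet> ?e = \<chi> *s ?e" .
    have "?e \<bullet> crossing_at n i = (\<Sum>\<pi>\<in>?S. (?w \<pi> / fact n) *s \<Phi> (\<pi> \<circ> simple_transp i))"
      using \<Phi>i(2) by (simp add: mul_sum_left mul_scale_left)
    also have "\<dots> = (\<Sum>\<pi>\<in>?S. (?w (\<pi> \<circ> simple_transp i) / fact n) *s \<Phi> \<pi>)"
      by (rule sum.reindex_bij_witness[of _ "\<lambda>\<pi>. \<pi> \<circ> simple_transp i" "\<lambda>\<pi>. \<pi> \<circ> simple_transp i"])
        (use st[OF i] in \<open>auto simp only: inv mem_Collect_eq intro!: permutes_compose\<close>)
    also have "\<dots> = \<chi> *s ?e" using w[OF i] by (simp add: scale_sum_right)
    finally show "?e \<bullet> crossing_at n i = \<chi> *s ?e" .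
  qed
  have at: "crossing_at n (Suc b) = wh (P a) s (P b)" if "n = Suc (Suc (a + b))" for a b using that by simp
  show ?thesis unfolding proj_def labs_def rabs_def
  proof (intro conjI allI impI)
    fix a b assume n: "n = Suc (Suc (a + b))"
    show "wh ([] @ P a) s (P b @ []) \<bullet> ?e = \<chi> *s ?e" "?e \<bullet> wh ([] @ P a) s (P b @ []) = \<chi> *s ?e"
      using key[of "Suc b"] at[OF n] n by simp_all
  qed (rule pol)
qed

end

section \<open>Symmetrizers in the Heisenberg category\<close>

context heis_cat begin

abbreviation "s \<equiv> ev (Gen Gs)"
abbreviation "sng n \<equiv> single C (replicate n Up) (replicate n Up)"
abbreviation "sngD n \<equiv> single C (replicate n Down) (replicate n Down)"

lemma ev_t: "ev t_tm = H.t"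
proof -
  have "fwh C [] (ev (Gen Gc)) [Up, Down] \<in> fhom C [Up, Down] [Down, Up, Up, Down]"
    by (rule wh_homI[OF H.c_hom]) simp_all
  from one_right[OF this] show ?thesis
    unfolding t_tm_def H.t_def by (simp add: wh_wh wh_one)
qed

lemma ev_dx: "ev (dx a) = ev (Gen Gd) \<bullet> fwh C [] (ev (xpow a)) [Down]"
  unfolding dx_def ev_simps ..

lemma ev_xc: "ev (xc a) = fwh C [Down] (ev (xpow a)) [] \<bullet> ev (Gen Gc)"
  unfolding xc_def ev_simps ..

lemma ev_xpow: "ev (xpow 0) = fone C [Up]" "ev (xpow (Suc a)) = ev (Gen Gx) \<bullet> ev (xpow a)"
  by simp_all

lemma heisenberg_pos:
  assumes k: "0 \<le> k"
  shows "heisenberg scale (fhom C) (fone C) (fmul C) (fwh C) Up s 1 Down H.sD H.t (ev (Gen Gx)) (ev (Gen Gd))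
    (- ev (Gen Gc)) 1 (nat k) (ev (Gen Gt')) (\<lambda>a. ev (Gen (Gu a))) (\<lambda>a. ev (xpow a))"
proof (rule H.heisenberg_pos[OF ev_xpow])
  show "ev (Gen Gt') \<in> fhom C [Down, Up] [Up, Down]" by (rule ev_hom, rule typed_gens)
  have lt: "int a < k" if "a < nat k" for a using that by simp
  show "ev (Gen (Gu a)) \<in> fhom C [] [Up, Down]" if "a < nat k" for a
    by (rule ev_hom, rule typed_gens(6)[OF lt[OF that]])
  show "H.t \<bullet> ev (Gen Gt') = fone C [Down, Up]"
    by (rule ev_rel[OF pos_tt'[OF k], of "[Down, Up]" "[Down, Up]", unfolded ev_simps ev_t])
      ((rule typed_basic typed_t | simp)+)
  show "H.t \<bullet> ev (Gen (Gu a)) = 0" if "a < nat k" for a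
    by (rule ev_rel[OF pos_tu[OF lt[OF that]], of "[]" "[Down, Up]", unfolded ev_simps ev_t])
      ((rule typed_gens(6)[OF lt[OF that]] typed_basic typed_t | simp)+)
  show "ev (Gen Gd) \<bullet> fwh C [] (ev (xpow a)) [Down] \<bullet> ev (Gen Gt') = 0" if "a < nat k" for a
    by (rule ev_rel[OF pos_dt'[OF lt[OF that]], of "[Down, Up]" "[]", unfolded ev_simps ev_dx mul_assoc])
      ((rule typed_basic typed_dx | simp)+)
  show "ev (Gen Gd) \<bullet> fwh C [] (ev (xpow a)) [Down] \<bullet> ev (Gen (Gu b)) = (if a = b then fone C [] else 0)"
    if "a < nat k" "b < nat k" for a b
  proof -
    have "ev (Cmp (dx a) (Gen (Gu b))) = ev (if a = b then Idt [] else Zer [] [])"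
      by (rule ev_rel[OF pos_du[OF lt[OF that(1)] lt[OF that(2)]], of "[]" "[]"])
       (rule typed_basic typed_dx typed_gens(6)[OF lt[OF that(2)]] | simp add: typed.intros)+
    then show ?thesis by (simp only: ev_simps ev_dx mul_assoc if_distrib[of ev])
  qed
  show "ev (Gen Gt') \<bullet> H.t + (\<Sum>a<nat k. ev (Gen (Gu a)) \<bullet> ev (Gen Gd) \<bullet> fwh C [] (ev (xpow a)) [Down]) = fone C [Up, Down]"
  proof -
    have ty: "typ (tm_sum [Up, Down] [Up, Down] (map (\<lambda>a. Cmp (Gen (Gu a)) (dx a)) [0..<nat k])) [Up, Down] [Up, Down]"
      by (rule typed_sum) (auto intro: typed.intros(3)[OF typed_dx typed_gens(6)])
    show ?thesis
      by (rule ev_rel[OF pos_sum[OF k], of "[Up, Down]" "[Up, Down]", unfolded ev_simps ev_t ev_sum ev_dx])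
        ((rule ty typed_basic typed_t | simp)+)
  qed
qed

lemma heisenberg_neg:
  assumes k: "k \<le> 0"
  shows "\<exists>xq. heisenberg scale (\<lambda>X Y. fhom C Y X) (fone C) (\<lambda>g f. f \<bullet> g) (fwh C) Down H.sD (- 1) Up s H.t
    H.xD (ev (Gen Gc)) (ev (Gen Gd)) (- 1) (nat (- k)) (ev (Gen Gt')) (\<lambda>a. ev (Gen (Gv a))) xq"
proof (rule H.heisenberg_neg[OF ev_xpow])
  show "ev (Gen Gt') \<in> fhom C [Down, Up] [Up, Down]" by (rule ev_hom, rule typed_gens)
  have lt: "int a < - k" if "a < nat (- k)" for a using that by simp
  show "ev (Gen (Gv a)) \<in> fhom C [Down, Up] []" if "a < nat (- k)" for a
    by (rule ev_hom, rule typed_gens(7)[OF lt[OF that]])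
  show "ev (Gen Gt') \<bullet> H.t = fone C [Up, Down]"
    by (rule ev_rel[OF neg_t't[OF k], of "[Up, Down]" "[Up, Down]", unfolded ev_simps ev_t])
      ((rule typed_basic typed_t | simp)+)
  show "ev (Gen Gt') \<bullet> fwh C [Down] (ev (xpow a)) [] \<bullet> ev (Gen Gc) = 0" if "a < nat (- k)" for a
    by (rule ev_rel[OF neg_t'c[OF lt[OF that]], of "[]" "[Up, Down]", unfolded ev_simps ev_xc])
      ((rule typed_basic typed_xc | simp)+)
  show "ev (Gen (Gv a)) \<bullet> H.t = 0" if "a < nat (- k)" for a
    by (rule ev_rel[OF neg_vt[OF lt[OF that]], of "[Up, Down]" "[]", unfolded ev_simps ev_t])
      ((rule typed_gens(7)[OF lt[OF that]] typed_basic typed_t | simp)+)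
  show "ev (Gen (Gv a)) \<bullet> fwh C [Down] (ev (xpow b)) [] \<bullet> ev (Gen Gc) = (if a = b then fone C [] else 0)"
    if "a < nat (- k)" "b < nat (- k)" for a b
  proof -
    have "ev (Cmp (Gen (Gv a)) (xc b)) = ev (if a = b then Idt [] else Zer [] [])"
      by (rule ev_rel[OF neg_vc[OF lt[OF that(1)] lt[OF that(2)]], of "[]" "[]"])
       (rule typed_basic typed_xc typed_gens(7)[OF lt[OF that(1)]] | simp add: typed.intros)+
    then show ?thesis by (simp only: ev_simps ev_xc if_distrib[of ev])
  qed
  show "H.t \<bullet> ev (Gen Gt') + (\<Sum>a<nat (- k). (fwh C [Down] (ev (xpow a)) [] \<bullet> ev (Gen Gc)) \<bullet> ev (Gen (Gv a))) = fone C [Down, Up]"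
  proof -
    have ty: "typ (tm_sum [Down, Up] [Down, Up] (map (\<lambda>a. Cmp (xc a) (Gen (Gv a))) [0..<nat (- k)])) [Down, Up] [Down, Up]"
      by (rule typed_sum) (auto intro: typed.intros(3)[OF typed_gens(7) typed_xc])
    show ?thesis
      by (rule ev_rel[OF neg_sum[OF k], of "[Down, Up]" "[Down, Up]", unfolded ev_simps ev_t ev_sum ev_xc])
        ((rule ty typed_basic typed_t | simp)+)
  qed
qed

lemma typed_ncup: "typ (ncup n) [] (replicate n Down @ replicate n Up)"
  by (induction n) (auto intro!: typed_basic simp: replicate_append_same)

lemma typed_ncap: "typ (ncap n) (replicate n Up @ replicate n Down) []"
  by (induction n) (auto intro!: typed_basic simp: replicate_append_same)

lemma ev_ncup: "ev (ncup n) = H.cupn n"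
proof (induction n)
  case (Suc n)
  then show ?case by (simp only: ncup.simps ev_simps H.cupn.simps wh_wh append_Nil append_Nil2)
qed (simp only: ncup.simps ev_simps H.cupn.simps)

lemma ev_ncap: "ev (ncap n) = H.capn n"
proof (induction n)
  case (Suc n)
  then show ?case by (simp only: ncap.simps ev_simps H.capn.simps wh_wh append_Nil append_Nil2)
qed (simp only: ncap.simps ev_simps H.capn.simps)

lemma mate_dual:
  assumes "F \<in> hom C (replicate n Up) (replicate n Up)"
  shows "mate k n F \<in> hom C (replicate n Down) (replicate n Down) \<and> sngD n (mate k n F) = H.dual n (sng n F)"
proof -
  let ?U = "replicate n Up" and ?D = "replicate n Down"
  obtain f where f: "typ f ?U ?U" "F = cls f" using hom_cls[OF assms] by blast
  let ?g1 = "Ten (ncup n) (Idt ?D)" and ?g2 = "Ten (Idt ?D) (Ten f (Idt ?D))" and ?g3 = "Ten (Idt ?D) (ncap n)"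
  have I: "typ (Idt ?D) ?D ?D" by (rule typed_basic)
  have 1: "typ ?g1 ?D (?D @ ?U @ ?D)" by (rule typed_Ten[OF typed_ncup I]) simp_all
  have 2: "typ (Ten f (Idt ?D)) (?U @ ?D) (?U @ ?D)" by (rule typed_Ten[OF f(1) I]) simp_all
  have 3: "typ ?g2 (?D @ ?U @ ?D) (?D @ ?U @ ?D)" by (rule typed_Ten[OF I 2]) simp_all
  have 4: "typ ?g3 (?D @ ?U @ ?D) ?D" by (rule typed_Ten[OF I typed_ncap]) simp_all
  have m: "mate k n F = cls (Cmp ?g3 (Cmp ?g2 ?g1))"
    unfolding mate_def Let_def C_def[symmetric] cls_Idt f(2) cls_Ten[OF typed_ncup I] cls_Ten[OF f(1) I] cls_Ten[OF I 2]
      cls_Ten[OF I typed_ncap] cls_Cmp[OF 1 3] cls_Cmp[OF typed.intros(3)[OF 1 3] 4] ..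
  have ty: "typ (Cmp ?g3 (Cmp ?g2 ?g1)) ?D ?D" by (rule typed.intros(3)[OF typed.intros(3)[OF 1 3] 4])
  have "sngD n (mate k n F) = ev (Cmp ?g3 (Cmp ?g2 ?g1))" using ev_single[OF ty] m by simp
  also have "\<dots> = H.dual n (sng n F)"
    using ev_single[OF f(1)] f(2) by (simp only: ev_simps ev_ncup ev_ncap H.dual_def wh_wh append_Nil append_Nil2)
  finally show ?thesis using cls_hom[OF ty] m by simp
qed

lemma finite_permutes: "finite {\<pi>. \<pi> permutes {1..n :: nat}}"
  by (rule finite_permutations) simp

lemma grp_basis_in: "\<pi> permutes {1..n} \<Longrightarrow> grp_basis \<pi> \<in> grp_alg n"
  by (auto simp: grp_basis_def grp_alg_def)

lemma grp_alg_add: "a \<in> grp_alg n \<Longrightarrow> b \<in> grp_alg n \<Longrightarrow> (\<lambda>\<pi>. a \<pi> + b \<pi>) \<in> grp_alg n"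
  by (simp add: grp_alg_def)

lemma grp_alg_scale: "a \<in> grp_alg n \<Longrightarrow> (\<lambda>\<pi>. c * a \<pi>) \<in> grp_alg n"
  by (auto simp: grp_alg_def)

lemma sum_scale_basis:
  assumes "\<pi> permutes {1..n}"
  shows "(\<Sum>\<sigma> | \<sigma> permutes {1..n}. scale (grp_basis \<pi> \<sigma>) (\<Phi> \<sigma>)) = (\<Phi> \<pi> :: (updown, 'a heis_mor, 'a) fam)"
proof -
  have "(\<Sum>\<sigma> | \<sigma> permutes {1..n}. scale (grp_basis \<pi> \<sigma>) (\<Phi> \<sigma>)) = (\<Sum>\<sigma> | \<sigma> permutes {1..n}. if \<sigma> = \<pi> then \<Phi> \<sigma> else 0)"
    by (rule sum.cong) (auto simp: grp_basis_def)
  also have "\<dots> = \<Phi> \<pi>" using assms finite_permutes[of n] by simp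
  finally show ?thesis .
qed

definition crossing_tm :: "nat \<Rightarrow> nat \<Rightarrow> 'a heis_tm" where
  "crossing_tm n i = Ten (Idt (replicate (n - i - 1) Up)) (Ten (Gen Gs) (Idt (replicate (i - 1) Up)))"

lemma typed_crossing: "1 \<le> i \<Longrightarrow> i < n \<Longrightarrow> typ (crossing_tm n i) (replicate n Up) (replicate n Up)"
proof -
  assume "1 \<le> i" "i < n"
  then have n: "n = n - i - 1 + Suc (Suc (i - 1))" by simp
  have e: "replicate n Up = replicate (n - i - 1) Up @ [Up, Up] @ replicate (i - 1) Up"
    by (subst n) (simp only: replicate_add replicate_Suc append_Cons append_Nil)
  show ?thesis unfolding crossing_tm_def
    by (rule typed_Ten, rule typed_basic, rule typed_Ten, rule typed_basic, rule typed_basic) (simp_all only: e append_Nil)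
qed

lemma ev_crossing: "ev (crossing_tm n i) = fwh C (replicate (n - i - 1) Up) s (replicate (i - 1) Up)"
  unfolding crossing_tm_def ev_simps by (simp add: wh_wh del: ev.simps)

lemma strandsU: "\<chi> * \<chi> = 1 \<Longrightarrow> strands scale (fhom C) (fone C) (fmul C) (fwh C) Up s \<chi>"
  by (rule H.strandsU)

definition iota_spec where
  "iota_spec n \<phi> \<longleftrightarrow> grp_alg_hom n C (replicate n Up) \<phi> \<and>
     (\<forall>i\<in>{1..<n}. \<phi> (grp_basis (simple_transp i)) = cls (crossing_tm n i))"

text \<open>Permutations act by \<open>ex_symm_rep\<close>, and the action is extended linearly.
  Convolution becomes composition after substituting \<open>\<sigma> \<circ> \<rho>\<close> for the
  permutation summed over.\<close>

lemma ex_iota: "\<exists>\<phi>. iota_spec n \<phi>"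
proof -
  interpret S: strands scale "fhom C" "fone C" "fmul C" "fwh C" Up s 1 by (rule strandsU) simp
  let ?X = "replicate n Up" and ?S = "{\<pi>. \<pi> permutes {1..n}}"
  obtain \<Phi> where \<Phi>: "S.symm_rep n \<Phi>" using S.ex_symm_rep by blast
  have \<Phi>h: "\<Phi> \<pi> \<in> fhom C ?X ?X" if "\<pi> permutes {1..n}" for \<pi> using S.symm_rep_hom[OF \<Phi> that] .
  define F where "F a = (\<Sum>\<pi>\<in>?S. scale (a \<pi>) (\<Phi> \<pi>))" for a
  define \<phi> where "\<phi> a = comp (F a) C ?X ?X" for a
  have Fh: "F a \<in> fhom C ?X ?X" for a unfolding F_def by (intro sum_hom scale_hom) (use \<Phi>h in auto)
  have \<phi>F: "single C ?X ?X (\<phi> a) = F a" for a unfolding \<phi>_def by (rule single_comp[OF word_cat_C Fh])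
  have \<phi>h: "\<phi> a \<in> hom C ?X ?X" for a unfolding \<phi>_def by (rule comp_hom[OF word_cat_C])
  have eqI: "F a = single C ?X ?X G \<Longrightarrow> G \<in> hom C ?X ?X \<Longrightarrow> \<phi> a = G" for a G
    using single_inject[OF word_cat_C \<phi>h] \<phi>F by metis
  have Fb: "F (grp_basis \<pi>) = \<Phi> \<pi>" if "\<pi> permutes {1..n}" for \<pi> unfolding F_def by (rule sum_scale_basis[OF that])
  have Fm: "F (grp_mult n a b) = F a \<bullet> F b" for a b
  proof -
    have "F (grp_mult n a b) = (\<Sum>\<pi>\<in>?S. \<Sum>\<sigma>\<in>?S. scale (a \<sigma> * b (inv \<sigma> \<circ> \<pi>)) (\<Phi> \<pi>))"
      unfolding F_def grp_mult_def by (simp only: fam.scale_sum_left)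
    also have "\<dots> = (\<Sum>\<sigma>\<in>?S. \<Sum>\<pi>\<in>?S. scale (a \<sigma> * b (inv \<sigma> \<circ> \<pi>)) (\<Phi> \<pi>))" by (rule sum.swap)
    also have "\<dots> = (\<Sum>\<sigma>\<in>?S. \<Sum>\<rho>\<in>?S. scale (a \<sigma> * b \<rho>) (\<Phi> \<sigma> \<bullet> \<Phi> \<rho>))"
    proof (rule sum.cong[OF HOL.refl])
      fix \<sigma> assume "\<sigma> \<in> ?S"
      then have \<sigma>: "\<sigma> permutes {1..n}" by simp
      have i1: "inv \<sigma> \<circ> (\<sigma> \<circ> \<rho>) = \<rho>" and i2: "\<sigma> \<circ> (inv \<sigma> \<circ> \<rho>) = \<rho>" for \<rho>
        using permutes_inverses[OF \<sigma>] by (auto simp: fun_eq_iff)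
      show "(\<Sum>\<pi>\<in>?S. scale (a \<sigma> * b (inv \<sigma> \<circ> \<pi>)) (\<Phi> \<pi>)) = (\<Sum>\<rho>\<in>?S. scale (a \<sigma> * b \<rho>) (\<Phi> \<sigma> \<bullet> \<Phi> \<rho>))"
      proof (rule sum.reindex_bij_witness[of _ "\<lambda>\<rho>. \<sigma> \<circ> \<rho>" "\<lambda>\<pi>. inv \<sigma> \<circ> \<pi>"])
        fix \<pi> assume "\<pi> \<in> ?S"
        then have \<pi>: "\<pi> permutes {1..n}" by simp
        show "\<sigma> \<circ> (inv \<sigma> \<circ> \<pi>) = \<pi>" "inv \<sigma> \<circ> (\<sigma> \<circ> \<pi>) = \<pi>" by (rule i2, rule i1)
        show "inv \<sigma> \<circ> \<pi> \<in> ?S" "\<sigma> \<circ> \<pi> \<in> ?S"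
          using permutes_compose[OF \<pi> permutes_inv[OF \<sigma>]] permutes_compose[OF \<pi> \<sigma>] by (simp_all only: mem_Collect_eq)
        have "\<Phi> \<sigma> \<bullet> \<Phi> (inv \<sigma> \<circ> \<pi>) = \<Phi> (\<sigma> \<circ> (inv \<sigma> \<circ> \<pi>))"
          using \<Phi> \<sigma> permutes_compose[OF \<pi> permutes_inv[OF \<sigma>]] unfolding S.symm_rep_def by metis
        then show "scale (a \<sigma> * b (inv \<sigma> \<circ> \<pi>)) (\<Phi> \<sigma> \<bullet> \<Phi> (inv \<sigma> \<circ> \<pi>)) = scale (a \<sigma> * b (inv \<sigma> \<circ> \<pi>)) (\<Phi> \<pi>)"
          by (simp only: i2)
      qed
    qed
    also have "\<dots> = (\<Sum>\<sigma>\<in>?S. \<Sum>\<rho>\<in>?S. scale (a \<sigma>) (\<Phi> \<sigma>) \<bullet> scale (b \<rho>) (\<Phi> \<rho>))"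
      by (intro sum.cong HOL.refl) (simp only: mul_scale_left mul_scale_right fam.scale_scale mult.commute)
    also have "\<dots> = F a \<bullet> F b" by (simp only: F_def[of a] mul_sum_left) (simp only: F_def[of b] mul_sum_right)
    finally show ?thesis .
  qed
  have "grp_alg_hom n C ?X \<phi>" unfolding grp_alg_hom_def
  proof (intro conjI ballI allI)
    show "\<phi> (grp_basis id) = idm C ?X"
      by (rule eqI[OF _ hidm_hom[OF word_cat_C]])
        (simp only: Fb[OF permutes_id] \<Phi>[unfolded S.symm_rep_def, THEN conjunct1] fone_def[OF word_cat_C])
    show "\<phi> (grp_mult n a b) = cmp C (\<phi> a) (\<phi> b)" for a b
    proof (rule eqI)
      show "cmp C (\<phi> a) (\<phi> b) \<in> hom C ?X ?X" by (rule hcmp_hom[OF word_cat_C \<phi>h \<phi>h])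
      have "F a \<bullet> F b = single C ?X ?X (cmp C (\<phi> a) (\<phi> b))"
        using fmul_single[OF word_cat_C \<phi>h[of b] \<phi>h[of a]] by (simp only: \<phi>F if_True simp_thms)
      then show "F (grp_mult n a b) = single C ?X ?X (cmp C (\<phi> a) (\<phi> b))" by (simp only: Fm)
    qed
    show "\<phi> (\<lambda>\<pi>. a \<pi> + b \<pi>) = add C (\<phi> a) (\<phi> b)" for a b
      by (rule eqI) (simp_all add: hadd_hom[OF word_cat_C \<phi>h \<phi>h] single_add[OF word_cat_C \<phi>h \<phi>h] \<phi>F, simp add: F_def fam.scale_left_distrib sum.distrib)
    show "\<phi> (\<lambda>\<pi>. c * a \<pi>) = scl C c (\<phi> a)" for a c
      by (rule eqI) (simp_all add: hscl_hom[OF word_cat_C \<phi>h] single_scl[OF word_cat_C \<phi>h] \<phi>F, simp add: F_def fam.scale_sum_right)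
  qed (rule \<phi>h)
  moreover have "\<phi> (grp_basis (simple_transp i)) = cls (crossing_tm n i)" if "i \<in> {1..<n}" for i
  proof (rule eqI)
    have i: "1 \<le> i" "i < n" using that by auto
    show "cls (crossing_tm n i) \<in> hom C ?X ?X" by (rule cls_hom[OF typed_crossing[OF i]])
    have "F (grp_basis (simple_transp i)) = ev (crossing_tm n i)"
      unfolding Fb[OF simple_transp_permutes[OF i]] ev_crossing using \<Phi> i unfolding S.symm_rep_def by blast
    then show "F (grp_basis (simple_transp i)) = single C ?X ?X (cls (crossing_tm n i))"
      using ev_single[OF typed_crossing[OF i]] by simp
  qed
  ultimately show ?thesis unfolding iota_spec_def by blast
qed

lemma iota_iota_spec: "iota_spec n (iota k n)"
proof -
  have "iota k n = Eps (iota_spec n)"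
    unfolding iota_def by (rule arg_cong[of _ _ Eps]) (simp only: fun_eq_iff iota_spec_def C_def[symmetric] crossing_tm_def simp_thms)
  then show ?thesis using someI_ex[OF ex_iota[of n]] by (simp only:)
qed

lemma iota_hom: "a \<in> grp_alg n \<Longrightarrow> iota k n a \<in> hom C (replicate n Up) (replicate n Up)"
  using iota_iota_spec[of n] unfolding iota_spec_def grp_alg_hom_def by blast

lemma grp_mult_basis:
  assumes "\<pi> permutes {1..n}" "\<rho> permutes {1..n}"
  shows "grp_mult n (grp_basis \<pi>) (grp_basis \<rho>) = (grp_basis (\<pi> \<circ> \<rho>) :: _ \<Rightarrow> 'a)"
proof
  fix \<tau>
  have "grp_mult n (grp_basis \<pi>) (grp_basis \<rho>) \<tau> = (\<Sum>\<sigma> | \<sigma> permutes {1..n}. if \<sigma> = \<pi> then grp_basis \<rho> (inv \<pi> \<circ> \<tau>) else (0::'a))"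
    unfolding grp_mult_def by (rule sum.cong) (auto simp: grp_basis_def)
  also have "\<dots> = grp_basis \<rho> (inv \<pi> \<circ> \<tau>)" using assms(1) finite_permutes[of n] by simp
  also have "\<dots> = grp_basis (\<pi> \<circ> \<rho>) \<tau>"
  proof -
    have "inv \<pi> \<circ> \<tau> = \<rho> \<longleftrightarrow> \<tau> = \<pi> \<circ> \<rho>" 
    proof -
      have "\<pi> \<circ> (inv \<pi> \<circ> \<tau>) = \<tau>" "inv \<pi> \<circ> (\<pi> \<circ> \<rho>) = \<rho>"
        by (simp_all only: o_assoc permutes_inv_o[OF assms(1)] id_comp)
      then show ?thesis by metis
    qed
    then show ?thesis by (simp only: grp_basis_def)
  qed
  finally show "grp_mult n (grp_basis \<pi>) (grp_basis \<rho>) \<tau> = (grp_basis (\<pi> \<circ> \<rho>) \<tau> :: 'a)" .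
qed

text \<open>Follows from the specification of \<open>iota\<close> alone, so the choice made by
  \<open>SOME\<close> does not matter: basis elements multiply like permutations.\<close>

lemma iota_symm_rep:
  fixes \<chi> :: 'a
  assumes "\<chi> * \<chi> = 1"
  shows "strands.symm_rep (fone C) (fmul C) (fwh C) Up s n (\<lambda>\<pi>. sng n (iota k n (grp_basis \<pi>)))"
proof -
  interpret S: strands scale "fhom C" "fone C" "fmul C" "fwh C" Up s \<chi> by (rule strandsU[OF assms])
  note I = iota_iota_spec[of n, unfolded iota_spec_def grp_alg_hom_def]
  show ?thesis unfolding S.symm_rep_def
  proof (intro conjI allI impI)
    show "sng n (iota k n (grp_basis id)) = fone C (replicate n Up)" using I by (simp add: fone_def[OF word_cat_C])
    fix \<pi> \<rho> assume p: "\<pi> permutes {1..n}" "\<rho> permutes {1..n}"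
    note b = grp_basis_in[OF p(1)] grp_basis_in[OF p(2)]
    have "iota k n (grp_basis (\<pi> \<circ> \<rho>)) = cmp C (iota k n (grp_basis \<pi>)) (iota k n (grp_basis \<rho>))"
      using I b unfolding grp_mult_basis[OF p, symmetric] by blast
    then show "sng n (iota k n (grp_basis (\<pi> \<circ> \<rho>))) = sng n (iota k n (grp_basis \<pi>)) \<bullet> sng n (iota k n (grp_basis \<rho>))"
      using fmul_single[OF word_cat_C iota_hom[OF b(2)] iota_hom[OF b(1)]] by (simp only: if_True simp_thms)
  next
    fix i assume i: "1 \<le> i" "i < n"
    then have "iota k n (grp_basis (simple_transp i)) = cls (crossing_tm n i)" using I by auto
    then show "sng n (iota k n (grp_basis (simple_transp i))) = S.crossing_at n i"
      using ev_single[OF typed_crossing[OF i]] ev_crossing[of n i] by simp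
  qed
qed

text \<open>The specification gives additivity for two summands and homogeneity only, so the
  expansion in basis elements is an induction over finite sets of permutations.\<close>

lemma iota_sum:
  assumes a: "a \<in> grp_alg n"
  shows "sng n (iota k n a) = (\<Sum>\<pi> | \<pi> permutes {1..n}. scale (a \<pi>) (sng n (iota k n (grp_basis \<pi>))))"
proof -
  note I = iota_iota_spec[of n, unfolded iota_spec_def grp_alg_hom_def]
  let ?\<phi> = "\<lambda>a. sng n (iota k n a)"
  have add: "?\<phi> (\<lambda>\<pi>. a \<pi> + b \<pi>) = ?\<phi> a + ?\<phi> b" if "a \<in> grp_alg n" "b \<in> grp_alg n" for a b
    by (simp only: I[THEN conjunct1, THEN conjunct2, THEN conjunct2, THEN conjunct2, THEN conjunct1, THEN bspec, THEN bspec, OF that]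
      single_add[OF word_cat_C iota_hom[OF that(1)] iota_hom[OF that(2)]])
  have scl: "?\<phi> (\<lambda>\<pi>. c * a \<pi>) = scale c (?\<phi> a)" if "a \<in> grp_alg n" for a c
    by (simp only: I[THEN conjunct1, THEN conjunct2, THEN conjunct2, THEN conjunct2, THEN conjunct2, THEN spec, THEN bspec, OF that]
      single_scl[OF word_cat_C iota_hom[OF that]])
  have "(\<lambda>\<tau>. \<Sum>\<pi>\<in>T. a \<pi> * grp_basis \<pi> \<tau>) \<in> grp_alg n \<and>
     ?\<phi> (\<lambda>\<tau>. \<Sum>\<pi>\<in>T. a \<pi> * grp_basis \<pi> \<tau>) = (\<Sum>\<pi>\<in>T. scale (a \<pi>) (?\<phi> (grp_basis \<pi>)))"
    if "finite T" "T \<subseteq> {\<pi>. \<pi> permutes {1..n}}" for T using that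
  proof (induction T rule: finite_induct)
    case empty
    have "?\<phi> (\<lambda>\<tau>. 0 * grp_basis id \<tau>) = scale 0 (?\<phi> (grp_basis id))"
      by (rule scl[OF grp_basis_in[OF permutes_id]])
    then show ?case by (simp add: grp_alg_def)
  next
    case (insert \<pi> T)
    have p: "grp_basis \<pi> \<in> grp_alg n" using insert by (intro grp_basis_in) simp
    then have p': "(\<lambda>\<tau>. a \<pi> * grp_basis \<pi> \<tau>) \<in> grp_alg n" by (rule grp_alg_scale)
    have IH: "(\<lambda>\<tau>. \<Sum>\<pi>\<in>T. a \<pi> * grp_basis \<pi> \<tau>) \<in> grp_alg n"
       "?\<phi> (\<lambda>\<tau>. \<Sum>\<pi>\<in>T. a \<pi> * grp_basis \<pi> \<tau>) = (\<Sum>\<pi>\<in>T. scale (a \<pi>) (?\<phi> (grp_basis \<pi>)))"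
      using insert by auto
    have s: "(\<lambda>\<tau>. \<Sum>\<pi>\<in>insert \<pi> T. a \<pi> * grp_basis \<pi> \<tau>) = (\<lambda>\<tau>. a \<pi> * grp_basis \<pi> \<tau> + (\<Sum>\<pi>\<in>T. a \<pi> * grp_basis \<pi> \<tau>))"
      using insert(1,2) by (simp add: fun_eq_iff)
    show ?case unfolding s
    proof
      show "(\<lambda>\<tau>. a \<pi> * grp_basis \<pi> \<tau> + (\<Sum>\<pi>\<in>T. a \<pi> * grp_basis \<pi> \<tau>)) \<in> grp_alg n"
        by (rule grp_alg_add[OF p' IH(1)])
    qed (simp only: add[OF p' IH(1)] scl[OF p] IH(2) sum.insert[OF insert(1,2)])
  qed
  from this[OF finite_permutes order_refl] have
    "?\<phi> (\<lambda>\<tau>. \<Sum>\<pi> | \<pi> permutes {1..n}. a \<pi> * grp_basis \<pi> \<tau>) = (\<Sum>\<pi> | \<pi> permutes {1..n}. scale (a \<pi>) (?\<phi> (grp_basis \<pi>)))" by blast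
  moreover have "(\<lambda>\<tau>. \<Sum>\<pi> | \<pi> permutes {1..n}. a \<pi> * grp_basis \<pi> \<tau>) = a"
  proof
    fix \<tau>
    have "(\<Sum>\<pi> | \<pi> permutes {1..n}. a \<pi> * grp_basis \<pi> \<tau>) = (\<Sum>\<pi> | \<pi> permutes {1..n}. if \<pi> = \<tau> then a \<tau> else 0)"
      by (rule sum.cong) (auto simp: grp_basis_def)
    also have "\<dots> = a \<tau>" using a finite_permutes[of n] by (simp add: grp_alg_def)
    finally show "(\<Sum>\<pi> | \<pi> permutes {1..n}. a \<pi> * grp_basis \<pi> \<tau>) = a \<tau>" .
  qed
  ultimately show ?thesis by simp
qed

lemma proj_iota:
  fixes \<chi> :: 'a
  assumes \<chi>: "\<chi> = 1 \<or> \<chi> = - 1" and a: "a = (\<lambda>\<pi>. if \<pi> permutes {1..n} then \<chi> ^ coxeter_length n \<pi> / fact n else 0)"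
  shows "iota k n a \<in> hom C (replicate n Up) (replicate n Up) \<and> proj Up s \<chi> n (sng n (iota k n a))"
proof -
  have sq: "\<chi> * \<chi> = 1" using \<chi> by auto
  interpret S: strands scale "fhom C" "fone C" "fmul C" "fwh C" Up s \<chi> by (rule strandsU[OF sq])
  have a': "a \<in> grp_alg n" by (simp add: grp_alg_def a)
  have "sng n (iota k n a) = (\<Sum>\<pi> | \<pi> permutes {1..n}. scale (\<chi> ^ coxeter_length n \<pi> / fact n) (sng n (iota k n (grp_basis \<pi>))))"
    unfolding iota_sum[OF a'] by (rule sum.cong) (simp_all add: a)
  then show ?thesis using S.proj_symm_rep[OF iota_symm_rep[OF sq] \<chi>] iota_hom[OF a'] by simp
qed

lemma proj_symmetrizer:
  "iota k n (symmetrizer n) \<in> hom C (replicate n Up) (replicate n Up) \<and> proj Up s 1 n (sng n (iota k n (symmetrizer n)))"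
  by (rule proj_iota) (auto simp: symmetrizer_def fun_eq_iff)

lemma proj_antisymmetrizer:
  "mate k n (iota k n (antisymmetrizer n)) \<in> hom C (replicate n Down) (replicate n Down) \<and>
   proj Down H.sD (- 1) n (sngD n (mate k n (iota k n (antisymmetrizer n))))"
proof -
  have "iota k n (antisymmetrizer n) \<in> hom C (replicate n Up) (replicate n Up) \<and> proj Up s (- 1) n (sng n (iota k n (antisymmetrizer n)))"
    by (rule proj_iota) (auto simp: antisymmetrizer_def fun_eq_iff)
  then show ?thesis using mate_dual[of "iota k n (antisymmetrizer n)" n] H.proj_dual[of "- 1" n] by auto
qed

end

section \<open>Diagonal objects of the Karoubi envelope\<close>

lemma mk_mat_simps [simp]: "mdom (mk_mat X Y E) = X" "mcod (mk_mat X Y E) = Y"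
  "i < length Y \<Longrightarrow> j < length X \<Longrightarrow> ent (mk_mat X Y E) i j = E i j"
  by (simp_all add: mk_mat_def)

lemma mk_mat_cong:
  "(\<And>i j. i < length Y \<Longrightarrow> j < length X \<Longrightarrow> E i j = E' i j) \<Longrightarrow> mk_mat X Y E = mk_mat X Y E'"
  by (simp add: mk_mat_def fun_eq_iff)

lemma cmp_mk_mat: "cmp (additive_envelope C) (mk_mat Y Z G) (mk_mat X Y F)
  = mk_mat X Z (\<lambda>i j. hom_sum C (X ! j) (Z ! i) (map (\<lambda>l. cmp C (G i l) (F l j)) [0..<length Y]))"
proof -
  have *: "map (\<lambda>l. cmp C (ent (mk_mat Y Z G) i l) (ent (mk_mat X Y F) l j)) [0..<length Y]
    = map (\<lambda>l. cmp C (G i l) (F l j)) [0..<length Y]" if "i < length Z" "j < length X" for i j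
    using that by (intro map_cong) auto
  show ?thesis unfolding additive_envelope_def by (simp, rule mk_mat_cong) (simp only: *)
qed

lemma mk_mat_hom: "(\<And>i j. i < length Y \<Longrightarrow> j < length X \<Longrightarrow> E i j \<in> hom C (X ! j) (Y ! i)) \<Longrightarrow>
  mk_mat X Y E \<in> hom (additive_envelope C) X Y"
  unfolding additive_envelope_def by auto

text \<open>Sums of objects of the form \<open>kar_pair\<close> have block diagonal idempotents.
  Recording the blocks as a list turns \<open>kar_dsum\<close> into concatenation and the zero
  object into the empty list.\<close>

definition diag_mat where
  "diag_mat C ps = mk_mat (map fst ps) (map fst ps) (\<lambda>i j. if i = j then snd (ps ! i) else zer C (fst (ps ! j)) (fst (ps ! i)))"

definition diag_ob where "diag_ob C ps = (map fst ps, diag_mat C ps)"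

lemma kar_pair_diag: "kar_pair X e = diag_ob C [(X, e)]"
  unfolding kar_pair_def diag_ob_def diag_mat_def by (auto intro: mk_mat_cong)

lemma kar_dsum_diag: "kar_dsum C (diag_ob C ps) (diag_ob C qs) = diag_ob C (ps @ qs)"
proof -
  have "mat_dsum C (diag_mat C ps) (diag_mat C qs) = diag_mat C (ps @ qs)"
    unfolding mat_dsum_def diag_mat_def mk_mat_simps map_append length_map length_append
    by (rule mk_mat_cong) (auto simp: nth_append)
  then show ?thesis by (simp add: kar_dsum_def diag_ob_def)
qed

text \<open>The order of summands is chosen by \<open>SOME\<close>; what is passed on is only that
  it is some enumeration without repetition.\<close>

lemma kar_Dsum_diag:
  assumes "finite I" "\<And>i. i \<in> I \<Longrightarrow> A i = diag_ob C (P i)"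
  obtains "is" where "distinct is" "set is = I" "kar_Dsum C I A = diag_ob C (concat (map P is))"
proof -
  let ?is = "SOME is. distinct is \<and> set is = I"
  have i: "distinct ?is \<and> set ?is = I"
    using finite_distinct_list[OF assms(1)] by (intro someI_ex[of "\<lambda>is. distinct is \<and> set is = I"]) blast
  have z: "kar_zero_ob = diag_ob C []"
    by (simp add: kar_zero_ob_def diag_ob_def diag_mat_def mk_mat_def)
  have "foldr (kar_dsum C) (map A is) kar_zero_ob = diag_ob C (concat (map P is))" if "set is \<subseteq> I" for "is"
    using that by (induction "is") (simp_all add: z kar_dsum_diag assms(2))
  with i show ?thesis by (intro that[of ?is]) (auto simp: kar_Dsum_def)
qed

lemma kar_Dsum_Sigma:
  assumes I: "finite I" and K: "\<And>r. r \<in> I \<Longrightarrow> finite (K r)"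
  obtains js where "distinct js" "set js = Sigma I K"
    "kar_Dsum C I (\<lambda>r. kar_Dsum C (K r) (\<lambda>_. kar_pair (Y r) (E r))) = diag_ob C (map (\<lambda>j. (Y (fst j), E (fst j))) js)"
proof -
  have "\<forall>r\<in>I. \<exists>is. distinct is \<and> set is = K r \<and>
      kar_Dsum C (K r) (\<lambda>_. kar_pair (Y r) (E r)) = diag_ob C (map (\<lambda>_. (Y r, E r)) is)"
  proof
    fix r assume "r \<in> I"
    obtain "is" where "distinct is" "set is = K r"
      "kar_Dsum C (K r) (\<lambda>_. kar_pair (Y r) (E r)) = diag_ob C (concat (map (\<lambda>_. [(Y r, E r)]) is))"
      by (rule kar_Dsum_diag[OF K[OF \<open>r \<in> I\<close>] kar_pair_diag])
    moreover have "concat (map (\<lambda>_. [(Y r, E r)]) is) = map (\<lambda>_. (Y r, E r)) is" by (induction "is") simp_all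
    ultimately show "\<exists>is. distinct is \<and> set is = K r \<and>
      kar_Dsum C (K r) (\<lambda>_. kar_pair (Y r) (E r)) = diag_ob C (map (\<lambda>_. (Y r, E r)) is)" by auto
  qed
  from bchoice[OF this] obtain L where L: "\<And>r. r \<in> I \<Longrightarrow> distinct (L r) \<and> set (L r) = K r \<and>
      kar_Dsum C (K r) (\<lambda>_. kar_pair (Y r) (E r)) = diag_ob C (map (\<lambda>_. (Y r, E r)) (L r))" by blast
  have A: "kar_Dsum C (K r) (\<lambda>_. kar_pair (Y r) (E r)) = diag_ob C (map (\<lambda>_. (Y r, E r)) (L r))" if "r \<in> I" for r
    using L[OF that] by blast
  obtain rs where rs: "distinct rs" "set rs = I"
    "kar_Dsum C I (\<lambda>r. kar_Dsum C (K r) (\<lambda>_. kar_pair (Y r) (E r))) = diag_ob C (concat (map (\<lambda>r. map (\<lambda>_. (Y r, E r)) (L r)) rs))"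
    by (rule kar_Dsum_diag[OF I A])
  let ?js = "concat (map (\<lambda>r. map (Pair r) (L r)) rs)"
  have "distinct (concat (map (\<lambda>r. map (Pair r) (L r)) rs'))" if "distinct rs'" "set rs' \<subseteq> I" for rs'
    using that L by (induction rs') (auto simp: distinct_map inj_on_def)
  then have "distinct ?js" using rs by simp
  moreover have "set ?js = Sigma I K" using rs(2) L by auto
  moreover have "concat (map (\<lambda>r. map (\<lambda>_. (Y r, E r)) (L r)) rs) = map (\<lambda>j. (Y (fst j), E (fst j))) ?js"
    by (simp add: map_concat comp_def)
  ultimately show ?thesis using that rs(3) by simp
qed

lemma tob_kar_pair:
  assumes "word_cat C" shows "tob (Kar C) (kar_pair X e) (kar_pair Y f) = kar_pair (X @ Y) (tmo C e f)"
  unfolding Kar_def idempotent_completion_def additive_envelope_def kar_pair_def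
  by (simp add: tob_C[OF assms]) (rule mk_mat_cong, simp)

context
  fixes C :: "('g list, 'm, 'a::field_char_0) linmon"
  assumes C: "word_cat C"
begin

interpretation S: strict_linear_monoidal C using C by (simp add: word_cat_def)
interpretation W: word_category scale "fhom C" "fone C" "fmul C" "fwh C" by (rule word_category_fam[OF C])

lemma hom_sum_single:
  assumes "\<And>l. l < n \<Longrightarrow> f l \<in> hom C A B"
  shows "hom_sum C A B (map f [0..<n]) \<in> hom C A B \<and>
    single C A B (hom_sum C A B (map f [0..<n])) = (\<Sum>l<n. single C A B (f l))"
proof -
  have "hom_sum C A B fs \<in> hom C A B \<and> single C A B (hom_sum C A B fs) = sum_list (map (single C A B) fs)"
    if "set fs \<subseteq> hom C A B" for fs
    using that unfolding hom_sum_def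
    by (induction fs) (auto simp: hzer_hom[OF C] single_zer[OF C] single_add[OF C] intro: hadd_hom[OF C])
  from this[of "map f [0..<n]"] assms show ?thesis
    by (simp add: image_subset_iff interv_sum_list_conv_sum_set_nat atLeast0LessThan comp_def)
qed

lemma hom_sum_one: "F \<in> hom C A B \<Longrightarrow> hom_sum C A B [F] = F"
  by (simp add: hom_sum_def hadd_zer_right[OF C])

lemma hom_sum_eqI:
  assumes "\<And>l. l < n \<Longrightarrow> f l \<in> hom C A B" "g \<in> hom C A B" "(\<Sum>l<n. single C A B (f l)) = single C A B g"
  shows "hom_sum C A B (map f [0..<n]) = g"
  using hom_sum_single[of n f A B] assms single_inject[OF C] by metis

lemma hom_sum_delta:
  assumes "i < n" "f i \<in> hom C A B" "\<And>l. l < n \<Longrightarrow> l \<noteq> i \<Longrightarrow> f l = zer C A B"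
  shows "hom_sum C A B (map f [0..<n]) = f i"
proof (rule hom_sum_eqI)
  show "f l \<in> hom C A B" if "l < n" for l using assms that hzer_hom[OF C] by (cases "l = i") auto
  have "(\<Sum>l<n. single C A B (f l)) = (\<Sum>l<n. if l = i then single C A B (f i) else 0)"
    using assms(3) by (intro sum.cong) (auto simp: single_zer[OF C])
  then show "(\<Sum>l<n. single C A B (f l)) = single C A B (f i)" using assms(1) by simp
qed (rule assms(2))

text \<open>The maps to the summands form the column \<open>f\<close>, their partners the row
  \<open>g\<close>. The matrix product with sums over all summands is evaluated through
  \<open>single\<close>, where it is an ordinary finite sum.\<close>

lemma isomorphic_diag_ob:
  assumes d: "W.dec X (single C X X e) J Y (\<lambda>i. single C (Y i) (Y i) (E i)) A"
    and e: "e \<in> hom C X X" and E: "\<And>i. i \<in> J \<Longrightarrow> E i \<in> hom C (Y i) (Y i)"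
    and js: "distinct js" "set js = J"
  shows "isomorphic (Kar C) (kar_pair X e) (diag_ob C (map (\<lambda>i. (Y i, E i)) js))"
proof -
  note sm = fmul_single[OF C] and inj = single_inject[OF C, THEN iffD1] and ch = hcmp_hom[OF C]
  let ?e = "single C X X e" and ?E = "\<lambda>i. single C (Y i) (Y i) (E i)"
  obtain B where A: "\<And>i. i \<in> J \<Longrightarrow> A i \<in> fhom C X (Y i)" "\<And>i. i \<in> J \<Longrightarrow> fmul C (A i) ?e = A i"
      "\<And>i. i \<in> J \<Longrightarrow> fmul C (?E i) (A i) = A i"
    and B: "\<And>i. i \<in> J \<Longrightarrow> B i \<in> fhom C (Y i) X" "\<And>i. i \<in> J \<Longrightarrow> fmul C ?e (B i) = B i"
      "\<And>i. i \<in> J \<Longrightarrow> fmul C (B i) (?E i) = B i"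
    and AB: "\<And>i j. i \<in> J \<Longrightarrow> j \<in> J \<Longrightarrow> fmul C (A i) (B j) = (if i = j then ?E i else 0)"
    and BA: "(\<Sum>i\<in>J. fmul C (B i) (A i)) = ?e"
    using d unfolding W.dec_def by blast
  define a where "a i = comp (A i) C X (Y i)" for i
  define b where "b i = comp (B i) C (Y i) X" for i
  have a: "a i \<in> hom C X (Y i)" and b: "b i \<in> hom C (Y i) X" for i
    unfolding a_def b_def by (rule comp_hom[OF C])+
  have sa: "single C X (Y i) (a i) = A i" and sb: "single C (Y i) X (b i) = B i" if "i \<in> J" for i
    unfolding a_def b_def using single_comp[OF C] A(1) B(1) that by auto
  have ae: "cmp C (a i) e = a i" and Ea: "cmp C (E i) (a i) = a i" and eb: "cmp C e (b i) = b i" and bE: "cmp C (b i) (E i) = b i"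
    if "i \<in> J" for i
  proof -
    show "cmp C (a i) e = a i" by (rule inj[OF ch[OF e a] a])
      (use A(2)[OF that] sm[OF e a[of i]] in \<open>simp add: sa[OF that]\<close>)
    show "cmp C (E i) (a i) = a i" by (rule inj[OF ch[OF a E[OF that]] a])
      (use A(3)[OF that] sm[OF a[of i] E[OF that]] in \<open>simp add: sa[OF that]\<close>)
    show "cmp C e (b i) = b i" by (rule inj[OF ch[OF b e] b])
      (use B(2)[OF that] sm[OF b[of i] e] in \<open>simp add: sb[OF that]\<close>)
    show "cmp C (b i) (E i) = b i" by (rule inj[OF ch[OF E[OF that] b] b])
      (use B(3)[OF that] sm[OF E[OF that] b[of i]] in \<open>simp add: sb[OF that]\<close>)
  qed
  have ab: "cmp C (a i) (b j) = (if i = j then E i else zer C (Y j) (Y i))" if "i \<in> J" "j \<in> J" for i j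
  proof (rule inj[OF ch[OF b a]])
    show "(if i = j then E i else zer C (Y j) (Y i)) \<in> hom C (Y j) (Y i)" using E[OF that(1)] E[OF that(2)] hzer_hom[OF C] by simp
    have *: "fmul C (A i) (B j) = single C (Y j) (Y i) (cmp C (a i) (b j))"
      using sm[OF b[of j] a[of i]] by (simp only: sa[OF that(1)] sb[OF that(2)] if_True simp_thms)
    show "single C (Y j) (Y i) (cmp C (a i) (b j)) = single C (Y j) (Y i) (if i = j then E i else zer C (Y j) (Y i))"
      unfolding *[symmetric] AB[OF that] using single_zer[OF C] by simp
  qed
  have EE: "cmp C (E i) (E i) = E i" if "i \<in> J" for i
  proof -
    have "cmp C (E i) (E i) = cmp C (cmp C (E i) (a i)) (b i)"
      using S.cmp_assoc[OF obs_C[OF C] obs_C[OF C] obs_C[OF C] obs_C[OF C] b a E[OF that]] ab[OF that that] by simp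
    then show ?thesis using Ea[OF that] ab[OF that that] by simp
  qed
  have "fmul C ?e ?e = ?e" unfolding BA[symmetric] using B(2) by (subst BA) (simp add: W.mul_sum_right flip: W.mul_assoc)
  then have ee: "cmp C e e = e" using sm[OF e e] inj[OF ch[OF e e] e] by simp
  let ?n = "length js" and ?ys = "map Y js"
  let ?D = "\<lambda>i j. if i = j then E (js ! i) else zer C (Y (js ! j)) (Y (js ! i))"
  have J: "js ! i \<in> J" if "i < ?n" for i using that js(2) nth_mem by blast
  have D: "?D i j \<in> hom C (Y (js ! j)) (Y (js ! i))" if "i < ?n" "j < ?n" for i j
    using that E[OF J] hzer_hom[OF C] by auto
  define f where "f = mk_mat [X] ?ys (\<lambda>i j. a (js ! i))"
  define g where "g = mk_mat ?ys [X] (\<lambda>i j. b (js ! j))"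
  define \<Delta> where "\<Delta> = mk_mat ?ys ?ys ?D"
  define \<epsilon> where "\<epsilon> = mk_mat [X] [X] (\<lambda>i j. e)"
  have fe: "cmp (additive_envelope C) f \<epsilon> = f" unfolding f_def \<epsilon>_def cmp_mk_mat
    by (rule mk_mat_cong) (use ae[OF J] a in \<open>simp add: less_Suc_eq hom_sum_one\<close>)
  have \<epsilon>\<epsilon>: "cmp (additive_envelope C) \<epsilon> \<epsilon> = \<epsilon>" unfolding \<epsilon>_def cmp_mk_mat
    by (rule mk_mat_cong) (use ee e in \<open>simp add: less_Suc_eq hom_sum_one\<close>)
  have eg: "cmp (additive_envelope C) \<epsilon> g = g" unfolding g_def \<epsilon>_def cmp_mk_mat
    by (rule mk_mat_cong) (use eb[OF J] b in \<open>simp add: less_Suc_eq hom_sum_one\<close>)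
  have fg: "cmp (additive_envelope C) f g = \<Delta>" unfolding f_def g_def \<Delta>_def cmp_mk_mat
  proof (rule mk_mat_cong)
    fix i j assume ij: "i < length ?ys" "j < length ?ys"
    then have "cmp C (a (js ! i)) (b (js ! j)) = ?D i j" using ab[OF J J, of i j] js(1) by (simp add: nth_eq_iff_index_eq)
    then show "hom_sum C (?ys ! j) (?ys ! i) (map (\<lambda>l. cmp C (a (js ! i)) (b (js ! j))) [0..<length [X]]) = ?D i j"
      using hom_sum_one[OF D[of i j]] ij by simp
  qed
  have Df: "cmp (additive_envelope C) \<Delta> f = f" unfolding f_def \<Delta>_def cmp_mk_mat
  proof (rule mk_mat_cong)
    fix i j assume ij: "i < length ?ys" "j < length [X]"
    have "hom_sum C X (Y (js ! i)) (map (\<lambda>l. cmp C (?D i l) (a (js ! l))) [0..<?n]) = cmp C (?D i i) (a (js ! i))"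
      by (rule hom_sum_delta) (use ij Ea[OF J, of i] a hzer_cmp[OF C a] in auto)
    then show "hom_sum C ([X] ! j) (?ys ! i) (map (\<lambda>l. cmp C (?D i l) (a (js ! l))) [0..<length ?ys]) = a (js ! i)"
      using ij Ea[OF J, of i] by simp
  qed
  have gD: "cmp (additive_envelope C) g \<Delta> = g" unfolding g_def \<Delta>_def cmp_mk_mat
  proof (rule mk_mat_cong)
    fix i j assume ij: "i < length [X]" "j < length ?ys"
    have "hom_sum C (Y (js ! j)) X (map (\<lambda>l. cmp C (b (js ! l)) (?D l j)) [0..<?n]) = cmp C (b (js ! j)) (?D j j)"
      by (rule hom_sum_delta) (use ij bE[OF J, of j] b hcmp_zer[OF C b] in auto)
    then show "hom_sum C (?ys ! j) ([X] ! i) (map (\<lambda>l. cmp C (b (js ! l)) (?D l j)) [0..<length ?ys]) = b (js ! j)"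
      using ij bE[OF J, of j] by simp
  qed
  have DD: "cmp (additive_envelope C) \<Delta> \<Delta> = \<Delta>" unfolding \<Delta>_def cmp_mk_mat
  proof (rule mk_mat_cong)
    fix i j assume ij: "i < length ?ys" "j < length ?ys"
    have z: "cmp C (E (js ! i)) (zer C (Y (js ! j)) (Y (js ! i))) = zer C (Y (js ! j)) (Y (js ! i))"
      using hcmp_zer[OF C E[OF J]] ij by simp
    have "hom_sum C (Y (js ! j)) (Y (js ! i)) (map (\<lambda>l. cmp C (?D i l) (?D l j)) [0..<?n]) = cmp C (?D i i) (?D i j)"
    proof (rule hom_sum_delta)
      show "i < ?n" using ij by simp
      show "cmp C (?D i i) (?D i j) \<in> hom C (Y (js ! j)) (Y (js ! i))" using ch[OF D D, of i j i] ij by simp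
      fix l assume "l < ?n" "l \<noteq> i"
      then show "cmp C (?D i l) (?D l j) = zer C (Y (js ! j)) (Y (js ! i))" using hzer_cmp[OF C D[of l j]] ij by simp
    qed
    then show "hom_sum C (?ys ! j) (?ys ! i) (map (\<lambda>l. cmp C (?D i l) (?D l j)) [0..<length ?ys]) = ?D i j"
      using ij EE[OF J, of i] z by (cases "i = j") simp_all
  qed
  have gf: "cmp (additive_envelope C) g f = \<epsilon>" unfolding f_def g_def \<epsilon>_def cmp_mk_mat
  proof (rule mk_mat_cong)
    fix i j :: nat assume ij: "i < length [X]" "j < length [X]"
    have "(\<Sum>l<?n. single C X X (cmp C (b (js ! l)) (a (js ! l)))) = (\<Sum>l<?n. fmul C (B (js ! l)) (A (js ! l)))"
      using sm[OF a b] sa[OF J] sb[OF J] by (intro sum.cong) (simp_all, metis)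
    also have "\<dots> = (\<Sum>i\<in>J. fmul C (B i) (A i))"
      using sum.reindex_bij_betw[OF bij_betw_nth[OF js(1) HOL.refl js(2)[symmetric]]] .
    also have "\<dots> = ?e" by (rule BA)
    finally show "hom_sum C ([X] ! j) ([X] ! i) (map (\<lambda>l. cmp C (b (js ! l)) (a (js ! l))) [0..<length ?ys]) = e"
      using hom_sum_eqI[of ?n "\<lambda>l. cmp C (b (js ! l)) (a (js ! l))" X X e] ch[OF a b] e ij by simp
  qed
  have h: "f \<in> hom (additive_envelope C) [X] ?ys" "g \<in> hom (additive_envelope C) ?ys [X]"
    "\<epsilon> \<in> hom (additive_envelope C) [X] [X]" "\<Delta> \<in> hom (additive_envelope C) ?ys ?ys"
    unfolding f_def g_def \<epsilon>_def \<Delta>_def by (rule mk_mat_hom; use a b e D in simp)+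
  have ob: "diag_ob C (map (\<lambda>i. (Y i, E i)) js) = (?ys, \<Delta>)"
    unfolding diag_ob_def diag_mat_def \<Delta>_def by (auto simp: comp_def intro!: mk_mat_cong)
  have kp: "kar_pair X e = ([X], \<epsilon>)" by (simp add: kar_pair_def \<epsilon>_def)
  have obs: "[X] \<in> obs (additive_envelope C)" "?ys \<in> obs (additive_envelope C)"
    using obs_C[OF C] by (auto simp: additive_envelope_def)
  note K = Kar_def idempotent_completion_def
  have "([X], \<epsilon>) \<in> obs (Kar C)" "(?ys, \<Delta>) \<in> obs (Kar C)"
    using h(3,4) obs \<epsilon>\<epsilon> DD by (simp_all add: K)
  moreover have "f \<in> hom (Kar C) ([X], \<epsilon>) (?ys, \<Delta>)" "g \<in> hom (Kar C) (?ys, \<Delta>) ([X], \<epsilon>)"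
    using h(1,2) by (simp_all add: K fe Df gD eg)
  moreover have "cmp (Kar C) g f = idm (Kar C) ([X], \<epsilon>)" "cmp (Kar C) f g = idm (Kar C) (?ys, \<Delta>)"
    by (simp_all add: K gf fg)
  ultimately show ?thesis unfolding ob kp isomorphic_def by blast
qed

end

section \<open>Partitions in a box\<close>

lemma strict_gap:
  assumes l: "sorted_wrt (>) (l :: nat list)" and "i \<le> j" "j < length l"
  shows "l ! j + (j - i) \<le> l ! i"
  using assms(2,3)
proof (induction j rule: dec_induct)
  case (step j)
  have "l ! Suc j < l ! j" using sorted_wrt_nth_less[OF l, of j "Suc j"] step by simp
  then show ?case using step by simp
qed simp

lemma pad_filter:
  "sorted_wrt (\<ge>) (p :: nat list) \<Longrightarrow> filter (\<lambda>x. 0 < x) p @ replicate (length p - length (filter (\<lambda>x. 0 < x) p)) 0 = p"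
proof (induction p)
  case (Cons x p)
  show ?case
  proof (cases "x = 0")
    case True
    then have "set (x # p) \<subseteq> {0}" using Cons.prems by auto
    then have "x # p = replicate (length (x # p)) 0" by (intro replicate_eqI) auto
    then show ?thesis by (metis append_Nil diff_zero filter_replicate less_irrefl list.size(3) replicate_0)
  next
    case False
    then show ?thesis using Cons by simp
  qed
qed simp

definition strict_lists :: "nat \<Rightarrow> nat \<Rightarrow> nat list set" where
  "strict_lists r k = {l. sorted_wrt (>) l \<and> set l \<subseteq> {..<k} \<and> length l = r}"

text \<open>Partitions are stored without zero parts; padding to length \<open>r\<close> makes all
  of them long enough for the staircase.\<close>

lemma bij_box_weak:
  "bij_betw (\<lambda>p. p @ replicate (r - length p) 0) (box_partitions r k)
     {p. sorted_wrt (\<ge>) p \<and> set p \<subseteq> {..k - r} \<and> length p = r}"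
proof (rule bij_betw_byWitness[where f' = "filter (\<lambda>x. 0 < x)"])
  show "\<forall>p\<in>box_partitions r k. filter (\<lambda>x. 0 < x) (p @ replicate (r - length p) 0) = p"
    by (auto simp: box_partitions_def)
  show "\<forall>p\<in>{p. sorted_wrt (\<ge>) p \<and> set p \<subseteq> {..k - r} \<and> length p = r}.
      filter (\<lambda>x. 0 < x) p @ replicate (r - length (filter (\<lambda>x. 0 < x) p)) 0 = p"
    using pad_filter by auto
  show "(\<lambda>p. p @ replicate (r - length p) 0) ` box_partitions r k \<subseteq> {p. sorted_wrt (\<ge>) p \<and> set p \<subseteq> {..k - r} \<and> length p = r}"
    by (auto simp: box_partitions_def sorted_wrt_append sorted_wrt_iff_nth_less[of _ "replicate _ _"])
  show "filter (\<lambda>x. 0 < x) ` {p. sorted_wrt (\<ge>) p \<and> set p \<subseteq> {..k - r} \<and> length p = r} \<subseteq> box_partitions r k"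
    by (auto simp: box_partitions_def sorted_wrt_filter)
qed

text \<open>Adding the staircase \<open>(r - 1, \<dots>, 1, 0)\<close> turns weakly decreasing sequences into strict ones.\<close>

lemma bij_weak_strict:
  assumes "r \<le> k"
  shows "bij_betw (\<lambda>p. map (\<lambda>i. p ! i + (r - Suc i)) [0..<r])
     {p. sorted_wrt (\<ge>) p \<and> set p \<subseteq> {..k - r} \<and> length p = r} (strict_lists r k)"
proof (rule bij_betw_byWitness[where f' = "\<lambda>l. map (\<lambda>i. l ! i - (r - Suc i)) [0..<r]"])
  let ?W = "{p. sorted_wrt (\<ge>) p \<and> set p \<subseteq> {..k - r} \<and> length p = r}"
  let ?F = "\<lambda>p. map (\<lambda>i. p ! i + (r - Suc i)) [0..<r]" and ?G = "\<lambda>l. map (\<lambda>i. l ! i - (r - Suc i)) [0..<r]"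
  have low: "r - Suc i \<le> l ! i" and high: "l ! i + i < k" if l: "l \<in> strict_lists r k" and i: "i < r" for l i
  proof -
    have l': "sorted_wrt (>) l" "length l = r" "set l \<subseteq> {..<k}" using l by (auto simp: strict_lists_def)
    have "i \<le> r - 1" "r - 1 < length l" using l' i by auto
    from strict_gap[OF l'(1) this] show "r - Suc i \<le> l ! i" by linarith
    have "l ! 0 \<in> set l" by (rule nth_mem) (use l' i in auto)
    then have "l ! 0 < k" using l' by blast
    then show "l ! i + i < k" using strict_gap[OF l'(1), of 0 i] l' i by simp
  qed
  show "\<forall>p\<in>?W. ?G (?F p) = p" by (auto intro: nth_equalityI)
  show "\<forall>l\<in>strict_lists r k. ?F (?G l) = l"
  proof
    fix l assume l: "l \<in> strict_lists r k"
    show "?F (?G l) = l"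
    proof (rule nth_equalityI)
      show "length (?F (?G l)) = length l" using l by (simp add: strict_lists_def)
      fix i assume "i < length (?F (?G l))"
      then have i: "i < r" by simp
      have "?F (?G l) ! i = l ! i - (r - Suc i) + (r - Suc i)" using i by simp
      also have "\<dots> = l ! i" using low[OF l i] by (rule le_add_diff_inverse2)
      finally show "?F (?G l) ! i = l ! i" .
    qed
  qed
  show "?F ` ?W \<subseteq> strict_lists r k"
  proof clarify
    fix p :: "nat list" assume p: "sorted_wrt (\<ge>) p" "set p \<subseteq> {..k - length p}" "r = length p"
    have "p ! i + (r - Suc i) < k" if "i < r" for i
    proof -
      have "p ! i \<in> set p" by (rule nth_mem) (use that p(3) in simp)
      then have "p ! i \<le> k - r" using p(2,3) by auto
      then show ?thesis using that assms by linarith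
    qed
    moreover have "p ! j + (r - Suc j) < p ! i + (r - Suc i)" if "i < j" "j < r" for i j
      using sorted_wrt_nth_less[OF p(1), of i j] that p(3) by simp
    ultimately show "map (\<lambda>i. p ! i + (length p - Suc i)) [0..<length p] \<in> strict_lists (length p) k"
      using p(3) by (auto simp: strict_lists_def sorted_wrt_iff_nth_less)
  qed
  show "?G ` strict_lists r k \<subseteq> ?W"
  proof (intro image_subsetI CollectI conjI)
    fix l assume l: "l \<in> strict_lists r k"
    then have l': "sorted_wrt (>) l" "length l = r" by (auto simp: strict_lists_def)
    have "l ! j - (r - Suc j) \<le> l ! i - (r - Suc i)" if "i < j" "j < r" for i j
      using strict_gap[OF l'(1), of i j] that l'(2) by linarith
    then show "sorted_wrt (\<ge>) (?G l)" by (auto simp: sorted_wrt_iff_nth_less)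
    have "l ! i - (r - Suc i) \<le> k - r" if "i < r" for i using high[OF l that] that by linarith
    then show "set (?G l) \<subseteq> {..k - r}" by auto
  qed simp
qed

lemma bij_box_strict: "r \<le> k \<Longrightarrow> \<exists>h. bij_betw h (box_partitions r k) (strict_lists r k)"
  using bij_betw_trans[OF bij_box_weak bij_weak_strict] by blast

lemma finite_strict_lists: "finite (strict_lists r k)"
  by (rule finite_subset[OF _ finite_lists_length_eq[of "{..<k}" r]]) (auto simp: strict_lists_def)

lemma finite_box_partitions: "r \<le> k \<Longrightarrow> finite (box_partitions r k)"
  using bij_box_strict[of r k] bij_betw_finite finite_strict_lists by blast

text \<open>The source of the bound \<open>k\<close> on \<open>r\<close> in the direct sum, which is
  not among the conditions defining \<open>Ix\<close>.\<close>

lemma strict_list_length: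
  assumes "sorted_wrt (>) (l :: nat list)" "set l \<subseteq> {..<k}" shows "length l \<le> k"
proof (cases "length l")
  case (Suc n)
  then have "l ! 0 \<in> set l" by (intro nth_mem) simp
  then have "l ! 0 < k" using assms(2) by blast
  then show ?thesis using strict_gap[OF assms(1), of 0 n] Suc by simp
qed simp

lemma bij_strict_index:
  "\<exists>h. bij_betw h (Sigma {0..min (min m n) k} (\<lambda>r. box_partitions r k))
      {l. sorted_wrt (>) l \<and> set l \<subseteq> {..<k} \<and> length l \<le> m \<and> length l \<le> n} \<and>
     (\<forall>i\<in>Sigma {0..min (min m n) k} (\<lambda>r. box_partitions r k). length (h i) = fst i)"
proof -
  have "\<forall>r\<in>{0..min (min m n) k}. \<exists>h. bij_betw h (box_partitions r k) (strict_lists r k)"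
    using bij_box_strict by auto
  from bchoice[OF this] obtain h
    where "\<forall>r\<in>{0..min (min m n) k}. bij_betw (h r) (box_partitions r k) (strict_lists r k)" ..
  then have h: "bij_betw (h r) (box_partitions r k) (strict_lists r k)" if "r \<in> {0..min (min m n) k}" for r
    using that by (rule bspec)
  let ?J = "Sigma {0..min (min m n) k} (\<lambda>r. box_partitions r k)" and ?h = "\<lambda>(r, p). h r p"
  have len: "?h i \<in> strict_lists (fst i) k" if "i \<in> ?J" for i
  proof -
    note that
    then obtain r p where i: "i = (r, p)" "r \<in> {0..min (min m n) k}" "p \<in> box_partitions r k" by blast
    then have "h r p \<in> strict_lists r k" using bij_betwE[OF h[OF i(2)]] by blast
    then show ?thesis by (simp add: i(1))
  qed
  have "bij_betw ?h ?J {l. sorted_wrt (>) l \<and> set l \<subseteq> {..<k} \<and> length l \<le> m \<and> length l \<le> n}"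
  proof (rule bij_betwI')
    fix i j assume ij: "i \<in> ?J" "j \<in> ?J"
    show "?h i = ?h j \<longleftrightarrow> i = j"
    proof
      assume eq: "?h i = ?h j"
      then have f: "fst i = fst j" using len[OF ij(1)] len[OF ij(2)] by (simp add: strict_lists_def)
      have "inj_on (h (fst i)) (box_partitions (fst i) k)" using h[of "fst i"] ij by (auto simp: bij_betw_def)
      then have "snd i = snd j" using eq f ij by (auto simp: inj_on_def split_def)
      with f show "i = j" by (simp add: prod_eq_iff)
    qed simp
  next
    fix i assume "i \<in> ?J"
    then show "?h i \<in> {l. sorted_wrt (>) l \<and> set l \<subseteq> {..<k} \<and> length l \<le> m \<and> length l \<le> n}"
      using len[of i] by (auto simp: strict_lists_def)
  next
    fix l :: "nat list" assume l: "l \<in> {l. sorted_wrt (>) l \<and> set l \<subseteq> {..<k} \<and> length l \<le> m \<and> length l \<le> n}"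
    then have r: "length l \<in> {0..min (min m n) k}" using strict_list_length[of l k] by auto
    have "l \<in> h (length l) ` box_partitions (length l) k"
      using h[OF r] l by (auto simp: bij_betw_def strict_lists_def)
    then show "\<exists>i\<in>?J. l = ?h i" using r by force
  qed
  moreover have "\<forall>i\<in>?J. length (?h i) = fst i" using len by (auto simp: strict_lists_def)
  ultimately show ?thesis by blast
qed

section \<open>The isomorphisms\<close>

context word_category begin

lemma dec_reindex:
  assumes b: "bij_betw \<phi> J I" and d: "dec X e I Y E A"
    and Y: "\<And>j. j \<in> J \<Longrightarrow> Y' j = Y (\<phi> j)" and E: "\<And>j. j \<in> J \<Longrightarrow> E' j = E (\<phi> j)"
  shows "dec X e J Y' E' (\<lambda>j. A (\<phi> j))"
proof -
  obtain B where A: "\<And>i. i \<in> I \<Longrightarrow> A i \<in> hom X (Y i) \<and> A i \<bullet> e = A i \<and> E i \<bullet> A i = A i"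
    and B: "\<And>i. i \<in> I \<Longrightarrow> B i \<in> hom (Y i) X \<and> e \<bullet> B i = B i \<and> B i \<bullet> E i = B i"
    and AB: "\<And>i j. i \<in> I \<Longrightarrow> j \<in> I \<Longrightarrow> A i \<bullet> B j = (if i = j then E i else 0)"
    and BA: "(\<Sum>i\<in>I. B i \<bullet> A i) = e" and fin: "finite I"
    using d unfolding dec_def by blast
  have \<phi>: "\<phi> j \<in> I" if "j \<in> J" for j using that b by (auto simp: bij_betw_def)
  have inj: "\<phi> i = \<phi> j \<longleftrightarrow> i = j" if "i \<in> J" "j \<in> J" for i j using that b by (auto simp: bij_betw_def inj_on_def)
  have "finite J" using bij_betw_finite[OF b] fin by simp
  moreover have "(\<Sum>j\<in>J. B (\<phi> j) \<bullet> A (\<phi> j)) = e" using sum.reindex_bij_betw[OF b, of "\<lambda>i. B i \<bullet> A i"] BA by simp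
  ultimately show ?thesis unfolding dec_def
    by (intro conjI ballI exI[of _ "\<lambda>j. B (\<phi> j)"]) (use A B AB \<phi> inj Y E in auto)
qed

text \<open>Reversal exchanges the maps to the summands with the maps from them.\<close>

lemma dec_opposite:
  assumes "word_category.dec (\<lambda>X Y. hom Y X) (\<lambda>g f. f \<bullet> g) X e I Y E A"
  shows "\<exists>B. dec X e I Y E B"
proof -
  interpret O: word_category scale "\<lambda>X Y. hom Y X" one "\<lambda>g f. f \<bullet> g" wh by (rule opposite)
  obtain B where A: "\<And>i. i \<in> I \<Longrightarrow> A i \<in> hom (Y i) X \<and> e \<bullet> A i = A i \<and> A i \<bullet> E i = A i"
    and B: "\<And>i. i \<in> I \<Longrightarrow> B i \<in> hom X (Y i) \<and> B i \<bullet> e = B i \<and> E i \<bullet> B i = B i"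
    and AB: "\<And>i j. i \<in> I \<Longrightarrow> j \<in> I \<Longrightarrow> B j \<bullet> A i = (if i = j then E i else 0)"
    and BA: "(\<Sum>i\<in>I. A i \<bullet> B i) = e" and fin: "finite I"
    using assms unfolding O.dec_def by blast
  show ?thesis unfolding dec_def
    by (intro exI[of _ B] conjI ballI exI[of _ A]) (use A B AB BA fin in auto)
qed

end

context strands begin

lemma opposite_strands: "strands scale (\<lambda>X Y. hom Y X) one (\<lambda>g f. f \<bullet> g) wh V s \<chi>"
  by (intro strands.intro opposite strands_axioms.intro) (simp_all add: s_hom s_sq braid char_sq mul_assoc)

text \<open>A word becomes the reversed word, with the same value, and left and right absorption
  change places.\<close>

lemma proj_opposite:
  assumes "proj V s \<chi> n e"
  shows "word_category.proj scale one (\<lambda>g f. f \<bullet> g) wh V s \<chi> n e"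
proof -
  interpret O: strands scale "\<lambda>X Y. hom Y X" one "\<lambda>g f. f \<bullet> g" wh V s \<chi> by (rule opposite_strands)
  have "O.pol V s \<chi> n w \<kappa>" if "pol V s \<chi> n w \<kappa>" for w \<kappa> using that
  proof (induction rule: pol.induct)
    case (pol_one n) show ?case by (rule O.pol_one)
  next
    case (pol_mul n w \<kappa> a b)
    have "O.pol V s \<chi> n (wh (P a) s (P b)) \<chi>" using pol_mul.hyps(2) by (intro O.pol_s) simp
    from O.pol_prod[OF pol_mul.IH this] show ?case by (simp add: mult.commute)
  qed (auto intro: O.pol_add O.pol_scale)
  then show ?thesis using assms unfolding O.proj_def proj_def O.labs_def labs_def O.rabs_def rabs_def by blast
qed

lemma self_crossing: "crossing scale hom one mul wh V s \<chi> V s \<chi> s"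
  by unfold_locales (simp_all add: s_hom braid)

text \<open>The crossing of two bundles of one colour is invertible because \<open>s\<close> is, and
  it carries one tensor product of projectors to the other. It is a decomposition with a single
  summand.\<close>

lemma dec_commute:
  assumes e: "\<And>n. proj V s \<chi> n (e n)"
  shows "\<exists>A. dec (P m @ P n) (wh [] (e m) (P n) \<bullet> wh (P m) (e n) []) {()} (\<lambda>_. P n @ P m)
    (\<lambda>_. wh [] (e n) (P m) \<bullet> wh (P n) (e m) []) A"
proof -
  interpret cr: crossing scale hom one mul wh V s \<chi> V s \<chi> s by (rule self_crossing)
  let ?X = "P m @ P n" and ?Y = "P n @ P m"
  define a b a' b' where ab: "a = wh [] (e m) (P n)" "b = wh (P m) (e n) []" "a' = wh (P n) (e m) []" "b' = wh [] (e n) (P m)"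
  have h: "a \<in> hom ?X ?X" "b \<in> hom ?X ?X" "a' \<in> hom ?Y ?Y" "b' \<in> hom ?Y ?Y"
    unfolding ab by (rule wh_homI[OF proj_hom[OF e]]; simp)+
  have id: "a \<bullet> a = a" "b \<bullet> b = b" "a' \<bullet> a' = a'" "b' \<bullet> b' = b'"
    unfolding ab by (simp_all only: wh_mul[symmetric] proj_idem[OF e])
  have c: "a \<bullet> b = b \<bullet> a" "a' \<bullet> b' = b' \<bullet> a'"
    using exchange[OF proj_hom[OF e[of m]] proj_hom[OF e[of n]], of "[]" "[]" "[]"]
      exchange[OF proj_hom[OF e[of n]] proj_hom[OF e[of m]], of "[]" "[]" "[]"] unfolding ab by simp_all
  have "invertible [V, V] [V, V] s" unfolding invertible_def using s_hom s_sq by blast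
  from cr.invertible_cross[OF this, of m n] obtain Q Q' where Q: "Q = cr.cross m n"
    "Q \<in> hom ?X ?Y" "Q' \<in> hom ?Y ?X" "Q' \<bullet> Q = one ?X" "Q \<bullet> Q' = one ?Y"
    unfolding invertible_def by blast
  have pol: "pol V s \<chi> n (e n) 1" for n using e unfolding proj_def by blast
  have s1: "a' \<bullet> Q = Q \<bullet> a" and s2: "b' \<bullet> Q = Q \<bullet> b"
    unfolding ab Q(1) by (rule cr.cross_polU[OF pol], rule cr.cross_polV[OF pol])
  define p q where pq: "p = a \<bullet> b" "q = b' \<bullet> a'"
  have ph: "p \<in> hom ?X ?X" "q \<in> hom ?Y ?Y" unfolding pq using h by (auto intro: mul_hom)
  have pp: "p \<bullet> p = p"
    unfolding pq by (simp only: mul_assoc reassoc[OF c(1)[symmetric]] reassoc[OF id(1)] id(2))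
  have qq: "q \<bullet> q = q"
    unfolding pq by (simp only: mul_assoc reassoc[OF c(2)] reassoc[OF id(4)] id(3))
  have qQ: "q \<bullet> Q = Q \<bullet> p"
    unfolding pq by (simp only: mul_assoc s1 reassoc[OF s2] c(1))
  have Qq: "Q' \<bullet> q = p \<bullet> Q'"
  proof -
    have "Q' \<bullet> q = Q' \<bullet> (q \<bullet> Q) \<bullet> Q'" using one_right[OF ph(2)] by (simp only: mul_assoc Q(5))
    also have "\<dots> = (Q' \<bullet> Q) \<bullet> p \<bullet> Q'" by (simp only: qQ mul_assoc)
    also have "\<dots> = p \<bullet> Q'" using one_left[OF mul_hom[OF Q(3) ph(1)]] by (simp only: Q(4))
    finally show ?thesis .
  qed
  have "dec ?X p {()} (\<lambda>_. ?Y) (\<lambda>_. q) (\<lambda>_. Q \<bullet> p)" unfolding dec_def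
  proof (intro conjI ballI exI[of _ "\<lambda>_. Q' \<bullet> q"])
    show "Q \<bullet> p \<in> hom ?X ?Y" "Q' \<bullet> q \<in> hom ?Y ?X" using mul_hom[OF ph(1) Q(2)] mul_hom[OF ph(2) Q(3)] .
    show "(Q \<bullet> p) \<bullet> p = Q \<bullet> p" "(Q' \<bullet> q) \<bullet> q = Q' \<bullet> q" by (simp_all only: mul_assoc pp qq)
    show "q \<bullet> Q \<bullet> p = Q \<bullet> p" by (simp only: reassoc[OF qQ] mul_assoc pp)
    show "p \<bullet> Q' \<bullet> q = Q' \<bullet> q" by (simp only: reassoc[OF Qq[symmetric]] mul_assoc qq)
    have "(Q \<bullet> p) \<bullet> Q' \<bullet> q = q \<bullet> (Q \<bullet> Q') \<bullet> q" by (simp only: qQ[symmetric] mul_assoc)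
    then show "(Q \<bullet> p) \<bullet> Q' \<bullet> q = (if i = j then q else 0)" for i j :: unit
      using one_left[OF ph(2)] by (simp add: Q(5) qq)
    have "(Q' \<bullet> q) \<bullet> Q \<bullet> p = p \<bullet> (Q' \<bullet> Q) \<bullet> p" by (simp only: Qq mul_assoc)
    then show "(\<Sum>i\<in>{()}. (Q' \<bullet> q) \<bullet> Q \<bullet> p) = p" using one_left[OF ph(1)] by (simp add: Q(4) pp)
  qed simp
  then show ?thesis unfolding pq ab by blast
qed

end

context heis_cat begin

abbreviation "eH n \<equiv> iota k n (symmetrizer n)"
abbreviation "eE n \<equiv> mate k n (iota k n (antisymmetrizer n))"

lemmas eH = proj_symmetrizer[THEN conjunct1] proj_symmetrizer[THEN conjunct2]
lemmas eE = proj_antisymmetrizer[THEN conjunct1] proj_antisymmetrizer[THEN conjunct2]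

lemma tensor_single:
  "F \<in> hom C X X \<Longrightarrow> G \<in> hom C Y Y \<Longrightarrow>
   single C (X @ Y) (X @ Y) (tmo C F G) = fwh C [] (single C X X F) Y \<bullet> fwh C X (single C Y Y G) []"
  by (rule tmo_single[OF word_cat_C])

lemma isomorphic_commute:
  assumes "strands scale (fhom C) (fone C) (fmul C) (fwh C) V \<sigma> \<chi>"
    and g: "\<And>n. g n \<in> hom C (replicate n V) (replicate n V)"
    and p: "\<And>n. proj V \<sigma> \<chi> n (single C (replicate n V) (replicate n V) (g n))"
  shows "isomorphic (Kar C) (tob (Kar C) (kar_pair (replicate m V) (g m)) (kar_pair (replicate n V) (g n)))
    (tob (Kar C) (kar_pair (replicate n V) (g n)) (kar_pair (replicate m V) (g m)))"
proof -
  interpret S: strands scale "fhom C" "fone C" "fmul C" "fwh C" V \<sigma> \<chi> by fact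
  obtain A where A: "dec (S.P m @ S.P n) (single C (S.P m @ S.P n) (S.P m @ S.P n) (tmo C (g m) (g n))) {()} (\<lambda>_. S.P n @ S.P m)
     (\<lambda>_. single C (S.P n @ S.P m) (S.P n @ S.P m) (tmo C (g n) (g m))) A"
    using S.dec_commute[OF p, of m n] unfolding tensor_single[OF g g] by blast
  have "isomorphic (Kar C) (kar_pair (S.P m @ S.P n) (tmo C (g m) (g n)))
     (diag_ob C (map (\<lambda>_. (S.P n @ S.P m, tmo C (g n) (g m))) [()]))"
    by (rule isomorphic_diag_ob[OF word_cat_C A]) ((rule htmo_hom[OF word_cat_C g g] | simp)+)
  then show ?thesis by (simp only: tob_kar_pair[OF word_cat_C] list.map kar_pair_diag[of _ _ C, symmetric])
qed

text \<open>The summand attached to a list depends on its length only, so strict lists may be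
  replaced by partitions along any bijection that matches length with \<open>r\<close>.\<close>

lemma isomorphic_Dsum:
  assumes d: "dec X (single C X X F) {l. sorted_wrt (>) l \<and> set l \<subseteq> {..<K} \<and> length l \<le> m \<and> length l \<le> n} T E A"
    and F: "F \<in> hom C X X" and G: "\<And>r. G r \<in> hom C (Y r) (Y r)"
    and T: "\<And>l. T l = Y (length l)" and E: "\<And>l. E l = single C (Y (length l)) (Y (length l)) (G (length l))"
  shows "isomorphic (Kar C) (kar_pair X F)
    (kar_Dsum C {0..min (min m n) K} (\<lambda>r. kar_Dsum C (box_partitions r K) (\<lambda>_. kar_pair (Y r) (G r))))"
proof -
  let ?J = "Sigma {0..min (min m n) K} (\<lambda>r. box_partitions r K)"
  obtain h where h: "bij_betw h ?J {l. sorted_wrt (>) l \<and> set l \<subseteq> {..<K} \<and> length l \<le> m \<and> length l \<le> n}"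
    "\<And>i. i \<in> ?J \<Longrightarrow> length (h i) = fst i"
    using bij_strict_index[of m n K] by blast
  have d': "dec X (single C X X F) ?J (\<lambda>j. Y (fst j)) (\<lambda>j. single C (Y (fst j)) (Y (fst j)) (G (fst j))) (\<lambda>j. A (h j))"
    by (rule dec_reindex[OF h(1) d]) (simp_all only: T E h(2))
  obtain js where js: "distinct js" "set js = ?J"
    "kar_Dsum C {0..min (min m n) K} (\<lambda>r. kar_Dsum C (box_partitions r K) (\<lambda>_. kar_pair (Y r) (G r)))
      = diag_ob C (map (\<lambda>j. (Y (fst j), G (fst j))) js)"
    by (rule kar_Dsum_Sigma[of "{0..min (min m n) K}" "\<lambda>r. box_partitions r K" C Y G]) (auto intro: finite_box_partitions)
  show ?thesis unfolding js(3) by (rule isomorphic_diag_ob[OF word_cat_C d' F G js(1,2)])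
qed

lemma isomorphic_pos:
  assumes k: "0 \<le> k"
  shows "isomorphic (Kar C) (tob (Kar C) (Hplus k m) (Eminus k n))
    (kar_Dsum C {0..min (min m n) (nat k)} (\<lambda>r. kar_Dsum C (box_partitions r (nat k))
      (\<lambda>la. tob (Kar C) (Eminus k (n - r)) (Hplus k (m - r)))))"
proof -
  interpret G: heisenberg_proj scale "fhom C" "fone C" "fmul C" "fwh C" Up s 1 Down H.sD H.t "ev (Gen Gx)" "ev (Gen Gd)"
    "- ev (Gen Gc)" 1 "nat k" "ev (Gen Gt')" "\<lambda>a. ev (Gen (Gu a))" "\<lambda>a. ev (xpow a)" "\<lambda>n. sng n (eH n)" "\<lambda>n. sngD n (eE n)"
    by (intro heisenberg_proj.intro heisenberg_pos[OF k] heisenberg_proj_axioms.intro eH(2) eE(2))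
  have EF: "G.EF m n = single C (replicate m Up @ replicate n Down) (replicate m Up @ replicate n Down) (tmo C (eH m) (eE n))"
    unfolding G.EF_def by (rule tensor_single[OF eH(1) eE(1), symmetric])
  have FE: "G.E m n l = single C (replicate (n - length l) Down @ replicate (m - length l) Up)
      (replicate (n - length l) Down @ replicate (m - length l) Up) (tmo C (eE (n - length l)) (eH (m - length l)))" for l
    unfolding G.E_def G.FE_def by (rule tensor_single[OF eE(1) eH(1), symmetric])
  note d = G.T_all[of m n, unfolded G.T_def EF G.Ix_def]
  show ?thesis unfolding Hplus_def Eminus_def tob_kar_pair[OF word_cat_C]
    by (rule isomorphic_Dsum[OF d _ _ _ FE]) (auto simp: G.tgt_def intro: htmo_hom[OF word_cat_C] eH(1) eE(1))
qed

lemma isomorphic_neg: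
  assumes k: "k \<le> 0"
  shows "isomorphic (Kar C) (tob (Kar C) (Eminus k m) (Hplus k n))
    (kar_Dsum C {0..min (min m n) (nat (- k))} (\<lambda>r. kar_Dsum C (box_partitions r (nat (- k)))
      (\<lambda>la. tob (Kar C) (Hplus k (n - r)) (Eminus k (m - r)))))"
proof -
  interpret SU: strands scale "fhom C" "fone C" "fmul C" "fwh C" Up s 1 by (rule H.strandsU) simp
  interpret SD: strands scale "fhom C" "fone C" "fmul C" "fwh C" Down H.sD "- 1" by (rule H.strandsD) simp
  obtain xq where hn: "heisenberg scale (\<lambda>X Y. fhom C Y X) (fone C) (\<lambda>g f. f \<bullet> g) (fwh C) Down H.sD (- 1) Up s H.t
    H.xD (ev (Gen Gc)) (ev (Gen Gd)) (- 1) (nat (- k)) (ev (Gen Gt')) (\<lambda>a. ev (Gen (Gv a))) xq"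
    using heisenberg_neg[OF k] by blast
  have pH: "word_category.proj scale (fone C) (\<lambda>g f. f \<bullet> g) (fwh C) Up s (- (- 1)) n (sng n (eH n))" for n
    using SU.proj_opposite[OF eH(2)] by (simp only: minus_minus)
  interpret G: heisenberg_proj scale "\<lambda>X Y. fhom C Y X" "fone C" "\<lambda>g f. f \<bullet> g" "fwh C" Down H.sD "- 1" Up s H.t
    H.xD "ev (Gen Gc)" "ev (Gen Gd)" "- 1" "nat (- k)" "ev (Gen Gt')" "\<lambda>a. ev (Gen (Gv a))" xq "\<lambda>n. sngD n (eE n)" "\<lambda>n. sng n (eH n)"
    by (intro heisenberg_proj.intro hn heisenberg_proj_axioms.intro SD.proj_opposite eE(2) pH)
  \<comment> \<open>Composition in this instance is reversed, so the second form of the idempotent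
    is the one that reads as a tensor product in the original category.\<close>
  have EF: "G.EF m n = single C (replicate m Down @ replicate n Up) (replicate m Down @ replicate n Up) (tmo C (eE m) (eH n))"
    unfolding G.EF_alt by (rule tensor_single[OF eE(1) eH(1), symmetric])
  have FE: "G.E m n l = single C (replicate (n - length l) Up @ replicate (m - length l) Down)
      (replicate (n - length l) Up @ replicate (m - length l) Down) (tmo C (eH (n - length l)) (eE (m - length l)))" for l
    unfolding G.E_def G.FE_alt by (rule tensor_single[OF eH(1) eE(1), symmetric])
  obtain B where d: "dec (replicate m Down @ replicate n Up) (G.EF m n) (G.Ix m n) (G.tgt m n) (G.E m n) B"
    using dec_opposite[OF G.T_all[of m n, unfolded G.T_def]] by blast
  note d = d[unfolded EF G.Ix_def]
  show ?thesis unfolding Hplus_def Eminus_def tob_kar_pair[OF word_cat_C]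
    by (rule isomorphic_Dsum[OF d _ _ _ FE]) (auto simp: G.tgt_def intro: htmo_hom[OF word_cat_C] eH(1) eE(1))
qed

end

theorem theorem1p2:
  fixes k :: int and m n :: nat
  shows "let C = (Heis k :: (updown list, 'a::field_char_0 heis_mor, 'a) linmon);
             K = Kar C; H = Hplus k; E = Eminus k
         in isomorphic K (tob K (H m) (H n)) (tob K (H n) (H m)) \<and>
            isomorphic K (tob K (E m) (E n)) (tob K (E n) (E m)) \<and>
            (k \<ge> 0 \<longrightarrow> isomorphic K (tob K (H m) (E n))
               (kar_Dsum C {0..min (min m n) (nat k)} (\<lambda>r.
                  kar_Dsum C (box_partitions r (nat k)) (\<lambda>la. tob K (E (n - r)) (H (m - r)))))) \<and>
            (k \<le> 0 \<longrightarrow> isomorphic K (tob K (E m) (H n))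
               (kar_Dsum C {0..min (min m n) (nat (- k))} (\<lambda>r.
                  kar_Dsum C (box_partitions r (nat (- k))) (\<lambda>la. tob K (H (n - r)) (E (m - r))))))"
proof -
  interpret heis_cat k "Heis k :: (updown list, 'a heis_mor, 'a) linmon" by unfold_locales (rule HOL.refl)
  show ?thesis unfolding Let_def
  proof (intro conjI impI)
    show "isomorphic (Kar (Heis k)) (tob (Kar (Heis k)) (Hplus k m) (Hplus k n)) (tob (Kar (Heis k)) (Hplus k n) (Hplus k m :: 'a heis_kar_ob))"
      unfolding Hplus_def by (rule isomorphic_commute[OF H.strandsU[of 1] eH]) simp
    show "isomorphic (Kar (Heis k)) (tob (Kar (Heis k)) (Eminus k m) (Eminus k n)) (tob (Kar (Heis k)) (Eminus k n) (Eminus k m :: 'a heis_kar_ob))"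
      unfolding Eminus_def by (rule isomorphic_commute[OF H.strandsD[of "- 1"] eE]) simp
  qed (rule isomorphic_pos isomorphic_neg; assumption)+
qed

end
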